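(* Let $p$ be a prime and $e\ge1$ an integer not divisible by $p$. For any integer $n>e$, the categories $\mathcal H_{p,e}^n$ and $\mathcal C_{p,e}$ are equivalent.
   Context: Valued hyperfields. A hyperfield is a set $H$ with elements $0,1$, a multiplication making $H^\times=H\setminus\{0\}$ an abelian group with identity $1$ and $0\cdot\alpha=0$, and a commutative, associative multivalued addition $+:H\times H\to 2^H$ (with $\alpha+B=\bigcup_{\beta\in B}(\alpha+\beta)$) such that $(\alpha+\beta)\gamma\subseteq\alpha\gamma+\beta\gamma$, $\alpha+0=\{\alpha\}$, each $\alpha$ has a unique $-\alpha$ with $0\in\alpha+(-\alpha)$, and $\alpha\in\beta+(-\gamma)\Leftrightarrow\beta\in\alpha+\gamma$. A discrete valued hyperfield is a hyperfield with $\nu:H\to\Gamma\cup\{\infty\}$, $\Gamma$ a (nontrivial) discrete subgroup of $\mathbb R$, such that $\nu(\alpha)=\infty\Leftrightarrow\alpha=0$, $\nu(\alpha\beta)=\nu(\alpha)+\nu(\beta)$, all elements of $\alpha+\beta$ have value $\ge\min\{\nu(\alpha),\nu(\beta)\}$, $\nu$ is constant on $\alpha+\beta$ unless $0\in\alpha+\beta$, and there is $\rho_H\in\Gamma$ such that each $\alpha+\beta$ is a closed ball of radius $\rho_H+\min\{\nu(\alpha),\nu(\beta)\}$. Here the distance of $\alpha\neq\beta$ is measured by the constant value $\nu(\alpha-\beta)$ of $\nu$ on $\alpha+(-\beta)$, and a closed ball of radius $r$ is a set $\{\gamma:\gamma=\gamma_0\text{ or }\nu(\gamma-\gamma_0)\ge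 r\}$. Put $\theta_H=\min\{\nu(x):\nu(x)>0\}$; the length of $H$ is the integer $l\ge1$ with $\rho_H=l\theta_H$. Let $\mathcal O_H=\{\alpha:\nu(\alpha)\ge0\}$. For $\eta\in\{\theta_H,\rho_H\}$ put $\alpha\equiv_\eta\beta$ iff all elements of $\alpha-\beta$ have value $\ge\eta$. Then $R(H)=\mathcal O_H/\equiv_{\rho_H}$ is a principal Artinian local ring of length $l$, with the induced multiplication and $[\alpha]+[\beta]=[\gamma]$ for any $\gamma\in\alpha+\beta$; $k(H)=\mathcal O_H/\equiv_{\theta_H}$ is its residue field. If $k(H)$ has characteristic $p$, then $H$ is of mixed characteristic $(0,p)$ with ramification index $e$ if $p\ne0$ in $R(H)$ and $p\in\mathfrak m_{R(H)}^e\setminus\mathfrak m_{R(H)}^{e+1}$. It is normalized if $\theta_H=1/e$. Isometric homomorphisms. Let $H_1,H_2$ be valued hyperfields with $\nu_1(H_1^\times)=\nu_2(H_2^\times)$. An isometric homomorphism $f:H_1\to H_2$ is a map with $f(0)=0$, $f(1)=1$, $f(\alpha\beta)=f(\alpha)f(\beta)$, $f^{-1}(\alpha+\beta)=f^{-1}(\alpha)+f^{-1}(\beta)$ for $\alpha,\beta\in f(H_1)$, $\nu_2(f(\alpha))=\nu_1(\alpha)$, and $f^{-1}(1)$ a ball. Over $p$. Suppose the length is $>e$. Each $H$ comes equipped with a fixed choice of an element $P_H=a\varpi^e\in H$, where $\nu(\varpi)=\theta_H$, $\nu(a)=0$ and $[a\varpi^e]=p$ in $R(H)$. For $H=K/(1+\mathfrak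 m^n)$ coming from a discrete valued field $K$ one takes the class of $p$. A map $f:H_1\to H_2$ is over $p$ if $f(P_{H_1})=P_{H_2}$. Categories. $\mathcal C_{p,e}$: objects are complete discrete valuation rings of mixed characteristic $(0,p)$ with perfect residue field and ramification index $e$ (i.e. $pR=\mathfrak m^e$); morphisms are injective (isometric) ring homomorphisms. $\mathcal H_{p,e}^n$ for $n>e$: objects are normalized discrete valued hyperfields of length $n$, of mixed characteristic $(0,p)$, with perfect residue field and ramification index $e$; morphisms are the isometric homomorphisms over $p$. *)

theory Defs
  imports
    "HOL-Algebra.Ring_Divisibility"
    "HOL-Algebra.Ideal_Product"
    "HOL-Algebra.QuotRing"
    "HOL-Computational_Algebra.Primes"
    "HOL-Analysis.Isolated"
    "HOL-Library.Extended_Real"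
    "HOL-Library.FuncSet"
begin

section \<open>Categories and their equivalence\<close>

text \<open>Hom-sets need not be disjoint, so composition and the action of a functor on
  morphisms carry the objects involved as arguments; \<open>Comp C X Y Z g f\<close> is
  \<open>g \<circ> f\<close> for \<open>f : X \<rightarrow> Y\<close> and \<open>g : Y \<rightarrow> Z\<close>.\<close>

record ('o, 'm) category =
  Obj :: "'o set"
  Hom :: "'o \<Rightarrow> 'o \<Rightarrow> 'm set"
  Ident :: "'o \<Rightarrow> 'm"
  Comp :: "'o \<Rightarrow> 'o \<Rightarrow> 'o \<Rightarrow> 'm \<Rightarrow> 'm \<Rightarrow> 'm"

locale category =
  fixes C :: "('o, 'm) category"
  assumes Ident_in_Hom: "X \<in> Obj C \<Longrightarrow> Ident C X \<in> Hom C X X"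
    and Comp_in_Hom:
      "\<lbrakk>X \<in> Obj C; Y \<in> Obj C; Z \<in> Obj C; f \<in> Hom C X Y; g \<in> Hom C Y Z\<rbrakk>
        \<Longrightarrow> Comp C X Y Z g f \<in> Hom C X Z"
    and Comp_Ident_right:
      "\<lbrakk>X \<in> Obj C; Y \<in> Obj C; f \<in> Hom C X Y\<rbrakk> \<Longrightarrow> Comp C X X Y f (Ident C X) = f"
    and Comp_Ident_left:
      "\<lbrakk>X \<in> Obj C; Y \<in> Obj C; f \<in> Hom C X Y\<rbrakk> \<Longrightarrow> Comp C X Y Y (Ident C Y) f = f"
    and Comp_assoc:
      "\<lbrakk>W \<in> Obj C; X \<in> Obj C; Y \<in> Obj C; Z \<in> Obj C;
        f \<in> Hom C W X; g \<in> Hom C X Y; h \<in> Hom C Y Z\<rbrakk>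
        \<Longrightarrow> Comp C W Y Z h (Comp C W X Y g f) = Comp C W X Z (Comp C X Y Z h g) f"

definition iso_arrow :: "('o, 'm) category \<Rightarrow> 'o \<Rightarrow> 'o \<Rightarrow> 'm \<Rightarrow> bool" where
  "iso_arrow C X Y f \<longleftrightarrow> f \<in> Hom C X Y \<and>
    (\<exists>g \<in> Hom C Y X. Comp C X Y X g f = Ident C X \<and> Comp C Y X Y f g = Ident C Y)"

record ('o1, 'm1, 'o2, 'm2) cat_functor =
  on_obj :: "'o1 \<Rightarrow> 'o2"
  on_arr :: "'o1 \<Rightarrow> 'o1 \<Rightarrow> 'm1 \<Rightarrow> 'm2"

locale cat_functor = dom: category C + cod: category D
  for C :: "('o1, 'm1) category" and D :: "('o2, 'm2) category" +
  fixes F :: "('o1, 'm1, 'o2, 'm2) cat_functor"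
  assumes on_obj_closed: "X \<in> Obj C \<Longrightarrow> on_obj F X \<in> Obj D"
    and on_arr_closed:
      "\<lbrakk>X \<in> Obj C; Y \<in> Obj C; f \<in> Hom C X Y\<rbrakk>
        \<Longrightarrow> on_arr F X Y f \<in> Hom D (on_obj F X) (on_obj F Y)"
    and on_arr_Ident: "X \<in> Obj C \<Longrightarrow> on_arr F X X (Ident C X) = Ident D (on_obj F X)"
    and on_arr_Comp:
      "\<lbrakk>X \<in> Obj C; Y \<in> Obj C; Z \<in> Obj C; f \<in> Hom C X Y; g \<in> Hom C Y Z\<rbrakk>
        \<Longrightarrow> on_arr F X Z (Comp C X Y Z g f) =
            Comp D (on_obj F X) (on_obj F Y) (on_obj F Z) (on_arr F Y Z g) (on_arr F X Y f)"

definition id_functor :: "('o, 'm, 'o, 'm) cat_functor" where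
  "id_functor = \<lparr>on_obj = (\<lambda>X. X), on_arr = (\<lambda>X Y f. f)\<rparr>"

definition comp_functor ::
  "('o2, 'm2, 'o3, 'm3) cat_functor \<Rightarrow> ('o1, 'm1, 'o2, 'm2) cat_functor
    \<Rightarrow> ('o1, 'm1, 'o3, 'm3) cat_functor" where
  "comp_functor G F =
    \<lparr>on_obj = (\<lambda>X. on_obj G (on_obj F X)),
     on_arr = (\<lambda>X Y f. on_arr G (on_obj F X) (on_obj F Y) (on_arr F X Y f))\<rparr>"

locale natural_isomorphism = F: cat_functor C D F + G: cat_functor C D G
  for C :: "('o1, 'm1) category" and D :: "('o2, 'm2) category"
    and F G :: "('o1, 'm1, 'o2, 'm2) cat_functor" +
  fixes \<eta> :: "'o1 \<Rightarrow> 'm2"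
  assumes component_iso: "X \<in> Obj C \<Longrightarrow> iso_arrow D (on_obj F X) (on_obj G X) (\<eta> X)"
    and naturality:
      "\<lbrakk>X \<in> Obj C; Y \<in> Obj C; f \<in> Hom C X Y\<rbrakk>
        \<Longrightarrow> Comp D (on_obj F X) (on_obj F Y) (on_obj G Y) (\<eta> Y) (on_arr F X Y f) =
            Comp D (on_obj F X) (on_obj G X) (on_obj G Y) (on_arr G X Y f) (\<eta> X)"

definition equivalent_categories :: "('o1, 'm1) category \<Rightarrow> ('o2, 'm2) category \<Rightarrow> bool" where
  "equivalent_categories C D \<longleftrightarrow> category C \<and> category D \<and>
    (\<exists>F G \<eta> \<epsilon>. cat_functor C D F \<and> cat_functor D C G \<and>
      natural_isomorphism C C id_functor (comp_functor G F) \<eta> \<and>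
      natural_isomorphism D D (comp_functor F G) id_functor \<epsilon>)"


section \<open>Rings\<close>

definition nat_elem :: "('a, 'b) ring_scheme \<Rightarrow> nat \<Rightarrow> 'a" where
  "nat_elem R k = [k] \<cdot>\<^bsub>R\<^esub> \<one>\<^bsub>R\<^esub>"

definition ring_char :: "('a, 'b) ring_scheme \<Rightarrow> nat" where
  "ring_char R =
    (if \<exists>k>0. nat_elem R k = \<zero>\<^bsub>R\<^esub> then LEAST k. k > 0 \<and> nat_elem R k = \<zero>\<^bsub>R\<^esub> else 0)"

definition perfect_field :: "('a, 'b) ring_scheme \<Rightarrow> bool" where
  "perfect_field K \<longleftrightarrow> field K \<and>
    (ring_char K = 0 \<or> (\<forall>x \<in> carrier K. \<exists>y \<in> carrier K. y [^]\<^bsub>K\<^esub> ring_char K = x))"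

text \<open>The maximal ideal of a local ring.\<close>

definition max_ideal :: "('a, 'b) ring_scheme \<Rightarrow> 'a set" where
  "max_ideal R = (THE I. maximalideal I R)"

definition ideal_pow :: "('a, 'b) ring_scheme \<Rightarrow> 'a set \<Rightarrow> nat \<Rightarrow> 'a set" where
  "ideal_pow R I k = I [^]\<^bsub>ideals_set R\<^esub> k"

locale discrete_valuation_ring = principal_domain R for R (structure) +
  assumes ex1_maximal: "\<exists>!I. maximalideal I R"
    and not_field: "\<not> field R"

locale complete_discrete_valuation_ring = discrete_valuation_ring R for R (structure) +
  assumes Cauchy_converges:
    "\<lbrakk>x \<in> UNIV \<rightarrow> carrier R;
      \<forall>k. \<exists>N. \<forall>i\<ge>N. \<forall>j\<ge>N. x i \<ominus> x j \<in> ideal_pow R (max_ideal R) k\<rbrakk>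
      \<Longrightarrow> \<exists>L \<in> carrier R. \<forall>k. \<exists>N. \<forall>i\<ge>N. x (i::nat) \<ominus> L \<in> ideal_pow R (max_ideal R) k"

definition CDVR_objects :: "nat \<Rightarrow> nat \<Rightarrow> 'u ring set" where
  "CDVR_objects p e = {R. complete_discrete_valuation_ring R \<and>
     ring_char R = 0 \<and> ring_char (R Quot max_ideal R) = p \<and>
     perfect_field (R Quot max_ideal R) \<and>
     PIdl\<^bsub>R\<^esub> nat_elem R p = ideal_pow R (max_ideal R) e}"

text \<open>The valuation on a ring with \<open>p R = \<mm>\<^sup>e\<close> is normalized by \<open>\<nu>(p) = 1\<close>, so it takes the
  value \<open>k/e\<close> exactly on \<open>\<mm>\<^sup>k - \<mm>\<^sup>k\<^sup>+\<^sup>1\<close>; for a fixed \<open>e\<close>, preserving it is the last condition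
  below. Maps are taken to be \<open>undefined\<close> outside the carrier, so that equality of morphisms
  is equality of functions.\<close>

definition CDVR_hom :: "'u ring \<Rightarrow> 'u ring \<Rightarrow> ('u \<Rightarrow> 'u) set" where
  "CDVR_hom R S = {f \<in> ring_hom R S \<inter> extensional (carrier R).
     inj_on f (carrier R) \<and>
     (\<forall>x \<in> carrier R. \<forall>k. f x \<in> ideal_pow S (max_ideal S) k \<longleftrightarrow> x \<in> ideal_pow R (max_ideal R) k)}"

definition CDVR_cat :: "nat \<Rightarrow> nat \<Rightarrow> ('u ring, 'u \<Rightarrow> 'u) category" where
  "CDVR_cat p e = \<lparr>Obj = CDVR_objects p e, Hom = CDVR_hom,
     Ident = (\<lambda>R. restrict id (carrier R)), Comp = (\<lambda>R S T g f. compose (carrier R) g f)\<rparr>"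


section \<open>Valued hyperfields\<close>

record 'a hyperfield = "'a monoid" +
  hzero :: 'a
  hadd :: "'a \<Rightarrow> 'a \<Rightarrow> 'a set"

definition hset_add :: "('a, 'b) hyperfield_scheme \<Rightarrow> 'a set \<Rightarrow> 'a set \<Rightarrow> 'a set" where
  "hset_add H A B = (\<Union>\<alpha>\<in>A. \<Union>\<beta>\<in>B. hadd H \<alpha> \<beta>)"

definition hneg :: "('a, 'b) hyperfield_scheme \<Rightarrow> 'a \<Rightarrow> 'a" where
  "hneg H \<alpha> = (THE \<beta>. \<beta> \<in> carrier H \<and> hzero H \<in> hadd H \<alpha> \<beta>)"

definition hsub :: "('a, 'b) hyperfield_scheme \<Rightarrow> 'a \<Rightarrow> 'a \<Rightarrow> 'a set" where
  "hsub H \<alpha> \<beta> = hadd H \<alpha> (hneg H \<beta>)"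

locale hyperfield =
  fixes H :: "('a, 'b) hyperfield_scheme" (structure)
  assumes zero_closed: "hzero H \<in> carrier H"
    and units_comm_group:
      "comm_group \<lparr>carrier = carrier H - {hzero H}, monoid.mult = mult H, one = one H\<rparr>"
    and zero_mult: "\<alpha> \<in> carrier H \<Longrightarrow> hzero H \<otimes> \<alpha> = hzero H"
    and mult_zero: "\<alpha> \<in> carrier H \<Longrightarrow> \<alpha> \<otimes> hzero H = hzero H"
    and hadd_closed: "\<lbrakk>\<alpha> \<in> carrier H; \<beta> \<in> carrier H\<rbrakk> \<Longrightarrow> hadd H \<alpha> \<beta> \<subseteq> carrier H"
    and hadd_comm: "\<lbrakk>\<alpha> \<in> carrier H; \<beta> \<in> carrier H\<rbrakk> \<Longrightarrow> hadd H \<alpha> \<beta> = hadd H \<beta> \<alpha>"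
    and hadd_assoc:
      "\<lbrakk>\<alpha> \<in> carrier H; \<beta> \<in> carrier H; \<gamma> \<in> carrier H\<rbrakk>
        \<Longrightarrow> hset_add H {\<alpha>} (hadd H \<beta> \<gamma>) = hset_add H (hadd H \<alpha> \<beta>) {\<gamma>}"
    and distrib:
      "\<lbrakk>\<alpha> \<in> carrier H; \<beta> \<in> carrier H; \<gamma> \<in> carrier H\<rbrakk>
        \<Longrightarrow> (\<lambda>\<delta>. \<delta> \<otimes> \<gamma>) ` hadd H \<alpha> \<beta> \<subseteq> hadd H (\<alpha> \<otimes> \<gamma>) (\<beta> \<otimes> \<gamma>)"
    and hadd_zero: "\<alpha> \<in> carrier H \<Longrightarrow> hadd H \<alpha> (hzero H) = {\<alpha>}"
    and ex1_neg: "\<alpha> \<in> carrier H \<Longrightarrow> \<exists>!\<beta>. \<beta> \<in> carrier H \<and> hzero H \<in> hadd H \<alpha> \<beta>"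
    and reversible:
      "\<lbrakk>\<alpha> \<in> carrier H; \<beta> \<in> carrier H; \<gamma> \<in> carrier H\<rbrakk>
        \<Longrightarrow> \<alpha> \<in> hsub H \<beta> \<gamma> \<longleftrightarrow> \<beta> \<in> hadd H \<alpha> \<gamma>"

record 'a valued_hyperfield = "'a hyperfield" +
  val :: "'a \<Rightarrow> ereal"

text \<open>The group \<open>\<Gamma>\<close> is taken to be the value group \<open>\<nu>(H - {0})\<close>. With a larger \<open>\<Gamma>\<close> the radius
  \<open>\<rho>\<close> would not be determined by the hyperaddition.\<close>

definition value_group :: "('a, 'b) valued_hyperfield_scheme \<Rightarrow> real set" where
  "value_group H = {r. \<exists>\<alpha> \<in> carrier H - {hzero H}. val H \<alpha> = ereal r}"

text \<open>The constant value of \<open>\<nu>\<close> on \<open>\<alpha> - \<beta>\<close>, for \<open>\<alpha> \<noteq> \<beta>\<close>.\<close>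

definition val_diff :: "('a, 'b) valued_hyperfield_scheme \<Rightarrow> 'a \<Rightarrow> 'a \<Rightarrow> ereal" where
  "val_diff H \<alpha> \<beta> = (THE v. \<forall>\<gamma> \<in> hsub H \<alpha> \<beta>. val H \<gamma> = v)"

text \<open>The radius is extended real because \<open>0 + 0 = {0}\<close> has to be a ball of radius
  \<open>\<rho> + \<infinity>\<close>.\<close>

definition closed_ball :: "('a, 'b) valued_hyperfield_scheme \<Rightarrow> 'a \<Rightarrow> ereal \<Rightarrow> 'a set" where
  "closed_ball H \<gamma>\<^sub>0 r = {\<gamma> \<in> carrier H. \<gamma> = \<gamma>\<^sub>0 \<or> val_diff H \<gamma> \<gamma>\<^sub>0 \<ge> r}"

definition is_closed_ball :: "('a, 'b) valued_hyperfield_scheme \<Rightarrow> ereal \<Rightarrow> 'a set \<Rightarrow> bool" where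
  "is_closed_ball H r B \<longleftrightarrow> (\<exists>\<gamma>\<^sub>0 \<in> carrier H. B = closed_ball H \<gamma>\<^sub>0 r)"

definition is_radius :: "('a, 'b) valued_hyperfield_scheme \<Rightarrow> real \<Rightarrow> bool" where
  "is_radius H \<rho> \<longleftrightarrow> \<rho> \<in> value_group H \<and>
    (\<forall>\<alpha> \<in> carrier H. \<forall>\<beta> \<in> carrier H.
      is_closed_ball H (ereal \<rho> + min (val H \<alpha>) (val H \<beta>)) (hadd H \<alpha> \<beta>))"

locale discrete_valued_hyperfield = hyperfield H
  for H :: "('a, 'b) valued_hyperfield_scheme" (structure) +
  assumes val_not_MInf: "\<alpha> \<in> carrier H \<Longrightarrow> val H \<alpha> \<noteq> -\<infinity>"
    and val_eq_PInf: "\<alpha> \<in> carrier H \<Longrightarrow> val H \<alpha> = \<infinity> \<longleftrightarrow> \<alpha> = hzero H"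
    and val_mult:
      "\<lbrakk>\<alpha> \<in> carrier H; \<beta> \<in> carrier H\<rbrakk> \<Longrightarrow> val H (\<alpha> \<otimes> \<beta>) = val H \<alpha> + val H \<beta>"
    and value_group_discrete: "discrete (value_group H)"
    and value_group_nontrivial: "value_group H \<noteq> {0}"
    and val_hadd_ge:
      "\<lbrakk>\<alpha> \<in> carrier H; \<beta> \<in> carrier H; \<gamma> \<in> hadd H \<alpha> \<beta>\<rbrakk>
        \<Longrightarrow> val H \<gamma> \<ge> min (val H \<alpha>) (val H \<beta>)"
    and val_hadd_const:
      "\<lbrakk>\<alpha> \<in> carrier H; \<beta> \<in> carrier H; hzero H \<notin> hadd H \<alpha> \<beta>;
        \<gamma> \<in> hadd H \<alpha> \<beta>; \<delta> \<in> hadd H \<alpha> \<beta>\<rbrakk> \<Longrightarrow> val H \<gamma> = val H \<delta>"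
    and ex_radius: "\<exists>\<rho>. is_radius H \<rho>"

definition rho :: "('a, 'b) valued_hyperfield_scheme \<Rightarrow> real" where
  "rho H = (THE \<rho>. is_radius H \<rho>)"

definition theta :: "('a, 'b) valued_hyperfield_scheme \<Rightarrow> real" where
  "theta H = (LEAST r. r \<in> value_group H \<and> r > 0)"

definition has_length :: "('a, 'b) valued_hyperfield_scheme \<Rightarrow> nat \<Rightarrow> bool" where
  "has_length H l \<longleftrightarrow> l \<ge> 1 \<and> rho H = real l * theta H"

definition valuation_hyperring :: "('a, 'b) valued_hyperfield_scheme \<Rightarrow> 'a set" where
  "valuation_hyperring H = {\<alpha> \<in> carrier H. val H \<alpha> \<ge> 0}"

definition hcong :: "('a, 'b) valued_hyperfield_scheme \<Rightarrow> real \<Rightarrow> ('a \<times> 'a) set" where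
  "hcong H \<eta> = {(\<alpha>, \<beta>). \<alpha> \<in> valuation_hyperring H \<and> \<beta> \<in> valuation_hyperring H \<and>
     (\<forall>\<gamma> \<in> hsub H \<alpha> \<beta>. val H \<gamma> \<ge> ereal \<eta>)}"

definition hclass :: "('a, 'b) valued_hyperfield_scheme \<Rightarrow> real \<Rightarrow> 'a \<Rightarrow> 'a set" where
  "hclass H \<eta> \<alpha> = hcong H \<eta> `` {\<alpha>}"

text \<open>The unions below are over equal classes, since the operations do not depend on the
  chosen representatives (nor on the chosen element of \<open>\<alpha> + \<beta>\<close>).\<close>

definition hquot :: "('a, 'b) valued_hyperfield_scheme \<Rightarrow> real \<Rightarrow> 'a set ring" where
  "hquot H \<eta> =
    \<lparr>carrier = valuation_hyperring H // hcong H \<eta>,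
     monoid.mult = (\<lambda>A B. \<Union>\<alpha>\<in>A. \<Union>\<beta>\<in>B. hclass H \<eta> (\<alpha> \<otimes>\<^bsub>H\<^esub> \<beta>)),
     one = hclass H \<eta> \<one>\<^bsub>H\<^esub>,
     zero = hclass H \<eta> (hzero H),
     add = (\<lambda>A B. \<Union>\<alpha>\<in>A. \<Union>\<beta>\<in>B. \<Union>\<gamma>\<in>hadd H \<alpha> \<beta>. hclass H \<eta> \<gamma>)\<rparr>"

definition trunc_ring :: "('a, 'b) valued_hyperfield_scheme \<Rightarrow> 'a set ring" where
  "trunc_ring H = hquot H (rho H)"

definition res_field :: "('a, 'b) valued_hyperfield_scheme \<Rightarrow> 'a set ring" where
  "res_field H = hquot H (theta H)"

definition mixed_char :: "('a, 'b) valued_hyperfield_scheme \<Rightarrow> nat \<Rightarrow> nat \<Rightarrow> bool" where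
  "mixed_char H p e \<longleftrightarrow> ring_char (res_field H) = p \<and>
    nat_elem (trunc_ring H) p \<noteq> \<zero>\<^bsub>trunc_ring H\<^esub> \<and>
    nat_elem (trunc_ring H) p \<in> ideal_pow (trunc_ring H) (max_ideal (trunc_ring H)) e
      - ideal_pow (trunc_ring H) (max_ideal (trunc_ring H)) (e + 1)"

definition normalized :: "('a, 'b) valued_hyperfield_scheme \<Rightarrow> nat \<Rightarrow> bool" where
  "normalized H e \<longleftrightarrow> theta H = 1 / real e"

definition is_isometric_hom ::
  "('a, 'b) valued_hyperfield_scheme \<Rightarrow> ('c, 'd) valued_hyperfield_scheme \<Rightarrow> ('a \<Rightarrow> 'c) \<Rightarrow> bool"
where
  "is_isometric_hom H1 H2 f \<longleftrightarrow>
    value_group H1 = value_group H2 \<and>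
    f \<in> carrier H1 \<rightarrow> carrier H2 \<and>
    f (hzero H1) = hzero H2 \<and>
    f \<one>\<^bsub>H1\<^esub> = \<one>\<^bsub>H2\<^esub> \<and>
    (\<forall>\<alpha> \<in> carrier H1. \<forall>\<beta> \<in> carrier H1. f (\<alpha> \<otimes>\<^bsub>H1\<^esub> \<beta>) = f \<alpha> \<otimes>\<^bsub>H2\<^esub> f \<beta>) \<and>
    (\<forall>\<alpha> \<in> f ` carrier H1. \<forall>\<beta> \<in> f ` carrier H1.
      f -` hadd H2 \<alpha> \<beta> \<inter> carrier H1 =
      hset_add H1 (f -` {\<alpha>} \<inter> carrier H1) (f -` {\<beta>} \<inter> carrier H1)) \<and>
    (\<forall>\<alpha> \<in> carrier H1. val H2 (f \<alpha>) = val H1 \<alpha>) \<and>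
    (\<exists>r. is_closed_ball H1 r (f -` {\<one>\<^bsub>H2\<^esub>} \<inter> carrier H1))"

text \<open>Valued hyperfields equipped with a chosen element \<open>P\<close>. It is part of the data of an
  object: the condition \<open>[P] = p\<close> does not determine it, as it only fixes \<open>P\<close> modulo elements of
  value at least \<open>\<rho>\<close>.\<close>

record 'a pointed_hyperfield = "'a valued_hyperfield" +
  pelt :: 'a

definition pelt_over :: "('a, 'b) pointed_hyperfield_scheme \<Rightarrow> nat \<Rightarrow> nat \<Rightarrow> bool" where
  "pelt_over H p e \<longleftrightarrow>
    (\<exists>a \<in> carrier H. \<exists>\<pi> \<in> carrier H. val H \<pi> = ereal (theta H) \<and> val H a = 0 \<and>
      pelt H = a \<otimes>\<^bsub>H\<^esub> \<pi> [^]\<^bsub>H\<^esub> e) \<and>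
    hclass H (rho H) (pelt H) = nat_elem (trunc_ring H) p"

definition HF_objects :: "nat \<Rightarrow> nat \<Rightarrow> nat \<Rightarrow> 'u pointed_hyperfield set" where
  "HF_objects p e n = {H. discrete_valued_hyperfield H \<and> normalized H e \<and> has_length H n \<and>
     mixed_char H p e \<and> perfect_field (res_field H) \<and> pelt_over H p e}"

definition HF_hom :: "'u pointed_hyperfield \<Rightarrow> 'u pointed_hyperfield \<Rightarrow> ('u \<Rightarrow> 'u) set" where
  "HF_hom H1 H2 = {f \<in> extensional (carrier H1).
     is_isometric_hom H1 H2 f \<and> f (pelt H1) = pelt H2}"

definition HF_cat :: "nat \<Rightarrow> nat \<Rightarrow> nat \<Rightarrow> ('u pointed_hyperfield, 'u \<Rightarrow> 'u) category" where
  "HF_cat p e n = \<lparr>Obj = HF_objects p e n, Hom = HF_hom,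
     Ident = (\<lambda>H. restrict id (carrier H)), Comp = (\<lambda>H1 H2 H3 g f. compose (carrier H1) g f)\<rparr>"


section \<open>The universe of carriers\<close>

text \<open>The objects of both categories have their carriers in one type, which plays the role of a
  universe. A complete discrete valuation ring with residue field \<open>k\<close> is as large as the set of
  sequences in \<open>k\<close>, while a hyperfield of finite length with residue field \<open>k\<close> need only be as
  large as \<open>k\<close> (or countably infinite). So the universe must be closed under forming sets of
  sequences. Every set embeds into such a universe, by the lemma below.\<close>

definition seq_closed_universe :: "'u itself \<Rightarrow> bool" where
  "seq_closed_universe _ \<longleftrightarrow> (\<exists>c :: (nat \<Rightarrow> 'u) \<Rightarrow> 'u. inj c)"

lemma seq_closed_universe_seq: "seq_closed_universe TYPE(nat \<Rightarrow> 'a)"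
proof -
  have "inj (\<lambda>(s :: nat \<Rightarrow> nat \<Rightarrow> 'a) k. s (fst (prod_decode k)) (snd (prod_decode k)))"
  proof (rule injI)
    fix s t :: "nat \<Rightarrow> nat \<Rightarrow> 'a"
    assume eq: "(\<lambda>k. s (fst (prod_decode k)) (snd (prod_decode k))) =
                (\<lambda>k. t (fst (prod_decode k)) (snd (prod_decode k)))"
    show "s = t"
    proof (intro ext)
      fix i j
      show "s i j = t i j" using fun_cong[OF eq, of "prod_encode (i, j)"] by simp
    qed
  qed
  then show ?thesis unfolding seq_closed_universe_def by blast
qed

end

theory Submission
 imports Defs "HOL-Algebra.Chinese_Remainder"
  "HOL-Algebra.Free_Abelian_Groups" "HOL-Algebra.Weak_Morphisms" "HOL-Computational_Algebra.Polynomial"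
begin

text \<open>The functor sends \<open>R\<close> with fraction field \<open>K\<close> to the hyperfield \<open>K / (1 + m^n)\<close>; it is fully faithful
and essentially surjective. What is used of this hyperfield is the multiplicative map \<open>sp\<close> from \<open>R\<close>
onto its integers, for which \<open>sp z\<close> lies in \<open>sp x + sp y\<close> iff \<open>z - x - y\<close> is small compared to \<open>x\<close> and
\<open>y\<close> (locale \<open>truncation\<close>, lemma \<open>hadd_sp_iff\<close>). So every homomorphism of rings induces a unique one
of hyperfields (\<open>induced_hom\<close>).

Going back rests on two facts. Tameness: since \<open>p\<close> does not divide \<open>e\<close>, every one-unit has a unique
\<open>e\<close>-th root among the one-units, and \<open>p\<close> is a Teichmueller element \<open>w\<close> times the \<open>e\<close>-th power of a
uniformizer \<open>x\<close>; as \<open>n > e\<close>, an equation of this kind between classes in the hyperfield lifts to \<open>R\<close>.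
Rigidity: an element of \<open>R\<close> is an expansion in powers of \<open>x\<close> with Teichmueller digits, and the
relation \<open>p = w x^e\<close> governs the carries. Hence in a product of two rings the expansions with matching
digits form a subring, the graph of a homomorphism (\<open>graph_hom\<close>). With two valuation rings this shows
that a homomorphism of hyperfields over \<open>p\<close> comes from a homomorphism of rings (\<open>full\<close>), which is
unique (\<open>faithful\<close>).

For a given hyperfield \<open>H\<close> the graph runs from a valuation ring onto the truncated ring of \<open>H\<close>, and
\<open>H\<close> is recovered because a unit of \<open>H\<close> is determined by its class there (\<open>truncation_exists\<close>).
That valuation ring has the residue field \<open>k\<close> of \<open>H\<close> and satisfies \<open>p = w x^e\<close> with prescribed residue
of \<open>w\<close>. It is built from the monoid ring \<open>Z[k]\<close>, whose completion along the kernel of \<open>Z[k] -> k\<close> is the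
ring of Witt vectors, by adjoining \<open>x\<close> and completing (\<open>CDVR_with_residue_field\<close>).\<close>

section \<open>Fully faithful and essentially surjective functors\<close>

text \<open>A quasi-inverse chooses for every \<open>Z\<close> an object \<open>F0 Z\<close> and an isomorphism \<open>u Z\<close> from \<open>Z\<close> to the image of
\<open>F0 Z\<close>, and takes preimages of the conjugates of arrows by \<open>u\<close>.\<close>

lemma equivalent_categories_if_fully_faithful_ess_surj:
 fixes C :: "('o1, 'm1) category" and D :: "('o2, 'm2) category"
  and G :: "('o2, 'm2, 'o1, 'm1) cat_functor"
 assumes G: "cat_functor D C G"
  and ff: "!!X Y g. [|X \<in> Obj D; Y \<in> Obj D; g \<in> Hom C (on_obj G X) (on_obj G Y)|]
   ==> \<exists>!f. f \<in> Hom D X Y & on_arr G X Y f = g"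
  and es: "!!Z. Z \<in> Obj C ==> \<exists>X \<in> Obj D. \<exists>f. iso_arrow C Z (on_obj G X) f"
 shows "equivalent_categories C D"
proof -
 interpret G: cat_functor D C G by fact
 define F0 where "F0 Z = (SOME X. X \<in> Obj D & (\<exists>f. iso_arrow C Z (on_obj G X) f))" for Z
 let ?T = "%Z. on_obj G (F0 Z)"
 define u where "u Z = (SOME f. iso_arrow C Z (?T Z) f)" for Z
 define v where "v Z = (SOME g. g \<in> Hom C (?T Z) Z &
   Comp C Z (?T Z) Z g (u Z) = Ident C Z &
   Comp C (?T Z) Z (?T Z) (u Z) g = Ident C (?T Z))" for Z
 have F0: "F0 Z \<in> Obj D & (\<exists>f. iso_arrow C Z (?T Z) f)" if "Z \<in> Obj C" for Z
  unfolding F0_def by (rule someI_ex) (use es[OF that] in blast)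
 have u_iso: "iso_arrow C Z (?T Z) (u Z)" if "Z \<in> Obj C" for Z
  unfolding u_def by (rule someI_ex) (use F0[OF that] in blast)
 have F0D: "F0 Z \<in> Obj D" if "Z \<in> Obj C" for Z using F0 that by blast
 have GC: "on_obj G X \<in> Obj C" if "X \<in> Obj D" for X using G.on_obj_closed that .
 have v: "v Z \<in> Hom C (?T Z) Z &
   Comp C Z (?T Z) Z (v Z) (u Z) = Ident C Z &
   Comp C (?T Z) Z (?T Z) (u Z) (v Z) = Ident C (?T Z)"
  if "Z \<in> Obj C" for Z
  unfolding v_def
  by (rule someI_ex) (use u_iso[OF that] in \<open>auto simp: iso_arrow_def\<close>)
 have uH: "u Z \<in> Hom C Z (?T Z)" if "Z \<in> Obj C" for Z
  using u_iso[OF that] by (simp add: iso_arrow_def)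
 define pre where "pre X Y g = (THE f. f \<in> Hom D X Y & on_arr G X Y f = g)" for X Y g
 have pre: "pre X Y g \<in> Hom D X Y" "on_arr G X Y (pre X Y g) = g"
  if "X \<in> Obj D" "Y \<in> Obj D" "g \<in> Hom C (on_obj G X) (on_obj G Y)" for X Y g
  using theI'[OF ff[OF that]] by (auto simp: pre_def)
 have inj: "f = f'" if "X \<in> Obj D" "Y \<in> Obj D" "f \<in> Hom D X Y" "f' \<in> Hom D X Y"
  "on_arr G X Y f = on_arr G X Y f'" for X Y f f'
  using ff[OF that(1,2) G.on_arr_closed[OF that(1,2,3)]] that by metis
 define F where "F = \<lparr>on_obj = F0, on_arr = (%Z Z' f. pre (F0 Z) (F0 Z')
   (Comp C (?T Z) Z' (?T Z') (u Z')
    (Comp C (?T Z) Z Z' f (v Z))))\<rparr>"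
 have Fo: "on_obj F Z = F0 Z" for Z by (simp add: F_def)
 have conj_Hom: "Comp C (?T Z) Z' (?T Z') (u Z')
    (Comp C (?T Z) Z Z' f (v Z)) \<in> Hom C (?T Z) (?T Z')"
  if "Z \<in> Obj C" "Z' \<in> Obj C" "f \<in> Hom C Z Z'" for Z Z' f
  using that by (intro G.cod.Comp_in_Hom GC F0D uH conjunct1[OF v])
 have Fa: "on_arr F Z Z' f \<in> Hom D (F0 Z) (F0 Z')"
  "on_arr G (F0 Z) (F0 Z') (on_arr F Z Z' f) = Comp C (?T Z) Z' (?T Z') (u Z')
    (Comp C (?T Z) Z Z' f (v Z))"
  if "Z \<in> Obj C" "Z' \<in> Obj C" "f \<in> Hom C Z Z'" for Z Z' f
  using pre[OF F0D[OF that(1)] F0D[OF that(2)] conj_Hom[OF that]] by (simp_all add: F_def)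
 have F_u: "Comp C Z (?T Z) (?T Z') (on_arr G (F0 Z) (F0 Z') (on_arr F Z Z' f)) (u Z)
   = Comp C Z Z' (?T Z') (u Z') f"
  if Z: "Z \<in> Obj C" "Z' \<in> Obj C" "f \<in> Hom C Z Z'" for Z Z' f
 proof -
  note H = GC[OF F0D[OF Z(1)]] GC[OF F0D[OF Z(2)]] uH[OF Z(1)] uH[OF Z(2)] v[OF Z(1)] v[OF Z(2)] Z
  have fv: "Comp C (?T Z) Z Z' f (v Z) \<in> Hom C (?T Z) Z'"
   using H by (intro G.cod.Comp_in_Hom) auto
  have "Comp C Z (?T Z) (?T Z') (on_arr G (F0 Z) (F0 Z') (on_arr F Z Z' f)) (u Z)
   = Comp C Z Z' (?T Z') (u Z') (Comp C Z (?T Z) Z' (Comp C (?T Z) Z Z' f (v Z)) (u Z))"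
   unfolding Fa[OF Z] using H fv by (intro G.cod.Comp_assoc[symmetric]) auto
  also have "Comp C Z (?T Z) Z' (Comp C (?T Z) Z Z' f (v Z)) (u Z)
   = Comp C Z Z Z' f (Comp C Z (?T Z) Z (v Z) (u Z))"
   using H by (intro G.cod.Comp_assoc[symmetric]) auto
  also have "\<dots> = f" using H by (simp add: G.cod.Comp_Ident_right)
  finally show ?thesis .
 qed
 have v_F: "Comp C (?T Z) (?T Z') Z' (v Z') (on_arr G (F0 Z) (F0 Z') (on_arr F Z Z' f))
   = Comp C (?T Z) Z Z' f (v Z)"
  if Z: "Z \<in> Obj C" "Z' \<in> Obj C" "f \<in> Hom C Z Z'" for Z Z' f
 proof -
  note H = GC[OF F0D[OF Z(1)]] GC[OF F0D[OF Z(2)]] uH[OF Z(1)] uH[OF Z(2)] v[OF Z(1)] v[OF Z(2)] Z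
  have fv: "Comp C (?T Z) Z Z' f (v Z) \<in> Hom C (?T Z) Z'"
   using H by (intro G.cod.Comp_in_Hom) auto
  have "Comp C (?T Z) (?T Z') Z' (v Z') (on_arr G (F0 Z) (F0 Z') (on_arr F Z Z' f))
   = Comp C (?T Z) Z' Z' (Comp C Z' (?T Z') Z' (v Z') (u Z')) (Comp C (?T Z) Z Z' f (v Z))"
   unfolding Fa[OF Z] using H fv by (intro G.cod.Comp_assoc) auto
  also have "\<dots> = Comp C (?T Z) Z Z' f (v Z)"
   using H fv by (simp add: G.cod.Comp_Ident_left)
  finally show ?thesis .
 qed
 have u_epi: "a = b" if Z: "Z \<in> Obj C" "X \<in> Obj C" "a \<in> Hom C (?T Z) X" "b \<in> Hom C (?T Z) X"
  "Comp C Z (?T Z) X a (u Z) = Comp C Z (?T Z) X b (u Z)" for Z X a b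
 proof -
  note H = GC[OF F0D[OF Z(1)]] uH[OF Z(1)] v[OF Z(1)] Z(1-4)
  have "a = Comp C (?T Z) (?T Z) X a (Comp C (?T Z) Z (?T Z) (u Z) (v Z))"
   using H by (simp add: G.cod.Comp_Ident_right)
  also have "\<dots> = Comp C (?T Z) Z X (Comp C Z (?T Z) X a (u Z)) (v Z)"
   using H by (intro G.cod.Comp_assoc) auto
  also have "\<dots> = Comp C (?T Z) Z X (Comp C Z (?T Z) X b (u Z)) (v Z)" by (simp add: Z)
  also have "\<dots> = Comp C (?T Z) (?T Z) X b (Comp C (?T Z) Z (?T Z) (u Z) (v Z))"
   using H by (intro G.cod.Comp_assoc[symmetric]) auto
  also have "\<dots> = b" using H by (simp add: G.cod.Comp_Ident_right)
  finally show ?thesis .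
 qed
 have F: "cat_functor C D F"
 proof (unfold_locales)
  fix X assume X: "X \<in> Obj C"
  show "on_obj F X \<in> Obj D" using F0D[OF X] by (simp add: Fo)
  note I = G.cod.Ident_in_Hom[OF X]
  have "on_arr G (F0 X) (F0 X) (on_arr F X X (Ident C X)) = Ident C (?T X)"
  proof (rule u_epi[OF X GC[OF F0D[OF X]]])
   show "on_arr G (F0 X) (F0 X) (on_arr F X X (Ident C X)) \<in> Hom C (?T X) (?T X)"
    by (intro G.on_arr_closed F0D X Fa I)
  qed (use F_u[OF X X I] in \<open>simp_all add: G.cod.Ident_in_Hom X GC F0D G.cod.Comp_Ident_left G.cod.Comp_Ident_right uH\<close>)
  then show "on_arr F X X (Ident C X) = Ident D (on_obj F X)"
   unfolding Fo
   by (intro inj[OF F0D[OF X] F0D[OF X] Fa(1)[OF X X I]])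
    (simp_all add: G.dom.Ident_in_Hom F0D X G.on_arr_Ident)
 next
  fix X Y f assume "X \<in> Obj C" "Y \<in> Obj C" "f \<in> Hom C X Y"
  then show "on_arr F X Y f \<in> Hom D (on_obj F X) (on_obj F Y)" using Fa by (simp add: Fo)
 next
  fix X Y Z f g assume A: "X \<in> Obj C" "Y \<in> Obj C" "Z \<in> Obj C" "f \<in> Hom C X Y" "g \<in> Hom C Y Z"
  have gf: "Comp C X Y Z g f \<in> Hom C X Z" using A by (intro G.cod.Comp_in_Hom)
  note XY = Fa(1)[OF A(1,2,4)] and YZ = Fa(1)[OF A(2,3,5)] and XZ = Fa(1)[OF A(1,3) gf]
  note D = F0D[OF A(1)] F0D[OF A(2)] F0D[OF A(3)]
  have c: "Comp D (F0 X) (F0 Y) (F0 Z) (on_arr F Y Z g) (on_arr F X Y f) \<in> Hom D (F0 X) (F0 Z)"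
   by (intro G.dom.Comp_in_Hom D XY YZ)
  note GD = GC[OF D(1)] GC[OF D(2)] GC[OF D(3)]
  note GH = G.on_arr_closed[OF D(1,2) XY] G.on_arr_closed[OF D(2,3) YZ] G.on_arr_closed[OF D(1,3) XZ]
  have "on_arr G (F0 X) (F0 Z) (on_arr F X Z (Comp C X Y Z g f)) =
    Comp C (?T X) (?T Y) (?T Z)
    (on_arr G (F0 Y) (F0 Z) (on_arr F Y Z g)) (on_arr G (F0 X) (F0 Y) (on_arr F X Y f))" (is "?l = ?r")
  proof (rule u_epi[OF A(1) GD(3) GH(3)])
   show "?r \<in> Hom C (?T X) (?T Z)" by (intro G.cod.Comp_in_Hom GD GH)
   have "Comp C X (?T X) (?T Z) ?r (u X) =
    Comp C X (?T Y) (?T Z) (on_arr G (F0 Y) (F0 Z) (on_arr F Y Z g))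
     (Comp C X (?T X) (?T Y) (on_arr G (F0 X) (F0 Y) (on_arr F X Y f)) (u X))"
    by (intro G.cod.Comp_assoc[symmetric] GD GH A uH)
   also have "\<dots> = Comp C X (?T Y) (?T Z) (on_arr G (F0 Y) (F0 Z) (on_arr F Y Z g))
     (Comp C X Y (?T Y) (u Y) f)" using F_u[OF A(1,2,4)] by simp
   also have "\<dots> = Comp C X Y (?T Z) (Comp C Y (?T Y) (?T Z) (on_arr G (F0 Y) (F0 Z) (on_arr F Y Z g)) (u Y)) f"
    by (intro G.cod.Comp_assoc GD GH A uH)
   also have "\<dots> = Comp C X Y (?T Z) (Comp C Y Z (?T Z) (u Z) g) f"
    using F_u[OF A(2,3,5)] by simp
   also have "\<dots> = Comp C X Z (?T Z) (u Z) (Comp C X Y Z g f)"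
    by (intro G.cod.Comp_assoc[symmetric] GD GH A uH)
   finally show "Comp C X (?T X) (?T Z) ?l (u X) = Comp C X (?T X) (?T Z) ?r (u X)"
    using F_u[OF A(1,3) gf] by simp
  qed
  then show "on_arr F X Z (Comp C X Y Z g f) =
    Comp D (on_obj F X) (on_obj F Y) (on_obj F Z) (on_arr F Y Z g) (on_arr F X Y f)"
   unfolding Fo
   by (intro inj[OF D(1,3) XZ c]) (simp add: G.on_arr_Comp[OF D XY YZ])
 qed
 interpret F: cat_functor C D F by fact
 have id_C: "cat_functor C C id_functor" and id_D: "cat_functor D D id_functor"
  by unfold_locales (simp_all add: id_functor_def)
 have GF: "cat_functor C C (comp_functor G F)"
  by unfold_locales
   (simp_all add: comp_functor_def F.on_obj_closed F.on_arr_closed F.on_arr_Ident F.on_arr_Comp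
     G.on_obj_closed G.on_arr_closed G.on_arr_Ident G.on_arr_Comp)
 have FG: "cat_functor D D (comp_functor F G)"
  by unfold_locales
   (simp_all add: comp_functor_def F.on_obj_closed F.on_arr_closed F.on_arr_Ident F.on_arr_Comp
     G.on_obj_closed G.on_arr_closed G.on_arr_Ident G.on_arr_Comp)
 have eta: "natural_isomorphism C C id_functor (comp_functor G F) u"
 proof (intro natural_isomorphism.intro id_C GF natural_isomorphism_axioms.intro)
  fix X assume "X \<in> Obj C"
  then show "iso_arrow C (on_obj id_functor X) (on_obj (comp_functor G F) X) (u X)"
   using u_iso by (simp add: id_functor_def comp_functor_def Fo)
 next
  fix X Y f assume "X \<in> Obj C" "Y \<in> Obj C" "f \<in> Hom C X Y"
  from F_u[OF this]
  show "Comp C (on_obj id_functor X) (on_obj id_functor Y) (on_obj (comp_functor G F) Y) (u Y) (on_arr id_functor X Y f) =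
    Comp C (on_obj id_functor X) (on_obj (comp_functor G F) X) (on_obj (comp_functor G F) Y)
    (on_arr (comp_functor G F) X Y f) (u X)"
   by (simp add: id_functor_def comp_functor_def Fo)
 qed
 define eps where "eps X = pre (F0 (on_obj G X)) X (v (on_obj G X))" for X
 define eps' where "eps' X = pre X (F0 (on_obj G X)) (u (on_obj G X))" for X
 have eps: "eps X \<in> Hom D (F0 (on_obj G X)) X" "on_arr G (F0 (on_obj G X)) X (eps X) = v (on_obj G X)"
  "eps' X \<in> Hom D X (F0 (on_obj G X))" "on_arr G X (F0 (on_obj G X)) (eps' X) = u (on_obj G X)"
  if X: "X \<in> Obj D" for X
  using pre[OF F0D[OF GC[OF X]] X conjunct1[OF v[OF GC[OF X]]]] pre[OF X F0D[OF GC[OF X]] uH[OF GC[OF X]]]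
  by (simp_all add: eps_def eps'_def)
 have epsn: "natural_isomorphism D D (comp_functor F G) id_functor eps"
 proof (intro natural_isomorphism.intro id_D FG natural_isomorphism_axioms.intro)
  fix X assume X: "X \<in> Obj D"
  note X' = F0D[OF GC[OF X]]
  have 1: "Comp D (F0 (on_obj G X)) X (F0 (on_obj G X)) (eps' X) (eps X) = Ident D (F0 (on_obj G X))"
   by (intro inj[OF X' X'] G.dom.Comp_in_Hom G.dom.Ident_in_Hom X X' eps)
    (simp add: G.on_arr_Comp X X' eps G.on_arr_Ident v GC)
  have 2: "Comp D X (F0 (on_obj G X)) X (eps X) (eps' X) = Ident D X"
   by (intro inj[OF X X] G.dom.Comp_in_Hom G.dom.Ident_in_Hom X X' eps)
    (simp add: G.on_arr_Comp X X' eps G.on_arr_Ident v GC)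
  show "iso_arrow D (on_obj (comp_functor F G) X) (on_obj id_functor X) (eps X)"
   using 1 2 eps[OF X] by (auto simp: iso_arrow_def id_functor_def comp_functor_def Fo)
 next
  fix X Y f assume A: "X \<in> Obj D" "Y \<in> Obj D" "f \<in> Hom D X Y"
  note D = F0D[OF GC[OF A(1)]] F0D[OF GC[OF A(2)]]
  note Gf = G.on_arr_closed[OF A]
  note FGf = Fa[OF GC[OF A(1)] GC[OF A(2)] Gf]
  have "Comp D (F0 (on_obj G X)) (F0 (on_obj G Y)) Y (eps Y) (on_arr F (on_obj G X) (on_obj G Y) (on_arr G X Y f))
    = Comp D (F0 (on_obj G X)) X Y f (eps X)"
  proof (rule inj[OF D(1) A(2)])
   show "on_arr G (F0 (on_obj G X)) Y (Comp D (F0 (on_obj G X)) (F0 (on_obj G Y)) Y (eps Y) (on_arr F (on_obj G X) (on_obj G Y) (on_arr G X Y f))) =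
    on_arr G (F0 (on_obj G X)) Y (Comp D (F0 (on_obj G X)) X Y f (eps X))"
    using v_F[OF GC[OF A(1)] GC[OF A(2)] Gf]
    by (simp add: G.on_arr_Comp[OF D A(2) FGf(1) eps(1)[OF A(2)]] G.on_arr_Comp[OF D(1) A(1,2) eps(1)[OF A(1)] A(3)]
      eps[OF A(1)] eps[OF A(2)])
  qed (intro G.dom.Comp_in_Hom D A eps FGf)+
  then show "Comp D (on_obj (comp_functor F G) X) (on_obj (comp_functor F G) Y) (on_obj id_functor Y) (eps Y) (on_arr (comp_functor F G) X Y f) =
    Comp D (on_obj (comp_functor F G) X) (on_obj id_functor X) (on_obj id_functor Y) (on_arr id_functor X Y f) (eps X)"
   by (simp add: id_functor_def comp_functor_def Fo)
 qed
 show ?thesis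
  unfolding equivalent_categories_def
  using G.cod.category_axioms G.dom.category_axioms F G eta epsn by blast
qed

section \<open>Commutative rings\<close>

lemma nat_elem_0: "nat_elem R 0 = \<zero>\<^bsub>R\<^esub>"
 and nat_elem_Suc: "nat_elem R (Suc k) = nat_elem R k \<oplus>\<^bsub>R\<^esub> \<one>\<^bsub>R\<^esub>"
 by (simp_all add: nat_elem_def add_pow_def)

context cring begin

lemma nat_elem_closed [simp, intro]: "nat_elem R k \<in> carrier R"
 by (simp add: nat_elem_def)

lemma nat_elem_add: "nat_elem R (j + k) = nat_elem R j \<oplus> nat_elem R k"
 by (simp add: nat_elem_def add.nat_pow_mult)

lemma nat_elem_1 [simp]: "nat_elem R (Suc 0) = \<one>"
 by (simp add: nat_elem_def)

lemma nat_elem_mult: "nat_elem R (j * k) = nat_elem R j \<otimes> nat_elem R k"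
proof (induction j)
 case 0 show ?case by (simp add: nat_elem_0)
next
 case (Suc j)
 have "nat_elem R (Suc j * k) = nat_elem R k \<oplus> nat_elem R j \<otimes> nat_elem R k"
  by (simp add: nat_elem_add Suc.IH)
 then show ?case by (simp add: nat_elem_Suc l_distr a_comm)
qed

lemma binomial_theorem:
 assumes x: "x \<in> carrier R" and y: "y \<in> carrier R"
 shows "(x \<oplus> y) [^] (m::nat) = (\<Oplus>i\<in>{..m}. nat_elem R (m choose i) \<otimes> (x [^] i \<otimes> y [^] (m - i)))"
proof (induction m)
 case 0 show ?case by simp
next
 case (Suc m)
 let ?s = "%m i. nat_elem R (m choose i) \<otimes> (x [^] i \<otimes> y [^] (m - i))"
 let ?a = "%i. nat_elem R (m choose i) \<otimes> (x [^] (Suc i) \<otimes> y [^] (m - i))"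
 let ?b = "%i. nat_elem R (m choose Suc i) \<otimes> (x [^] (Suc i) \<otimes> y [^] (m - i))"
 let ?c = "%i. nat_elem R (m choose i) \<otimes> (x [^] i \<otimes> y [^] (Suc m - i))"
 have "finsum R (?s (Suc m)) {..Suc m} = finsum R (%i. ?s (Suc m) (Suc i)) {..m} \<oplus> ?s (Suc m) 0"
  using x y by (subst finsum_Suc2) auto
 also have "finsum R (%i. ?s (Suc m) (Suc i)) {..m} = finsum R (%i. ?a i \<oplus> ?b i) {..m}"
  using x y by (intro finsum_cong') (auto simp: nat_elem_add l_distr)
 also have "\<dots> = finsum R ?a {..m} \<oplus> finsum R ?b {..m}"
  using x y by (intro finsum_addf) auto
 also have "\<dots> \<oplus> ?s (Suc m) 0 = finsum R ?a {..m} \<oplus> (finsum R ?b {..m} \<oplus> ?c 0)"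
  using x y by (simp add: a_assoc del: nat_pow_Suc)
 also have "finsum R ?b {..m} \<oplus> ?c 0 = finsum R ?c {..Suc m}"
  using x y by (subst finsum_Suc2[of ?c]) auto
 also have "\<dots> = finsum R ?c {..m}"
  using x y by (subst finsum_Suc) (auto simp: binomial_eq_0 nat_elem_0)
 also have "finsum R ?c {..m} = finsum R (%i. ?s m i \<otimes> y) {..m}"
  using x y by (intro finsum_cong') (auto simp: Suc_diff_le m_assoc)
 also have "\<dots> = finsum R (?s m) {..m} \<otimes> y"
  using x y by (intro finsum_ldistr[symmetric]) auto
 also have "finsum R ?a {..m} = finsum R (%i. ?s m i \<otimes> x) {..m}"
  using x y by (intro finsum_cong') (auto simp: m_ac)
 also have "\<dots> = finsum R (?s m) {..m} \<otimes> x"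
  using x y by (intro finsum_ldistr[symmetric]) auto
 finally show ?case using x y Suc by (simp add: r_distr)
qed

lemma finsum_in_subset:
 assumes "G \<subseteq> carrier R" "!!a b. [|a \<in> G; b \<in> G|] ==> a \<oplus> b \<in> G" "!!i. i \<le> q ==> f i \<in> G"
 shows "finsum R f {..(q::nat)} \<in> G"
 using assms(3)
proof (induction q)
 case 0 then show ?case using assms(1) by (simp add: subset_iff)
next
 case (Suc q)
 have "f \<in> {..Suc q} \<rightarrow> carrier R" using Suc.prems assms(1) by auto
 then show ?case using Suc by (simp add: assms(2))
qed

text \<open>The cofactor of \<open>p\<close> lies in every set \<open>G\<close> with the closure properties below; the induction on the
number of digits needs it in a set that is not an ideal.\<close>

lemma power_prime_add:
 assumes p: "Factorial_Ring.prime (p::nat)" and G: "G \<subseteq> carrier R" "\<zero> \<in> G" "\<one> \<in> G"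
  "!!a b. [|a \<in> G; b \<in> G|] ==> a \<oplus> b \<in> G" "!!a b. [|a \<in> G; b \<in> G|] ==> a \<otimes> b \<in> G"
  and x: "x \<in> G" and y: "y \<in> G"
 shows "\<exists>Q \<in> G. (x \<oplus> y) [^] p = x [^] p \<oplus> y [^] p \<oplus> nat_elem R p \<otimes> (x \<otimes> y \<otimes> Q)"
proof -
 have p2: "p \<ge> 2" using p prime_ge_2_nat by blast
 then obtain q where q: "p = Suc (Suc q)" using le_Suc_ex[of 2 p] by auto
 have xc: "x \<in> carrier R" "y \<in> carrier R" using x y G by auto
 have nG: "nat_elem R k \<in> G" for k by (induction k) (auto simp: nat_elem_0 nat_elem_Suc G)
 have pG: "a [^] k \<in> G" if "a \<in> G" for a and k :: nat
  using that G by (induction k) auto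
 let ?Q = "%i. nat_elem R ((p choose Suc i) div p) \<otimes> (x [^] i \<otimes> y [^] (q - i))"
 let ?s = "%i. nat_elem R (p choose i) \<otimes> (x [^] i \<otimes> y [^] (p - i))"
 have QG: "finsum R ?Q {..q} \<in> G"
  by (intro finsum_in_subset G nG pG x y) auto
 have "(x \<oplus> y) [^] p = finsum R ?s {..Suc (Suc q)}" unfolding binomial_theorem[OF xc] using q by simp
 also have "\<dots> = ?s p \<oplus> (finsum R (%i. ?s (Suc i)) {..q} \<oplus> ?s 0)"
  using xc by (subst finsum_Suc, simp, subst finsum_Suc2) (auto simp: q)
 also have "finsum R (%i. ?s (Suc i)) {..q} = finsum R (%i. (nat_elem R p \<otimes> (x \<otimes> y)) \<otimes> ?Q i) {..q}"
 proof (intro finsum_cong')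
  fix i assume i: "i \<in> {..q}"
  then have "p dvd (p choose Suc i)" using p q by (intro dvd_choose_prime) auto
  then have c: "nat_elem R (p choose Suc i) = nat_elem R p \<otimes> nat_elem R ((p choose Suc i) div p)"
   by (metis dvd_mult_div_cancel nat_elem_mult)
  have "p - Suc i = Suc (q - i)" using i q by auto
  then show "?s (Suc i) = (nat_elem R p \<otimes> (x \<otimes> y)) \<otimes> ?Q i"
   using xc by (simp add: c m_ac)
 qed (use xc in auto)
 also have "\<dots> = (nat_elem R p \<otimes> (x \<otimes> y)) \<otimes> finsum R ?Q {..q}"
  using xc by (intro finsum_rdistr[symmetric]) auto
 finally have "(x \<oplus> y) [^] p = x [^] p \<oplus> y [^] p \<oplus> nat_elem R p \<otimes> (x \<otimes> y \<otimes> finsum R ?Q {..q})"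
  using xc QG G(1) by (simp add: a_ac m_assoc subset_iff)
 then show ?thesis using QG by blast
qed

lemma power_add_mod_square:
 assumes x: "x \<in> carrier R" and h: "h \<in> carrier R"
 shows "\<exists>Q \<in> carrier R. (x \<oplus> h) [^] Suc m = x [^] Suc m \<oplus> nat_elem R (Suc m) \<otimes> (x [^] m \<otimes> h) \<oplus> h \<otimes> h \<otimes> Q"
proof (induction m)
 case 0 show ?case using x h by (intro bexI[of _ \<zero>]) auto
next
 case (Suc m)
 then obtain Q where Q: "Q \<in> carrier R"
  "(x \<oplus> h) [^] Suc m = x [^] Suc m \<oplus> nat_elem R (Suc m) \<otimes> (x [^] m \<otimes> h) \<oplus> h \<otimes> h \<otimes> Q" by blast
 define N where "N = nat_elem R (Suc m)"
 define X where "X = x [^] m"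
 have c: "N \<in> carrier R" "X \<in> carrier R" using x by (auto simp: N_def X_def)
 have "(x \<oplus> h) [^] Suc (Suc m) = (X \<otimes> x \<oplus> N \<otimes> (X \<otimes> h) \<oplus> h \<otimes> h \<otimes> Q) \<otimes> (x \<oplus> h)"
  using Q x h by (simp add: N_def X_def)
 also have "\<dots> = X \<otimes> x \<otimes> x \<oplus> (N \<oplus> \<one>) \<otimes> (X \<otimes> x \<otimes> h) \<oplus> h \<otimes> h \<otimes> (N \<otimes> X \<oplus> Q \<otimes> (x \<oplus> h))"
  by (use c x h Q(1) in algebra)
 finally show ?case
  using x h Q(1) c by (intro bexI[of _ "N \<otimes> X \<oplus> Q \<otimes> (x \<oplus> h)"])
    (auto simp: N_def X_def nat_elem_Suc[of R "Suc m"])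
qed

lemma ideal_prod_PIdl:
 assumes "a \<in> carrier R" "b \<in> carrier R"
 shows "ideal_prod R (PIdl a) (PIdl b) = PIdl (a \<otimes> b)"
 using assms
 by (simp add: ideal_prod_eq_genideal cgenideal_ideal cgenideal_prod)
  (metis cgenideal_eq_genideal cgenideal_ideal genideal_minimal genideal_self' m_closed
   Idl_subset_ideal subset_antisym cgenideal_self genideal_self ideal.Icarr subsetI)

lemma hom_nat_elem: assumes "h \<in> ring_hom R S" "cring S" shows "h (nat_elem R k) = nat_elem S k"
proof (induction k)
 case 0
 show ?case using ring_hom_zero[OF assms(1) ring_axioms cring.axioms(1)[OF assms(2)]] by (simp add: nat_elem_0)
next
 case (Suc k)
 then show ?case using ring_hom_add[OF assms(1)] ring_hom_one[OF assms(1)] by (simp add: nat_elem_Suc)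
qed

lemma ideal_pow_PIdl:
 assumes "a \<in> carrier R"
 shows "ideal_pow R (PIdl a) k = PIdl (a [^] k)"
proof (induction k)
 case 0
 have "PIdl \<one> = carrier R" by (force simp: cgenideal_def)
 then show ?case by (simp add: ideal_pow_def ideals_set_def nat_pow_def)
next
 case (Suc k)
 have "ideal_pow R (PIdl a) (Suc k) = ideal_prod R (ideal_pow R (PIdl a) k) (PIdl a)"
  by (simp add: ideal_pow_def ideals_set_def nat_pow_def)
 then show ?case using assms by (simp add: Suc ideal_prod_PIdl)
qed

lemma local_ringI:
 assumes M: "ideal M R" "\<one> \<notin> M" and U: "!!x. [|x \<in> carrier R; x \<notin> M|] ==> x \<in> Units R"
 shows "maximalideal M R" "!!I. maximalideal I R ==> I = M" "max_ideal R = M"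
proof -
 interpret M: ideal M R by fact
 have unit: "J = carrier R" if "ideal J R" "x \<in> J" "x \<in> Units R" for J x
 proof -
  interpret J: ideal J R by fact
  have "inv x \<otimes> x \<in> J" using that by (intro J.I_l_closed) auto
  then show ?thesis using that by (intro J.one_imp_carrier) simp
 qed
 show max: "maximalideal M R"
 proof (rule maximalidealI[OF M(1)])
  show "carrier R ~= M" using M(2) by auto
  fix J assume J: "ideal J R" "M \<subseteq> J" "J \<subseteq> carrier R"
  show "J = M \<or> J = carrier R"
  proof (rule ccontr)
   assume "\<not> ?thesis"
   then obtain x where "x \<in> J" "x \<notin> M" "J ~= carrier R" using J(2) by auto
   then show False using unit[OF J(1)] U J(3) by blast
  qed
 qed
 show uniq: "I = M" if "maximalideal I R" for I
 proof -
  interpret I: maximalideal I R by fact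
  have "I \<subseteq> M"
  proof
   fix x assume "x \<in> I"
   then show "x \<in> M" using unit[OF I.is_ideal] U I.Icarr I.I_notcarr by metis
  qed
  then show ?thesis using I.I_maximal[OF M(1)] M.a_subset M(2) by blast
 qed
 show "max_ideal R = M"
  unfolding max_ideal_def by (intro the_equality max uniq)
qed

end

section \<open>Complete filtered rings\<close>

locale filtered_ring = cring R for R (structure) +
 fixes F :: "nat => 'a set"
 assumes F_ideal: "ideal (F k) R"
  and F_0: "F 0 = carrier R"
  and F_Suc: "F (Suc k) \<subseteq> F k"
  and F_mult: "[|a \<in> F i; b \<in> F j|] ==> a \<otimes> b \<in> F (i + j)"
  and F_separated: "[|x \<in> carrier R; !!k. x \<in> F k|] ==> x = \<zero>"
  and F_complete: "[|!!i. s i \<in> carrier R; !!i. s (Suc i) \<ominus> s i \<in> F i|] ==> \<exists>L \<in> carrier R. \<forall>i. L \<ominus> s i \<in> F i"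
begin

lemma F_carrier: "a \<in> F k ==> a \<in> carrier R"
 by (rule ideal.Icarr[OF F_ideal])
lemma F_zero [simp, intro]: "\<zero> \<in> F k"
 by (rule additive_subgroup.zero_closed[OF ideal.axioms(1)[OF F_ideal]])
lemma F_add: "[|a \<in> F k; b \<in> F k|] ==> a \<oplus> b \<in> F k"
 by (rule additive_subgroup.a_closed[OF ideal.axioms(1)[OF F_ideal]])
lemma F_neg: "a \<in> F k ==> \<ominus> a \<in> F k"
 by (rule additive_subgroup.a_inv_closed[OF ideal.axioms(1)[OF F_ideal]])
lemma F_diff: "[|a \<in> F k; b \<in> F k|] ==> a \<ominus> b \<in> F k"
 by (simp add: minus_eq F_add F_neg)
lemma F_mult_l: "[|a \<in> F k; b \<in> carrier R|] ==> b \<otimes> a \<in> F k"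
 by (rule ideal.I_l_closed[OF F_ideal])
lemma F_mult_r: "[|a \<in> F k; b \<in> carrier R|] ==> a \<otimes> b \<in> F k"
 by (rule ideal.I_r_closed[OF F_ideal])
lemma F_mono: "i \<le> j ==> F j \<subseteq> F i"
 by (rule lift_Suc_antimono_le[of F, OF F_Suc])
lemma F_monoD: "[|a \<in> F j; i \<le> j|] ==> a \<in> F i"
 using F_mono by blast

lemma F_diff_trans:
 assumes "a \<ominus> b \<in> F k" "b \<ominus> c \<in> F k" "a \<in> carrier R" "b \<in> carrier R" "c \<in> carrier R"
 shows "a \<ominus> c \<in> F k"
proof -
 have "a \<ominus> c = (a \<ominus> b) \<oplus> (b \<ominus> c)" by (use assms(3-5) in algebra)
 then show ?thesis using F_add assms by metis
qed

lemma F_diff_sym: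
 assumes "a \<ominus> b \<in> F k" "a \<in> carrier R" "b \<in> carrier R"
 shows "b \<ominus> a \<in> F k"
proof -
 have "b \<ominus> a = \<ominus> (a \<ominus> b)" by (use assms(2-3) in algebra)
 then show ?thesis using F_neg assms by metis
qed

lemma F_diff_mult:
 assumes "a \<ominus> b \<in> F k" "c \<ominus> d \<in> F k" "a \<in> carrier R" "b \<in> carrier R" "c \<in> carrier R" "d \<in> carrier R"
 shows "a \<otimes> c \<ominus> b \<otimes> d \<in> F k"
proof -
 have "a \<otimes> c \<ominus> b \<otimes> d = (a \<ominus> b) \<otimes> c \<oplus> b \<otimes> (c \<ominus> d)" by (use assms(3-) in algebra)
 then show ?thesis using assms by (simp add: F_add F_mult_l F_mult_r)
qed

lemma F_diff_pow:
 assumes "a \<ominus> b \<in> F k" "a \<in> carrier R" "b \<in> carrier R"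
 shows "a [^] (m::nat) \<ominus> b [^] m \<in> F k"
proof (induction m)
 case 0 show ?case by (simp add: minus_eq r_neg)
next
 case (Suc m) then show ?case using assms by (simp add: F_diff_mult)
qed

lemma F_diff_mem:
 assumes "a \<ominus> b \<in> F k" "b \<in> F k" "a \<in> carrier R"
 shows "a \<in> F k"
proof -
 have b: "b \<in> carrier R" using assms F_carrier by auto
 have "a = (a \<ominus> b) \<oplus> b" by (use assms(3) b in algebra)
 then show ?thesis using F_add assms by metis
qed

lemma F_eqI:
 assumes "a \<in> carrier R" "b \<in> carrier R" "!!k. a \<ominus> b \<in> F k"
 shows "a = b"
proof -
 have "a \<ominus> b = \<zero>" using assms by (intro F_separated) auto
 then show ?thesis using assms by simp
qed

lemma diff_self_F [simp]: "a \<in> carrier R ==> a \<ominus> a \<in> F k"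
 by (simp add: minus_eq r_neg)

end

text \<open>Instances are the complete discrete valuation rings and the truncated rings of hyperfields, whose
filtration reaches zero. So \<open>p\<close> may be nilpotent here.\<close>

locale perfect_residue_ring = filtered_ring R F for R (structure) and F :: "nat => 'a set" +
 fixes p :: nat
 assumes prime_p: "Factorial_Ring.prime p"
  and p_in_F1: "nat_elem R p \<in> F 1"
  and one_notin_F1: "\<one> \<notin> F 1"
  and Units_if_notin_F1: "[|x \<in> carrier R; x \<notin> F 1|] ==> x \<in> Units R"
  and perfect: "x \<in> carrier R ==> \<exists>y \<in> carrier R. x \<ominus> y [^] p \<in> F 1"
begin

lemma p_ge_2: "p \<ge> 2" using prime_p prime_ge_2_nat by blast

lemma Units_iff_notin_F1: "x \<in> carrier R ==> x \<in> Units R \<longleftrightarrow> x \<notin> F 1"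
 using Units_if_notin_F1 one_notin_F1 F_mult_l[of x 1 "inv x"]
 by (metis Units_inv_closed Units_l_inv)

lemma F1_prime: "[|a \<in> carrier R; b \<in> carrier R; a \<otimes> b \<in> F 1|] ==> a \<in> F 1 \<or> b \<in> F 1"
 using Units_iff_notin_F1 Units_m_closed by auto

lemma F1_pow: "[|a \<in> carrier R; a [^] (m::nat) \<in> F 1|] ==> a \<in> F 1"
proof (induction m)
 case 0 then show ?case using one_notin_F1 by simp
next
 case (Suc m) then show ?case using F1_prime[of "a [^] m" a] by auto
qed

lemma diff_pow_p:
 assumes x: "x \<in> carrier R" and y: "y \<in> carrier R" and d: "x \<ominus> y \<in> F (Suc i)"
 shows "x [^] p \<ominus> y [^] p \<in> F (Suc (Suc i))"
proof -
 define h where "h = x \<ominus> y"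
 have h: "h \<in> carrier R" "h \<in> F (Suc i)" using x y d by (auto simp: h_def)
 have "\<exists>Q \<in> carrier R. (y \<oplus> h) [^] p = y [^] p \<oplus> h [^] p \<oplus> nat_elem R p \<otimes> (y \<otimes> h \<otimes> Q)"
  by (rule power_prime_add[OF prime_p subset_refl]) (use y h in auto)
 then obtain Q where Q: "Q \<in> carrier R" "(y \<oplus> h) [^] p = y [^] p \<oplus> h [^] p \<oplus> nat_elem R p \<otimes> (y \<otimes> h \<otimes> Q)"
  by blast
 have xy: "y \<oplus> h = x" unfolding h_def by (use x y in algebra)
 have hp: "h [^] p \<in> F (Suc (Suc i))"
 proof -
  obtain q where q: "p = Suc (Suc q)" using le_Suc_ex[OF p_ge_2] by auto
  have "h [^] p = h [^] q \<otimes> (h \<otimes> h)" using h by (simp add: q m_assoc)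
  moreover have "h \<otimes> h \<in> F (Suc (Suc i))" by (rule F_monoD[OF F_mult[OF h(2) h(2)]]) simp
  ultimately show ?thesis using F_mult_l h by auto
 qed
 have "nat_elem R p \<otimes> (y \<otimes> h \<otimes> Q) \<in> F (1 + Suc i)"
  using p_in_F1 h y Q by (intro F_mult F_mult_l F_mult_r) auto
 then have "h [^] p \<oplus> nat_elem R p \<otimes> (y \<otimes> h \<otimes> Q) \<in> F (Suc (Suc i))" using hp F_add by auto
 moreover have "x [^] p \<ominus> y [^] p = h [^] p \<oplus> nat_elem R p \<otimes> (y \<otimes> h \<otimes> Q)"
 proof -
  define A B C where "A = y [^] p" "B = h [^] p" "C = nat_elem R p \<otimes> (y \<otimes> h \<otimes> Q)"
  have "A \<in> carrier R" "B \<in> carrier R" "C \<in> carrier R" using y h Q by (auto simp: A_B_C_def)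
  then have "(A \<oplus> B \<oplus> C) \<ominus> A = B \<oplus> C"
   using a_comm[of A "B \<oplus> C"] by (simp add: minus_eq a_assoc r_neg)
  then show ?thesis using Q xy by (simp add: A_B_C_def)
 qed
 ultimately show ?thesis by simp
qed

lemma pow_p_inj:
 assumes x: "x \<in> carrier R" and y: "y \<in> carrier R" and d: "x [^] p \<ominus> y [^] p \<in> F 1"
 shows "x \<ominus> y \<in> F 1"
proof -
 define h where "h = x \<ominus> y"
 have h: "h \<in> carrier R" using x y by (auto simp: h_def)
 have "\<exists>Q \<in> carrier R. (y \<oplus> h) [^] p = y [^] p \<oplus> h [^] p \<oplus> nat_elem R p \<otimes> (y \<otimes> h \<otimes> Q)"
  by (rule power_prime_add[OF prime_p subset_refl]) (use y h in auto)
 then obtain Q where Q: "Q \<in> carrier R" "(y \<oplus> h) [^] p = y [^] p \<oplus> h [^] p \<oplus> nat_elem R p \<otimes> (y \<otimes> h \<otimes> Q)"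
  by blast
 have xy: "y \<oplus> h = x" unfolding h_def by (use x y in algebra)
 define A B C where "A = y [^] p" "B = h [^] p" "C = nat_elem R p \<otimes> (y \<otimes> h \<otimes> Q)"
 have c: "A \<in> carrier R" "B \<in> carrier R" "C \<in> carrier R" using y h Q by (auto simp: A_B_C_def)
 have "C \<in> F 1" unfolding A_B_C_def using p_in_F1 y h Q by (intro F_mult_r) auto
 moreover have "B = (x [^] p \<ominus> y [^] p) \<ominus> C"
 proof -
  have "((A \<oplus> B \<oplus> C) \<ominus> A) \<ominus> C = B"
   using c a_comm[of A "B \<oplus> C"] by (simp add: minus_eq a_assoc r_neg)
  then show ?thesis using Q xy by (simp add: A_B_C_def)
 qed
 ultimately have "B \<in> F 1" using d F_diff by auto
 then show ?thesis using F1_pow[OF h] by (simp add: A_B_C_def h_def)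
qed

lemma diff_pow_p_iter:
 assumes "x \<in> carrier R" "y \<in> carrier R" "x \<ominus> y \<in> F 1"
 shows "x [^] (p ^ j) \<ominus> y [^] (p ^ j) \<in> F (Suc j)"
proof (induction j)
 case 0 then show ?case using assms by simp
next
 case (Suc j)
 have "(x [^] (p ^ j)) [^] p \<ominus> (y [^] (p ^ j)) [^] p \<in> F (Suc (Suc j))"
  using Suc assms by (intro diff_pow_p) auto
 then show ?case using assms by (simp add: nat_pow_pow mult.commute)
qed

lemma pow_p_inj_iter:
 assumes "x \<in> carrier R" "y \<in> carrier R" "x [^] (p ^ j) \<ominus> y [^] (p ^ j) \<in> F 1"
 shows "x \<ominus> y \<in> F 1"
 using assms(3)
proof (induction j)
 case 0 then show ?case using assms by simp
next
 case (Suc j)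
 have "(x [^] (p ^ j)) [^] p \<ominus> (y [^] (p ^ j)) [^] p \<in> F 1"
  using Suc.prems assms by (simp add: nat_pow_pow mult.commute)
 then show ?case using Suc.IH pow_p_inj[of "x [^] (p ^ j)" "y [^] (p ^ j)"] assms by simp
qed

text \<open>Elements with \<open>p\<close>-power roots of every order. As taking \<open>p\<close>-th powers brings two elements one step closer, such
an element is determined by its residue; being defined by equations, the notion is preserved by
ring homomorphisms.\<close>

definition teich :: "'a set" where
 "teich = {x \<in> carrier R. \<forall>j::nat. \<exists>y \<in> carrier R. y [^] (p ^ j) = x}"

lemma teich_carrier: "t \<in> teich ==> t \<in> carrier R" by (simp add: teich_def)

lemma teich_mult: "[|s \<in> teich; t \<in> teich|] ==> s \<otimes> t \<in> teich"
 unfolding teich_def by (auto, metis m_closed nat_pow_distrib)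

lemma teich_one [simp, intro]: "\<one> \<in> teich"
 unfolding teich_def by (auto intro!: bexI[of _ \<one>])

lemma teich_zero [simp, intro]: "\<zero> \<in> teich"
proof -
 have "\<zero> [^] (p ^ j) = \<zero>" for j using p_ge_2 by (intro nat_pow_zero) auto
 then show ?thesis unfolding teich_def by (auto intro!: bexI[of _ \<zero>])
qed

lemma teich_pow: "s \<in> teich ==> s [^] (m::nat) \<in> teich"
 by (induction m) (auto intro: teich_mult)

lemma teich_unique:
 assumes s: "s \<in> teich" and t: "t \<in> teich" and d: "s \<ominus> t \<in> F 1"
 shows "s = t"
proof (rule F_eqI)
 show c: "s \<in> carrier R" "t \<in> carrier R" using s t by (auto simp: teich_def)
 fix k
 obtain x y where x: "x \<in> carrier R" "x [^] (p ^ k) = s" and y: "y \<in> carrier R" "y [^] (p ^ k) = t"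
  using s t unfolding teich_def by blast
 have "x \<ominus> y \<in> F 1" using pow_p_inj_iter[of x y k] x y d by simp
 then have "s \<ominus> t \<in> F (Suc k)" using diff_pow_p_iter[of x y k] x y by simp
 then show "s \<ominus> t \<in> F k" using F_Suc by blast
qed

lemma teich_zero_iff: "t \<in> teich ==> t \<in> F 1 \<longleftrightarrow> t = \<zero>"
 using teich_unique[of t \<zero>] teich_carrier[of t] by (auto simp: minus_eq)

lemma teich_exists:
 assumes x: "x \<in> carrier R"
 shows "\<exists>t \<in> teich. x \<ominus> t \<in> F 1"
proof -
 define root where "root z = (SOME y. y \<in> carrier R & z \<ominus> y [^] p \<in> F 1)" for z
 have root: "root z \<in> carrier R & z \<ominus> root z [^] p \<in> F 1" if "z \<in> carrier R" for z
  unfolding root_def by (rule someI_ex) (use perfect[OF that] in blast)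
 define y where "y j = (root ^^ j) x" for j
 have yc: "y j \<in> carrier R" for j by (induction j) (use x root in \<open>auto simp: y_def\<close>)
 have ys: "y j \<ominus> y (Suc j) [^] p \<in> F 1" for j using root[OF yc] by (simp add: y_def)
 define s where "s j i = y (i + j) [^] (p ^ i)" for i j
 have sc: "s j i \<in> carrier R" for i j by (simp add: s_def yc)
 have ss: "s j (Suc i) \<ominus> s j i \<in> F (Suc i)" for i j
 proof -
  have "y (i + j) [^] (p ^ i) \<ominus> (y (Suc (i + j)) [^] p) [^] (p ^ i) \<in> F (Suc i)"
   by (intro diff_pow_p_iter ys yc nat_pow_closed)
  then have "s j i \<ominus> s j (Suc i) \<in> F (Suc i)" by (simp add: s_def nat_pow_pow yc)
  then show ?thesis using F_diff_sym sc by blast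
 qed
 have "\<exists>L \<in> carrier R. \<forall>i. L \<ominus> s j i \<in> F i" for j
  by (intro F_complete sc F_monoD[OF ss]) simp
 then obtain z where z: "!!j. z j \<in> carrier R" "!!j i. z j \<ominus> s j i \<in> F i" by metis
 have zp: "z (Suc j) [^] p = z j" for j
 proof (rule F_eqI)
  fix k
  have "z (Suc j) [^] p \<ominus> s (Suc j) k [^] p \<in> F k" by (intro F_diff_pow z sc)
  also have "s (Suc j) k [^] p = s j (Suc k)" by (simp add: s_def nat_pow_pow yc mult.commute)
  finally have 1: "z (Suc j) [^] p \<ominus> s j (Suc k) \<in> F k" .
  have "s j (Suc k) \<ominus> z j \<in> F k" using F_diff_sym[OF F_monoD[OF z(2)[of j "Suc k"], of k] z(1) sc] by simp
  then show "z (Suc j) [^] p \<ominus> z j \<in> F k" using F_diff_trans[OF 1] z sc by auto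
 qed (use z in auto)
 have "z j [^] (p ^ j) = z 0" for j
 proof (induction j)
  case 0 show ?case using z by simp
 next
  case (Suc j)
  have "z (Suc j) [^] (p ^ Suc j) = (z (Suc j) [^] p) [^] (p ^ j)" using z by (simp add: nat_pow_pow)
  then show ?case by (simp add: zp Suc)
 qed
 then have T: "z 0 \<in> teich" unfolding teich_def using z by blast
 have "z 0 \<ominus> s 0 1 \<in> F 1" "s 0 1 \<ominus> s 0 0 \<in> F 1" using z(2) ss[of 0 0] by auto
 then have "z 0 \<ominus> x \<in> F 1" using F_diff_trans[of "z 0" "s 0 1" 1 "s 0 0"] z(1) sc x by (simp add: s_def[of 0 0] y_def)
 then show ?thesis using T F_diff_sym z x by blast
qed

lemma teich_root:
 assumes t: "t \<in> teich"
 shows "\<exists>s \<in> teich. s [^] p = t"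
proof -
 obtain y where y: "y \<in> carrier R" "y [^] p = t" using t unfolding teich_def by (auto dest: spec[of _ 1])
 obtain s where s: "s \<in> teich" "y \<ominus> s \<in> F 1" using teich_exists[OF y(1)] by blast
 have sc: "s \<in> carrier R" using s teich_carrier by auto
 have "s [^] p \<ominus> t \<in> F 1" unfolding y(2)[symmetric] by (intro F_diff_pow F_diff_sym[OF s(2)] sc y)
 then have "s [^] p = t" using teich_unique teich_pow s t by blast
 then show ?thesis using s by blast
qed

lemma teich_unit: "[|t \<in> teich; t ~= \<zero>|] ==> t \<in> Units R"
 using teich_zero_iff Units_iff_notin_F1 teich_carrier by blast

lemma nat_elem_unit:
 assumes "\<not> p dvd e"
 shows "nat_elem R e \<in> Units R"
proof (rule ccontr)
 assume "nat_elem R e \<notin> Units R"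
 then have e: "nat_elem R e \<in> F 1" using Units_iff_notin_F1 by auto
 have "coprime e p" using assms prime_p by (metis coprime_commute prime_imp_coprime_nat)
 moreover have "p ~= 1" using p_ge_2 by auto
 ultimately obtain a b where ab: "e * a = p * b + 1" using coprime_bezout_strong by blast
 have "nat_elem R e \<otimes> nat_elem R a = nat_elem R p \<otimes> nat_elem R b \<oplus> \<one>"
  using arg_cong[OF ab, of "nat_elem R"] by (simp only: nat_elem_mult nat_elem_add nat_elem_1 One_nat_def)
 then have "\<one> = nat_elem R e \<otimes> nat_elem R a \<ominus> nat_elem R p \<otimes> nat_elem R b"
  by (metis F_carrier add.inv_solve_right a_comm minus_eq nat_elem_closed m_closed one_closed)
 also have "\<dots> \<in> F 1" using e p_in_F1 by (intro F_diff F_mult_r) auto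
 finally show False using one_notin_F1 by simp
qed

text \<open>Newton iteration: as \<open>e\<close> is a unit and the approximate root \<open>d\<close> is congruent to one, adding
\<open>(c - d^e) / e\<close> to \<open>d\<close> gains a step of the filtration.\<close>

lemma one_unit_root:
 assumes e: "\<not> p dvd e" and c: "c \<in> carrier R" "c \<ominus> \<one> \<in> F (Suc m)"
 shows "\<exists>d \<in> carrier R. d \<ominus> \<one> \<in> F (Suc m) & d [^] e = c"
proof -
 obtain q where q: "e = Suc q" using e by (cases e) auto
 have eu: "nat_elem R e \<in> Units R" by (rule nat_elem_unit[OF e])
 define I where "I = inv (nat_elem R e)"
 have I: "I \<in> carrier R" "nat_elem R e \<otimes> I = \<one>" using eu by (auto simp: I_def)
 have step: "\<exists>d'. d' \<in> carrier R & d' \<ominus> d \<in> F (Suc j) & d' \<ominus> \<one> \<in> F 1 & c \<ominus> d' [^] e \<in> F (Suc (Suc j))"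
  if d: "d \<in> carrier R" "d \<ominus> \<one> \<in> F 1" "c \<ominus> d [^] e \<in> F (Suc j)" for d j
 proof -
  define h where "h = I \<otimes> (c \<ominus> d [^] e)"
  have h: "h \<in> carrier R" "h \<in> F (Suc j)" using I d c by (auto simp: h_def F_mult_l)
  obtain Q where Q: "Q \<in> carrier R"
   "(d \<oplus> h) [^] Suc q = d [^] Suc q \<oplus> nat_elem R (Suc q) \<otimes> (d [^] q \<otimes> h) \<oplus> h \<otimes> h \<otimes> Q"
   using power_add_mod_square[OF d(1) h(1)] by blast
  have dq: "\<one> \<ominus> d [^] q \<in> F 1"
   using F_diff_pow[OF F_diff_sym[OF d(2)], of q] d(1) by simp
  define A N D where "A = d [^] Suc q" "N = nat_elem R (Suc q)" "D = d [^] q"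
  have cc: "A \<in> carrier R" "N \<in> carrier R" "D \<in> carrier R" using d by (auto simp: A_N_D_def)
  have Nh: "N \<otimes> h = c \<ominus> A"
   using I c cc by (simp add: h_def A_N_D_def q m_assoc[symmetric])
  have "c \<ominus> (d \<oplus> h) [^] e = (c \<ominus> A) \<ominus> N \<otimes> (D \<otimes> h) \<ominus> h \<otimes> h \<otimes> Q"
   unfolding q Q(2) unfolding A_N_D_def[symmetric] by (use cc c h Q(1) in algebra)
  also have "\<dots> = N \<otimes> ((\<one> \<ominus> D) \<otimes> h) \<ominus> h \<otimes> h \<otimes> Q"
   unfolding Nh[symmetric] by (use cc c h Q(1) in algebra)
  also have "\<dots> \<in> F (Suc (Suc j))"
  proof (rule F_diff)
   have "(\<one> \<ominus> D) \<otimes> h \<in> F (1 + Suc j)" using dq h by (intro F_mult) (auto simp: A_N_D_def)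
   then show "N \<otimes> ((\<one> \<ominus> D) \<otimes> h) \<in> F (Suc (Suc j))" using cc by (auto intro: F_mult_l)
   have "h \<otimes> h \<in> F (Suc (Suc j))" by (rule F_monoD[OF F_mult[OF h(2) h(2)]]) simp
   then show "h \<otimes> h \<otimes> Q \<in> F (Suc (Suc j))" by (rule F_mult_r[OF _ Q(1)])
  qed
  finally have 1: "c \<ominus> (d \<oplus> h) [^] e \<in> F (Suc (Suc j))" .
  have 2: "(d \<oplus> h) \<ominus> d = h" by (use d h in algebra)
  have "h \<in> F 1" by (rule F_monoD[OF h(2)]) simp
  then have "(d \<oplus> h) \<ominus> d \<in> F 1" unfolding 2 .
  then have B: "(d \<oplus> h) \<ominus> \<one> \<in> F 1" by (rule F_diff_trans[OF _ d(2)]) (use d h in auto)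
  have "(d \<oplus> h) \<ominus> d \<in> F (Suc j)" unfolding 2 by (rule h(2))
  moreover have "d \<oplus> h \<in> carrier R" using d h by blast
  ultimately show ?thesis using 1 B by blast
 qed
 define P where "P j d \<longleftrightarrow> d \<in> carrier R & d \<ominus> \<one> \<in> F 1 & c \<ominus> d [^] e \<in> F (Suc (j + m))" for j d
 define Q where "Q j d d' \<longleftrightarrow> d' \<ominus> d \<in> F (Suc (j + m))" for j d d'
 have "P 0 \<one>" using c by (simp add: P_def)
 define f where "f = rec_nat \<one> (%j d. SOME d'. P (Suc j) d' & Q j d d')"
 have ex: "\<exists>d'. P (Suc j) d' & Q j d d'" if "P j d" for j d
  using step[of d "j + m"] that unfolding P_def Q_def by auto
 have s: "P (Suc j) (f (Suc j)) & Q j (f j) (f (Suc j))" if "P j (f j)" for j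
  using someI_ex[OF ex[OF that]] by (simp add: f_def)
 have Pf: "P j (f j)" for j by (induction j) (use s \<open>P 0 \<one>\<close> in \<open>auto simp: f_def\<close>)
 have fc: "f j \<in> carrier R" for j using Pf P_def by auto
 have fd: "f (Suc j) \<ominus> f j \<in> F (Suc (j + m))" for j using s[OF Pf] Q_def by auto
 obtain d where d: "d \<in> carrier R" "!!i. d \<ominus> f i \<in> F i"
  using F_complete[of f] fc fd by (meson F_monoD le_SucI le_add1)
 have f1: "f i \<ominus> \<one> \<in> F (Suc m)" for i
 proof (induction i)
  case 0 show ?case by (simp add: f_def)
 next
  case (Suc i)
  have "f (Suc i) \<ominus> f i \<in> F (Suc m)" using fd[of i] by (rule F_monoD) auto
  then show ?case using Suc F_diff_trans fc by blast
 qed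
 have "d \<ominus> \<one> \<in> F (Suc m)" using F_diff_trans[OF d(2)[of "Suc m"] f1] d fc by auto
 moreover have "d [^] e = c"
 proof (rule F_eqI)
  fix k
  have 1: "d [^] e \<ominus> f k [^] e \<in> F k" by (intro F_diff_pow d fc)
  have "c \<ominus> f k [^] e \<in> F k" using Pf[of k] F_monoD[of "c \<ominus> f k [^] e" "Suc (k + m)" k] unfolding P_def by simp
  then have "f k [^] e \<ominus> c \<in> F k" using c(1) fc F_diff_sym by blast
  then show "d [^] e \<ominus> c \<in> F k" using F_diff_trans[OF 1] d c fc by auto
 qed (use c d in auto)
 ultimately show ?thesis using d by blast
qed

lemma unit_eq_teich_power:
 assumes e: "\<not> p dvd e" and a: "a \<in> Units R"
 shows "\<exists>t \<in> teich. \<exists>d \<in> Units R. t \<in> Units R & a \<ominus> t \<in> F 1 & a = t \<otimes> d [^] e"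
proof -
 have ac: "a \<in> carrier R" using a by blast
 obtain t where t: "t \<in> teich" "a \<ominus> t \<in> F 1" using teich_exists[OF ac] by blast
 have tc: "t \<in> carrier R" by (rule teich_carrier[OF t(1)])
 have tU: "t \<in> Units R" using F_diff_mem[OF t(2) _ ac] Units_iff_notin_F1[OF ac] Units_iff_notin_F1[OF tc] a by blast
 define c where "c = inv t \<otimes> a"
 have c: "c \<in> carrier R" "t \<otimes> c = a" using tU tc ac by (simp_all add: c_def m_assoc[symmetric])
 have "c \<ominus> \<one> = inv t \<otimes> (a \<ominus> t)" using tU ac tc by (simp add: c_def minus_eq r_distr r_minus)
 then have c1: "c \<ominus> \<one> \<in> F (Suc 0)" using t F_mult_l tU by simp
 obtain d where d: "d \<in> carrier R" "d \<ominus> \<one> \<in> F (Suc 0)" "d [^] e = c" using one_unit_root[OF e c(1) c1] by blast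
 have "d \<notin> F 1" using F_diff_mem[OF F_diff_sym[OF d(2) d(1) one_closed]] one_notin_F1 by auto
 then have "d \<in> Units R" by (rule Units_if_notin_F1[OF d(1)])
 then show ?thesis using t tU d(3) c(2) by blast
qed

lemma one_unit_root_unique:
 assumes e: "\<not> p dvd e" and d: "d \<in> carrier R" "d \<ominus> \<one> \<in> F 1" "d [^] e = \<one>"
 shows "d = \<one>"
proof -
 obtain q where q: "e = Suc q" using e by (cases e) auto
 have eu: "nat_elem R e \<in> Units R" by (rule nat_elem_unit[OF e])
 define h where "h = d \<ominus> \<one>"
 have h: "h \<in> carrier R" using d by (auto simp: h_def)
 have dh: "\<one> \<oplus> h = d" unfolding h_def by (use d in algebra)
 obtain Q where Q: "Q \<in> carrier R" "(\<one> \<oplus> h) [^] Suc q = \<one> [^] Suc q \<oplus> nat_elem R (Suc q) \<otimes> (\<one> [^] q \<otimes> h) \<oplus> h \<otimes> h \<otimes> Q"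
  using power_add_mod_square[OF one_closed h] by blast
 define N where "N = nat_elem R e"
 have N: "N \<in> carrier R" "N \<in> Units R" using eu by (auto simp: N_def)
 have "\<one> = \<one> \<oplus> N \<otimes> h \<oplus> h \<otimes> h \<otimes> Q" using Q d h q dh by (simp add: N_def)
 then have "\<zero> = (\<one> \<oplus> N \<otimes> h \<oplus> h \<otimes> h \<otimes> Q) \<ominus> \<one>" by (simp add: minus_eq r_neg)
 also have "\<dots> = (N \<oplus> h \<otimes> Q) \<otimes> h" by (use N h Q(1) in algebra)
 finally have z: "(N \<oplus> h \<otimes> Q) \<otimes> h = \<zero>" by simp
 have hF: "h \<otimes> Q \<in> F 1" using d Q by (auto simp: h_def F_mult_r)
 have "N \<oplus> h \<otimes> Q \<notin> F 1"
 proof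
  assume "N \<oplus> h \<otimes> Q \<in> F 1"
  then have "(N \<oplus> h \<otimes> Q) \<ominus> h \<otimes> Q \<in> F 1" using F_diff hF by auto
  moreover have "(N \<oplus> h \<otimes> Q) \<ominus> h \<otimes> Q = N" by (use N(1) h Q(1) in algebra)
  ultimately show False using N Units_iff_notin_F1 by auto
 qed
 then have "N \<oplus> h \<otimes> Q \<in> Units R" using N h Q Units_iff_notin_F1 by auto
 then have "h = \<zero>" using z h by (metis Units_closed Units_inv_closed Units_l_inv l_one m_assoc r_null)
 then show ?thesis using dh by simp
qed

end

section \<open>Digit expansions\<close>

lemma (in cring) plus_minus_cancel:
 assumes "a \<in> carrier R" "b \<in> carrier R" shows "a \<oplus> (b \<ominus> a) = b"
 by (use assms in algebra)

text \<open>\<open>D\<close> plays the role of the Teichmueller elements and \<open>G m\<close> consists of the elements with a digit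
expansion in powers of \<open>\<pi>\<close> up to order \<open>m\<close>. A sum of two digits is a digit only up to carries, which
are controlled by \<open>p = w \<pi>^e\<close> with \<open>e = Suc j\<close>.\<close>

locale digit_ring = cring R for R (structure) +
 fixes F :: "nat => 'a set" and D :: "'a set" and \<pi> w :: 'a and j p :: nat
 assumes F_0: "F 0 = carrier R"
  and F_carrier: "a \<in> F k ==> a \<in> carrier R"
  and F_zero: "\<zero> \<in> F k"
  and F_add: "[|a \<in> F k; b \<in> F k|] ==> a \<oplus> b \<in> F k"
  and F_neg: "a \<in> F k ==> \<ominus> a \<in> F k"
  and F_mult_l: "[|a \<in> F k; b \<in> carrier R|] ==> b \<otimes> a \<in> F k"
  and F_Suc: "F (Suc k) \<subseteq> F k"
  and F_mult: "[|a \<in> F i; b \<in> F k|] ==> a \<otimes> b \<in> F (i + k)"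
  and D_carrier: "d \<in> D ==> d \<in> carrier R"
  and D_zero: "\<zero> \<in> D" and D_one: "\<one> \<in> D"
  and D_mult: "[|d \<in> D; d' \<in> D|] ==> d \<otimes> d' \<in> D"
  and D_root: "d \<in> D ==> \<exists>s \<in> D. s [^] p = d"
  and D_add: "[|d \<in> D; d' \<in> D|] ==> \<exists>s \<in> D. (d \<oplus> d') \<ominus> s \<in> F 1"
  and prime_p: "Factorial_Ring.prime p"
  and pi: "\<pi> \<in> F 1" and w: "w \<in> D"
  and p_eq: "nat_elem R p = w \<otimes> \<pi> [^] Suc j"
begin

primrec G :: "nat => 'a set" where
 "G 0 = carrier R"
| "G (Suc m) = {d \<oplus> \<pi> \<otimes> g \<oplus> f | d g f. d \<in> D & g \<in> G m & f \<in> F (Suc m)}"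

lemmas G_Suc = G.simps(2)
declare G.simps(2) [simp del]

lemma pi_carrier [simp, intro]: "\<pi> \<in> carrier R" using pi F_carrier by blast

lemma G_carrier: "g \<in> G m ==> g \<in> carrier R"
proof (induction m arbitrary: g)
 case (Suc m)
 then show ?case using D_carrier F_carrier unfolding G_Suc by fastforce
qed simp

lemma G_SucI: "[|d \<in> D; g \<in> G m; f \<in> F (Suc m)|] ==> d \<oplus> \<pi> \<otimes> g \<oplus> f \<in> G (Suc m)" unfolding G_Suc by blast

lemma F_subset_G: "f \<in> F m ==> f \<in> G m"
proof (induction m arbitrary: f)
 case 0 then show ?case using F_carrier by simp
next
 case (Suc m)
 have "\<zero> \<oplus> \<pi> \<otimes> \<zero> \<oplus> f \<in> G (Suc m)" by (intro G_SucI D_zero Suc F_zero)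
 then show ?case using Suc.prems F_carrier by simp
qed

lemma zero_G: "\<zero> \<in> G m" using F_zero F_subset_G by blast

lemma D_subset_G: "d \<in> D ==> d \<in> G m"
proof (cases m)
 case 0 then show "d \<in> D ==> d \<in> G m" using D_carrier by simp
next
 case (Suc m)
 assume d: "d \<in> D"
 have "d \<oplus> \<pi> \<otimes> \<zero> \<oplus> \<zero> \<in> G (Suc m)" by (intro G_SucI d zero_G F_zero)
 then show ?thesis using d D_carrier Suc by simp
qed

lemma G_decr: "G (Suc m) \<subseteq> G m"
proof (induction m)
 case 0 then show ?case using G_carrier[of _ "Suc 0"] by auto
next
 case (Suc m)
 then show ?case using F_Suc[of "Suc m"] unfolding G_Suc[of "Suc m"] G_Suc[of m] by blast
qed

lemma pi_G: "g \<in> G m ==> \<pi> \<otimes> g \<in> G (Suc m)"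
 using G_SucI[OF D_zero _ F_zero, of g m] G_carrier[of g m] by simp

abbreviation closed_at :: "nat => bool" where
 "closed_at m \<equiv> (\<forall>a \<in> G m. \<forall>b \<in> G m. a \<oplus> b \<in> G m & a \<otimes> b \<in> G m)"

lemma pi_pow_G: "closed_at m ==> \<pi> [^] (i::nat) \<in> G m"
proof (induction i)
 case 0 then show ?case using D_one D_subset_G by simp
next
 case (Suc i)
 have "\<pi> \<otimes> \<one> \<in> G m" using pi_G[OF D_subset_G[OF D_one]] G_decr by blast
 then show ?case using Suc by simp
qed

lemma p_pow_in_F: "nat_elem R (p ^ m) \<in> F m"
proof (induction m)
 case 0 then show ?case by (simp add: F_0)
next
 case (Suc m)
 have "nat_elem R p = (w \<otimes> \<pi> [^] j) \<otimes> \<pi>" unfolding p_eq using w D_carrier by (simp add: m_assoc)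
 then have "nat_elem R p \<in> F 1" using F_mult_l[OF pi] w D_carrier by simp
 then have "nat_elem R p \<otimes> nat_elem R (p ^ m) \<in> F (1 + m)" using Suc F_mult by blast
 then show ?case by (simp add: nat_elem_mult)
qed

lemma nat_elem_G: "closed_at m ==> nat_elem R k \<in> G m"
 by (induction k) (auto simp: nat_elem_0 nat_elem_Suc zero_G D_subset_G D_one)

lemma neg_G:
 assumes c: "closed_at m" and g: "g \<in> G m" shows "\<ominus> g \<in> G m"
proof -
 obtain q where q: "p ^ m = Suc q" using prime_p by (metis not0_implies_Suc power_not_zero not_prime_0)
 have "\<ominus> nat_elem R (p ^ m) \<in> G m" using F_neg[OF p_pow_in_F] F_subset_G by blast
 then have "nat_elem R q \<oplus> \<ominus> nat_elem R (p ^ m) \<in> G m" using c nat_elem_G by blast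
 moreover have "nat_elem R q \<oplus> \<ominus> (nat_elem R q \<oplus> \<one>) = \<ominus> \<one>"
 proof -
  define N where "N = nat_elem R q"
  have "N \<in> carrier R" by (simp add: N_def)
  then show ?thesis unfolding N_def[symmetric] by algebra
 qed
 ultimately have "\<ominus> \<one> \<in> G m" by (simp add: q nat_elem_Suc)
 then have "\<ominus> \<one> \<otimes> g \<in> G m" using c g by blast
 then show ?thesis using G_carrier[OF g] by (simp add: l_minus)
qed

text \<open>With roots \<open>\<sigma>\<close> and \<open>\<sigma>'\<close> of the digits \<open>d\<close> and \<open>d'\<close>, the induction hypothesis expands \<open>\<sigma> + \<sigma>'\<close>. In its
\<open>p\<close>-th power the mixed terms are multiples of \<open>p = w \<pi>^e\<close>, hence of \<open>\<pi>\<close>, which turns an expansion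
up to order \<open>m\<close> of the cofactor into one up to order \<open>m + 1\<close>.\<close>

lemma D_add_G:
 assumes m: "closed_at m" and m': "!!m'. m = Suc m' ==> closed_at m'" and d: "d \<in> D" "d' \<in> D"
 shows "d \<oplus> d' \<in> G (Suc m)"
proof (cases m)
 case 0
 obtain s where s: "s \<in> D" "(d \<oplus> d') \<ominus> s \<in> F 1" using D_add d by blast
 have c: "d \<in> carrier R" "d' \<in> carrier R" "s \<in> carrier R" "\<pi> \<in> carrier R" using d s D_carrier by auto
 have "s \<oplus> \<pi> \<otimes> \<zero> \<oplus> ((d \<oplus> d') \<ominus> s) \<in> G (Suc 0)" using s by (intro G_SucI zero_G) auto
 moreover have "s \<oplus> \<pi> \<otimes> \<zero> \<oplus> ((d \<oplus> d') \<ominus> s) = d \<oplus> d'"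
  by (use c in algebra)
 ultimately show ?thesis using 0 by simp
next
 case (Suc m')
 note c' = m'[OF Suc]
 obtain q where q: "p = Suc (Suc q)" using le_Suc_ex[OF prime_ge_2_nat[OF prime_p]] by auto
 obtain \<sigma> \<sigma>' where s: "\<sigma> \<in> D" "\<sigma> [^] p = d" "\<sigma>' \<in> D" "\<sigma>' [^] p = d'" using D_root d by meson
 have sG: "\<sigma> \<in> G m" "\<sigma>' \<in> G m" using s D_subset_G by auto
 then have "\<sigma> \<oplus> \<sigma>' \<in> G (Suc m')" using m Suc by simp
 then obtain s \<gamma> \<phi> where g: "s \<in> D" "\<gamma> \<in> G m'" "\<phi> \<in> F m" "\<sigma> \<oplus> \<sigma>' = s \<oplus> \<pi> \<otimes> \<gamma> \<oplus> \<phi>" using Suc unfolding G_Suc by auto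
 define y where "y = \<pi> \<otimes> \<gamma> \<oplus> \<phi>"
 have carr: "\<sigma> \<in> carrier R" "\<sigma>' \<in> carrier R" "s \<in> carrier R" "\<gamma> \<in> carrier R" "\<phi> \<in> carrier R" "y \<in> carrier R" "\<pi> \<in> carrier R"
  using s g D_carrier G_carrier F_carrier by (auto simp: y_def)
 have pg: "\<pi> \<otimes> \<gamma> \<in> G m" using pi_G[OF g(2)] Suc by simp
 have yG: "y \<in> G m" unfolding y_def using m pg F_subset_G[OF g(3)] by blast
 have sy: "\<sigma> \<oplus> \<sigma>' = s \<oplus> y" unfolding g(4) y_def using carr by (simp add: a_assoc)
 have Gc: "G m \<subseteq> carrier R" using G_carrier by auto
 have "\<exists>Q \<in> G m. (\<sigma> \<oplus> \<sigma>') [^] p = \<sigma> [^] p \<oplus> \<sigma>' [^] p \<oplus> nat_elem R p \<otimes> (\<sigma> \<otimes> \<sigma>' \<otimes> Q)"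
  by (rule power_prime_add[OF prime_p Gc zero_G D_subset_G[OF D_one]]) (use m sG in auto)
 then obtain Q where Q: "Q \<in> G m" "(\<sigma> \<oplus> \<sigma>') [^] p = d \<oplus> d' \<oplus> nat_elem R p \<otimes> (\<sigma> \<otimes> \<sigma>' \<otimes> Q)" using s by auto
 have "\<exists>Q \<in> G m. (s \<oplus> y) [^] p = s [^] p \<oplus> y [^] p \<oplus> nat_elem R p \<otimes> (s \<otimes> y \<otimes> Q)"
  by (rule power_prime_add[OF prime_p Gc zero_G D_subset_G[OF D_one]]) (use m yG g D_subset_G in auto)
 then obtain Q' where Q': "Q' \<in> G m" "(\<sigma> \<oplus> \<sigma>') [^] p = s [^] p \<oplus> y [^] p \<oplus> nat_elem R p \<otimes> (s \<otimes> y \<otimes> Q')"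
  using sy by auto
 define c where "c = w \<otimes> \<pi> [^] j"
 have cG: "c \<in> G m" unfolding c_def using m pi_pow_G D_subset_G[OF w] by blast
 have pc: "nat_elem R p = \<pi> \<otimes> c" unfolding p_eq c_def using w D_carrier by (simp add: m_ac)
 have cc: "c \<in> carrier R" "Q \<in> carrier R" "Q' \<in> carrier R" "d \<in> carrier R" "d' \<in> carrier R"
  using cG Q Q' G_carrier d D_carrier by auto
 define Y where "Y = y [^] q"
 have YG: "Y \<in> G m" unfolding Y_def
 proof (induction q)
  case 0 then show ?case using D_subset_G[OF D_one] by simp
 next
  case (Suc q) then show ?case using m yG by simp
 qed
 have Yc: "Y \<in> carrier R" using YG G_carrier by auto
 have yp: "y [^] p = \<pi> \<otimes> (\<gamma> \<otimes> y \<otimes> Y) \<oplus> \<phi> \<otimes> y \<otimes> Y"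
 proof -
  have "y [^] p = y \<otimes> y \<otimes> Y"
   unfolding q using carr Yc by (simp add: Y_def[symmetric] m_ac)
  also have "\<dots> = (\<pi> \<otimes> \<gamma> \<oplus> \<phi>) \<otimes> y \<otimes> Y"
   by (rule arg_cong[of _ _ "%z. z \<otimes> y \<otimes> Y"]) (rule y_def)
  also have "\<dots> = \<pi> \<otimes> (\<gamma> \<otimes> y \<otimes> Y) \<oplus> \<phi> \<otimes> y \<otimes> Y" by (use carr Yc in algebra)
  finally show ?thesis .
 qed
 have gy: "\<gamma> \<otimes> y \<in> G m"
 proof -
  have "\<gamma> \<otimes> \<gamma> \<in> G m'" using c' g by blast
  then have "\<pi> \<otimes> (\<gamma> \<otimes> \<gamma>) \<in> G m" using pi_G Suc by simp
  moreover have "\<gamma> \<otimes> \<phi> \<in> G m" by (intro F_subset_G F_mult_l g carr)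
  ultimately have "\<pi> \<otimes> (\<gamma> \<otimes> \<gamma>) \<oplus> \<gamma> \<otimes> \<phi> \<in> G m" using m by blast
  moreover have "\<pi> \<otimes> (\<gamma> \<otimes> \<gamma>) \<oplus> \<gamma> \<otimes> \<phi> = \<gamma> \<otimes> y"
   unfolding y_def by (use carr in algebra)
  ultimately show ?thesis by simp
 qed
 have fy: "\<phi> \<otimes> y \<otimes> Y \<in> F (Suc m)"
 proof -
  have "\<phi> \<in> F 1" using g(3) F_Suc lift_Suc_antimono_le[of F 1 m] Suc by auto
  moreover have "\<pi> \<otimes> \<gamma> \<in> F 1" using F_mult_l[OF pi carr(4)] carr by (simp add: m_comm)
  ultimately have "y \<in> F 1" unfolding y_def using F_add by blast
  then have "y \<otimes> \<phi> \<in> F (1 + m)" using g(3) F_mult by blast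
  then have "Y \<otimes> (y \<otimes> \<phi>) \<in> F (Suc m)" using F_mult_l Yc by simp
  then show ?thesis using Yc carr by (simp add: m_ac)
 qed
 define g' where "g' = \<gamma> \<otimes> y \<otimes> Y \<oplus> c \<otimes> (s \<otimes> y \<otimes> Q') \<oplus> \<ominus> (c \<otimes> (\<sigma> \<otimes> \<sigma>' \<otimes> Q))"
 have "g' \<in> G m" unfolding g'_def
  by (intro gy YG cG yG Q(1) Q'(1) sG D_subset_G[OF g(1)] neg_G[OF m] m[rule_format, THEN conjunct1] m[rule_format, THEN conjunct2])
 moreover have "s [^] p \<in> D"
 proof -
  have "s [^] k \<in> D" for k :: nat by (induction k) (use g D_one D_mult in auto)
  then show ?thesis .
 qed
 ultimately have 1: "s [^] p \<oplus> \<pi> \<otimes> g' \<oplus> \<phi> \<otimes> y \<otimes> Y \<in> G (Suc m)" using fy G_SucI by blast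
 define S where "S = s [^] p"
 have Sc: "S \<in> carrier R" using carr by (simp add: S_def)
 have "d \<oplus> d' = (d \<oplus> d' \<oplus> \<pi> \<otimes> c \<otimes> (\<sigma> \<otimes> \<sigma>' \<otimes> Q)) \<ominus> \<pi> \<otimes> c \<otimes> (\<sigma> \<otimes> \<sigma>' \<otimes> Q)"
  by (use carr cc in algebra)
 also have "d \<oplus> d' \<oplus> \<pi> \<otimes> c \<otimes> (\<sigma> \<otimes> \<sigma>' \<otimes> Q) = S \<oplus> (\<pi> \<otimes> (\<gamma> \<otimes> y \<otimes> Y) \<oplus> \<phi> \<otimes> y \<otimes> Y) \<oplus> \<pi> \<otimes> c \<otimes> (s \<otimes> y \<otimes> Q')"
  using Q(2) Q'(2) by (simp add: pc yp S_def)
 also have "\<dots> \<ominus> \<pi> \<otimes> c \<otimes> (\<sigma> \<otimes> \<sigma>' \<otimes> Q) = S \<oplus> \<pi> \<otimes> g' \<oplus> \<phi> \<otimes> y \<otimes> Y"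
  unfolding g'_def by (use carr cc Sc Yc in algebra)
 finally show ?thesis using 1 by (simp add: S_def)
qed

lemma closed_at_Suc:
 assumes m: "closed_at m" and m': "!!m'. m = Suc m' ==> closed_at m'"
 shows "closed_at (Suc m)"
proof (intro ballI conjI)
 fix a b assume "a \<in> G (Suc m)" "b \<in> G (Suc m)"
 then obtain d g f d' g' f' where a: "a = d \<oplus> \<pi> \<otimes> g \<oplus> f" "d \<in> D" "g \<in> G m" "f \<in> F (Suc m)"
  and b: "b = d' \<oplus> \<pi> \<otimes> g' \<oplus> f'" "d' \<in> D" "g' \<in> G m" "f' \<in> F (Suc m)" unfolding G_Suc by blast
 have carr: "d \<in> carrier R" "g \<in> carrier R" "f \<in> carrier R" "d' \<in> carrier R" "g' \<in> carrier R" "f' \<in> carrier R" "\<pi> \<in> carrier R"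
  using a b D_carrier G_carrier F_carrier by auto
 obtain s \<gamma> \<phi> where s: "s \<in> D" "\<gamma> \<in> G m" "\<phi> \<in> F (Suc m)" "d \<oplus> d' = s \<oplus> \<pi> \<otimes> \<gamma> \<oplus> \<phi>"
  using D_add_G[OF m m' a(2) b(2)] unfolding G_Suc by auto
 have carr': "s \<in> carrier R" "\<gamma> \<in> carrier R" "\<phi> \<in> carrier R" using s D_carrier G_carrier F_carrier by auto
 have "a \<oplus> b = (d \<oplus> d') \<oplus> \<pi> \<otimes> (g \<oplus> g') \<oplus> (f \<oplus> f')"
  unfolding a b by (use carr in algebra)
 also have "\<dots> = s \<oplus> \<pi> \<otimes> (\<gamma> \<oplus> (g \<oplus> g')) \<oplus> (\<phi> \<oplus> (f \<oplus> f'))"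
  unfolding s(4) by (use carr carr' in algebra)
 also have "\<dots> \<in> G (Suc m)"
  by (intro G_SucI s a b F_add m[rule_format, THEN conjunct1])
 finally show "a \<oplus> b \<in> G (Suc m)" .
 have "a \<otimes> b = d \<otimes> d' \<oplus> \<pi> \<otimes> ((d \<otimes> g' \<oplus> d' \<otimes> g) \<oplus> \<pi> \<otimes> (g \<otimes> g')) \<oplus> ((d' \<oplus> \<pi> \<otimes> g' \<oplus> f') \<otimes> f \<oplus> (d \<oplus> \<pi> \<otimes> g) \<otimes> f')"
  unfolding a b by (use carr in algebra)
 also have "\<dots> \<in> G (Suc m)"
 proof (intro G_SucI)
  show "d \<otimes> d' \<in> D" using D_mult a b by auto
  have pg: "\<pi> \<otimes> (g \<otimes> g') \<in> G m" using pi_G[of "g \<otimes> g'" m] G_decr[of m] m[rule_format, OF a(3) b(3)] by blast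
  show "(d \<otimes> g' \<oplus> d' \<otimes> g) \<oplus> \<pi> \<otimes> (g \<otimes> g') \<in> G m"
   by (intro pg m[rule_format, THEN conjunct1] m[rule_format, THEN conjunct2] a b D_subset_G)
  show "(d' \<oplus> \<pi> \<otimes> g' \<oplus> f') \<otimes> f \<oplus> (d \<oplus> \<pi> \<otimes> g) \<otimes> f' \<in> F (Suc m)"
   using a b carr by (intro F_add F_mult_l) auto
 qed
 finally show "a \<otimes> b \<in> G (Suc m)" .
qed

lemma closed_at_all: "closed_at m"
proof -
 have "closed_at m & closed_at (Suc m)"
 proof (induction m)
  case 0
  have "closed_at 0" by simp
  then show ?case using closed_at_Suc[of 0] by blast
 next
  case (Suc m) then show ?case using closed_at_Suc[of "Suc m"] by blast
 qed
 then show ?thesis ..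
qed

lemma G_add: "[|a \<in> G m; b \<in> G m|] ==> a \<oplus> b \<in> G m"
 and G_mult: "[|a \<in> G m; b \<in> G m|] ==> a \<otimes> b \<in> G m"
 and G_neg: "a \<in> G m ==> \<ominus> a \<in> G m"
 using closed_at_all neg_G by blast+

end

lemma RDirProd_simps [simp]:
 "carrier (RDirProd R S) = carrier R \<times> carrier S"
 "(a, b) \<otimes>\<^bsub>RDirProd R S\<^esub> (c, d) = (a \<otimes>\<^bsub>R\<^esub> c, b \<otimes>\<^bsub>S\<^esub> d)"
 "(a, b) \<oplus>\<^bsub>RDirProd R S\<^esub> (c, d) = (a \<oplus>\<^bsub>R\<^esub> c, b \<oplus>\<^bsub>S\<^esub> d)"
 "\<one>\<^bsub>RDirProd R S\<^esub> = (\<one>\<^bsub>R\<^esub>, \<one>\<^bsub>S\<^esub>)" "\<zero>\<^bsub>RDirProd R S\<^esub> = (\<zero>\<^bsub>R\<^esub>, \<zero>\<^bsub>S\<^esub>)"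
 by (auto simp: RDirProd_def DirProd_def monoid.defs)

lemma RDirProd_cring:
 assumes "cring R" "cring S" shows "cring (RDirProd R S)"
proof -
 interpret R: cring R by fact
 interpret S: cring S by fact
 interpret P: ring "RDirProd R S" by (rule RDirProd_ring[OF R.ring_axioms S.ring_axioms])
 show ?thesis
  by unfold_locales (auto simp: R.m_comm S.m_comm)
qed

text \<open>The digits of the product ring are the pairs of Teichmueller elements with equal residue in \<open>K\<close>.
\<open>P k\<close> says that \<open>\<pi>'\<close> can be cancelled in order \<open>k\<close>; it holds for all \<open>k\<close> in a valuation ring
and up to the length in a truncated ring.\<close>

locale residue_pair = R: perfect_residue_ring R F p + S: perfect_residue_ring S F' p
 for R :: "('a, 'c) ring_scheme" (structure) and F p
  and S :: "('b, 'd) ring_scheme" (structure) and F' +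
 fixes K :: "('k, 'l) ring_scheme" and r :: "'a => 'k" and r' :: "'b => 'k"
  and \<pi> w :: 'a and \<pi>' w' :: 'b and j :: nat and P :: "nat => bool"
 assumes K: "cring K" and r: "r \<in> ring_hom R K" and r': "r' \<in> ring_hom S K"
  and r_zero_iff: "x \<in> carrier R ==> r x = \<zero>\<^bsub>K\<^esub> \<longleftrightarrow> x \<in> F 1"
  and r'_zero_iff: "y \<in> carrier S ==> r' y = \<zero>\<^bsub>K\<^esub> \<longleftrightarrow> y \<in> F' 1"
  and r_range: "x \<in> carrier R ==> \<exists>y \<in> carrier S. r' y = r x"
  and pi: "\<pi> \<in> F 1" and pi': "\<pi>' \<in> F' 1"
  and F1_pi: "x \<in> F 1 ==> \<exists>y \<in> carrier R. x = \<pi> \<otimes> y"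
  and pi_div: "[|x \<in> carrier R; \<pi> \<otimes> x \<in> F (Suc k)|] ==> x \<in> F k"
  and pi'_div: "[|P (Suc k); y \<in> carrier S; \<pi>' \<otimes>\<^bsub>S\<^esub> y \<in> F' (Suc k)|] ==> y \<in> F' k"
  and P_Suc: "P (Suc k) ==> P k"
  and w: "w \<in> R.teich" and w': "w' \<in> S.teich" and w_w': "r w = r' w'"
  and p_eq: "nat_elem R p = w \<otimes> \<pi> [^] Suc j"
  and p_eq': "nat_elem S p = w' \<otimes>\<^bsub>S\<^esub> \<pi>' [^]\<^bsub>S\<^esub> Suc j"
begin

abbreviation Pr where "Pr \<equiv> RDirProd R S"
definition D :: "('a \<times> 'b) set" where "D = {(t, t'). t \<in> R.teich & t' \<in> S.teich & r t = r' t'}"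
definition FP :: "nat => ('a \<times> 'b) set" where "FP k = F k \<times> F' k"

lemma Pr_cring: "cring Pr" by (rule RDirProd_cring[OF R.is_cring S.is_cring])

lemma Pr_neg: "[|a \<in> carrier R; b \<in> carrier S|] ==> \<ominus>\<^bsub>Pr\<^esub> (a, b) = (\<ominus> a, \<ominus>\<^bsub>S\<^esub> b)"
proof -
 assume a: "a \<in> carrier R" "b \<in> carrier S"
 interpret P: cring Pr by (rule Pr_cring)
 have "(\<ominus> a, \<ominus>\<^bsub>S\<^esub> b) \<oplus>\<^bsub>Pr\<^esub> (a, b) = \<zero>\<^bsub>Pr\<^esub>" using a by (simp add: R.l_neg S.l_neg)
 then show ?thesis using a by (intro P.minus_equality) auto
qed

lemma Pr_diff: "[|a \<in> carrier R; b \<in> carrier S; c \<in> carrier R; d \<in> carrier S|]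
  ==> (a, b) \<ominus>\<^bsub>Pr\<^esub> (c, d) = (a \<ominus> c, b \<ominus>\<^bsub>S\<^esub> d)"
 by (simp add: a_minus_def Pr_neg)

lemma Pr_pow: "(a, b) [^]\<^bsub>Pr\<^esub> (k::nat) = (a [^] k, b [^]\<^bsub>S\<^esub> k)"
 by (induction k) (simp_all add: nat_pow_def)

lemma Pr_nat_elem: "nat_elem Pr k = (nat_elem R k, nat_elem S k)"
 by (induction k) (simp_all add: nat_elem_0 nat_elem_Suc)

lemma r_diff:
 assumes "x \<in> carrier R" "y \<in> carrier R" shows "r x = r y \<longleftrightarrow> x \<ominus> y \<in> F 1"
proof -
 interpret h: ring_hom_cring R K r
  using K r R.is_cring by (simp add: ring_hom_cring_def ring_hom_cring_axioms_def)
 have "r (x \<ominus> y) = r x \<ominus>\<^bsub>K\<^esub> r y" using assms by (simp add: a_minus_def)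
 then show ?thesis using assms r_zero_iff[of "x \<ominus> y"] h.S.r_right_minus_eq[of "r x" "r y"] by simp
qed

lemma r'_diff:
 assumes "x \<in> carrier S" "y \<in> carrier S" shows "r' x = r' y \<longleftrightarrow> x \<ominus>\<^bsub>S\<^esub> y \<in> F' 1"
proof -
 interpret h: ring_hom_cring S K r'
  using K r' S.is_cring by (simp add: ring_hom_cring_def ring_hom_cring_axioms_def)
 have "r' (x \<ominus>\<^bsub>S\<^esub> y) = r' x \<ominus>\<^bsub>K\<^esub> r' y" using assms by (simp add: a_minus_def)
 then show ?thesis using assms r'_zero_iff[of "x \<ominus>\<^bsub>S\<^esub> y"] h.S.r_right_minus_eq[of "r' x" "r' y"] by simp
qed

lemma r_pow: "x \<in> carrier R ==> r (x [^] (k::nat)) = r x [^]\<^bsub>K\<^esub> k"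
 by (metis K R.is_cring cring.axioms(1) r ring_hom_ring.hom_nat_pow ring_hom_ringI2)

lemma r'_pow: "x \<in> carrier S ==> r' (x [^]\<^bsub>S\<^esub> (k::nat)) = r' x [^]\<^bsub>K\<^esub> k"
 by (metis K S.is_cring cring.axioms(1) r' ring_hom_ring.hom_nat_pow ring_hom_ringI2)

lemma teich_partner:
 assumes "t \<in> carrier R" shows "\<exists>t' \<in> S.teich. r' t' = r t"
proof -
 obtain y where y: "y \<in> carrier S" "r' y = r t" using r_range assms by blast
 obtain t' where t': "t' \<in> S.teich" "y \<ominus>\<^bsub>S\<^esub> t' \<in> F' 1" using S.teich_exists[OF y(1)] by blast
 then show ?thesis using r'_diff[of y t'] y S.teich_carrier by auto
qed

lemma D_digit_ring: "digit_ring Pr FP D (\<pi>, \<pi>') (w, w') j p"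
proof (intro digit_ring.intro Pr_cring digit_ring_axioms.intro)
 show "FP 0 = carrier Pr" by (simp add: FP_def R.F_0 S.F_0)
 show "(\<pi>, \<pi>') \<in> FP 1" "(w, w') \<in> D" "Factorial_Ring.prime p"
  using pi pi' w w' w_w' R.prime_p by (auto simp: FP_def D_def)
 show "nat_elem Pr p = (w, w') \<otimes>\<^bsub>Pr\<^esub> (\<pi>, \<pi>') [^]\<^bsub>Pr\<^esub> Suc j"
  by (simp only: Pr_nat_elem Pr_pow RDirProd_simps p_eq p_eq')
 show "\<zero>\<^bsub>Pr\<^esub> \<in> D" "\<one>\<^bsub>Pr\<^esub> \<in> D"
  using ring_hom_one[OF r] ring_hom_one[OF r'] r_zero_iff[of "\<zero>"] r'_zero_iff[of "\<zero>\<^bsub>S\<^esub>"] by (auto simp: D_def)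
 fix d d' assume dd: "d \<in> D" "d' \<in> D"
 then show "d \<otimes>\<^bsub>Pr\<^esub> d' \<in> D"
  by (auto simp: D_def R.teich_mult S.teich_mult ring_hom_mult[OF r] ring_hom_mult[OF r'] R.teich_carrier S.teich_carrier)
 obtain t t' u u' where tu: "d = (t, t')" "d' = (u, u')" "t \<in> R.teich" "t' \<in> S.teich" "u \<in> R.teich" "u' \<in> S.teich"
  "r t = r' t'" "r u = r' u'" using dd by (auto simp: D_def)
 note tuc = R.teich_carrier[OF tu(3)] R.teich_carrier[OF tu(5)] S.teich_carrier[OF tu(4)] S.teich_carrier[OF tu(6)]
 obtain s where s: "s \<in> R.teich" "(t \<oplus> u) \<ominus> s \<in> F 1" using R.teich_exists[of "t \<oplus> u"] tuc by auto
 have sc: "s \<in> carrier R" using s R.teich_carrier by auto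
 obtain s' where s': "s' \<in> S.teich" "r' s' = r s" using teich_partner[OF sc] by blast
 have s'c: "s' \<in> carrier S" using s' S.teich_carrier by auto
 have "r' (t' \<oplus>\<^bsub>S\<^esub> u') = r (t \<oplus> u)" using tuc tu by (simp add: ring_hom_add[OF r] ring_hom_add[OF r'])
 also have "\<dots> = r s" using r_diff[of "t \<oplus> u" s] s tuc sc by simp
 finally have "(t' \<oplus>\<^bsub>S\<^esub> u') \<ominus>\<^bsub>S\<^esub> s' \<in> F' 1" using r'_diff[of "t' \<oplus>\<^bsub>S\<^esub> u'" s'] s' tuc s'c by simp
 then show "\<exists>s \<in> D. (d \<oplus>\<^bsub>Pr\<^esub> d') \<ominus>\<^bsub>Pr\<^esub> s \<in> FP 1"
  using s s' tu tuc sc s'c by (intro bexI[of _ "(s, s')"]) (auto simp: D_def FP_def Pr_diff)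
next
 fix d assume "d \<in> D"
 then obtain t t' where t: "d = (t, t')" "t \<in> R.teich" "t' \<in> S.teich" "r t = r' t'" by (auto simp: D_def)
 then show "d \<in> carrier Pr" using R.teich_carrier S.teich_carrier by auto
 obtain s where s: "s \<in> R.teich" "s [^] p = t" using R.teich_root t by blast
 have sc: "s \<in> carrier R" using s R.teich_carrier by auto
 obtain s' where s': "s' \<in> S.teich" "r' s' = r s" using teich_partner[OF sc] by blast
 have s'c: "s' \<in> carrier S" using s' S.teich_carrier by auto
 have "r' (s' [^]\<^bsub>S\<^esub> p) = r' t'" using s' s t s'c sc by (metis r_pow r'_pow)
 then have "s' [^]\<^bsub>S\<^esub> p = t'"
  using r'_diff[of "s' [^]\<^bsub>S\<^esub> p" t'] S.teich_unique[OF S.teich_pow[OF s'(1)] t(3)] s'c S.teich_carrier[OF t(3)] by simp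
 then show "\<exists>s\<in>D. s [^]\<^bsub>Pr\<^esub> p = d" using s s' t by (intro bexI[of _ "(s, s')"]) (auto simp: D_def Pr_pow)
next
 fix a b k assume "a \<in> FP k"
 then have a: "fst a \<in> F k" "snd a \<in> F' k" by (auto simp: FP_def)
 note ac = R.F_carrier[OF a(1)] S.F_carrier[OF a(2)]
 show "a \<in> carrier Pr" using ac by (auto simp: mem_Times_iff)
 show "\<ominus>\<^bsub>Pr\<^esub> a \<in> FP k" using Pr_neg[OF ac] a by (auto simp: FP_def R.F_neg S.F_neg)
 { assume "b \<in> carrier Pr"
  then show "b \<otimes>\<^bsub>Pr\<^esub> a \<in> FP k" using a
   by (cases a; cases b) (auto simp: FP_def R.F_mult_l S.F_mult_l) }
 { assume "b \<in> FP k"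
  then show "a \<oplus>\<^bsub>Pr\<^esub> b \<in> FP k" using a
   by (cases a; cases b) (auto simp: FP_def R.F_add S.F_add) }
next
 fix a b i k assume "a \<in> FP i" "b \<in> FP k"
 then show "a \<otimes>\<^bsub>Pr\<^esub> b \<in> FP (i + k)"
  by (cases a; cases b) (auto simp: FP_def R.F_mult S.F_mult)
qed (use R.F_Suc S.F_Suc in \<open>auto simp: FP_def\<close>)

sublocale DR: digit_ring Pr FP D "(\<pi>, \<pi>')" "(w, w')" j p
 by (rule D_digit_ring)

lemma D_zero_iff: "(t, t') \<in> D ==> t \<in> F 1 \<longleftrightarrow> t' \<in> F' 1"
 using r_zero_iff[of t] r'_zero_iff[of t'] R.teich_carrier[of t] S.teich_carrier[of t'] by (simp add: D_def)

lemma pi_c: "\<pi> \<in> carrier R" "\<pi>' \<in> carrier S" using pi pi' R.F_carrier S.F_carrier by auto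

lemma G_SucE:
 assumes "(x, y) \<in> DR.G (Suc m)"
 obtains t t' g g' f f' where "(t, t') \<in> D" "(g, g') \<in> DR.G m" "f \<in> F (Suc m)" "f' \<in> F' (Suc m)"
  "x = t \<oplus> \<pi> \<otimes> g \<oplus> f" "y = t' \<oplus>\<^bsub>S\<^esub> \<pi>' \<otimes>\<^bsub>S\<^esub> g' \<oplus>\<^bsub>S\<^esub> f'"
  "t \<in> R.teich" "t' \<in> S.teich" "t \<in> carrier R" "t' \<in> carrier S" "g \<in> carrier R" "g' \<in> carrier S" "f \<in> carrier R" "f' \<in> carrier S"
proof -
 obtain d g f where dgf: "(x, y) = d \<oplus>\<^bsub>Pr\<^esub> (\<pi>, \<pi>') \<otimes>\<^bsub>Pr\<^esub> g \<oplus>\<^bsub>Pr\<^esub> f" "d \<in> D" "g \<in> DR.G m" "f \<in> FP (Suc m)"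
  using assms unfolding DR.G_Suc by blast
 obtain t t' g1 g2 f1 f2 where e: "d = (t, t')" "g = (g1, g2)" "f = (f1, f2)" by (metis surj_pair)
 have "g \<in> carrier Pr" using DR.G_carrier dgf by blast
 then show thesis
  using that[of t t' g1 g2 f1 f2] dgf e R.teich_carrier S.teich_carrier R.F_carrier S.F_carrier
  by (auto simp: D_def FP_def)
qed

lemma G_F':
 "[|(x, y) \<in> DR.G m; x \<in> F m|] ==> y \<in> F' m"
proof (induction m arbitrary: x y)
 case 0 then show ?case using DR.G_carrier[OF 0(1)] by (simp add: S.F_0)
next
 case (Suc m)
 show ?case
 proof (rule G_SucE[OF Suc.prems(1)])
  fix t t' g g' f f'
  assume e: "(t, t') \<in> D" "(g, g') \<in> DR.G m" "f \<in> F (Suc m)" "f' \<in> F' (Suc m)"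
   "x = t \<oplus> \<pi> \<otimes> g \<oplus> f" "y = t' \<oplus>\<^bsub>S\<^esub> \<pi>' \<otimes>\<^bsub>S\<^esub> g' \<oplus>\<^bsub>S\<^esub> f'"
   "t \<in> R.teich" "t' \<in> S.teich" "t \<in> carrier R" "t' \<in> carrier S" "g \<in> carrier R" "g' \<in> carrier S" "f \<in> carrier R" "f' \<in> carrier S"
  have p1: "\<pi> \<in> carrier R" and p2: "\<pi>' \<in> carrier S" by (rule pi_c)+
  have xf: "x \<ominus> f \<in> F (Suc m)" using Suc.prems e R.F_diff by blast
  have 1: "\<pi> \<otimes> g \<in> F 1" using R.F_mult_r pi e by blast
  have xf1: "x \<ominus> f \<in> F 1" using R.F_monoD[OF xf] by simp
  have "(x \<ominus> f) \<ominus> \<pi> \<otimes> g = t" unfolding e(5) by (use e p1 p2 in algebra)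
  then have t: "t \<in> F 1" using R.F_diff[OF xf1 1] by simp
  then have z: "t = \<zero>" "t' = \<zero>\<^bsub>S\<^esub>" using D_zero_iff e R.teich_zero_iff S.teich_zero_iff by auto
  have "x \<ominus> f = \<pi> \<otimes> g" unfolding e(5) z by (use e p1 p2 in algebra)
  then have "g \<in> F m" using xf pi_div e by metis
  then have "g' \<in> F' m" using Suc.IH e by blast
  then have "\<pi>' \<otimes>\<^bsub>S\<^esub> g' \<in> F' (1 + m)" using S.F_mult pi' by blast
  then show "y \<in> F' (Suc m)" using e z S.F_add by simp
 qed
qed

lemma G_F:
 "[|(x, y) \<in> DR.G m; y \<in> F' m; P m|] ==> x \<in> F m"
proof (induction m arbitrary: x y)
 case 0 then show ?case using DR.G_carrier[OF 0(1)] by (simp add: R.F_0)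
next
 case (Suc m)
 show ?case
 proof (rule G_SucE[OF Suc.prems(1)])
  fix t t' g g' f f'
  assume e: "(t, t') \<in> D" "(g, g') \<in> DR.G m" "f \<in> F (Suc m)" "f' \<in> F' (Suc m)"
   "x = t \<oplus> \<pi> \<otimes> g \<oplus> f" "y = t' \<oplus>\<^bsub>S\<^esub> \<pi>' \<otimes>\<^bsub>S\<^esub> g' \<oplus>\<^bsub>S\<^esub> f'"
   "t \<in> R.teich" "t' \<in> S.teich" "t \<in> carrier R" "t' \<in> carrier S" "g \<in> carrier R" "g' \<in> carrier S" "f \<in> carrier R" "f' \<in> carrier S"
  have p1: "\<pi> \<in> carrier R" and p2: "\<pi>' \<in> carrier S" by (rule pi_c)+
  have xf: "y \<ominus>\<^bsub>S\<^esub> f' \<in> F' (Suc m)" using Suc.prems e S.F_diff by blast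
  have 1: "\<pi>' \<otimes>\<^bsub>S\<^esub> g' \<in> F' 1" using S.F_mult_r pi' e by blast
  have xf1: "y \<ominus>\<^bsub>S\<^esub> f' \<in> F' 1" using S.F_monoD[OF xf] by simp
  have "(y \<ominus>\<^bsub>S\<^esub> f') \<ominus>\<^bsub>S\<^esub> \<pi>' \<otimes>\<^bsub>S\<^esub> g' = t'" unfolding e(6) by (use e p1 p2 in algebra)
  then have t: "t' \<in> F' 1" using S.F_diff[OF xf1 1] by simp
  then have z: "t = \<zero>" "t' = \<zero>\<^bsub>S\<^esub>" using D_zero_iff e R.teich_zero_iff S.teich_zero_iff by auto
  have "y \<ominus>\<^bsub>S\<^esub> f' = \<pi>' \<otimes>\<^bsub>S\<^esub> g'" unfolding e(6) z by (use e p1 p2 in algebra)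
  then have "g' \<in> F' m" using xf pi'_div Suc.prems(3) e by metis
  then have "g \<in> F m" using Suc.IH e P_Suc Suc.prems(3) by blast
  then have "\<pi> \<otimes> g \<in> F (1 + m)" using R.F_mult pi by blast
  then show "x \<in> F (Suc m)" using e z R.F_add by simp
 qed
qed

lemma G_total: "x \<in> carrier R ==> \<exists>y \<in> carrier S. (x, y) \<in> DR.G m"
proof (induction m arbitrary: x)
 case 0 then show ?case by auto
next
 case (Suc m)
 obtain t where t: "t \<in> R.teich" "x \<ominus> t \<in> F 1" using R.teich_exists Suc.prems by blast
 have tc: "t \<in> carrier R" using t R.teich_carrier by auto
 obtain x1 where x1: "x1 \<in> carrier R" "x \<ominus> t = \<pi> \<otimes> x1" using F1_pi t by blast
 obtain y1 where y1: "y1 \<in> carrier S" "(x1, y1) \<in> DR.G m" using Suc.IH x1 by blast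
 obtain t' where t': "t' \<in> S.teich" "r' t' = r t" using teich_partner[OF tc] by blast
 have t'c: "t' \<in> carrier S" using t' S.teich_carrier by auto
 have "(t, t') \<oplus>\<^bsub>Pr\<^esub> (\<pi>, \<pi>') \<otimes>\<^bsub>Pr\<^esub> (x1, y1) \<oplus>\<^bsub>Pr\<^esub> \<zero>\<^bsub>Pr\<^esub> \<in> DR.G (Suc m)"
  by (rule DR.G_SucI[OF _ y1(2) DR.F_zero]) (use t t' in \<open>auto simp: D_def\<close>)
 moreover have "t \<oplus> (x \<ominus> t) = x" by (use tc Suc.prems in algebra)
 then have "t \<oplus> \<pi> \<otimes> x1 = x" using x1 by simp
 ultimately have "(x, t' \<oplus>\<^bsub>S\<^esub> \<pi>' \<otimes>\<^bsub>S\<^esub> y1) \<in> DR.G (Suc m)"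
  using tc t'c x1 y1 pi_c Suc.prems by simp
 then show ?case using t'c pi_c y1 by (intro bexI[of _ "t' \<oplus>\<^bsub>S\<^esub> \<pi>' \<otimes>\<^bsub>S\<^esub> y1"]) auto
qed

lemma G_diff:
 assumes "(x, y) \<in> DR.G m" "(x, y') \<in> DR.G m" shows "y \<ominus>\<^bsub>S\<^esub> y' \<in> F' m"
proof -
 have c: "x \<in> carrier R" "y \<in> carrier S" "y' \<in> carrier S" using assms DR.G_carrier by fastforce+
 have "(x, y) \<ominus>\<^bsub>Pr\<^esub> (x, y') \<in> DR.G m" unfolding a_minus_def using assms DR.G_add DR.G_neg by blast
 then have "(\<zero>, y \<ominus>\<^bsub>S\<^esub> y') \<in> DR.G m" using c by (simp add: Pr_diff R.minus_eq R.r_neg)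
 then show ?thesis using G_F' by blast
qed

text \<open>The graph of \<open>h\<close> is the intersection of the sets \<open>G m\<close> of the product ring. It is defined everywhere by
successive approximation and completeness of \<open>S\<close>; it is univalent because the digits of \<open>(0, y)\<close>
vanish one after the other; and it is a subring as every \<open>G m\<close> is one.\<close>

lemma graph_hom:
 "\<exists>h \<in> ring_hom R S. h \<pi> = \<pi>' &
   (\<forall>t \<in> R.teich. \<forall>t' \<in> S.teich. r t = r' t' --> h t = t') &
   (\<forall>k. \<forall>x \<in> F k. h x \<in> F' k) &
   (\<forall>k. P k --> (\<forall>x \<in> carrier R. h x \<in> F' k --> x \<in> F k)) &
   (\<forall>x \<in> carrier R. r' (h x) = r x) &
   ((\<forall>y \<in> carrier S. \<exists>x \<in> carrier R. r x = r' y) --> (\<forall>y \<in> F' 1. \<exists>z \<in> carrier S. y = \<pi>' \<otimes>\<^bsub>S\<^esub> z) -->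
   (\<forall>k. \<forall>y \<in> carrier S. \<exists>x \<in> carrier R. y \<ominus>\<^bsub>S\<^esub> h x \<in> F' k))"
proof -
 have ex: "\<exists>y. \<forall>m. (x, y) \<in> DR.G m" if x: "x \<in> carrier R" for x
 proof -
  obtain s where s: "!!m. s m \<in> carrier S" "!!m. (x, s m) \<in> DR.G m" using G_total[OF x] by metis
  have "s (Suc m) \<ominus>\<^bsub>S\<^esub> s m \<in> F' m" for m using s DR.G_decr by (intro G_diff) blast+
  then obtain L where L: "L \<in> carrier S" "!!m. L \<ominus>\<^bsub>S\<^esub> s m \<in> F' m" using S.F_complete[of s] s by blast
  have "(x, L) \<in> DR.G m" for m
  proof -
   have "(\<zero>, L \<ominus>\<^bsub>S\<^esub> s m) \<in> FP m" using L by (simp add: FP_def)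
   then have "(x, s m) \<oplus>\<^bsub>Pr\<^esub> (\<zero>, L \<ominus>\<^bsub>S\<^esub> s m) \<in> DR.G m" using s DR.G_add DR.F_subset_G by blast
   moreover have "s m \<oplus>\<^bsub>S\<^esub> (L \<ominus>\<^bsub>S\<^esub> s m) = L" by (rule S.plus_minus_cancel[OF s(1) L(1)])
   ultimately show ?thesis using x by simp
  qed
  then show ?thesis by blast
 qed
 define h where "h x = (SOME y. \<forall>m. (x, y) \<in> DR.G m)" for x
 have h: "(x, h x) \<in> DR.G m" if "x \<in> carrier R" for x m
  using someI_ex[OF ex[OF that]] by (simp add: h_def)
 have hc: "h x \<in> carrier S" if "x \<in> carrier R" for x using DR.G_carrier[OF h[OF that, of 0]] by simp
 have uniq: "h x = y" if "!!m. (x, y) \<in> DR.G m" "x \<in> carrier R" "y \<in> carrier S" for x y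
  by (rule S.F_eqI[OF hc that(3)]) (use that h G_diff in blast)+
 have "h \<in> ring_hom R S"
 proof (rule ring_hom_memI)
  fix x y assume xy: "x \<in> carrier R" "y \<in> carrier R"
  show "h x \<in> carrier S" using hc xy by blast
  have "(x, h x) \<otimes>\<^bsub>Pr\<^esub> (y, h y) \<in> DR.G m" for m using h xy DR.G_mult by blast
  then show "h (x \<otimes> y) = h x \<otimes>\<^bsub>S\<^esub> h y" using xy hc by (intro uniq) auto
  have "(x, h x) \<oplus>\<^bsub>Pr\<^esub> (y, h y) \<in> DR.G m" for m using h xy DR.G_add by blast
  then show "h (x \<oplus> y) = h x \<oplus>\<^bsub>S\<^esub> h y" using xy hc by (intro uniq) auto
 next
  have "(\<one>, \<one>\<^bsub>S\<^esub>) \<in> DR.G m" for m using DR.D_subset_G[OF DR.D_one] by simp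
  then show "h \<one> = \<one>\<^bsub>S\<^esub>" by (intro uniq) auto
 qed
 moreover have "h \<pi> = \<pi>'"
 proof (rule uniq)
  fix m show "(\<pi>, \<pi>') \<in> DR.G m" using DR.pi_pow_G[OF DR.closed_at_all, of 1 m] pi_c by (simp add: Pr_pow)
 qed (use pi_c in auto)
 moreover have ht: "h t = t'" if "t \<in> R.teich" "t' \<in> S.teich" "r t = r' t'" for t t'
 proof (rule uniq)
  fix m show "(t, t') \<in> DR.G m" by (rule DR.D_subset_G) (use that in \<open>simp add: D_def\<close>)
 qed (use that R.teich_carrier S.teich_carrier in auto)
 moreover have hF: "h x \<in> F' k" if "x \<in> F k" for x k
  using G_F'[OF h that] R.F_carrier[OF that] by blast
 moreover have "x \<in> F k" if "P k" "x \<in> carrier R" "h x \<in> F' k" for x k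
  using G_F[OF h[OF that(2)] that(3,1)] .
 moreover have "r' (h x) = r x" if x: "x \<in> carrier R" for x
 proof -
  obtain t where t: "t \<in> R.teich" "x \<ominus> t \<in> F 1" using R.teich_exists x by blast
  have tc: "t \<in> carrier R" using t R.teich_carrier by auto
  obtain t' where t': "t' \<in> S.teich" "r' t' = r t" using teich_partner[OF tc] by blast
  have "h t = t'" using ht t t' by simp
  have "h (x \<ominus> t) = h x \<ominus>\<^bsub>S\<^esub> h t"
   using \<open>h \<in> ring_hom R S\<close> x tc
   by (metis R.is_cring S.is_cring R.minus_eq S.minus_eq R.a_inv_closed ring_hom_add ring_hom_cring.hom_a_inv
     ring_hom_cring.intro ring_hom_cring_axioms.intro)
  then have "h x \<ominus>\<^bsub>S\<^esub> t' \<in> F' 1" using hF[OF t(2)] \<open>h t = t'\<close> by simp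
  then have "r' (h x) = r' t'" using r'_diff hc x t' S.teich_carrier by blast
  also have "\<dots> = r x" using t' t r_diff[of x t] x tc by simp
  finally show ?thesis .
 qed
 moreover have "\<exists>x \<in> carrier R. y \<ominus>\<^bsub>S\<^esub> h x \<in> F' k"
  if A: "\<forall>y \<in> carrier S. \<exists>x \<in> carrier R. r x = r' y" "\<forall>y \<in> F' 1. \<exists>z \<in> carrier S. y = \<pi>' \<otimes>\<^bsub>S\<^esub> z"
   and y: "y \<in> carrier S" for k y
 proof -
  have "\<exists>x \<in> carrier R. (x, y) \<in> DR.G k" using y
  proof (induction k arbitrary: y)
   case 0 then show ?case using R.zero_closed by auto
  next
   case (Suc m)
   obtain t' where t': "t' \<in> S.teich" "y \<ominus>\<^bsub>S\<^esub> t' \<in> F' 1" using S.teich_exists Suc.prems by blast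
   have t'c: "t' \<in> carrier S" using t' S.teich_carrier by auto
   obtain y1 where y1: "y1 \<in> carrier S" "y \<ominus>\<^bsub>S\<^esub> t' = \<pi>' \<otimes>\<^bsub>S\<^esub> y1" using A t' by blast
   obtain x1 where x1: "x1 \<in> carrier R" "(x1, y1) \<in> DR.G m" using Suc.IH y1 by blast
   obtain x where x: "x \<in> carrier R" "r x = r' t'" using A t'c by blast
   obtain t where t: "t \<in> R.teich" "x \<ominus> t \<in> F 1" using R.teich_exists x by blast
   have tc: "t \<in> carrier R" using t R.teich_carrier by auto
   have rt: "r t = r' t'" using r_diff[of x t] x t tc by simp
   have "(t, t') \<oplus>\<^bsub>Pr\<^esub> (\<pi>, \<pi>') \<otimes>\<^bsub>Pr\<^esub> (x1, y1) \<oplus>\<^bsub>Pr\<^esub> \<zero>\<^bsub>Pr\<^esub> \<in> DR.G (Suc m)"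
    by (rule DR.G_SucI[OF _ x1(2) DR.F_zero]) (use t t' rt in \<open>auto simp: D_def\<close>)
   moreover have "t' \<oplus>\<^bsub>S\<^esub> (y \<ominus>\<^bsub>S\<^esub> t') = y" by (use t'c Suc.prems in algebra)
   then have "t' \<oplus>\<^bsub>S\<^esub> \<pi>' \<otimes>\<^bsub>S\<^esub> y1 = y" using y1 by simp
   ultimately have "(t \<oplus> \<pi> \<otimes> x1, y) \<in> DR.G (Suc m)"
    using tc t'c x1 y1 pi_c Suc.prems by simp
   then show ?case using tc pi_c x1 by (intro bexI[of _ "t \<oplus> \<pi> \<otimes> x1"]) auto
  qed
  then show ?thesis using G_diff h by blast
 qed
 ultimately show ?thesis by (intro bexI[of _ h]) blast+
qed

end

section \<open>Valued hyperfields\<close>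

context hyperfield begin

lemma hunits_group: "comm_group \<lparr>carrier = carrier H - {hzero H}, monoid.mult = mult H, one = one H\<rparr>"
 by (rule units_comm_group)

lemma one_carrier [simp, intro]: "\<one> \<in> carrier H" and one_nonzero [simp]: "\<one> ~= hzero H"
proof -
 interpret U: comm_group "\<lparr>carrier = carrier H - {hzero H}, monoid.mult = mult H, one = one H\<rparr>"
  by (rule hunits_group)
 show "\<one> \<in> carrier H" "\<one> ~= hzero H" using U.one_closed by auto
qed

lemma zero_carrier [simp, intro]: "hzero H \<in> carrier H" by (rule zero_closed)

lemma nonzero_mult: "[|a \<in> carrier H; b \<in> carrier H; a ~= hzero H; b ~= hzero H|] ==> a \<otimes> b \<in> carrier H - {hzero H}"
proof -
 interpret U: comm_group "\<lparr>carrier = carrier H - {hzero H}, monoid.mult = mult H, one = one H\<rparr>"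
  by (rule hunits_group)
 show "[|a \<in> carrier H; b \<in> carrier H; a ~= hzero H; b ~= hzero H|] ==> a \<otimes> b \<in> carrier H - {hzero H}"
  using U.m_closed[of a b] by auto
qed

lemma comm_monoid_H: "comm_monoid H"
proof -
 interpret U: comm_group "\<lparr>carrier = carrier H - {hzero H}, monoid.mult = mult H, one = one H\<rparr>"
  by (rule hunits_group)
 have cl: "a \<otimes> b \<in> carrier H" if "a \<in> carrier H" "b \<in> carrier H" for a b
  using that nonzero_mult[of a b] zero_mult[of b] mult_zero[of a] by (cases "a = hzero H"; cases "b = hzero H") auto
 show ?thesis
 proof (rule comm_monoidI)
  fix a b c assume abc: "a \<in> carrier H" "b \<in> carrier H" "c \<in> carrier H"
  show "a \<otimes> b \<otimes> c = a \<otimes> (b \<otimes> c)"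
   using U.m_assoc[of a b c] abc cl[of a b] cl[of b c] cl[of a c] zero_mult mult_zero
   by (cases "a = hzero H"; cases "b = hzero H"; cases "c = hzero H") auto
 next
  fix a b assume ab: "a \<in> carrier H" "b \<in> carrier H"
  show "a \<otimes> b \<in> carrier H" using cl ab .
  show "a \<otimes> b = b \<otimes> a" using U.m_comm[of a b] ab zero_mult mult_zero
   by (cases "a = hzero H"; cases "b = hzero H") auto
 next
  fix a assume a: "a \<in> carrier H"
  show "\<one> \<otimes> a = a" using U.l_one[of a] a mult_zero[of \<one>] by (cases "a = hzero H") auto
 qed auto
qed

sublocale comm_monoid H by (rule comm_monoid_H)

lemma mult_eq_zero_iff: "[|a \<in> carrier H; b \<in> carrier H|] ==> a \<otimes> b = hzero H \<longleftrightarrow> a = hzero H \<or> b = hzero H"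
 using nonzero_mult[of a b] zero_mult mult_zero by auto

lemma nonzero_inverse:
 assumes "a \<in> carrier H" "a ~= hzero H"
 shows "\<exists>b \<in> carrier H. b ~= hzero H & a \<otimes> b = \<one> & b \<otimes> a = \<one>"
proof -
 interpret U: comm_group "\<lparr>carrier = carrier H - {hzero H}, monoid.mult = mult H, one = one H\<rparr>"
  by (rule hunits_group)
 show ?thesis using U.r_inv_ex[of a] assms m_comm by auto
qed

lemma hyper_cancel:
 assumes "a \<in> carrier H" "b \<in> carrier H" "c \<in> carrier H" "c ~= hzero H" "a \<otimes> c = b \<otimes> c"
 shows "a = b"
proof -
 obtain d where d: "d \<in> carrier H" "c \<otimes> d = \<one>" using nonzero_inverse assms by blast
 have e: "x \<otimes> c \<otimes> d = x" if "x \<in> carrier H" for x using that d assms(3) by (simp add: m_assoc)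
 show ?thesis using e[OF assms(1)] e[OF assms(2)] assms(5) by metis
qed

lemma pow_nonzero: "[|a \<in> carrier H; a ~= hzero H|] ==> a [^] (k::nat) ~= hzero H"
 by (induction k) (auto simp: mult_eq_zero_iff)

lemma hneg: "a \<in> carrier H ==> hneg H a \<in> carrier H & hzero H \<in> hadd H a (hneg H a)"
 unfolding hneg_def by (rule theI') (rule ex1_neg)

lemma hneg_carrier [simp, intro]: "a \<in> carrier H ==> hneg H a \<in> carrier H" using hneg by blast

lemma hneg_unique: "[|a \<in> carrier H; b \<in> carrier H; hzero H \<in> hadd H a b|] ==> b = hneg H a"
 using ex1_neg hneg by blast

lemma hneg_hneg [simp]: "a \<in> carrier H ==> hneg H (hneg H a) = a"
 using hneg_unique[of "hneg H a" a] hneg[of a] hadd_comm[of a "hneg H a"] by auto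

lemma hneg_zero [simp]: "hneg H (hzero H) = hzero H"
 using hneg_unique[of "hzero H" "hzero H"] hadd_zero[of "hzero H"] by auto

lemma zero_hadd: "a \<in> carrier H ==> hadd H (hzero H) a = {a}"
 using hadd_comm[of a "hzero H"] hadd_zero by auto

lemma hneg_mult: "[|a \<in> carrier H; c \<in> carrier H|] ==> hneg H a \<otimes> c = hneg H (a \<otimes> c)"
proof (rule hneg_unique)
 assume ac: "a \<in> carrier H" "c \<in> carrier H"
 have "hzero H \<otimes> c \<in> (%d. d \<otimes> c) ` hadd H a (hneg H a)" using hneg[OF ac(1)] by blast
 then show "hzero H \<in> hadd H (a \<otimes> c) (hneg H a \<otimes> c)" using distrib[of a "hneg H a" c] ac zero_mult by auto
qed auto

lemma hsub_closed: "[|a \<in> carrier H; b \<in> carrier H; c \<in> hsub H a b|] ==> c \<in> carrier H"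
 unfolding hsub_def using hadd_closed by blast

lemma hadd_carrier: "[|c \<in> hadd H a b; a \<in> carrier H; b \<in> carrier H|] ==> c \<in> carrier H"
 using hadd_closed by blast

lemma zero_in_hsub_iff: "[|a \<in> carrier H; b \<in> carrier H|] ==> hzero H \<in> hsub H a b \<longleftrightarrow> a = b"
 using hneg_unique[of a "hneg H b"] hneg[of b] unfolding hsub_def by (metis hneg_hneg hneg_carrier)

lemma in_hsub_iff: "[|a \<in> carrier H; b \<in> carrier H; c \<in> carrier H|] ==> a \<in> hsub H b c \<longleftrightarrow> b \<in> hadd H a c"
 by (rule reversible)

lemma hadd_assocD:
 assumes "x \<in> hadd H a b" "y \<in> hadd H x c" "a \<in> carrier H" "b \<in> carrier H" "c \<in> carrier H"
 shows "\<exists>z \<in> hadd H b c. y \<in> hadd H a z"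
 using hadd_assoc[OF assms(3-5)] assms(1,2) unfolding hset_add_def by blast

lemma hadd_assocD':
 assumes "z \<in> hadd H b c" "y \<in> hadd H a z" "a \<in> carrier H" "b \<in> carrier H" "c \<in> carrier H"
 shows "\<exists>x \<in> hadd H a b. y \<in> hadd H x c"
 using hadd_assoc[OF assms(3-5)] assms(1,2) unfolding hset_add_def by blast

lemma hadd_exchange:
 assumes g: "g \<in> hadd H a b" and a: "a \<in> hadd H d a'" and b: "b \<in> hadd H d' b'"
  and c: "d \<in> carrier H" "a' \<in> carrier H" "d' \<in> carrier H" "b' \<in> carrier H"
 shows "\<exists>x \<in> hadd H d d'. \<exists>y \<in> hadd H a' b'. g \<in> hadd H x y"
proof -
 have bc: "b \<in> carrier H" using b c hadd_carrier by blast
 obtain z where z: "z \<in> hadd H a' b" "g \<in> hadd H d z" using hadd_assocD[OF a g c(1,2) bc] by blast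
 have "z \<in> hadd H b a'" using z hadd_comm c bc by auto
 then obtain y where y: "y \<in> hadd H b' a'" "z \<in> hadd H d' y" using hadd_assocD[OF b _ c(3,4,2)] by blast
 have "y \<in> hadd H a' b'" using y hadd_comm c by auto
 moreover obtain x where "x \<in> hadd H d d'" "g \<in> hadd H x y"
  using hadd_assocD'[OF y(2) z(2) c(1,3)] hadd_carrier[OF y(1) c(4,2)] by blast
 ultimately show ?thesis by blast
qed

lemma hadd_mult:
 assumes "a \<in> carrier H" "b \<in> carrier H" "c \<in> carrier H" "d \<in> hadd H a b"
 shows "d \<otimes> c \<in> hadd H (a \<otimes> c) (b \<otimes> c)"
 using distrib[OF assms(1-3)] assms(4) by blast

lemma hadd_mult_iff:
 assumes "a \<in> carrier H" "b \<in> carrier H" "c \<in> carrier H" "c ~= hzero H" "d \<in> carrier H"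
 shows "d \<otimes> c \<in> hadd H (a \<otimes> c) (b \<otimes> c) \<longleftrightarrow> d \<in> hadd H a b"
proof
 assume A: "d \<otimes> c \<in> hadd H (a \<otimes> c) (b \<otimes> c)"
 obtain i where i: "i \<in> carrier H" "c \<otimes> i = \<one>" using nonzero_inverse assms by blast
 have "d \<otimes> c \<otimes> i \<in> hadd H (a \<otimes> c \<otimes> i) (b \<otimes> c \<otimes> i)" by (rule hadd_mult[OF _ _ i(1) A]) (use assms in auto)
 moreover have e: "x \<otimes> c \<otimes> i = x" if "x \<in> carrier H" for x using that i assms(3) by (simp add: m_assoc)
 ultimately show "d \<in> hadd H a b" using e[OF assms(1)] e[OF assms(2)] e[OF assms(5)] by metis
qed (use hadd_mult assms in blast)

end

context discrete_valued_hyperfield begin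

lemma val_zero [simp]: "val H (hzero H) = \<infinity>" using val_eq_PInf by auto

lemma val_real: "[|a \<in> carrier H; a ~= hzero H|] ==> \<exists>r. val H a = ereal r & r \<in> value_group H"
 using val_not_MInf[of a] val_eq_PInf[of a] unfolding value_group_def by (cases "val H a") auto

lemma val_one [simp]: "val H \<one> = 0"
proof -
 obtain r where r: "val H \<one> = ereal r" using val_real[of \<one>] by auto
 have "val H (\<one> \<otimes> \<one>) = val H \<one> + val H \<one>" by (intro val_mult) auto
 then show ?thesis using r by simp
qed

lemma val_hneg [simp]: assumes a: "a \<in> carrier H" shows "val H (hneg H a) = val H a"
proof -
 have "hneg H \<one> \<otimes> hneg H \<one> = \<one>" using hneg_mult[of \<one> "hneg H \<one>"] by simp
 then have 1: "val H (hneg H \<one>) + val H (hneg H \<one>) = 0" using val_mult[of "hneg H \<one>" "hneg H \<one>"] by simp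
 then have "val H (hneg H \<one>) = 0" by (cases "val H (hneg H \<one>)") (auto simp: zero_ereal_def)
 moreover have "hneg H a = hneg H \<one> \<otimes> a" using hneg_mult[of \<one> a] a by simp
 ultimately show ?thesis using val_mult[of "hneg H \<one>" a] a by simp
qed

lemma val_pow: "a \<in> carrier H ==> val H a = ereal r ==> val H (a [^] (k::nat)) = ereal (real k * r)"
 by (induction k) (auto simp: val_mult algebra_simps)

definition near :: "ereal => 'a => 'a => bool" where
 "near r a b \<longleftrightarrow> (\<exists>c \<in> hsub H a b. val H c \<ge> r)"

lemma hadd_nonempty: assumes "a \<in> carrier H" "b \<in> carrier H" shows "hadd H a b ~= {}"
proof -
 obtain \<rho> where "is_radius H \<rho>" using ex_radius by blast
 then obtain c where "c \<in> carrier H" "hadd H a b = closed_ball H c (ereal \<rho> + min (val H a) (val H b))"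
  using assms unfolding is_radius_def is_closed_ball_def by blast
 then show ?thesis by (auto simp: closed_ball_def)
qed

lemma val_const: "[|a \<in> carrier H; b \<in> carrier H; a ~= b; c \<in> hsub H a b; d \<in> hsub H a b|] ==> val H c = val H d"
 unfolding hsub_def by (rule val_hadd_const[of a "hneg H b"]) (auto simp flip: hsub_def simp: zero_in_hsub_iff)

lemma val_diff_eq: assumes "a \<in> carrier H" "b \<in> carrier H" "a ~= b" "c \<in> hsub H a b"
 shows "val_diff H a b = val H c"
 unfolding val_diff_def
proof (rule the_equality)
 show "\<forall>\<gamma>\<in>hsub H a b. val H \<gamma> = val H c" using val_const[OF assms(1-3) _ assms(4)] by blast
qed (use assms(4) in auto)

lemma near_iff_val_diff: assumes "a \<in> carrier H" "b \<in> carrier H"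
 shows "near r a b \<longleftrightarrow> a = b \<or> val_diff H a b \<ge> r"
proof (cases "a = b")
 case True
 then show ?thesis using zero_in_hsub_iff[of a a] assms unfolding near_def by (auto intro!: bexI[of _ "hzero H"])
next
 case False
 obtain c where "c \<in> hsub H a b" using hadd_nonempty[of a "hneg H b"] assms unfolding hsub_def by auto
 moreover have "\<forall>d \<in> hsub H a b. val_diff H a b = val H d" using val_diff_eq[OF assms False] by blast
 ultimately show ?thesis unfolding near_def using False by metis
qed

lemma closed_ball_eq: "c \<in> carrier H ==> closed_ball H c r = {x \<in> carrier H. near r x c}"
 unfolding closed_ball_def using near_iff_val_diff by blast

lemma near_alt: assumes "a \<in> carrier H" "b \<in> carrier H"
 shows "near r a b \<longleftrightarrow> (\<exists>c \<in> carrier H. a \<in> hadd H c b & val H c \<ge> r)"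
 unfolding near_def using in_hsub_iff assms hsub_closed by blast

lemma near_refl [simp]: "a \<in> carrier H ==> near r a a" using near_iff_val_diff by simp

lemma near_sym: assumes "near r a b" "a \<in> carrier H" "b \<in> carrier H" shows "near r b a"
proof -
 obtain c where c: "c \<in> hsub H a b" "val H c \<ge> r" using assms near_def by blast
 have cc: "c \<in> carrier H" using c hsub_closed assms by blast
 have "a \<in> hadd H b c" using c in_hsub_iff[of c a b] assms cc hadd_comm by auto
 then have "b \<in> hsub H a c" using in_hsub_iff[of b a c] assms cc by auto
 then have "b \<in> hadd H (hneg H c) a" using hadd_comm assms cc unfolding hsub_def by auto
 then show ?thesis using near_alt[of b a r] assms c cc by (auto intro!: bexI[of _ "hneg H c"])
qed

lemma near_trans:
 assumes "near r a b" "near r b c" "a \<in> carrier H" "b \<in> carrier H" "c \<in> carrier H" shows "near r a c"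
proof -
 obtain d d' where d: "d \<in> carrier H" "a \<in> hadd H d b" "val H d \<ge> r" and d': "d' \<in> carrier H" "b \<in> hadd H d' c" "val H d' \<ge> r"
  using assms near_alt by meson
 obtain x where x: "x \<in> hadd H d d'" "a \<in> hadd H x c" using hadd_assocD'[OF d'(2) d(2) d(1) d'(1) assms(5)] by blast
 have "val H x \<ge> min (val H d) (val H d')" using val_hadd_ge x d d' by blast
 then have "val H x \<ge> r" using d d' by (metis min.bounded_iff order_trans)
 then show ?thesis using near_alt[of a c] assms x hadd_carrier[OF x(1) d(1) d'(1)] by blast
qed

lemma near_mono: "[|near r a b; s \<le> r|] ==> near s a b" unfolding near_def using order_trans by blast

lemma near_zero: "a \<in> carrier H ==> near r a (hzero H) \<longleftrightarrow> val H a \<ge> r"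
 unfolding near_def hsub_def using hadd_zero by simp

lemma near_val: assumes "near r a b" "a \<in> carrier H" "b \<in> carrier H" "val H b \<ge> r" shows "val H a \<ge> r"
 using near_trans[OF assms(1), of "hzero H"] near_zero assms by simp

lemma near_add:
 assumes "near r a a'" "near r b b'" "c \<in> hadd H a b" "a \<in> carrier H" "a' \<in> carrier H" "b \<in> carrier H" "b' \<in> carrier H"
 shows "\<exists>c' \<in> hadd H a' b'. near r c c'"
proof -
 obtain d d' where d: "d \<in> carrier H" "a \<in> hadd H d a'" "val H d \<ge> r" and d': "d' \<in> carrier H" "b \<in> hadd H d' b'" "val H d' \<ge> r"
  using assms near_alt by meson
 obtain x y where xy: "x \<in> hadd H d d'" "y \<in> hadd H a' b'" "c \<in> hadd H x y"
  using hadd_exchange[OF assms(3) d(2) d'(2)] d d' assms by blast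
 have "val H x \<ge> min (val H d) (val H d')" using val_hadd_ge xy d d' by blast
 then have "val H x \<ge> r" using d d' by (metis min.bounded_iff order_trans)
 then have "near r c y" using near_alt[of c y] hadd_carrier xy d d' assms by blast
 then show ?thesis using xy by blast
qed

lemma near_mult:
 assumes "near r a b" "a \<in> carrier H" "b \<in> carrier H" "c \<in> carrier H"
 shows "near (r + val H c) (a \<otimes> c) (b \<otimes> c)"
proof -
 obtain d where d: "d \<in> carrier H" "a \<in> hadd H d b" "val H d \<ge> r" using assms near_alt by meson
 have "a \<otimes> c \<in> hadd H (d \<otimes> c) (b \<otimes> c)" using hadd_mult d assms by blast
 moreover have "val H (d \<otimes> c) \<ge> r + val H c" using d assms by (simp add: val_mult add_right_mono)
 ultimately show ?thesis using near_alt[of "a \<otimes> c" "b \<otimes> c"] d assms by blast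
qed

text \<open>A ball is determined by any of its elements, so membership in a sum reduces to closeness to one of its elements.\<close>

lemma hadd_radius:
 assumes "is_radius H \<rho>" "a \<in> carrier H" "b \<in> carrier H" "c \<in> hadd H a b"
 shows "d \<in> hadd H a b \<longleftrightarrow> d \<in> carrier H & near (ereal \<rho> + min (val H a) (val H b)) d c"
proof -
 obtain z where z: "z \<in> carrier H" "hadd H a b = closed_ball H z (ereal \<rho> + min (val H a) (val H b))"
  using assms unfolding is_radius_def is_closed_ball_def by blast
 have "c \<in> carrier H" "near (ereal \<rho> + min (val H a) (val H b)) c z" using assms(4) z closed_ball_eq by auto
 then show ?thesis unfolding z closed_ball_eq[OF z(1)] using near_trans near_sym z(1) by blast
qed

lemma hsub_self:
 assumes "is_radius H \<rho>" "a \<in> carrier H" "d \<in> carrier H"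
 shows "d \<in> hsub H a a \<longleftrightarrow> val H d \<ge> ereal \<rho> + val H a"
 using hadd_radius[OF assms(1,2) hneg_carrier[OF assms(2)], of "hzero H" d] assms near_zero zero_in_hsub_iff[of a a]
 unfolding hsub_def by simp

lemma is_radius_rho: "is_radius H (rho H)" and is_radius_unique: "is_radius H \<rho> ==> \<rho> = rho H"
proof -
 have le: "r \<le> s" if r: "is_radius H r" and s: "is_radius H s" for r s
 proof -
  obtain a where a: "a \<in> carrier H" "val H a = ereal s" using s unfolding is_radius_def value_group_def by blast
  have "a \<in> hsub H \<one> \<one>" using hsub_self[OF s _ a(1), of \<one>] a by simp
  then show ?thesis using hsub_self[OF r _ a(1), of \<one>] a by simp
 qed
 have uniq: "\<exists>!r. is_radius H r" using ex_radius le by (metis order_antisym)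
 then show "is_radius H (rho H)" unfolding rho_def by (rule theI')
 then show "is_radius H \<rho> ==> \<rho> = rho H" using uniq by blast
qed

lemmas hadd_ball = hadd_radius[OF is_radius_rho]
lemmas hsub_self_iff = hsub_self[OF is_radius_rho]

text \<open>Elements that are closer to each other than the radius of balls around them coincide.\<close>

lemma near_imp_eq:
 assumes rho: "rho H \<ge> 0" and a: "a \<in> carrier H" and b: "b \<in> carrier H" and n: "near (ereal (rho H) + val H a) a b"
 shows "a = b"
proof -
 obtain d where d: "d \<in> hsub H a b" "val H d \<ge> ereal (rho H) + val H a" using n near_def by blast
 have dc: "d \<in> carrier H" using d hsub_closed a b by blast
 have le: "val H a \<le> val H d"
  using d(2) rho add_right_mono[of 0 "ereal (rho H)" "val H a"] by (simp add: zero_ereal_def[symmetric])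
 have "near (val H a) a b" unfolding near_def using d(1) le by blast
 then have "near (val H a) b a" using near_sym a b by blast
 then have ab: "val H a \<le> val H b" using near_val a b by blast
 then have m: "min (val H a) (val H (hneg H b)) = val H a" using b by (simp add: min_def)
 have "near (ereal (rho H) + val H a) (hzero H) d" using near_sym[of _ d "hzero H"] near_zero[OF dc] d dc by blast
 then have "hzero H \<in> hsub H a b"
  using hadd_ball[OF a hneg_carrier[OF b], of d "hzero H"] d m unfolding hsub_def by simp
 then show ?thesis using zero_in_hsub_iff a b by blast
qed

abbreviation Oh where "Oh \<equiv> valuation_hyperring H"

lemma Oh_iff: "a \<in> Oh \<longleftrightarrow> a \<in> carrier H & val H a \<ge> 0" by (simp add: valuation_hyperring_def)
lemma Oh_carrier: "a \<in> Oh ==> a \<in> carrier H" by (simp add: Oh_iff)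
lemma Oh_mult: "[|a \<in> Oh; b \<in> Oh|] ==> a \<otimes> b \<in> Oh" by (simp add: Oh_iff val_mult)
lemma Oh_one [simp, intro]: "\<one> \<in> Oh" by (simp add: Oh_iff)
lemma Oh_zero [simp, intro]: "hzero H \<in> Oh" by (simp add: Oh_iff)
lemma Oh_hneg: "a \<in> Oh ==> hneg H a \<in> Oh" by (simp add: Oh_iff)
lemma Oh_hadd: "[|c \<in> hadd H a b; a \<in> Oh; b \<in> Oh|] ==> c \<in> Oh"
 using val_hadd_ge[of a b c] hadd_carrier[of c a b] by (auto simp: Oh_iff min_def split: if_splits intro: order_trans)
lemma Oh_pow: "a \<in> Oh ==> a [^] (k::nat) \<in> Oh" by (induction k) (auto intro: Oh_mult)

text \<open>Both residue rings are covered: \<open>\<eta>\<close> is \<open>rho\<close> for the truncated ring and \<open>theta\<close> for the residue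
field. A radius of at most \<open>rho\<close> makes a sum of classes a single class.\<close>

context
 fixes \<eta> :: real
 assumes eta_pos: "\<eta> > 0" and eta_rho: "\<eta> \<le> rho H"
begin

abbreviation cl where "cl \<equiv> hclass H \<eta>"
abbreviation Q where "Q \<equiv> hquot H \<eta>"

lemma hcong_iff: "(a, b) \<in> hcong H \<eta> \<longleftrightarrow> a \<in> Oh & b \<in> Oh & near (ereal \<eta>) a b"
proof (cases "a = b & a \<in> Oh")
 case True
 have "val H d \<ge> ereal \<eta>" if "d \<in> hsub H a a" for d
 proof -
  have "ereal \<eta> \<le> ereal (rho H) + val H a" using eta_rho True Oh_iff[of a]
   by (metis add_mono add.right_neutral ereal_less_eq(3))
  then show ?thesis using hsub_self_iff[of a d] that True hsub_closed[of a a d] by (auto simp: Oh_iff)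
 qed
 then show ?thesis using True by (auto simp: hcong_def Oh_iff)
next
 case False
 show ?thesis
 proof (cases "a \<in> Oh & b \<in> Oh")
  case True
  then have ab: "a \<in> carrier H" "b \<in> carrier H" "a ~= b" using False Oh_carrier by auto
  obtain c where c: "c \<in> hsub H a b" using hadd_nonempty[of a "hneg H b"] ab unfolding hsub_def by blast
  have "!!d. d \<in> hsub H a b ==> val H d = val H c" using val_const[OF ab _ c] .
  then show ?thesis using True c by (simp only: hcong_def near_def mem_Collect_eq prod.case) metis
 next
  case False
  then show ?thesis by (auto simp: hcong_def)
 qed
qed

lemma hcong_equiv: "equiv Oh (hcong H \<eta>)"
proof (rule equivI)
 show "hcong H \<eta> \<subseteq> Oh \<times> Oh" by (auto simp: hcong_iff)
 show "refl_on Oh (hcong H \<eta>)" by (auto simp: refl_on_def hcong_iff Oh_carrier)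
 show "sym (hcong H \<eta>)" by (auto simp: sym_def hcong_iff Oh_carrier intro: near_sym)
 show "trans (hcong H \<eta>)"
  unfolding trans_def hcong_iff using near_trans Oh_carrier by blast
qed

lemma cl_eq_iff: "[|a \<in> Oh; b \<in> Oh|] ==> cl a = cl b \<longleftrightarrow> near (ereal \<eta>) a b"
 unfolding hclass_def using eq_equiv_class_iff[OF hcong_equiv] hcong_iff by auto

lemma Q_carrier: "carrier Q = cl ` Oh"
 by (auto simp: hquot_def hclass_def quotient_def)

lemma cl_in_Q: "a \<in> Oh ==> cl a \<in> carrier Q" by (auto simp: Q_carrier)

lemma in_cl: "b \<in> cl a \<longleftrightarrow> a \<in> Oh & b \<in> Oh & near (ereal \<eta>) a b"
 by (auto simp: hclass_def hcong_iff)

lemma Q_one: "\<one>\<^bsub>Q\<^esub> = cl \<one>" and Q_zero: "\<zero>\<^bsub>Q\<^esub> = cl (hzero H)" by (simp_all add: hquot_def)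

lemma near_mult_O:
 assumes "near (ereal \<eta>) a a'" "near (ereal \<eta>) b b'" "a \<in> Oh" "a' \<in> Oh" "b \<in> Oh" "b' \<in> Oh"
 shows "near (ereal \<eta>) (a \<otimes> b) (a' \<otimes> b')"
proof -
 have le: "ereal \<eta> \<le> ereal \<eta> + val H x" if "x \<in> Oh" for x
  using that Oh_iff by (metis add.right_neutral add_left_mono)
 have 1: "near (ereal \<eta>) (a \<otimes> b) (a' \<otimes> b)"
  using near_mono[OF near_mult[of "ereal \<eta>" a a' b] le] assms Oh_carrier by blast
 have "near (ereal \<eta>) (b \<otimes> a') (b' \<otimes> a')"
  using near_mono[OF near_mult[of "ereal \<eta>" b b' a'] le] assms Oh_carrier by blast
 then have 2: "near (ereal \<eta>) (a' \<otimes> b) (a' \<otimes> b')" using assms Oh_carrier m_comm by metis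
 show ?thesis using near_trans[OF 1 2] assms Oh_carrier by blast
qed

lemma Q_mult: assumes "a \<in> Oh" "b \<in> Oh" shows "cl a \<otimes>\<^bsub>Q\<^esub> cl b = cl (a \<otimes> b)"
proof -
 have "cl (x \<otimes> y) = cl (a \<otimes> b)" if "x \<in> cl a" "y \<in> cl b" for x y
  using that assms cl_eq_iff[of "x \<otimes> y" "a \<otimes> b"] near_mult_O[of x a y b] near_sym Oh_mult Oh_carrier
  by (auto simp: in_cl)
 moreover have "a \<in> cl a" "b \<in> cl b" using assms by (auto simp: in_cl Oh_carrier)
 ultimately have "(\<Union>x\<in>cl a. \<Union>y\<in>cl b. cl (x \<otimes> y)) = cl (a \<otimes> b)" by blast
 then show ?thesis by (simp add: hquot_def)
qed

lemma near_hadd_O: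
 assumes "near (ereal \<eta>) a a'" "near (ereal \<eta>) b b'" "a \<in> Oh" "a' \<in> Oh" "b \<in> Oh" "b' \<in> Oh"
  "c \<in> hadd H a b" "c' \<in> hadd H a' b'"
 shows "near (ereal \<eta>) c c'"
proof -
 obtain d where d: "d \<in> hadd H a' b'" "near (ereal \<eta>) c d"
  using near_add[OF assms(1,2,7)] assms Oh_carrier by blast
 have "near (ereal (rho H) + min (val H a') (val H b')) d c'"
  using hadd_ball[of a' b' c' d] d assms Oh_carrier by blast
 moreover have "ereal \<eta> \<le> ereal (rho H) + min (val H a') (val H b')"
  using eta_rho assms Oh_iff by (metis add_mono add.right_neutral ereal_less_eq(3) min.bounded_iff)
 ultimately have "near (ereal \<eta>) d c'" using near_mono by blast
 then show ?thesis using near_trans[OF d(2)] assms d hadd_carrier Oh_carrier by meson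
qed

lemma Q_add: assumes "a \<in> Oh" "b \<in> Oh" "c \<in> hadd H a b" shows "cl a \<oplus>\<^bsub>Q\<^esub> cl b = cl c"
proof -
 have "cl z = cl c" if "x \<in> cl a" "y \<in> cl b" "z \<in> hadd H x y" for x y z
  using that assms cl_eq_iff[of z c] near_hadd_O[of x a y b z c] near_sym Oh_hadd[of z x y] Oh_hadd[of c a b] Oh_carrier
  by (auto simp: in_cl)
 moreover have "a \<in> cl a" "b \<in> cl b" using assms by (auto simp: in_cl Oh_carrier)
 ultimately have "(\<Union>x\<in>cl a. \<Union>y\<in>cl b. \<Union>z\<in>hadd H x y. cl z) = cl c" using assms(3) by blast
 then show ?thesis by (simp add: hquot_def)
qed

lemma Q_add_ex: assumes "a \<in> Oh" "b \<in> Oh" obtains c where "c \<in> hadd H a b" "c \<in> Oh" "cl a \<oplus>\<^bsub>Q\<^esub> cl b = cl c"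
 using hadd_nonempty[of a b] Oh_hadd Q_add assms Oh_carrier by (metis ex_in_conv)

lemma Q_cring: "cring Q"
proof (rule cringI)
 show "abelian_group Q"
 proof (rule abelian_groupI)
  fix x y assume "x \<in> carrier Q" "y \<in> carrier Q"
  then obtain a b where ab: "a \<in> Oh" "b \<in> Oh" "x = cl a" "y = cl b" by (auto simp: Q_carrier)
  obtain c where c: "c \<in> hadd H a b" "c \<in> Oh" "x \<oplus>\<^bsub>Q\<^esub> y = cl c" using Q_add_ex[OF ab(1,2)] ab by metis
  show "x \<oplus>\<^bsub>Q\<^esub> y \<in> carrier Q" using c cl_in_Q by simp
  show "x \<oplus>\<^bsub>Q\<^esub> y = y \<oplus>\<^bsub>Q\<^esub> x" using c Q_add[OF ab(2,1), of c] ab hadd_comm Oh_carrier by auto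
  fix z assume "z \<in> carrier Q"
  then obtain d where d: "d \<in> Oh" "z = cl d" by (auto simp: Q_carrier)
  obtain s where s: "s \<in> hadd H c d" "s \<in> Oh" "cl c \<oplus>\<^bsub>Q\<^esub> z = cl s" using Q_add_ex[OF c(2) d(1)] d by metis
  obtain t where t: "t \<in> hadd H b d" "s \<in> hadd H a t" using hadd_assocD[OF c(1) s(1)] ab d Oh_carrier by blast
  have tO: "t \<in> Oh" using Oh_hadd t ab d by blast
  have "y \<oplus>\<^bsub>Q\<^esub> z = cl t" using Q_add t ab d by simp
  then have "x \<oplus>\<^bsub>Q\<^esub> (y \<oplus>\<^bsub>Q\<^esub> z) = cl s" using Q_add[OF ab(1) tO t(2)] ab by simp
  then show "x \<oplus>\<^bsub>Q\<^esub> y \<oplus>\<^bsub>Q\<^esub> z = x \<oplus>\<^bsub>Q\<^esub> (y \<oplus>\<^bsub>Q\<^esub> z)" using c s by simp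
 next
  fix x assume "x \<in> carrier Q"
  then obtain a where a: "a \<in> Oh" "x = cl a" by (auto simp: Q_carrier)
  show "\<zero>\<^bsub>Q\<^esub> \<oplus>\<^bsub>Q\<^esub> x = x" using Q_add[of "hzero H" a a] a zero_hadd Oh_carrier by (simp add: Q_zero)
  have "hzero H \<in> hadd H (hneg H a) a" using hneg[of a] hadd_comm[of a "hneg H a"] a Oh_carrier by auto
  then have "cl (hneg H a) \<oplus>\<^bsub>Q\<^esub> x = \<zero>\<^bsub>Q\<^esub>" using Q_add[of "hneg H a" a] a Oh_hneg by (simp add: Q_zero)
  then show "\<exists>y\<in>carrier Q. y \<oplus>\<^bsub>Q\<^esub> x = \<zero>\<^bsub>Q\<^esub>" using cl_in_Q Oh_hneg a by blast
 qed (auto simp: Q_zero cl_in_Q)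
 show "comm_monoid Q"
  by (rule comm_monoidI) (auto simp: Q_carrier Q_one Q_mult Oh_mult Oh_carrier m_ac)
 fix x y z assume "x \<in> carrier Q" "y \<in> carrier Q" "z \<in> carrier Q"
 then obtain a b d where ab: "a \<in> Oh" "b \<in> Oh" "d \<in> Oh" "x = cl a" "y = cl b" "z = cl d" by (auto simp: Q_carrier)
 obtain c where c: "c \<in> hadd H a b" "c \<in> Oh" "x \<oplus>\<^bsub>Q\<^esub> y = cl c" using Q_add_ex[OF ab(1,2)] ab by metis
 have "c \<otimes> d \<in> hadd H (a \<otimes> d) (b \<otimes> d)" using hadd_mult c ab Oh_carrier by blast
 then show "(x \<oplus>\<^bsub>Q\<^esub> y) \<otimes>\<^bsub>Q\<^esub> z = x \<otimes>\<^bsub>Q\<^esub> z \<oplus>\<^bsub>Q\<^esub> y \<otimes>\<^bsub>Q\<^esub> z"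
  using c ab Q_mult Q_add Oh_mult by simp
qed

lemma Q_pow: "a \<in> Oh ==> cl a [^]\<^bsub>Q\<^esub> (k::nat) = cl (a [^] k)"
 by (induction k) (auto simp: nat_pow_def Q_one Q_mult Oh_pow simp flip: nat_pow_def)

lemma cl_zero_iff: "a \<in> Oh ==> cl a = \<zero>\<^bsub>Q\<^esub> \<longleftrightarrow> val H a \<ge> ereal \<eta>"
 unfolding Q_zero using cl_eq_iff[of a "hzero H"] near_zero Oh_carrier by auto

lemma Q_minus: assumes "a \<in> Oh" "b \<in> Oh" "c \<in> hsub H a b" shows "cl a \<ominus>\<^bsub>Q\<^esub> cl b = cl c"
proof -
 interpret Q: cring Q by (rule Q_cring)
 have "c \<in> Oh" using Oh_hadd[of c a "hneg H b"] assms Oh_hneg unfolding hsub_def by blast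
 moreover have "a \<in> hadd H c b" using assms in_hsub_iff[of c a b] Oh_carrier calculation by blast
 ultimately have "cl a = cl c \<oplus>\<^bsub>Q\<^esub> cl b" using Q_add assms by simp
 then have "cl a \<ominus>\<^bsub>Q\<^esub> cl b = cl c \<oplus>\<^bsub>Q\<^esub> (cl b \<ominus>\<^bsub>Q\<^esub> cl b)"
  using cl_in_Q assms \<open>c \<in> Oh\<close> by (simp add: Q.minus_eq Q.a_assoc)
 then show ?thesis using cl_in_Q assms \<open>c \<in> Oh\<close> by simp
qed

lemma Q_unit: assumes "a \<in> carrier H" "val H a = 0" shows "cl a \<in> Units Q"
proof -
 interpret Q: cring Q by (rule Q_cring)
 have "a ~= hzero H" using assms by auto
 then obtain b where b: "b \<in> carrier H" "b ~= hzero H" "a \<otimes> b = \<one>" using nonzero_inverse assms by blast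
 have "val H a + val H b = 0" using b val_mult[of a b] assms by simp
 then have "b \<in> Oh" using assms b by (simp add: Oh_iff)
 moreover have "a \<in> Oh" using assms by (simp add: Oh_iff)
 ultimately have ab: "cl b \<in> carrier Q" "cl a \<in> carrier Q" "cl a \<otimes>\<^bsub>Q\<^esub> cl b = \<one>\<^bsub>Q\<^esub>"
  using b by (auto simp: cl_in_Q Q_mult Q_one)
 moreover have "cl b \<otimes>\<^bsub>Q\<^esub> cl a = \<one>\<^bsub>Q\<^esub>" using Q.m_comm[OF ab(1,2)] ab(3) by simp
 ultimately show ?thesis unfolding Units_def by blast
qed

end

text \<open>A representative that serves for all radii links the image of \<open>p\<close> in the truncated ring with its image in
the residue field.\<close>

lemma nat_elem_rep: "\<exists>x \<in> Oh. \<forall>\<eta>. 0 < \<eta> & \<eta> \<le> rho H --> nat_elem (hquot H \<eta>) k = hclass H \<eta> x"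
proof (induction k)
 case 0 show ?case by (intro bexI[of _ "hzero H"]) (auto simp: nat_elem_0 Q_zero)
next
 case (Suc k)
 then obtain x where x: "x \<in> Oh" "!!\<eta>. 0 < \<eta> & \<eta> \<le> rho H ==> nat_elem (hquot H \<eta>) k = hclass H \<eta> x" by blast
 obtain y where y: "y \<in> hadd H x \<one>" using hadd_nonempty[of x \<one>] x Oh_carrier by auto
 have "y \<in> Oh" using Oh_hadd y x by blast
 then show ?case using x y by (intro bexI[of _ y]) (auto simp: nat_elem_Suc Q_one Q_add)
qed

end

lemma (in cring) idealI':
 assumes "I \<subseteq> carrier R" "\<zero> \<in> I" "!!a b. [|a \<in> I; b \<in> I|] ==> a \<oplus> b \<in> I"
  "!!a x. [|a \<in> I; x \<in> carrier R|] ==> x \<otimes> a \<in> I"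
 shows "ideal I R"
proof (rule idealI[OF ring_axioms])
 show "subgroup I (add_monoid R)"
 proof (rule add.subgroupI)
  fix a assume a: "a \<in> I"
  have "\<ominus> \<one> \<otimes> a \<in> I" using assms(4)[OF a] by simp
  then show "\<ominus> a \<in> I" using a assms(1) by (simp add: l_minus subset_iff)
 qed (use assms in auto)
qed (use assms m_comm in \<open>auto simp: subset_iff\<close>)

context discrete_valued_hyperfield begin

lemma vg_iff: "r \<in> value_group H \<longleftrightarrow> (\<exists>a \<in> carrier H. a ~= hzero H & val H a = ereal r)"
 by (auto simp: value_group_def)

lemma vg_zero: "0 \<in> value_group H" unfolding vg_iff by (intro bexI[of _ \<one>]) (auto simp: zero_ereal_def)

lemma vg_add: assumes "r \<in> value_group H" "s \<in> value_group H" shows "r + s \<in> value_group H"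
proof -
 obtain a b where "a \<in> carrier H" "b \<in> carrier H" "a ~= hzero H" "b ~= hzero H" "val H a = ereal r" "val H b = ereal s"
  using assms vg_iff by blast
 then show ?thesis unfolding vg_iff by (intro bexI[of _ "a \<otimes> b"]) (auto simp: val_mult mult_eq_zero_iff)
qed

lemma val_inverse:
 assumes "a \<in> carrier H" "b \<in> carrier H" "a \<otimes> b = \<one>" "val H a = ereal r" shows "val H b = ereal (- r)"
proof -
 have "val H a + val H b = 0" using val_mult[of a b] assms by simp
 then show ?thesis using assms by (cases "val H b") (auto simp: zero_ereal_def)
qed

lemma vg_neg: assumes "r \<in> value_group H" shows "- r \<in> value_group H"
proof -
 obtain a where a: "a \<in> carrier H" "a ~= hzero H" "val H a = ereal r" using assms vg_iff by blast
 obtain b where "b \<in> carrier H" "b ~= hzero H" "a \<otimes> b = \<one>" using nonzero_inverse a by blast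
 then show ?thesis using val_inverse a vg_iff by blast
qed

lemma vg_of_int: assumes "r \<in> value_group H" shows "of_int k * r \<in> value_group H"
proof -
 have nat: "real m * r \<in> value_group H" for m
  by (induction m) (use vg_zero vg_add assms in \<open>auto simp: algebra_simps\<close>)
 show ?thesis
 proof (cases "k \<ge> 0")
  case True then show ?thesis using nat[of "nat k"] by simp
 next
  case False
  then show ?thesis using vg_neg[OF nat[of "nat (- k)"]] by simp
 qed
qed

text \<open>A nontrivial discrete subgroup of the reals has a least positive element, and consists
 of its integral multiples.\<close>

lemma theta_least: "theta H \<in> value_group H" "theta H > 0" "!!r. [|r \<in> value_group H; r > 0|] ==> theta H \<le> r"
proof -
 obtain d where d: "d > 0" "!!y. y \<in> value_group H ==> dist 0 y < d ==> y = 0"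
  using isolated_inE_dist[OF discreteD[OF value_group_discrete vg_zero]] by blast
 obtain x where x: "x \<in> value_group H" "x ~= 0" using value_group_nontrivial vg_zero by blast
 define g where "g = \<bar>x\<bar>"
 have g: "g \<in> value_group H" "g > 0" using x vg_neg[of x] by (auto simp: g_def abs_if)
 define A where "A = {r \<in> value_group H. 0 < r & r \<le> g}"
 have sep: "r = s" if "r \<in> value_group H" "s \<in> value_group H" "\<bar>r - s\<bar> < d" for r s
  using d(2)[of "r - s"] vg_add[OF that(1) vg_neg[OF that(2)]] that(3) by (simp add: dist_real_def)
 have "inj_on (%r. \<lfloor>r / d\<rfloor>) A"
 proof (rule inj_onI)
  fix r s assume rs: "r \<in> A" "s \<in> A" "\<lfloor>r / d\<rfloor> = \<lfloor>s / d\<rfloor>"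
  have "\<bar>r / d - s / d\<bar> < 1" using rs(3) by linarith
  then have "\<bar>r - s\<bar> < d" using d(1) by (simp add: field_simps abs_if split: if_splits)
  then show "r = s" using sep rs by (auto simp: A_def)
 qed
 moreover have "(%r. \<lfloor>r / d\<rfloor>) ` A \<subseteq> {0..\<lfloor>g / d\<rfloor>}"
  using d(1) by (auto simp: A_def intro!: floor_mono divide_right_mono)
 ultimately have fin: "finite A" by (meson finite_atLeastAtMost_int finite_imageD finite_subset)
 have ne: "A ~= {}" using g by (auto simp: A_def)
 define m where "m = Min A"
 have m: "m \<in> A" "!!r. r \<in> A ==> m \<le> r" using fin ne by (auto simp: m_def)
 have min: "m \<le> r" if "r \<in> value_group H" "r > 0" for r
  using that m by (cases "r \<le> g") (auto simp: A_def)
 have "theta H = m" unfolding theta_def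
  by (rule Least_equality) (use m min in \<open>auto simp: A_def\<close>)
 then show "theta H \<in> value_group H" "theta H > 0" "!!r. [|r \<in> value_group H; r > 0|] ==> theta H \<le> r"
  using m min by (auto simp: A_def)
qed

lemma value_group_eq: "value_group H = range (%k::int. of_int k * theta H)"
proof (intro equalityI subsetI)
 fix r assume r: "r \<in> value_group H"
 define k where "k = \<lfloor>r / theta H\<rfloor>"
 define s where "s = r - of_int k * theta H"
 have s: "s \<in> value_group H" using vg_add[OF r vg_neg[OF vg_of_int[OF theta_least(1), of k]]] by (simp add: s_def)
 have "of_int k \<le> r / theta H" "r / theta H < of_int k + 1" unfolding k_def by linarith+
 then have "0 \<le> s" "s < theta H" using theta_least(2) by (auto simp: s_def field_simps)
 then have "s = 0" using theta_least(3)[OF s] by linarith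
 then show "r \<in> range (%k::int. of_int k * theta H)" by (auto simp: s_def)
qed (use vg_of_int theta_least in auto)

end

lemma (in discrete_valued_hyperfield) near_infinity:
 "[|a \<in> carrier H; b \<in> carrier H|] ==> near \<infinity> a b \<longleftrightarrow> a = b"
 unfolding near_def using zero_in_hsub_iff[of a b] hsub_closed[of a b] val_eq_PInf by auto

locale normalized_hyperfield = discrete_valued_hyperfield H
 for H :: "('a, 'b) valued_hyperfield_scheme" (structure) +
 fixes e n :: nat
 assumes e_pos: "e \<ge> 1" and normalized: "normalized H e" and len: "has_length H n"
begin

definition E :: "nat => ereal" where "E k = ereal (real k / real e)"

lemma n_pos: "n \<ge> 1" using len by (simp add: has_length_def)
lemma theta_E: "ereal (theta H) = E 1" using normalized by (simp add: E_def normalized_def)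
lemma rho_eq: "rho H = real n / real e" using normalized len by (simp add: normalized_def has_length_def)
lemma rho_E: "ereal (rho H) = E n" by (simp add: E_def rho_eq)
lemma rho_pos: "rho H > 0" using rho_eq n_pos e_pos by simp
lemma theta_le_rho: "theta H \<le> rho H" using normalized n_pos e_pos by (simp add: rho_eq normalized_def divide_right_mono)
lemma E_add: "E i + E j = E (i + j)" by (simp add: E_def add_divide_distrib)
lemma E_le: "E i \<le> E j \<longleftrightarrow> i \<le> j" using e_pos by (simp add: E_def divide_le_cancel)
lemma E_zero [simp]: "E 0 = 0" by (simp add: E_def zero_ereal_def)
lemma E_nonneg [simp]: "0 \<le> E k" using E_le[of 0 k] by simp

lemma val_int: assumes "a \<in> carrier H" "a ~= hzero H" shows "\<exists>k::int. val H a = ereal (of_int k / real e)"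
 using val_real[OF assms] normalized by (auto simp: value_group_eq normalized_def)

lemma val_Oh: assumes "a \<in> Oh" "a ~= hzero H" shows "\<exists>k. val H a = E k"
proof -
 obtain k :: int where k: "val H a = ereal (of_int k / real e)" using val_int assms Oh_carrier by blast
 then have "0 \<le> of_int k / real e" using assms Oh_iff by (simp add: zero_ereal_def)
 then have "k \<ge> 0" using e_pos by (simp add: zero_le_divide_iff)
 then show ?thesis using k by (intro exI[of _ "nat k"]) (simp add: E_def)
qed

lemma uniformizer_exists: "\<exists>u \<in> carrier H. val H u = E 1"
 using theta_least(1) theta_E vg_iff by metis

lemma not_E1: "a \<in> Oh ==> \<not> E 1 \<le> val H a ==> val H a = 0"
 using val_Oh[of a] by (cases "a = hzero H") (auto simp: E_le not_less_eq_eq)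

lemma near_rho_eq: "[|a \<in> carrier H; val H a = 0; b \<in> carrier H; near (E n) a b|] ==> a = b"
 using near_imp_eq[of a b] rho_pos rho_E by simp

lemma divide_exists:
 assumes "a \<in> carrier H" "u \<in> carrier H" "val H u = E k" "val H a \<ge> E (k + m)"
 shows "\<exists>b \<in> carrier H. a = u \<otimes> b & val H b \<ge> E m"
proof -
 have "u ~= hzero H" using assms by (auto simp: E_def)
 then obtain v where v: "v \<in> carrier H" "u \<otimes> v = \<one>" using nonzero_inverse assms by blast
 have "val H v = ereal (- (real k / real e))" using val_inverse[OF assms(2) v] assms(3) by (simp add: E_def)
 then have "val H (v \<otimes> a) \<ge> E m" using assms v
  by (cases "val H a") (auto simp: val_mult E_def add_divide_distrib)
 moreover have "u \<otimes> (v \<otimes> a) = a" using v assms by (simp flip: m_assoc)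
 ultimately show ?thesis using v assms by (intro bexI[of _ "v \<otimes> a"]) auto
qed

abbreviation cr where "cr \<equiv> hclass H (rho H)"
abbreviation Rh where "Rh \<equiv> trunc_ring H"

lemma Rh_def': "Rh = hquot H (rho H)" by (simp add: trunc_ring_def)

definition Fh :: "nat => 'a set set" where "Fh k = cr ` {a \<in> Oh. val H a \<ge> E k}"

lemmas rho_facts = rho_pos order_refl[of "rho H"]
lemmas Rh_cring = Q_cring[OF rho_facts, folded Rh_def']
lemmas Rh_carrier = Q_carrier[OF rho_facts, folded Rh_def']
lemmas Rh_mult = Q_mult[OF rho_facts, folded Rh_def']
lemmas Rh_add = Q_add[OF rho_facts, folded Rh_def']
lemmas Rh_one = Q_one[OF rho_facts, folded Rh_def']
lemmas Rh_zero = Q_zero[OF rho_facts, folded Rh_def']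
lemmas Rh_pow = Q_pow[OF rho_facts, folded Rh_def']
lemmas Rh_minus = Q_minus[OF rho_facts, folded Rh_def']
lemmas Rh_unit = Q_unit[OF rho_facts, folded Rh_def']
lemmas cr_zero_iff = cl_zero_iff[OF rho_facts, folded Rh_def', unfolded rho_E]
lemmas cr_eq_iff = cl_eq_iff[OF rho_facts, unfolded rho_E]

lemma cr_in_Fh_iff: "[|a \<in> Oh; k \<le> n|] ==> cr a \<in> Fh k \<longleftrightarrow> val H a \<ge> E k"
proof
 assume a: "a \<in> Oh" and k: "k \<le> n" and "cr a \<in> Fh k"
 then obtain b where b: "b \<in> Oh" "val H b \<ge> E k" "cr a = cr b" unfolding Fh_def by blast
 then have "near (E k) a b" using cr_eq_iff a near_mono k E_le by blast
 then show "val H a \<ge> E k" using near_val a b Oh_carrier by blast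
qed (auto simp: Fh_def)

lemma Fh_large: "n \<le> k ==> Fh k = {\<zero>\<^bsub>Rh\<^esub>}"
proof (intro equalityI subsetI)
 fix x assume k: "n \<le> k" and "x \<in> Fh k"
 then obtain a where a: "a \<in> Oh" "val H a \<ge> E k" "x = cr a" unfolding Fh_def by blast
 then have "val H a \<ge> E n" using k E_le order_trans by blast
 then show "x \<in> {\<zero>\<^bsub>Rh\<^esub>}" using cr_zero_iff a by simp
qed (auto simp: Fh_def Rh_zero)

lemma Fh_ideal: "ideal (Fh k) Rh"
proof -
 interpret Q: cring Rh by (rule Rh_cring)
 show ?thesis
 proof (rule Q.idealI')
  show "Fh k \<subseteq> carrier Rh" unfolding Fh_def Rh_carrier by blast
  show "\<zero>\<^bsub>Rh\<^esub> \<in> Fh k" unfolding Fh_def Rh_zero by auto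
  fix x y assume "x \<in> Fh k"
  then obtain a where a: "a \<in> Oh" "val H a \<ge> E k" "x = cr a" unfolding Fh_def by blast
  { assume "y \<in> Fh k"
   then obtain b where b: "b \<in> Oh" "val H b \<ge> E k" "y = cr b" unfolding Fh_def by blast
   obtain c where c: "c \<in> hadd H a b" using hadd_nonempty a b Oh_carrier by blast
   have "val H c \<ge> min (val H a) (val H b)" using val_hadd_ge c a b Oh_carrier by blast
   then have "val H c \<ge> E k" using a b by (metis min.bounded_iff order_trans)
   moreover have "c \<in> Oh" using Oh_hadd a b c by blast
   ultimately show "x \<oplus>\<^bsub>Rh\<^esub> y \<in> Fh k" using Rh_add a b c unfolding Fh_def by auto }
  { assume "y \<in> carrier Rh"
   then obtain b where b: "b \<in> Oh" "y = cr b" by (auto simp: Rh_carrier)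
   have "val H (b \<otimes> a) \<ge> 0 + E k" using a b Oh_iff by (simp add: val_mult add_mono del: add_0_left)
   then show "y \<otimes>\<^bsub>Rh\<^esub> x \<in> Fh k" using Rh_mult a b Oh_mult unfolding Fh_def by auto }
 qed
qed

lemma Fh_Suc: "Fh (Suc k) \<subseteq> Fh k"
 unfolding Fh_def using E_le[of k "Suc k"] by (auto intro: order_trans)

lemma Fh_zero: "Fh 0 = carrier Rh" unfolding Fh_def Rh_carrier using Oh_iff by auto

lemma Fh_mult: assumes "x \<in> Fh i" "y \<in> Fh j" shows "x \<otimes>\<^bsub>Rh\<^esub> y \<in> Fh (i + j)"
proof -
 obtain a b where a: "a \<in> Oh" "val H a \<ge> E i" "x = cr a" and b: "b \<in> Oh" "val H b \<ge> E j" "y = cr b"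
  using assms unfolding Fh_def by blast
 have "val H (a \<otimes> b) \<ge> E (i + j)" using a b Oh_carrier by (simp add: val_mult add_mono flip: E_add)
 then show ?thesis using Rh_mult a b Oh_mult unfolding Fh_def by auto
qed

lemma Rh_filtered: "filtered_ring Rh Fh"
proof -
 interpret Q: cring Rh by (rule Rh_cring)
 have mono: "Fh j \<subseteq> Fh i" if "i \<le> j" for i j using lift_Suc_antimono_le[of Fh, OF Fh_Suc that] .
 show ?thesis
 proof (intro filtered_ring.intro filtered_ring_axioms.intro Rh_cring)
  fix s :: "nat => 'a set" assume s: "!!i. s i \<in> carrier Rh" "!!i. s (Suc i) \<ominus>\<^bsub>Rh\<^esub> s i \<in> Fh i"
  have st: "s (i + d) \<ominus>\<^bsub>Rh\<^esub> s i \<in> Fh i" for i d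
  proof (induction d)
   case 0
   have "\<zero>\<^bsub>Rh\<^esub> \<in> Fh i" by (auto simp: Fh_def Rh_zero)
   then show ?case using s by (simp add: Q.minus_eq Q.r_neg)
  next
   case (Suc d)
   have "s (Suc (i + d)) \<ominus>\<^bsub>Rh\<^esub> s (i + d) \<in> Fh i" using s mono[of i "i + d"] by auto
   then have "(s (Suc (i + d)) \<ominus>\<^bsub>Rh\<^esub> s (i + d)) \<oplus>\<^bsub>Rh\<^esub> (s (i + d) \<ominus>\<^bsub>Rh\<^esub> s i) \<in> Fh i"
    using Suc additive_subgroup.a_closed[OF ideal.axioms(1)[OF Fh_ideal]] by blast
   moreover have "(s (Suc (i + d)) \<ominus>\<^bsub>Rh\<^esub> s (i + d)) \<oplus>\<^bsub>Rh\<^esub> (s (i + d) \<ominus>\<^bsub>Rh\<^esub> s i) = s (Suc (i + d)) \<ominus>\<^bsub>Rh\<^esub> s i"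
   proof -
    define x y z where "x = s (Suc (i + d))" "y = s (i + d)" "z = s i"
    have "x \<in> carrier Rh" "y \<in> carrier Rh" "z \<in> carrier Rh" using s by (auto simp: x_y_z_def)
    then show ?thesis unfolding x_y_z_def[symmetric] by algebra
   qed
   ultimately show ?case by simp
  qed
  show "\<exists>L\<in>carrier Rh. \<forall>i. L \<ominus>\<^bsub>Rh\<^esub> s i \<in> Fh i"
  proof (intro bexI[of _ "s n"] allI s)
   fix i
   show "s n \<ominus>\<^bsub>Rh\<^esub> s i \<in> Fh i"
   proof (cases "i \<le> n")
    case True then show ?thesis using st[of i "n - i"] by simp
   next
    case False
    have "s (n + (i - n)) \<ominus>\<^bsub>Rh\<^esub> s n \<in> Fh n" by (rule st)
    then have "s i = s n" using False Fh_large[of n] s by simp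
    then show ?thesis using s Fh_large[of i] False by simp
   qed
  qed
 next
  fix x assume "!!k. x \<in> Fh k" then show "x = \<zero>\<^bsub>Rh\<^esub>" using Fh_large[of n] by blast
 qed (use Fh_ideal Fh_zero Fh_Suc Fh_mult in auto)
qed

lemma nat_elem_p_rep:
 "\<exists>x \<in> Oh. nat_elem Rh k = cr x & nat_elem (res_field H) k = hclass H (theta H) x"
 using nat_elem_rep[of k] rho_pos theta_le_rho theta_least(2) unfolding trunc_ring_def res_field_def by blast

lemma Rh_perfect_residue:
 assumes p: "Factorial_Ring.prime p" "ring_char (res_field H) = p" "perfect_field (res_field H)"
 shows "perfect_residue_ring Rh Fh p"
proof -
 interpret Q: filtered_ring Rh Fh by (rule Rh_filtered)
 note th = theta_least(2) theta_le_rho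
 interpret k: cring "res_field H" using Q_cring[OF th] by (simp add: res_field_def)
 have p0: "p > 0" using p(1) prime_gt_0_nat by blast
 have np: "nat_elem (res_field H) p = \<zero>\<^bsub>res_field H\<^esub>"
 proof -
  let ?P = "%k. k > 0 & nat_elem (res_field H) k = \<zero>\<^bsub>res_field H\<^esub>"
  have "\<exists>k. ?P k" using p(2) p0 unfolding ring_char_def by (auto split: if_splits)
  then have "?P (LEAST k. ?P k)" by (rule LeastI_ex)
  then show ?thesis using p(2) \<open>\<exists>k. ?P k\<close> unfolding ring_char_def by (auto split: if_splits)
 qed
 show ?thesis
 proof (unfold_locales)
  show "Factorial_Ring.prime p" by (rule p)
  obtain x where x: "x \<in> Oh" "nat_elem Rh p = cr x" "nat_elem (res_field H) p = hclass H (theta H) x"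
   using nat_elem_p_rep by blast
  then have "val H x \<ge> E 1" using np cl_zero_iff[OF th x(1)] theta_E by (simp add: res_field_def)
  then show "nat_elem Rh p \<in> Fh 1" using x by (auto simp: Fh_def)
  show "\<one>\<^bsub>Rh\<^esub> \<notin> Fh 1" using cr_in_Fh_iff[of \<one> 1] n_pos E_le[of 1 0] by (auto simp: Rh_one)
 next
  fix x assume "x \<in> carrier Rh" "x \<notin> Fh 1"
  then obtain a where a: "a \<in> Oh" "x = cr a" "\<not> E 1 \<le> val H a" using cr_in_Fh_iff[of _ 1] n_pos by (auto simp: Rh_carrier)
  then show "x \<in> Units Rh" using not_E1 Rh_unit Oh_carrier by blast
 next
  fix x assume "x \<in> carrier Rh"
  then obtain a where a: "a \<in> Oh" "x = cr a" by (auto simp: Rh_carrier)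
  have "hclass H (theta H) a \<in> carrier (res_field H)" using cl_in_Q[OF th a(1)] by (simp add: res_field_def)
  then obtain y where y: "y \<in> carrier (res_field H)" "y [^]\<^bsub>res_field H\<^esub> p = hclass H (theta H) a"
   using p p0 unfolding perfect_field_def by auto
  then obtain b where b: "b \<in> Oh" "y = hclass H (theta H) b" using Q_carrier[OF th] by (auto simp: res_field_def)
  have "hclass H (theta H) a = hclass H (theta H) (b [^] p)" using y b Q_pow[OF th b(1), of p] by (simp add: res_field_def)
  then have "near (E 1) a (b [^] p)" using cl_eq_iff[OF th a(1)] Oh_pow[OF b(1)] theta_E by simp
  then obtain d where d: "d \<in> hsub H a (b [^] p)" "val H d \<ge> E 1" unfolding near_def by blast
  have "x \<ominus>\<^bsub>Rh\<^esub> (cr b) [^]\<^bsub>Rh\<^esub> p = cr d" using Rh_minus[OF a(1) Oh_pow[OF b(1)] d(1)] a Rh_pow b by simp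
  moreover have "d \<in> Oh"
   using hsub_closed[OF Oh_carrier[OF a(1)] Oh_carrier[OF Oh_pow[OF b(1)]] d(1)] order_trans[OF E_nonneg d(2)] by (simp add: Oh_iff)
  ultimately have "x \<ominus>\<^bsub>Rh\<^esub> (cr b) [^]\<^bsub>Rh\<^esub> p \<in> Fh 1" using d by (auto simp: Fh_def)
  then show "\<exists>y\<in>carrier Rh. x \<ominus>\<^bsub>Rh\<^esub> y [^]\<^bsub>Rh\<^esub> p \<in> Fh 1" using b by (intro bexI[of _ "cr b"]) (auto simp: Rh_carrier)
 qed
qed

lemma Fh_PIdl: assumes u: "u \<in> carrier H" "val H u = E 1" shows "Fh k = PIdl\<^bsub>Rh\<^esub> (cr u [^]\<^bsub>Rh\<^esub> k)"
proof -
 have uO: "u \<in> Oh" using u E_nonneg[of 1] by (simp add: Oh_iff)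
 have vk: "val H (u [^] k) = E k" using val_pow[OF u(1), of "1 / real e" k] u(2) by (simp add: E_def)
 show ?thesis
 proof (intro equalityI subsetI)
  fix x assume "x \<in> Fh k"
  then obtain a where a: "a \<in> Oh" "val H a \<ge> E k" "x = cr a" unfolding Fh_def by blast
  obtain b where b: "b \<in> carrier H" "a = u [^] k \<otimes> b" "val H b \<ge> E 0"
   using divide_exists[OF Oh_carrier[OF a(1)] Oh_carrier[OF Oh_pow[OF uO]] vk, of 0] a(2) by auto
  have bO: "b \<in> Oh" using b by (simp add: Oh_iff)
  have "x = cr b \<otimes>\<^bsub>Rh\<^esub> cr (u [^] k)" using a b bO Rh_mult[OF bO Oh_pow[OF uO]] m_comm u(1) by simp
  then show "x \<in> PIdl\<^bsub>Rh\<^esub> (cr u [^]\<^bsub>Rh\<^esub> k)" using bO Rh_pow[OF uO] unfolding cgenideal_def Rh_carrier by auto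
 next
  fix x assume "x \<in> PIdl\<^bsub>Rh\<^esub> (cr u [^]\<^bsub>Rh\<^esub> k)"
  then obtain b where b: "b \<in> Oh" "x = cr b \<otimes>\<^bsub>Rh\<^esub> cr (u [^] k)" using Rh_pow[OF uO] unfolding cgenideal_def Rh_carrier by auto
  moreover have "cr (u [^] k) \<in> Fh k" using vk Oh_pow[OF uO] by (auto simp: Fh_def)
  ultimately show "x \<in> Fh k" using ideal.I_l_closed[OF Fh_ideal] by (auto simp: Rh_carrier)
 qed
qed

lemma Rh_max_ideal: "max_ideal Rh = Fh 1" and Rh_ideal_pow: "ideal_pow Rh (max_ideal Rh) k = Fh k"
proof -
 interpret Q: cring Rh by (rule Rh_cring)
 show m: "max_ideal Rh = Fh 1"
 proof (rule Q.local_ringI(3)[OF Fh_ideal])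
  show "\<one>\<^bsub>Rh\<^esub> \<notin> Fh 1" using cr_in_Fh_iff[of \<one> 1] n_pos E_le[of 1 0] by (auto simp: Rh_one)
  fix x assume "x \<in> carrier Rh" "x \<notin> Fh 1"
  then obtain a where a: "a \<in> Oh" "x = cr a" "\<not> E 1 \<le> val H a" using cr_in_Fh_iff[of _ 1] n_pos by (auto simp: Rh_carrier)
  then show "x \<in> Units Rh" using not_E1 Rh_unit Oh_carrier by blast
 qed
 obtain u where u: "u \<in> carrier H" "val H u = E 1" using uniformizer_exists by blast
 have uO: "u \<in> Oh" using u E_nonneg[of 1] by (simp add: Oh_iff)
 have c: "cr u \<in> carrier Rh" using uO by (auto simp: Rh_carrier)
 show "ideal_pow Rh (max_ideal Rh) k = Fh k"
  using Q.ideal_pow_PIdl[OF c, of k] Fh_PIdl[OF u, of 1] Fh_PIdl[OF u, of k] m c by simp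
qed

lemma Rh_div:
 assumes u: "u \<in> carrier H" "val H u = E 1" and k: "Suc k \<le> n" and y: "y \<in> carrier Rh" "cr u \<otimes>\<^bsub>Rh\<^esub> y \<in> Fh (Suc k)"
 shows "y \<in> Fh k"
proof -
 have uO: "u \<in> Oh" using u E_nonneg[of 1] by (simp add: Oh_iff)
 obtain a where a: "a \<in> Oh" "y = cr a" using y by (auto simp: Rh_carrier)
 have "val H (u \<otimes> a) \<ge> E (Suc k)" using y a Rh_mult[OF uO a(1)] cr_in_Fh_iff[OF Oh_mult[OF uO a(1)] k] by simp
 then have "val H a \<ge> E k" using u a Oh_carrier[OF a(1)]
  by (cases "val H a") (auto simp: val_mult E_def add_divide_distrib)
 then show ?thesis using a by (auto simp: Fh_def)
qed

end

section \<open>Isometric homomorphisms\<close>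

locale isometric_hom = H1: normalized_hyperfield H1 e n + H2: normalized_hyperfield H2 e n
 for H1 :: "('a, 'b) valued_hyperfield_scheme" and H2 :: "('c, 'd) valued_hyperfield_scheme" and e n +
 fixes f assumes iso: "is_isometric_hom H1 H2 f"
begin

lemma f_closed: "a \<in> carrier H1 ==> f a \<in> carrier H2" using iso by (auto simp: is_isometric_hom_def)
lemma f_zero: "f (hzero H1) = hzero H2" and f_one: "f \<one>\<^bsub>H1\<^esub> = \<one>\<^bsub>H2\<^esub>"
 using iso by (auto simp: is_isometric_hom_def)
lemma f_mult: "[|a \<in> carrier H1; b \<in> carrier H1|] ==> f (a \<otimes>\<^bsub>H1\<^esub> b) = f a \<otimes>\<^bsub>H2\<^esub> f b"
 and f_val: "a \<in> carrier H1 ==> val H2 (f a) = val H1 a"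
 using iso by (auto simp: is_isometric_hom_def)

lemma f_preimage: "[|a \<in> carrier H1; b \<in> carrier H1|] ==>
  f -` hadd H2 (f a) (f b) \<inter> carrier H1 = hset_add H1 (f -` {f a} \<inter> carrier H1) (f -` {f b} \<inter> carrier H1)"
 using iso by (auto simp: is_isometric_hom_def)

lemma f_hadd: "[|a \<in> carrier H1; b \<in> carrier H1; c \<in> hadd H1 a b|] ==> f c \<in> hadd H2 (f a) (f b)"
 using f_preimage[of a b] unfolding hset_add_def by blast

lemma f_hneg: "a \<in> carrier H1 ==> f (hneg H1 a) = hneg H2 (f a)"
 using H2.hneg_unique[of "f a" "f (hneg H1 a)"] f_hadd[of a "hneg H1 a" "hzero H1"] H1.hneg[of a] f_closed f_zero by auto

lemma rho_same: "rho H1 = rho H2" using H1.rho_eq H2.rho_eq by simp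

lemma f_inj: "inj_on f (carrier H1)"
proof (rule inj_onI)
 fix a b assume ab: "a \<in> carrier H1" "b \<in> carrier H1" "f a = f b"
 obtain d where d: "d \<in> hsub H1 a b" using H1.hadd_nonempty[of a "hneg H1 b"] ab unfolding hsub_def by auto
 have dc: "d \<in> carrier H1" using d H1.hsub_closed ab by blast
 have "f d \<in> hsub H2 (f a) (f a)" using f_hadd[of a "hneg H1 b" d] d ab f_hneg unfolding hsub_def by auto
 then have "val H2 (f d) \<ge> ereal (rho H2) + val H2 (f a)" using H2.hsub_self_iff[of "f a" "f d"] f_closed ab dc by blast
 then have "H1.near (ereal (rho H1) + val H1 a) a b"
  using f_val[OF dc] f_val[OF ab(1)] d rho_same unfolding H1.near_def by auto
 then show "a = b" using H1.near_imp_eq[of a b] H1.rho_pos ab by simp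
qed

lemma f_hadd_iff: assumes "a \<in> carrier H1" "b \<in> carrier H1" "c \<in> carrier H1"
 shows "f c \<in> hadd H2 (f a) (f b) \<longleftrightarrow> c \<in> hadd H1 a b"
proof -
 have s: "f -` {f x} \<inter> carrier H1 = {x}" if "x \<in> carrier H1" for x using f_inj that by (auto dest: inj_onD)
 have "f -` hadd H2 (f a) (f b) \<inter> carrier H1 = hadd H1 a b"
  unfolding f_preimage[OF assms(1,2)] s[OF assms(1)] s[OF assms(2)] by (simp add: hset_add_def)
 then show ?thesis using assms(3) by blast
qed

end

lemma is_isometric_homI:
 assumes "discrete_valued_hyperfield H1" "value_group H1 = value_group H2"
  "!!a. a \<in> carrier H1 ==> f a \<in> carrier H2" "f (hzero H1) = hzero H2" "f \<one>\<^bsub>H1\<^esub> = \<one>\<^bsub>H2\<^esub>"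
  "!!a b. [|a \<in> carrier H1; b \<in> carrier H1|] ==> f (a \<otimes>\<^bsub>H1\<^esub> b) = f a \<otimes>\<^bsub>H2\<^esub> f b"
  "!!a. a \<in> carrier H1 ==> val H2 (f a) = val H1 a" and inj: "inj_on f (carrier H1)"
  and add: "!!a b c. [|a \<in> carrier H1; b \<in> carrier H1; c \<in> carrier H1|] ==> f c \<in> hadd H2 (f a) (f b) \<longleftrightarrow> c \<in> hadd H1 a b"
 shows "is_isometric_hom H1 H2 f"
proof -
 interpret H1: discrete_valued_hyperfield H1 by fact
 have s: "f -` {f x} \<inter> carrier H1 = {x}" if "x \<in> carrier H1" for x using inj that by (auto dest: inj_onD)
 have "f -` {\<one>\<^bsub>H2\<^esub>} \<inter> carrier H1 = closed_ball H1 \<one>\<^bsub>H1\<^esub> \<infinity>"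
  using s[of "\<one>\<^bsub>H1\<^esub>"] assms(5) H1.near_infinity by (auto simp: H1.closed_ball_eq)
 then have "\<exists>r. is_closed_ball H1 r (f -` {\<one>\<^bsub>H2\<^esub>} \<inter> carrier H1)" unfolding is_closed_ball_def by blast
 moreover have "f -` hadd H2 (f a) (f b) \<inter> carrier H1 = hset_add H1 (f -` {f a} \<inter> carrier H1) (f -` {f b} \<inter> carrier H1)"
  if "a \<in> carrier H1" "b \<in> carrier H1" for a b
  unfolding s[OF that(1)] s[OF that(2)] using add[OF that] H1.hadd_carrier that by (auto simp: hset_add_def)
 ultimately show ?thesis unfolding is_isometric_hom_def using assms by auto
qed

lemma HF_objectD:
 assumes "H \<in> HF_objects p e n" "e \<ge> 1"
 shows "normalized_hyperfield H e n"
 using assms by (simp add: HF_objects_def normalized_hyperfield_def normalized_hyperfield_axioms_def)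

lemma HF_objectI:
 assumes "discrete_valued_hyperfield H" "e \<ge> 1" "normalized H e" "has_length H n" "n > e"
  "ring_char (res_field H) = p" "perfect_field (res_field H)" "pelt_over H p e"
 shows "H \<in> HF_objects p e n"
proof -
 interpret normalized_hyperfield H e n
  using assms by (simp add: normalized_hyperfield_def normalized_hyperfield_axioms_def)
 obtain a u where a: "a \<in> carrier H" "u \<in> carrier H" "val H u = ereal (theta H)" "val H a = 0"
  "pelt H = a \<otimes>\<^bsub>H\<^esub> u [^]\<^bsub>H\<^esub> e" and P: "cr (pelt H) = nat_elem Rh p"
  using assms(8) unfolding pelt_over_def by blast
 have v: "val H (pelt H) = E e"
  using val_pow[OF a(2), of "1 / real e" e] a theta_E by (simp add: val_mult E_def)
 have PO: "pelt H \<in> Oh" using v a E_nonneg[of e] by (simp add: Oh_iff)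
 have "cr (pelt H) \<in> Fh e" "cr (pelt H) \<notin> Fh (e + 1)" "cr (pelt H) ~= \<zero>\<^bsub>Rh\<^esub>"
  using cr_in_Fh_iff[OF PO] cr_zero_iff[OF PO] v assms(5) by (auto simp: E_le)
 then have "mixed_char H p e" unfolding mixed_char_def Rh_ideal_pow using assms(6) P by auto
 then show ?thesis using assms by (simp add: HF_objects_def)
qed

lemma HF_hom_id: assumes H: "H \<in> HF_objects p e n" "e \<ge> 1" shows "restrict id (carrier H) \<in> HF_hom H H"
proof -
 interpret normalized_hyperfield H e n using HF_objectD H .
 have P: "pelt H \<in> carrier H" using H unfolding HF_objects_def pelt_over_def by auto
 have "is_isometric_hom H H (restrict id (carrier H))"
  by (rule is_isometric_homI) (auto intro: discrete_valued_hyperfield_axioms)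
 then show ?thesis using P by (simp add: HF_hom_def)
qed

lemma HF_hom_compose:
 assumes H: "H1 \<in> HF_objects p e n" "H2 \<in> HF_objects p e n" "H3 \<in> HF_objects p e n" "e \<ge> 1"
  and f: "f \<in> HF_hom H1 H2" and g: "g \<in> HF_hom H2 H3"
 shows "compose (carrier H1) g f \<in> HF_hom H1 H3"
proof -
 interpret f: isometric_hom H1 H2 e n f
  using HF_objectD[OF H(1,4)] HF_objectD[OF H(2,4)] f by (simp add: isometric_hom_def isometric_hom_axioms_def HF_hom_def)
 interpret g: isometric_hom H2 H3 e n g
  using HF_objectD[OF H(2,4)] HF_objectD[OF H(3,4)] g by (simp add: isometric_hom_def isometric_hom_axioms_def HF_hom_def)
 have P: "pelt H1 \<in> carrier H1" using H unfolding HF_objects_def pelt_over_def by auto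
 have "is_isometric_hom H1 H3 (compose (carrier H1) g f)"
 proof (rule is_isometric_homI)
  show "discrete_valued_hyperfield H1" by (rule f.H1.discrete_valued_hyperfield_axioms)
  show "value_group H1 = value_group H3" using f.iso g.iso by (simp add: is_isometric_hom_def)
  show "inj_on (compose (carrier H1) g f) (carrier H1)"
   using f.f_inj g.f_inj f.f_closed by (auto simp: inj_on_def compose_def)
  fix a b c assume "a \<in> carrier H1" "b \<in> carrier H1" "c \<in> carrier H1"
  then show "compose (carrier H1) g f c \<in> hadd H3 (compose (carrier H1) g f a) (compose (carrier H1) g f b) \<longleftrightarrow> c \<in> hadd H1 a b"
   by (simp add: compose_def f.f_closed g.f_hadd_iff f.f_hadd_iff)
 qed (auto simp: compose_def f.f_closed g.f_closed f.f_zero g.f_zero f.f_one g.f_one f.f_mult g.f_mult f.f_val g.f_val)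
 then show ?thesis using f g P by (auto simp: HF_hom_def compose_def)
qed

lemma compose_id_left: "f \<in> extensional A ==> f ` A \<subseteq> B ==> compose A (restrict id B) f = f"
 by (auto simp: compose_def extensional_def fun_eq_iff)
lemma compose_id_right: "f \<in> extensional A ==> compose A f (restrict id A) = f"
 by (auto simp: compose_def extensional_def fun_eq_iff)

lemma HF_hom_range: "f \<in> HF_hom H1 H2 ==> f ` carrier H1 \<subseteq> carrier H2"
 by (auto simp: HF_hom_def is_isometric_hom_def)

lemma HF_category: assumes "e \<ge> 1" shows "category (HF_cat p e n)"
proof
 fix X assume "X \<in> Obj (HF_cat p e n)"
 then show "Ident (HF_cat p e n) X \<in> Hom (HF_cat p e n) X X" using HF_hom_id assms by (simp add: HF_cat_def)
next
 fix X Y Z f g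
 assume "X \<in> Obj (HF_cat p e n)" "Y \<in> Obj (HF_cat p e n)" "Z \<in> Obj (HF_cat p e n)"
  "f \<in> Hom (HF_cat p e n) X Y" "g \<in> Hom (HF_cat p e n) Y Z"
 then show "Comp (HF_cat p e n) X Y Z g f \<in> Hom (HF_cat p e n) X Z"
  using HF_hom_compose[of X p e n Y Z] assms by (simp add: HF_cat_def)
next
 fix W X Y Z f g h
 assume "f \<in> Hom (HF_cat p e n) W X"
 then have "f ` carrier W \<subseteq> carrier X" using HF_hom_range[of f W X] by (simp add: HF_cat_def)
 then show "Comp (HF_cat p e n) W Y Z h (Comp (HF_cat p e n) W X Y g f) = Comp (HF_cat p e n) W X Z (Comp (HF_cat p e n) X Y Z h g) f"
  by (auto simp: HF_cat_def compose_def fun_eq_iff restrict_def)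
next
 fix X Y f assume "f \<in> Hom (HF_cat p e n) X Y"
 then have f: "f \<in> HF_hom X Y" by (simp add: HF_cat_def)
 then have "f \<in> extensional (carrier X)" by (simp add: HF_hom_def)
 then show "Comp (HF_cat p e n) X X Y f (Ident (HF_cat p e n) X) = f"
  "Comp (HF_cat p e n) X Y Y (Ident (HF_cat p e n) Y) f = f"
  using compose_id_left[OF _ HF_hom_range[OF f]] compose_id_right by (auto simp: HF_cat_def)
qed

lemma CDVR_hom_range: "f \<in> CDVR_hom R S ==> f ` carrier R \<subseteq> carrier S"
 by (auto simp: CDVR_hom_def dest: ring_hom_closed)

lemma CDVR_category: "category (CDVR_cat p e)"
proof
 fix X assume "X \<in> Obj (CDVR_cat p e)"
 then have "cring X" by (simp add: CDVR_cat_def CDVR_objects_def complete_discrete_valuation_ring_def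
   discrete_valuation_ring_def principal_domain_def domain_def)
 then interpret X: cring X .
 show "Ident (CDVR_cat p e) X \<in> Hom (CDVR_cat p e) X X"
  by (auto simp: CDVR_cat_def CDVR_hom_def intro!: ring_hom_memI)
next
 fix X Y Z f g
 assume XYZ: "X \<in> Obj (CDVR_cat p e)" "Y \<in> Obj (CDVR_cat p e)" "Z \<in> Obj (CDVR_cat p e)"
  "f \<in> Hom (CDVR_cat p e) X Y" "g \<in> Hom (CDVR_cat p e) Y Z"
 then have "cring X" by (simp add: CDVR_cat_def CDVR_objects_def complete_discrete_valuation_ring_def
   discrete_valuation_ring_def principal_domain_def domain_def)
 then interpret X: cring X .
 have f: "f \<in> CDVR_hom X Y" and g: "g \<in> CDVR_hom Y Z" using XYZ by (auto simp: CDVR_cat_def)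
 have fr: "f \<in> ring_hom X Y" and gr: "g \<in> ring_hom Y Z" using f g by (auto simp: CDVR_hom_def)
 have "compose (carrier X) g f \<in> ring_hom X Z"
  by (rule ring_hom_memI) (auto simp: compose_def ring_hom_closed[OF fr] ring_hom_closed[OF gr] ring_hom_mult[OF fr]
    ring_hom_mult[OF gr] ring_hom_add[OF fr] ring_hom_add[OF gr] ring_hom_one[OF fr] ring_hom_one[OF gr])
 moreover have "inj_on (compose (carrier X) g f) (carrier X)"
  using f g ring_hom_closed[OF fr] by (auto simp: CDVR_hom_def inj_on_def compose_def)
 ultimately show "Comp (CDVR_cat p e) X Y Z g f \<in> Hom (CDVR_cat p e) X Z"
  using f g ring_hom_closed[OF fr] by (auto simp: CDVR_cat_def CDVR_hom_def compose_def)
next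
 fix W X Y Z f g h
 assume "f \<in> Hom (CDVR_cat p e) W X"
 then have "f ` carrier W \<subseteq> carrier X" using CDVR_hom_range[of f W X] by (simp add: CDVR_cat_def)
 then show "Comp (CDVR_cat p e) W Y Z h (Comp (CDVR_cat p e) W X Y g f) = Comp (CDVR_cat p e) W X Z (Comp (CDVR_cat p e) X Y Z h g) f"
  by (auto simp: CDVR_cat_def compose_def fun_eq_iff restrict_def)
next
 fix X Y f assume "f \<in> Hom (CDVR_cat p e) X Y"
 then have f: "f \<in> CDVR_hom X Y" by (simp add: CDVR_cat_def)
 then have "f \<in> extensional (carrier X)" by (simp add: CDVR_hom_def)
 then show "Comp (CDVR_cat p e) X X Y f (Ident (CDVR_cat p e) X) = f"
  "Comp (CDVR_cat p e) X Y Y (Ident (CDVR_cat p e) Y) f = f"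
  using compose_id_left[OF _ CDVR_hom_range[OF f]] compose_id_right by (auto simp: CDVR_cat_def)
qed

section \<open>Complete discrete valuation rings\<close>

lemma (in cring) PIdl_zero: "PIdl \<zero> = {\<zero>}"
 using cgenideal_eq_genideal[of \<zero>] genideal_zero by simp

locale cdvr_object =
 fixes R :: "'u ring" (structure) and p e :: nat
 assumes R_obj: "R \<in> CDVR_objects p e" and prime_p: "Factorial_Ring.prime p" and e_pos: "e \<ge> 1"

sublocale cdvr_object \<subseteq> complete_discrete_valuation_ring R
 using R_obj by (simp add: CDVR_objects_def)

context cdvr_object begin

lemma R_facts: "ring_char R = 0" "ring_char (R Quot max_ideal R) = p" "perfect_field (R Quot max_ideal R)"
  "PIdl nat_elem R p = ideal_pow R (max_ideal R) e"
 using R_obj by (simp_all add: CDVR_objects_def)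

definition F :: "nat => 'u set" where "F k = ideal_pow R (max_ideal R) k"

lemma max_ideal_maximal: "maximalideal (max_ideal R) R"
 unfolding max_ideal_def using theI'[OF ex1_maximal] .

definition \<pi>0 where "\<pi>0 = (SOME a. a \<in> carrier R & max_ideal R = PIdl a)"

lemma pi0: "\<pi>0 \<in> carrier R" "max_ideal R = PIdl \<pi>0"
proof -
 have "\<exists>a. a \<in> carrier R & max_ideal R = PIdl a"
  using exists_gen[OF maximalideal.axioms(1)[OF max_ideal_maximal]] by blast
 from someI_ex[OF this] show "\<pi>0 \<in> carrier R" "max_ideal R = PIdl \<pi>0" by (auto simp: \<pi>0_def)
qed

lemma F_eq: "F k = PIdl (\<pi>0 [^] k)"
 unfolding F_def pi0(2) by (rule ideal_pow_PIdl[OF pi0(1)])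

lemma mem_F: "x \<in> F k \<longleftrightarrow> (\<exists>r \<in> carrier R. x = \<pi>0 [^] k \<otimes> r)"
 unfolding F_eq cgenideal_def using pi0(1) by (auto simp: m_comm)

lemma F_1: "F 1 = max_ideal R" unfolding F_eq pi0(2) using pi0(1) by simp

lemma pi0_nonzero: "\<pi>0 ~= \<zero>"
proof
 assume "\<pi>0 = \<zero>"
 then have "max_ideal R = {\<zero>}" unfolding pi0(2) using PIdl_zero by simp
 then have "field R" using zeromaximalideal_fieldI max_ideal_maximal by simp
 then show False using not_field by simp
qed

lemma pi0_pow_nonzero: "\<pi>0 [^] (k::nat) ~= \<zero>"
 by (induction k) (simp_all add: pi0(1) pi0_nonzero integral_iff)

lemma one_not_in: "\<one> \<notin> F 1"
proof
 assume "\<one> \<in> F 1"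
 then have "max_ideal R = carrier R"
  using ideal.one_imp_carrier[OF maximalideal.axioms(1)[OF max_ideal_maximal]] F_1 by simp
 then show False using maximalideal.I_notcarr[OF max_ideal_maximal] by simp
qed

lemma unit_if_not_in: assumes "x \<in> carrier R" "x \<notin> F 1" shows "x \<in> Units R"
proof (rule ccontr)
 assume u: "x \<notin> Units R"
 have "\<zero> \<in> F 1" unfolding mem_F using pi0(1) by (intro bexI[of _ \<zero>]) auto
 then have "x \<in> carrier R - {\<zero>}" using assms by auto
 then obtain b where b: "b \<in> carrier R" "ring_irreducible b" "b divides x"
  using exists_irreducible_divisor[of x] u by blast
 have "PIdl b = max_ideal R"
  using irreducible_imp_maximalideal[OF b(1,2)] ex1_maximal max_ideal_maximal by blast
 moreover obtain c where "c \<in> carrier R" "x = b \<otimes> c" using b(3) unfolding factor_def by blast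
 then have "x \<in> PIdl b" unfolding cgenideal_def using b(1) m_comm by blast
 ultimately show False using assms F_1 by simp
qed

lemma F_ideal': "ideal (F k) R" unfolding F_eq by (intro cgenideal_ideal) (use pi0 in auto)

lemma pi0_div: assumes "x \<in> carrier R" "\<pi>0 \<otimes> x \<in> F (Suc k)" shows "x \<in> F k"
proof -
 obtain r where r: "r \<in> carrier R" "\<pi>0 \<otimes> x = \<pi>0 [^] Suc k \<otimes> r" using assms mem_F by blast
 then have "\<pi>0 \<otimes> x = \<pi>0 \<otimes> (\<pi>0 [^] k \<otimes> r)" using pi0 assms by (simp add: m_ac)
 then have "x = \<pi>0 [^] k \<otimes> r" using m_lcancel[OF pi0_nonzero pi0(1)] assms r pi0 by simp
 then show ?thesis using r mem_F by blast
qed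

lemma F_separated': assumes x: "x \<in> carrier R" "!!k. x \<in> F k" shows "x = \<zero>"
proof -
 define J where "J = {y \<in> carrier R. \<forall>k. y \<in> F k}"
 have "ideal J R"
 proof (rule idealI')
  fix a b assume "a \<in> J" "b \<in> J"
  then show "a \<oplus> b \<in> J" unfolding J_def
   using additive_subgroup.a_closed[OF ideal.axioms(1)[OF F_ideal']] by auto
 next
  fix a b assume "a \<in> J" "b \<in> carrier R"
  then show "b \<otimes> a \<in> J" unfolding J_def using ideal.I_l_closed[OF F_ideal'] by auto
 qed (auto simp: J_def additive_subgroup.zero_closed[OF ideal.axioms(1)[OF F_ideal']])
 then obtain z where z: "z \<in> carrier R" "J = PIdl z" using exists_gen by blast
 have zJ: "z \<in> J" unfolding z(2) using cgenideal_self z(1) by simp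
 have "z \<in> F 1" using zJ by (simp add: J_def)
 then obtain z' where z': "z' \<in> carrier R" "z = \<pi>0 \<otimes> z'" using mem_F[of z 1] pi0(1) by auto
 have "z' \<in> J" unfolding J_def using z' zJ pi0_div[OF z'(1)] by (auto simp: J_def)
 then obtain r where r: "r \<in> carrier R" "z' = r \<otimes> z" unfolding z(2) cgenideal_def by blast
 have "(\<one> \<ominus> \<pi>0 \<otimes> r) \<otimes> z = z \<ominus> \<pi>0 \<otimes> (r \<otimes> z)"
 proof -
  have c: "\<pi>0 \<in> carrier R" "r \<in> carrier R" "z \<in> carrier R" using pi0 r z by auto
  have "(\<one> \<ominus> a \<otimes> b) \<otimes> d = d \<ominus> a \<otimes> (b \<otimes> d)" if a: "a \<in> carrier R" and b: "b \<in> carrier R" and d: "d \<in> carrier R" for a b d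
   by (use a b d in algebra)
  then show ?thesis using c by blast
 qed
 also have "\<dots> = \<zero>" unfolding r(2)[symmetric] z'(2)[symmetric] using z(1) by (simp add: minus_eq r_neg)
 finally have "(\<one> \<ominus> \<pi>0 \<otimes> r) = \<zero> \<or> z = \<zero>" using integral_iff pi0 r z by simp
 moreover have "\<one> \<ominus> \<pi>0 \<otimes> r ~= \<zero>"
 proof
  assume "\<one> \<ominus> \<pi>0 \<otimes> r = \<zero>"
  then have "\<one> = \<pi>0 \<otimes> r" using pi0 r by simp
  moreover have "\<pi>0 \<otimes> r \<in> F 1" unfolding mem_F using pi0(1) r(1) by (intro bexI[of _ r]) auto
  ultimately show False using one_not_in by metis
 qed
 ultimately have "z = \<zero>" by blast
 then have "J = {\<zero>}" unfolding z(2) using PIdl_zero by simp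
 then show ?thesis using x J_def by auto
qed

lemma filtered: "filtered_ring R F"
proof (intro filtered_ring.intro filtered_ring_axioms.intro is_cring)
 fix k show "ideal (F k) R" by (rule F_ideal')
 show "F (Suc k) \<subseteq> F k"
 proof
  fix x assume "x \<in> F (Suc k)"
  then obtain r where "r \<in> carrier R" "x = \<pi>0 [^] Suc k \<otimes> r" using mem_F by blast
  then show "x \<in> F k" unfolding mem_F using pi0(1) by (intro bexI[of _ "\<pi>0 \<otimes> r"]) (auto simp: m_assoc)
 qed
next
 show "F 0 = carrier R" by (auto simp: mem_F)
next
 fix a b i j assume "a \<in> F i" "b \<in> F j"
 then obtain r s where rs: "r \<in> carrier R" "s \<in> carrier R" "a = \<pi>0 [^] i \<otimes> r" "b = \<pi>0 [^] j \<otimes> s" using mem_F by auto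
 then have "a \<otimes> b = \<pi>0 [^] (i + j) \<otimes> (r \<otimes> s)" using pi0(1) by (simp add: nat_pow_mult[symmetric] m_ac)
 then show "a \<otimes> b \<in> F (i + j)" unfolding mem_F using rs by blast
next
 fix x assume "x \<in> carrier R" "!!k. x \<in> F k" then show "x = \<zero>" by (rule F_separated')
next
 fix s :: "nat => 'u" assume s: "!!i::nat. s i \<in> carrier R" "!!i::nat. s (Suc i) \<ominus> s i \<in> F i"
 have Fs: "a \<oplus> b \<in> F k" if "a \<in> F k" "b \<in> F k" for a b k
  using additive_subgroup.a_closed[OF ideal.axioms(1)[OF F_ideal']] that by blast
 have Fn: "\<ominus> a \<in> F k" if "a \<in> F k" for a k
  using additive_subgroup.a_inv_closed[OF ideal.axioms(1)[OF F_ideal']] that by blast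
 have Fz: "\<zero> \<in> F k" for k using additive_subgroup.zero_closed[OF ideal.axioms(1)[OF F_ideal']] .
 have dec: "F (k + d) \<subseteq> F k" for k d
 proof
  fix x assume "x \<in> F (k + d)"
  then obtain r where "r \<in> carrier R" "x = \<pi>0 [^] (k + d) \<otimes> r" using mem_F by blast
  then show "x \<in> F k" unfolding mem_F using pi0(1)
   by (intro bexI[of _ "\<pi>0 [^] d \<otimes> r"]) (auto simp: m_assoc simp flip: nat_pow_mult)
 qed
 have tr: "x \<ominus> z \<in> F k" if "x \<ominus> y \<in> F k" "y \<ominus> z \<in> F k" and x: "x \<in> carrier R" and y: "y \<in> carrier R" and z: "z \<in> carrier R" for x y z k
 proof -
  have "(x \<ominus> y) \<oplus> (y \<ominus> z) = x \<ominus> z" by (use x y z in algebra)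
  then show ?thesis using Fs[OF that(1,2)] by simp
 qed
 have st: "s (i + d) \<ominus> s i \<in> F i" for i :: nat and d :: nat
 proof (induction d)
  case 0 then show ?case using s Fz by (simp add: minus_eq r_neg)
 next
  case (Suc d)
  have "s (Suc (i + d)) \<ominus> s (i + d) \<in> F i" using s dec by blast
  then show ?case using tr[OF _ Suc] s by simp
 qed
 have "\<exists>L \<in> carrier R. \<forall>k. \<exists>N. \<forall>i\<ge>N. s i \<ominus> L \<in> ideal_pow R (max_ideal R) k"
 proof (rule Cauchy_converges)
  show "s \<in> UNIV \<rightarrow> carrier R" using s by auto
  show "\<forall>k. \<exists>N. \<forall>i\<ge>N. \<forall>j\<ge>N. s i \<ominus> s j \<in> ideal_pow R (max_ideal R) k"
  proof (intro allI exI impI)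
   fix k i j :: nat assume ij: "k \<le> i" "k \<le> j"
   have 1: "s i \<ominus> s k \<in> F k" "s j \<ominus> s k \<in> F k" using st[of k "i - k"] st[of k "j - k"] ij by auto
   have "\<ominus> (s j \<ominus> s k) = s k \<ominus> s j" using s(1)[of j] s(1)[of k] by (simp add: minus_eq minus_add a_comm)
   then have "s k \<ominus> s j \<in> F k" using Fn[OF 1(2)] by simp
   then show "s i \<ominus> s j \<in> ideal_pow R (max_ideal R) k" using tr[OF 1(1)] s by (simp add: F_def)
  qed
 qed
 then obtain L where L: "L \<in> carrier R" "!!k. \<exists>N. \<forall>i\<ge>N. s i \<ominus> L \<in> F k" unfolding F_def by blast
 show "\<exists>L\<in>carrier R. \<forall>i. L \<ominus> s i \<in> F i"
 proof (intro bexI[OF _ L(1)] allI)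
  fix i
  obtain N where N: "\<forall>j\<ge>N. s j \<ominus> L \<in> F i" using L by blast
  define j where "j = i + N"
  have 1: "s j \<ominus> L \<in> F i" using N by (simp add: j_def)
  have "\<ominus> (s j \<ominus> L) = L \<ominus> s j" using s(1)[of j] L(1) by (simp add: minus_eq minus_add a_comm)
  then have 2: "L \<ominus> s j \<in> F i" using Fn[OF 1] by simp
  show "L \<ominus> s i \<in> F i" using tr[OF 2 st[of i N, folded j_def]] s L by blast
 qed
qed

sublocale filtered_ring R F by (rule filtered)

lemma rcos_hom: "(+>) (F 1) \<in> ring_hom R (R Quot F 1)" using ideal.rcos_ring_hom[OF F_ideal] .

lemma Quot_eq_iff: assumes "x \<in> carrier R" "y \<in> carrier R"
 shows "F 1 +> x = F 1 +> y \<longleftrightarrow> x \<ominus> y \<in> F 1"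
 using quotient_eq_iff_same_a_r_cos[OF F_ideal assms] by simp

lemma Quot_nat_elem: "nat_elem (R Quot F 1) k = F 1 +> nat_elem R k"
proof (induction k)
 case 0 then show ?case using ideal.rcos_const_imp_mem
  by (simp add: nat_elem_0 FactRing_def a_rcos_zero[OF F_ideal])
next
 case (Suc k)
 then show ?case using ring_hom_add[OF rcos_hom] ring_hom_one[OF rcos_hom] by (simp add: nat_elem_Suc)
qed

lemma Quot_nat_elem_zero: "nat_elem (R Quot F 1) k = \<zero>\<^bsub>R Quot F 1\<^esub> \<longleftrightarrow> nat_elem R k \<in> F 1"
proof -
 have "\<zero>\<^bsub>R Quot F 1\<^esub> = F 1 +> \<zero>" by (simp add: FactRing_def a_rcos_zero[OF F_ideal])
 then show ?thesis unfolding Quot_nat_elem using Quot_eq_iff[of "nat_elem R k" \<zero>] by (simp add: minus_eq)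
qed

lemma perfect_residue: "perfect_residue_ring R F p"
proof (intro perfect_residue_ring.intro filtered perfect_residue_ring_axioms.intro prime_p one_not_in)
 have "nat_elem R p \<in> PIdl nat_elem R p" by (rule cgenideal_self) simp
 then have "nat_elem R p \<in> F e" using R_facts(4) by (simp add: F_def)
 then show "nat_elem R p \<in> F 1" using F_monoD e_pos by blast
next
 fix x assume "x \<in> carrier R" "x \<notin> F 1" then show "x \<in> Units R" by (rule unit_if_not_in)
next
 fix x assume x: "x \<in> carrier R"
 have "F 1 +> x \<in> carrier (R Quot F 1)" using ring_hom_closed[OF rcos_hom x] .
 moreover have "ring_char (R Quot F 1) = p" "perfect_field (R Quot F 1)" using R_facts F_1 by simp_all
 ultimately obtain Y where Y: "Y \<in> carrier (R Quot F 1)" "Y [^]\<^bsub>R Quot F 1\<^esub> p = F 1 +> x"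
  using prime_p unfolding perfect_field_def by (metis not_prime_0)
 then obtain y where y: "y \<in> carrier R" "Y = F 1 +> y" unfolding FactRing_def A_RCOSETS_def' by auto
 have rg: "ring (R Quot F 1)" using ideal.quotient_is_ring[OF F_ideal] .
 have "ring_hom_ring R (R Quot F 1) ((+>) (F 1))" using ring_hom_ringI2[OF ring_axioms rg rcos_hom] .
 then have "F 1 +> (y [^] p) = (F 1 +> y) [^]\<^bsub>R Quot F 1\<^esub> p" using ring_hom_ring.hom_nat_pow y(1) by metis
 then have "x \<ominus> y [^] p \<in> F 1" using Quot_eq_iff[of x "y [^] p"] x y Y by simp
 then show "\<exists>y\<in>carrier R. x \<ominus> y [^] p \<in> F 1" using y by blast
qed

sublocale perfect_residue_ring R F p by (rule perfect_residue)

text \<open>Elements of valuation one, phrased so that all powers of the maximal ideal are at hand.\<close>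

definition unif :: "'u => bool" where "unif x \<longleftrightarrow> x \<in> carrier R & (\<forall>k. F k = PIdl (x [^] k))"

lemma unif_pi0: "unif \<pi>0" using pi0 F_eq by (simp add: unif_def)

lemma unif_mult_unit:
 assumes x: "unif x" and d: "d \<in> Units R" shows "unif (d \<otimes> x)"
proof -
 have xc: "x \<in> carrier R" "d \<in> carrier R" using x d by (auto simp: unif_def)
 have "PIdl ((d \<otimes> x) [^] k) = PIdl (x [^] k)" for k :: nat
 proof -
  have du: "d [^] k \<in> Units R" using d Units_pow_closed by simp
  have "(d \<otimes> x) [^] k = d [^] k \<otimes> x [^] k" using xc by (simp add: nat_pow_distrib)
  then have "(d \<otimes> x) [^] k \<sim> x [^] k" using xc du
   by (metis associatedI2 m_comm nat_pow_closed Units_closed)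
  then show ?thesis using associated_iff_same_ideal xc by simp
 qed
 then show ?thesis using x xc by (simp add: unif_def)
qed

lemma unif_mem: assumes "unif x" shows "y \<in> F k \<longleftrightarrow> (\<exists>r \<in> carrier R. y = x [^] k \<otimes> r)"
 using assms unfolding unif_def cgenideal_def by (auto simp: m_comm)

lemma unif_F1: "unif x ==> x \<in> F 1" using unif_mem[of x x 1] by (auto simp: unif_def intro!: bexI[of _ \<one>])

lemma unif_nonzero: assumes u: "unif x" shows "x ~= \<zero>"
proof
 assume x: "x = \<zero>"
 obtain r where "r \<in> carrier R" "\<pi>0 = x [^] (1::nat) \<otimes> r" using unif_mem[OF u] unif_F1[OF unif_pi0] by blast
 then show False using x pi0_nonzero by simp
qed

lemma unif_pow_nonzero: "unif x ==> x [^] (k::nat) ~= \<zero>"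
 using unif_nonzero[of x] by (induction k) (simp_all add: unif_def integral_iff)

lemma unif_div: assumes u: "unif x" and "y \<in> carrier R" "x [^] i \<otimes> y \<in> F (i + k)" shows "y \<in> F k"
proof -
 have xc: "x \<in> carrier R" using u by (simp add: unif_def)
 obtain r where r: "r \<in> carrier R" "x [^] i \<otimes> y = x [^] (i + k) \<otimes> r" using assms unif_mem by blast
 then have "x [^] i \<otimes> y = x [^] i \<otimes> (x [^] k \<otimes> r)" using xc by (simp add: nat_pow_mult[symmetric] m_assoc)
 then have "y = x [^] k \<otimes> r" using m_lcancel[OF unif_pow_nonzero[OF u], of i y "x [^] k \<otimes> r"] assms xc r by simp
 then show ?thesis using r unif_mem[OF u] by blast
qed

lemma F_not_Suc: "\<not> F k \<subseteq> F (Suc k)"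
proof
 assume "F k \<subseteq> F (Suc k)"
 moreover have "\<pi>0 [^] k \<in> F k" unfolding mem_F using pi0(1) by (intro bexI[of _ \<one>]) auto
 ultimately have "\<pi>0 [^] k \<otimes> \<one> \<in> F (k + 1)" using pi0 by auto
 then show False using unif_div[OF unif_pi0 one_closed] one_not_in by blast
qed

lemma factorization: assumes u: "unif x" and y: "y \<in> carrier R" "y ~= \<zero>"
 shows "\<exists>k::nat. \<exists>d \<in> Units R. y = x [^] k \<otimes> d"
proof -
 obtain k where k: "y \<notin> F k" using F_separated y by blast
 then have "\<exists>k. y \<in> F k & y \<notin> F (Suc k)"
 proof (induction k)
  case 0 then show ?case using y F_0 by simp
 next
  case (Suc k) then show ?case by blast
 qed
 then obtain k where k: "y \<in> F k" "y \<notin> F (Suc k)" by blast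
 then obtain r where r: "r \<in> carrier R" "y = x [^] k \<otimes> r" using unif_mem[OF u] by blast
 have xc: "x \<in> carrier R" using u by (simp add: unif_def)
 have "r \<notin> F 1"
 proof
  assume "r \<in> F 1"
  then have "x [^] k \<otimes> r \<in> F (k + 1)" using unif_mem[OF u, of "x [^] k" k] xc by (intro F_mult) (auto intro!: bexI[of _ \<one>])
  then show False using k r by simp
 qed
 then have "r \<in> Units R" by (rule Units_if_notin_F1[OF r(1)])
 with r(2) show ?thesis by - (rule exI[of _ k], rule bexI[of _ r])
qed

lemma p_in_Fe: "nat_elem R p \<in> F e" and p_notin: "nat_elem R p \<notin> F (Suc e)"
proof -
 have Fe: "F e = PIdl nat_elem R p" using R_facts(4) by (simp add: F_def)
 show "nat_elem R p \<in> F e" unfolding Fe by (rule cgenideal_self) simp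
 show "nat_elem R p \<notin> F (Suc e)"
 proof
  assume "nat_elem R p \<in> F (Suc e)"
  then have "PIdl nat_elem R p \<subseteq> F (Suc e)" using cgenideal_minimal[OF F_ideal] by blast
  then show False using F_not_Suc Fe by blast
 qed
qed

lemma tame_root:
 assumes e: "\<not> p dvd e" and x: "unif x" and w: "w \<in> Units R" and c: "c \<ominus> \<one> \<in> F (Suc m)" "c \<in> carrier R"
  and pe: "nat_elem R p = w \<otimes> c \<otimes> x [^] e"
 shows "\<exists>d \<in> carrier R. d \<ominus> \<one> \<in> F (Suc m) & unif (d \<otimes> x) & nat_elem R p = w \<otimes> (d \<otimes> x) [^] e"
proof -
 obtain d where d: "d \<in> carrier R" "d \<ominus> \<one> \<in> F (Suc m)" "d [^] e = c" using one_unit_root[OF e c(2,1)] by blast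
 have "d \<notin> F 1"
 proof
  assume d1: "d \<in> F 1"
  have "d \<ominus> \<one> \<in> F 1" using F_monoD[OF d(2)] by simp
  then have "\<one> \<ominus> d \<in> F 1" using F_diff_sym d by blast
  then show False using F_diff_mem[OF _ d1] one_not_in by blast
 qed
 then have "d \<in> Units R" using d Units_if_notin_F1 by blast
 moreover have "nat_elem R p = w \<otimes> (d \<otimes> x) [^] e"
  using pe d(1,3) Units_closed[OF w] x c(2) by (simp add: unif_def nat_pow_distrib m_assoc)
 ultimately show ?thesis using unif_mult_unit[OF x] d by blast
qed

text \<open>This is where tameness enters: dividing \<open>p\<close> by the \<open>e\<close>-th power of some uniformizer leaves a unit,
 whose one-unit part is an \<open>e\<close>-th power and can be moved into the uniformizer.\<close>

lemma tame_uniformizer: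
 assumes e: "\<not> p dvd e"
 shows "\<exists>x w. unif x & w \<in> teich & w ~= \<zero> & nat_elem R p = w \<otimes> x [^] e"
proof -
 obtain u where u: "u \<in> carrier R" "nat_elem R p = \<pi>0 [^] e \<otimes> u" using p_in_Fe mem_F by blast
 have "u \<notin> F 1"
 proof
  assume "u \<in> F 1"
  moreover have "\<pi>0 [^] e \<in> F e" unfolding mem_F using pi0(1) by (intro bexI[of _ \<one>]) auto
  ultimately have "nat_elem R p \<in> F (e + 1)" unfolding u(2) by (intro F_mult)
  then show False using p_notin by simp
 qed
 then have "u \<in> Units R" using u Units_if_notin_F1 by blast
 from unit_eq_teich_power[OF e this] obtain w d where w: "w \<in> teich" "w \<in> Units R" and d: "d \<in> Units R" "u = w \<otimes> d [^] e" by blast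
 have "nat_elem R p = w \<otimes> (d \<otimes> \<pi>0) [^] e" unfolding u(2) d(2) using w d pi0 by (simp add: nat_pow_distrib m_ac Units_closed)
 moreover have "w ~= \<zero>" using w(2) Units_iff_notin_F1[OF Units_closed[OF w(2)]] F_zero by auto
 ultimately show ?thesis using w(1) unif_mult_unit[OF unif_pi0 d(1)] by blast
qed

end

context cdvr_object begin

definition v :: "'u => nat" where "v x = (LEAST k. x \<notin> F (Suc k))"

lemma v_iff: assumes x: "x \<in> carrier R" "x ~= \<zero>" shows "x \<in> F k \<longleftrightarrow> k \<le> v x"
proof -
 obtain k0 where "x \<notin> F k0" using F_separated x by blast
 then have "x \<notin> F (Suc k0)" using F_Suc by blast
 then have out: "x \<notin> F (Suc (v x))" unfolding v_def by (rule LeastI)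
 have inn: "x \<in> F (v x)"
 proof (cases "v x")
  case 0 then show ?thesis using x F_0 by simp
 next
  case (Suc j)
  then have "j < (LEAST k. x \<notin> F (Suc k))" by (simp add: v_def)
  then have "\<not> (x \<notin> F (Suc j))" by (rule not_less_Least)
  then show ?thesis using Suc by simp
 qed
 show ?thesis using inn out F_monoD[of x "v x" k] F_monoD[of x k "Suc (v x)"] by (metis not_less_eq_eq)
qed

lemma v_eqI: "[|x \<in> F k; x \<notin> F (Suc k)|] ==> v x = k"
 using v_iff[of x k] v_iff[of x "Suc k"] F_carrier[of x k] by (cases "x = \<zero>") auto

lemma pi0_pow_in_F: "\<pi>0 [^] k \<in> F k" unfolding mem_F using pi0(1) by (intro bexI[of _ \<one>]) auto

lemma v_pi_unit: assumes d: "d \<in> Units R" shows "v (\<pi>0 [^] k \<otimes> d) = k"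
proof (rule v_eqI)
 have dc: "d \<in> carrier R" using d by auto
 show "\<pi>0 [^] k \<otimes> d \<in> F k" using pi0_pow_in_F dc by (rule F_mult_r)
 show "\<pi>0 [^] k \<otimes> d \<notin> F (Suc k)"
  using unif_div[OF unif_pi0 dc, of k 1] Units_iff_notin_F1[OF dc] d by auto
qed

lemma factor_v: assumes "x \<in> carrier R" "x ~= \<zero>" obtains d where "d \<in> Units R" "x = \<pi>0 [^] v x \<otimes> d"
 using factorization[OF unif_pi0 assms] v_pi_unit by metis

lemma v_mult: assumes "x \<in> carrier R" "x ~= \<zero>" "y \<in> carrier R" "y ~= \<zero>" shows "v (x \<otimes> y) = v x + v y"
proof -
 obtain d f where df: "d \<in> Units R" "x = \<pi>0 [^] v x \<otimes> d" "f \<in> Units R" "y = \<pi>0 [^] v y \<otimes> f"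
  using factor_v assms by metis
 have "x \<otimes> y = (\<pi>0 [^] v x \<otimes> d) \<otimes> (\<pi>0 [^] v y \<otimes> f)" using df by simp
 also have "\<dots> = \<pi>0 [^] (v x + v y) \<otimes> (d \<otimes> f)"
  using Units_closed[OF df(1)] Units_closed[OF df(3)] pi0(1) by (simp add: m_ac flip: nat_pow_mult)
 finally show ?thesis using v_pi_unit[of "d \<otimes> f" "v x + v y"] df by simp
qed

lemma v_pi: "v (\<pi>0 [^] k) = k" using v_pi_unit[of \<one> k] pi0 by simp
lemma v_unit: "d \<in> Units R ==> v d = 0" using v_pi_unit[of d 0] Units_closed by simp

lemma divide_F: assumes x: "x \<in> carrier R" "x ~= \<zero>" "z \<in> F (k + v x)" shows "\<exists>t \<in> F k. z = x \<otimes> t"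
proof -
 obtain d where d: "d \<in> Units R" "x = \<pi>0 [^] v x \<otimes> d" using factor_v x by metis
 obtain r where r: "r \<in> carrier R" "z = \<pi>0 [^] (k + v x) \<otimes> r" using x mem_F by blast
 have dc: "d \<in> carrier R" "inv d \<in> carrier R" using d by auto
 have "\<pi>0 [^] v x \<otimes> d \<otimes> (inv d \<otimes> (\<pi>0 [^] k \<otimes> r)) = \<pi>0 [^] v x \<otimes> (d \<otimes> inv d) \<otimes> \<pi>0 [^] k \<otimes> r"
  using dc r pi0(1) by (simp add: m_assoc)
 also have "\<dots> = z" using d r pi0(1) by (simp add: m_ac flip: nat_pow_mult)
 finally have "z = x \<otimes> (inv d \<otimes> (\<pi>0 [^] k \<otimes> r))" using d by simp
 moreover have "inv d \<otimes> (\<pi>0 [^] k \<otimes> r) \<in> F k" by (intro F_mult_l F_mult_r pi0_pow_in_F r dc)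
 ultimately show ?thesis by blast
qed

end

section \<open>The hyperfield of a complete discrete valuation ring\<close>

text \<open>The hyperfield \<open>K / (1 + m^n)\<close>. The fraction \<open>x / \<pi>0^N\<close> is given by the pair \<open>(x, N)\<close>, and pairs are
identified if they agree up to a factor in \<open>1 + m^n\<close> after clearing denominators. The injection \<open>enc\<close>
places representatives of the classes in the universe.\<close>

locale truncated_field = cdvr_object R p e for R :: "'u ring" (structure) and p e +
 fixes n :: nat and enc :: "'u \<times> nat => 'u"
 assumes n_gt: "n > e" and enc: "inj enc"
begin

definition V :: "'u set" where "V = {c \<in> carrier R. c \<ominus> \<one> \<in> F n}"

lemma V_carrier: "c \<in> V ==> c \<in> carrier R" by (simp add: V_def)
lemma V_one [simp, intro]: "\<one> \<in> V" by (simp add: V_def minus_eq r_neg)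
lemma V_unit: assumes "c \<in> V" shows "c \<in> Units R"
proof (rule Units_if_notin_F1)
 show c: "c \<in> carrier R" using assms V_carrier by blast
 show "c \<notin> F 1"
 proof
  assume c1: "c \<in> F 1"
  have "c \<ominus> \<one> \<in> F n" using assms by (simp add: V_def)
  then have "c \<ominus> \<one> \<in> F 1" using F_monoD n_gt by (metis One_nat_def Suc_leI less_nat_zero_code neq0_conv)
  then have "\<one> \<ominus> c \<in> F 1" using F_diff_sym c by blast
  then show False using F_diff_mem[OF _ c1] one_notin_F1 by blast
 qed
qed
lemma V_mult: assumes "c \<in> V" "d \<in> V" shows "c \<otimes> d \<in> V"
 using F_diff_mult[of c \<one> n d \<one>] assms by (simp add: V_def)
lemma V_inv: assumes "c \<in> V" shows "inv c \<in> V"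
proof -
 have c: "c \<in> carrier R" "c \<in> Units R" using assms V_unit V_carrier by auto
 have "c \<ominus> \<one> \<in> F n" using assms by (simp add: V_def)
 then have "\<one> \<ominus> c \<in> F n" using F_diff_sym c by blast
 then have "inv c \<otimes> (\<one> \<ominus> c) \<in> F n" using F_mult_l c by blast
 moreover have "inv c \<otimes> (\<one> \<ominus> c) = inv c \<ominus> \<one>" using c by (simp add: minus_eq r_distr r_minus)
 ultimately show ?thesis using c by (simp add: V_def)
qed

definition rel :: "'u \<times> nat => 'u \<times> nat => bool" where
 "rel z z' \<longleftrightarrow> (\<exists>c \<in> V. \<pi>0 [^] snd z' \<otimes> fst z \<otimes> c = \<pi>0 [^] snd z \<otimes> fst z')"

lemma rel_refl: "x \<in> carrier R ==> rel (x, N) (x, N)"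
 unfolding rel_def using pi0(1) by (intro bexI[of _ \<one>]) auto

lemma rel_sym: assumes "rel (x, N) (y, M)" "x \<in> carrier R" "y \<in> carrier R" shows "rel (y, M) (x, N)"
proof -
 obtain c where c: "c \<in> V" "\<pi>0 [^] M \<otimes> x \<otimes> c = \<pi>0 [^] N \<otimes> y" using assms unfolding rel_def by auto
 have cu: "c \<in> Units R" "c \<in> carrier R" using c V_unit V_carrier by auto
 have "\<pi>0 [^] N \<otimes> y \<otimes> inv c = \<pi>0 [^] M \<otimes> x \<otimes> (c \<otimes> inv c)"
  unfolding c(2)[symmetric] using cu(2) Units_inv_closed[OF cu(1)] assms pi0(1) by (simp add: m_assoc)
 also have "\<dots> = \<pi>0 [^] M \<otimes> x" using cu assms pi0(1) by simp
 finally show ?thesis unfolding rel_def using V_inv[OF c(1)] by auto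
qed

lemma rel_trans: assumes "rel (x, N) (y, M)" "rel (y, M) (z, K)" "x \<in> carrier R" "y \<in> carrier R" "z \<in> carrier R"
 shows "rel (x, N) (z, K)"
proof -
 obtain c where c: "c \<in> V" "\<pi>0 [^] M \<otimes> x \<otimes> c = \<pi>0 [^] N \<otimes> y" using assms unfolding rel_def by auto
 obtain d where d: "d \<in> V" "\<pi>0 [^] K \<otimes> y \<otimes> d = \<pi>0 [^] M \<otimes> z" using assms unfolding rel_def by auto
 define a b k where "a = \<pi>0 [^] N" "b = \<pi>0 [^] M" "k = \<pi>0 [^] K"
 have carr: "a \<in> carrier R" "b \<in> carrier R" "k \<in> carrier R" "c \<in> carrier R" "d \<in> carrier R"
  using pi0 c d V_carrier by (auto simp: a_b_k_def)
 have "b \<otimes> (k \<otimes> x \<otimes> (c \<otimes> d)) = k \<otimes> d \<otimes> (b \<otimes> x \<otimes> c)" using carr assms by (simp add: m_ac)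
 also have "\<dots> = a \<otimes> (k \<otimes> y \<otimes> d)" using c carr assms by (simp add: a_b_k_def[symmetric] m_ac)
 also have "\<dots> = b \<otimes> (a \<otimes> z)" using d carr assms by (simp add: a_b_k_def[symmetric] m_ac)
 finally have "k \<otimes> x \<otimes> (c \<otimes> d) = a \<otimes> z"
  using m_lcancel[of b] pi0_pow_nonzero[of M] carr assms by (simp add: a_b_k_def(2))
 then show ?thesis unfolding rel_def a_b_k_def using V_mult[OF c(1) d(1)] by auto
qed

definition Q :: "'u => nat => 'u" where
 "Q x N = enc (SOME z. fst z \<in> carrier R & rel (x, N) z)"

lemma Q_eq_iff: assumes x: "x \<in> carrier R" and y: "y \<in> carrier R"
 shows "Q x N = Q y M \<longleftrightarrow> rel (x, N) (y, M)"
proof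
 define P where "P x N z \<longleftrightarrow> fst z \<in> carrier R & rel (x, N) z" for x N and z :: "'u \<times> nat"
 have Qd: "Q x N = enc (Eps (P x N))" for x N by (simp add: Q_def P_def[abs_def])
 have P: "P x N (Eps (P x N))" if "x \<in> carrier R" for x N
  by (rule someI[of _ "(x, N)"]) (use rel_refl that in \<open>simp add: P_def\<close>)
 { assume "Q x N = Q y M"
  then have eq: "Eps (P x N) = Eps (P y M)" unfolding Qd using enc by (auto dest: injD)
  obtain z k where zk: "Eps (P x N) = (z, k)" by (metis surj_pair)
  have "P x N (z, k)" "P y M (z, k)" using P[OF x, of N] P[OF y, of M] eq zk by metis+
  then have "rel (x, N) (z, k)" "rel (y, M) (z, k)" "z \<in> carrier R" by (auto simp: P_def)
  then show "rel (x, N) (y, M)" using rel_trans rel_sym x y by meson }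
 assume r: "rel (x, N) (y, M)"
 have "P x N = P y M"
 proof
  fix z :: "'u \<times> nat"
  obtain z1 z2 where z: "z = (z1, z2)" by (cases z)
  have "rel (x, N) (z1, z2) \<longleftrightarrow> rel (y, M) (z1, z2)" if z1: "z1 \<in> carrier R"
   using rel_trans[OF r _ x y z1] rel_trans[OF rel_sym[OF r x y] _ y x z1] by blast
  then show "P x N z = P y M z" by (auto simp: P_def z)
 qed
 then show "Q x N = Q y M" unfolding Qd by simp
qed

lemma Q_eq: "[|x \<in> carrier R; y \<in> carrier R|] ==> Q x N = Q y M \<longleftrightarrow> (\<exists>c \<in> V. \<pi>0 [^] M \<otimes> x \<otimes> c = \<pi>0 [^] N \<otimes> y)"
 by (simp add: Q_eq_iff rel_def)

lemma Q_eq_same: assumes "x \<in> carrier R" "y \<in> carrier R" shows "Q x N = Q y N \<longleftrightarrow> (\<exists>c \<in> V. x \<otimes> c = y)"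
proof -
 have "\<pi>0 [^] N \<otimes> x \<otimes> c = \<pi>0 [^] N \<otimes> y \<longleftrightarrow> x \<otimes> c = y" if "c \<in> V" for c
  using m_lcancel[of "\<pi>0 [^] N" "x \<otimes> c" y] pi0_pow_nonzero[of N] pi0(1) assms V_carrier[OF that] by (simp add: m_assoc)
 then show ?thesis using Q_eq[OF assms] by blast
qed

lemma Q_scale: assumes "x \<in> carrier R" shows "Q (\<pi>0 [^] M \<otimes> x) (N + M) = Q x N"
proof -
 have "\<pi>0 [^] N \<otimes> (\<pi>0 [^] M \<otimes> x) \<otimes> \<one> = \<pi>0 [^] (N + M) \<otimes> x"
  using assms pi0(1) by (simp add: m_assoc flip: nat_pow_mult)
 then have "\<exists>c \<in> V. \<pi>0 [^] N \<otimes> (\<pi>0 [^] M \<otimes> x) \<otimes> c = \<pi>0 [^] (N + M) \<otimes> x" using V_one by blast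
 then show ?thesis by (rule Q_eq[THEN iffD2, rotated 2]) (use assms pi0(1) in auto)
qed

lemma Q_raise: assumes "x \<in> carrier R" "N \<le> M" shows "\<exists>y \<in> carrier R. Q x N = Q y M"
 using Q_scale[OF assms(1), of "M - N" N] assms pi0(1) by (intro bexI[of _ "\<pi>0 [^] (M - N) \<otimes> x"]) auto

lemma Q_zero_iff: assumes "x \<in> carrier R" shows "Q x N = Q \<zero> M \<longleftrightarrow> x = \<zero>"
proof
 assume "Q x N = Q \<zero> M"
 then obtain c where c: "c \<in> V" "\<pi>0 [^] M \<otimes> x \<otimes> c = \<zero>" using Q_eq[OF assms, of \<zero> N M] pi0(1) by auto
 have "c ~= \<zero>" using V_unit[OF c(1)] Units_iff_notin_F1[of \<zero>] by auto
 then show "x = \<zero>" using c V_carrier[OF c(1)] pi0(1) assms pi0_pow_nonzero[of M] by (simp add: integral_iff)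
next
 assume "x = \<zero>" then show "Q x N = Q \<zero> M" using Q_eq[of \<zero> \<zero> N M] pi0(1) by (auto intro!: bexI[of _ \<one>])
qed

definition CH :: "'u set" where "CH = {Q x N | x N. x \<in> carrier R}"
definition dq :: "'u => 'u \<times> nat" where "dq A = (SOME z. fst z \<in> carrier R & Q (fst z) (snd z) = A)"

lemma dq: assumes "A \<in> CH" obtains x N where "x \<in> carrier R" "Q x N = A" "dq A = (x, N)"
proof -
 have "\<exists>z. fst z \<in> carrier R & Q (fst z) (snd z) = A" using assms by (auto simp: CH_def)
 from someI_ex[OF this] show thesis using that[of "fst (dq A)" "snd (dq A)"] by (simp add: dq_def)
qed

definition Hn :: "'u pointed_hyperfield" where
 "Hn = \<lparr>carrier = CH, monoid.mult = (%A B. Q (fst (dq A) \<otimes> fst (dq B)) (snd (dq A) + snd (dq B))),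
   one = Q \<one> 0, hzero = Q \<zero> 0,
   hadd = (%A B. {Q (x \<oplus> y) N | x y N. x \<in> carrier R & y \<in> carrier R & Q x N = A & Q y N = B}),
   val = (%A. if fst (dq A) = \<zero> then \<infinity> else ereal ((real (v (fst (dq A))) - real (snd (dq A))) / real e)),
   pelt = Q (nat_elem R p) 0\<rparr>"

lemma Hn_simps [simp]: "carrier Hn = CH" "\<one>\<^bsub>Hn\<^esub> = Q \<one> 0" "hzero Hn = Q \<zero> 0" "pelt Hn = Q (nat_elem R p) 0"
 by (simp_all add: Hn_def)

lemma Q_in_CH [simp, intro]: "x \<in> carrier R ==> Q x N \<in> CH" by (auto simp: CH_def)

lemma Q_mult: assumes "x \<in> carrier R" "y \<in> carrier R" shows "Q x N \<otimes>\<^bsub>Hn\<^esub> Q y M = Q (x \<otimes> y) (N + M)"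
proof -
 obtain x' N' where x': "x' \<in> carrier R" "Q x' N' = Q x N" "dq (Q x N) = (x', N')" using dq[of "Q x N"] assms by blast
 obtain y' M' where y': "y' \<in> carrier R" "Q y' M' = Q y M" "dq (Q y M) = (y', M')" using dq[of "Q y M"] assms by blast
 obtain c where c: "c \<in> V" "\<pi>0 [^] N \<otimes> x' \<otimes> c = \<pi>0 [^] N' \<otimes> x" using Q_eq x' assms by blast
 obtain d where d: "d \<in> V" "\<pi>0 [^] M \<otimes> y' \<otimes> d = \<pi>0 [^] M' \<otimes> y" using Q_eq y' assms by blast
 have cd: "c \<in> carrier R" "d \<in> carrier R" using c d V_carrier by auto
 have "\<pi>0 [^] (N + M) \<otimes> (x' \<otimes> y') \<otimes> (c \<otimes> d) = (\<pi>0 [^] N \<otimes> x' \<otimes> c) \<otimes> (\<pi>0 [^] M \<otimes> y' \<otimes> d)"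
  using cd pi0(1) x' y' by (simp add: m_ac flip: nat_pow_mult)
 also have "\<dots> = \<pi>0 [^] (N' + M') \<otimes> (x \<otimes> y)"
  unfolding c(2) d(2) using pi0(1) assms by (simp add: m_ac flip: nat_pow_mult)
 finally have "Q (x' \<otimes> y') (N' + M') = Q (x \<otimes> y) (N + M)"
  using Q_eq[of "x' \<otimes> y'" "x \<otimes> y" "N' + M'" "N + M"] V_mult[OF c(1) d(1)] x' y' assms by auto
 then show ?thesis by (simp add: Hn_def x' y')
qed

lemma Q_val: assumes x: "x \<in> carrier R"
 shows "val Hn (Q x N) = (if x = \<zero> then \<infinity> else ereal ((real (v x) - real N) / real e))"
proof -
 obtain x' N' where x': "x' \<in> carrier R" "Q x' N' = Q x N" "dq (Q x N) = (x', N')" using dq[of "Q x N"] assms by blast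
 have z: "x' = \<zero> \<longleftrightarrow> x = \<zero>" using Q_zero_iff[OF x'(1), of N' 0] Q_zero_iff[OF x, of N 0] x'(2) by simp
 have "v x' + N = v x + N'" if nz: "x ~= \<zero>"
 proof -
  obtain c where c: "c \<in> V" "\<pi>0 [^] N \<otimes> x' \<otimes> c = \<pi>0 [^] N' \<otimes> x" using Q_eq x' assms by blast
  have cu: "c \<in> Units R" "c \<in> carrier R" "c ~= \<zero>" using V_unit[OF c(1)] V_carrier[OF c(1)] Units_iff_notin_F1[of \<zero>] by auto
  have xz: "x' ~= \<zero>" using z nz by simp
  have "v (\<pi>0 [^] N \<otimes> x' \<otimes> c) = N + v x'"
   using v_mult[of "\<pi>0 [^] N \<otimes> x'" c] v_mult[of "\<pi>0 [^] N" x'] cu xz x' pi0(1) pi0_pow_nonzero[of N] v_pi v_unit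
   by (simp add: integral_iff)
  moreover have "v (\<pi>0 [^] N' \<otimes> x) = N' + v x" using v_mult[of "\<pi>0 [^] N'" x] nz x pi0(1) pi0_pow_nonzero[of N'] v_pi by simp
  ultimately show ?thesis using c by simp
 qed
 then have "x ~= \<zero> ==> real (v x') - real N' = real (v x) - real N" by (simp add: algebra_simps flip: of_nat_add)
 then show ?thesis using z by (simp add: Hn_def x')
qed

lemma hadd_Q: assumes x: "x \<in> carrier R" and y: "y \<in> carrier R"
 shows "A \<in> hadd Hn (Q x N) (Q y N) \<longleftrightarrow> (\<exists>c \<in> V. \<exists>d \<in> V. A = Q (x \<otimes> c \<oplus> y \<otimes> d) N)"
proof
 assume "A \<in> hadd Hn (Q x N) (Q y N)"
 then obtain x' y' M where A: "A = Q (x' \<oplus> y') M" "x' \<in> carrier R" "y' \<in> carrier R" "Q x' M = Q x N" "Q y' M = Q y N"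
  by (auto simp: Hn_def)
 obtain c where c: "c \<in> V" "\<pi>0 [^] M \<otimes> x \<otimes> c = \<pi>0 [^] N \<otimes> x'" using Q_eq[OF x A(2)] A by metis
 obtain d where d: "d \<in> V" "\<pi>0 [^] M \<otimes> y \<otimes> d = \<pi>0 [^] N \<otimes> y'" using Q_eq[OF y A(3)] A by metis
 have cd: "c \<in> carrier R" "d \<in> carrier R" using c d V_carrier by auto
 have "A = Q (\<pi>0 [^] N \<otimes> (x' \<oplus> y')) (M + N)" using Q_scale A by simp
 also have "\<pi>0 [^] N \<otimes> (x' \<oplus> y') = \<pi>0 [^] M \<otimes> x \<otimes> c \<oplus> \<pi>0 [^] M \<otimes> y \<otimes> d"
  unfolding c(2) d(2) using A pi0(1) by (simp add: r_distr)
 also have "\<dots> = \<pi>0 [^] M \<otimes> (x \<otimes> c \<oplus> y \<otimes> d)" using x y cd pi0(1) by (simp add: r_distr m_assoc)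
 finally have "A = Q (x \<otimes> c \<oplus> y \<otimes> d) N" using Q_scale[of "x \<otimes> c \<oplus> y \<otimes> d" M N] x y cd by (simp add: add.commute)
 then show "\<exists>c \<in> V. \<exists>d \<in> V. A = Q (x \<otimes> c \<oplus> y \<otimes> d) N" using c d by blast
next
 assume "\<exists>c \<in> V. \<exists>d \<in> V. A = Q (x \<otimes> c \<oplus> y \<otimes> d) N"
 then obtain c d where cd: "c \<in> V" "d \<in> V" "A = Q (x \<otimes> c \<oplus> y \<otimes> d) N" by blast
 have cc: "c \<in> carrier R" "d \<in> carrier R" using cd V_carrier by auto
 have "Q (x \<otimes> c) N = Q x N" "Q (y \<otimes> d) N = Q y N" using Q_eq_same x y cc cd by (metis m_closed)+
 then show "A \<in> hadd Hn (Q x N) (Q y N)" using cd cc x y by (auto simp: Hn_def)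
qed

lemma common1: assumes "A \<in> CH" obtains x N where "x \<in> carrier R" "A = Q x N" using assms by (auto simp: CH_def)

lemma common2: assumes "A \<in> CH" "B \<in> CH" obtains x y N where "x \<in> carrier R" "y \<in> carrier R" "A = Q x N" "B = Q y N"
proof -
 obtain x N y M where xy: "x \<in> carrier R" "A = Q x N" "y \<in> carrier R" "B = Q y M" using assms by (auto simp: CH_def)
 obtain x' where x': "x' \<in> carrier R" "Q x N = Q x' (max N M)" using Q_raise[of x N "max N M"] xy by auto
 obtain y' where y': "y' \<in> carrier R" "Q y M = Q y' (max N M)" using Q_raise[of y M "max N M"] xy by auto
 show thesis using that[OF x'(1) y'(1)] xy x' y' by simp
qed

lemma common3: assumes "A \<in> CH" "B \<in> CH" "C \<in> CH"
 obtains x y z N where "x \<in> carrier R" "y \<in> carrier R" "z \<in> carrier R" "A = Q x N" "B = Q y N" "C = Q z N"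
proof -
 obtain x y N where xy: "x \<in> carrier R" "y \<in> carrier R" "A = Q x N" "B = Q y N" using common2 assms by metis
 obtain z M where z: "z \<in> carrier R" "C = Q z M" using common1 assms by metis
 obtain x' where x': "x' \<in> carrier R" "Q x N = Q x' (max N M)" using Q_raise[of x N "max N M"] xy by auto
 obtain y' where y': "y' \<in> carrier R" "Q y N = Q y' (max N M)" using Q_raise[of y N "max N M"] xy by auto
 obtain z' where z': "z' \<in> carrier R" "Q z M = Q z' (max N M)" using Q_raise[of z M "max N M"] z by auto
 show thesis using that[OF x'(1) y'(1) z'(1)] xy x' y' z z' by simp
qed

lemma hadd_Q_carrier: "[|A \<in> CH; B \<in> CH; D \<in> hadd Hn A B|] ==> D \<in> CH" by (auto simp: Hn_def)

lemma hadd_comm_Q: "hadd Hn A B = hadd Hn B A"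
proof -
 have "hadd Hn A B \<subseteq> hadd Hn B A" for A B
 proof
  fix D assume "D \<in> hadd Hn A B"
  then obtain x y N where "x \<in> carrier R" "y \<in> carrier R" "Q x N = A" "Q y N = B" "D = Q (x \<oplus> y) N" by (auto simp: Hn_def)
  moreover have "x \<oplus> y = y \<oplus> x" using calculation a_comm by blast
  ultimately show "D \<in> hadd Hn B A" by (auto simp: Hn_def)
 qed
 then show ?thesis by blast
qed

text \<open>The right-hand side is symmetric in the summands, whence associativity.\<close>

lemma hadd3: assumes x: "x \<in> carrier R" and y: "y \<in> carrier R" and z: "z \<in> carrier R"
 shows "D \<in> hset_add Hn (hadd Hn (Q x N) (Q y N)) {Q z N} \<longleftrightarrow>
  (\<exists>c \<in> V. \<exists>d \<in> V. \<exists>f \<in> V. D = Q (x \<otimes> c \<oplus> y \<otimes> d \<oplus> z \<otimes> f) N)"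
proof
 assume "D \<in> hset_add Hn (hadd Hn (Q x N) (Q y N)) {Q z N}"
 then obtain A where A: "A \<in> hadd Hn (Q x N) (Q y N)" "D \<in> hadd Hn A (Q z N)" by (auto simp: hset_add_def)
 then obtain c d where cd: "c \<in> V" "d \<in> V" "A = Q (x \<otimes> c \<oplus> y \<otimes> d) N" using hadd_Q x y by blast
 have cc: "c \<in> carrier R" "d \<in> carrier R" using cd V_carrier by auto
 have "D \<in> hadd Hn (Q (x \<otimes> c \<oplus> y \<otimes> d) N) (Q z N)" using A cd by simp
 then obtain f g where fg: "f \<in> V" "g \<in> V" "D = Q ((x \<otimes> c \<oplus> y \<otimes> d) \<otimes> f \<oplus> z \<otimes> g) N"
  using hadd_Q[of "x \<otimes> c \<oplus> y \<otimes> d" z] x y z cc by auto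
 have "D = Q (x \<otimes> (c \<otimes> f) \<oplus> y \<otimes> (d \<otimes> f) \<oplus> z \<otimes> g) N"
  using fg cc x y V_carrier[OF fg(1)] by (simp add: l_distr m_assoc)
 then show "\<exists>c \<in> V. \<exists>d \<in> V. \<exists>f \<in> V. D = Q (x \<otimes> c \<oplus> y \<otimes> d \<oplus> z \<otimes> f) N"
  using V_mult cd fg by blast
next
 assume "\<exists>c \<in> V. \<exists>d \<in> V. \<exists>f \<in> V. D = Q (x \<otimes> c \<oplus> y \<otimes> d \<oplus> z \<otimes> f) N"
 then obtain c d f where cd: "c \<in> V" "d \<in> V" "f \<in> V" "D = Q (x \<otimes> c \<oplus> y \<otimes> d \<oplus> z \<otimes> f) N" by blast
 have cc: "c \<in> carrier R" "d \<in> carrier R" "f \<in> carrier R" using cd V_carrier by auto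
 have "Q (x \<otimes> c \<oplus> y \<otimes> d) N \<in> hadd Hn (Q x N) (Q y N)" using hadd_Q x y cd by blast
 moreover have "D \<in> hadd Hn (Q (x \<otimes> c \<oplus> y \<otimes> d) N) (Q z N)"
 proof -
  have "D = Q ((x \<otimes> c \<oplus> y \<otimes> d) \<otimes> \<one> \<oplus> z \<otimes> f) N" using cd x y cc by simp
  then show ?thesis using hadd_Q[of "x \<otimes> c \<oplus> y \<otimes> d" z D N] x y z cc cd(3) V_one by blast
 qed
 ultimately show "D \<in> hset_add Hn (hadd Hn (Q x N) (Q y N)) {Q z N}" by (auto simp: hset_add_def)
qed

lemma neg_Q: assumes x: "x \<in> carrier R" and y: "y \<in> carrier R"
 shows "Q \<zero> 0 \<in> hadd Hn (Q x N) (Q y N) \<longleftrightarrow> Q y N = Q (\<ominus> x) N"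
proof
 assume "Q \<zero> 0 \<in> hadd Hn (Q x N) (Q y N)"
 then obtain c d where cd: "c \<in> V" "d \<in> V" "Q \<zero> 0 = Q (x \<otimes> c \<oplus> y \<otimes> d) N" using hadd_Q x y by blast
 have cc: "c \<in> carrier R" "d \<in> carrier R" "c \<in> Units R" "inv c \<in> carrier R" using cd V_carrier V_unit by auto
 have "x \<otimes> c \<oplus> y \<otimes> d = \<zero>" using cd Q_zero_iff[of "x \<otimes> c \<oplus> y \<otimes> d" N 0] x y cc by simp
 then have "y \<otimes> d = \<ominus> (x \<otimes> c)" using x y cc by (metis a_comm m_closed sum_zero_eq_neg)
 then have "y \<otimes> d \<otimes> inv c = \<ominus> (x \<otimes> (c \<otimes> inv c))" using x y cc by (simp add: l_minus m_assoc del: Units_r_inv)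
 then have "y \<otimes> (d \<otimes> inv c) = \<ominus> x" using x y cc by (simp add: m_assoc)
 then show "Q y N = Q (\<ominus> x) N" using Q_eq_same[of y "\<ominus> x" N] x y V_mult[OF cd(2) V_inv[OF cd(1)]] by auto
next
 assume "Q y N = Q (\<ominus> x) N"
 then obtain c where c: "c \<in> V" "y \<otimes> c = \<ominus> x" using Q_eq_same[of y "\<ominus> x" N] x y by auto
 then have "x \<otimes> \<one> \<oplus> y \<otimes> c = \<zero>" using x by (simp add: r_neg)
 then have "Q \<zero> 0 = Q (x \<otimes> \<one> \<oplus> y \<otimes> c) N" using Q_zero_iff[of \<zero> 0 N] by simp
 then show "Q \<zero> 0 \<in> hadd Hn (Q x N) (Q y N)" using hadd_Q[OF x y] c V_one by blast
qed

lemma hneg_Q: assumes x: "x \<in> carrier R" shows "hneg Hn (Q x N) = Q (\<ominus> x) N"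
 unfolding hneg_def
proof (rule the_equality)
 show "Q (\<ominus> x) N \<in> carrier Hn & hzero Hn \<in> hadd Hn (Q x N) (Q (\<ominus> x) N)" using neg_Q[of x "\<ominus> x" N] x by simp
next
 fix B assume B: "B \<in> carrier Hn & hzero Hn \<in> hadd Hn (Q x N) B"
 then obtain x' y M where xy: "x' \<in> carrier R" "y \<in> carrier R" "Q x N = Q x' M" "B = Q y M"
  using common2[of "Q x N" B] x by (metis Hn_simps(1) Q_in_CH)
 have "Q y M = Q (\<ominus> x') M" using neg_Q[OF xy(1,2), of M] B xy by simp
 obtain c where c: "c \<in> V" "\<pi>0 [^] M \<otimes> x \<otimes> c = \<pi>0 [^] N \<otimes> x'" using Q_eq x xy by blast
 have "\<pi>0 [^] M \<otimes> (\<ominus> x) \<otimes> c = \<pi>0 [^] N \<otimes> (\<ominus> x')"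
  using c V_carrier[OF c(1)] x xy pi0(1) by (simp add: r_minus l_minus)
 then have "Q (\<ominus> x) N = Q (\<ominus> x') M" using Q_eq[of "\<ominus> x" "\<ominus> x'" N M] x xy c by auto
 then show "B = Q (\<ominus> x) N" using xy \<open>Q y M = Q (\<ominus> x') M\<close> by simp
qed

lemma hsub_Q: "[|x \<in> carrier R; y \<in> carrier R|] ==> hsub Hn (Q x N) (Q y N) = hadd Hn (Q x N) (Q (\<ominus> y) N)"
 by (simp add: hsub_def hneg_Q)

lemma Hn_units: "comm_group \<lparr>carrier = carrier Hn - {hzero Hn}, monoid.mult = mult Hn, one = one Hn\<rparr>" (is "comm_group ?U")
proof (rule comm_groupI)
 show "\<one>\<^bsub>?U\<^esub>
   \<in> carrier ?U"
  using Q_zero_iff[of \<one> 0 0] by simp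
next
 fix A B assume "A \<in> carrier ?U"
  "B \<in> carrier ?U"
 then obtain x N y M where xy: "x \<in> carrier R" "A = Q x N" "y \<in> carrier R" "B = Q y M" "A ~= Q \<zero> 0" "B ~= Q \<zero> 0"
  by (auto simp: CH_def)
 then have "x ~= \<zero>" "y ~= \<zero>" using Q_zero_iff by auto
 then have "x \<otimes> y ~= \<zero>" using xy by (simp add: integral_iff)
 then show "A \<otimes>\<^bsub>?U\<^esub> B
   \<in> carrier ?U"
  using xy Q_mult Q_zero_iff[of "x \<otimes> y" "N + M" 0] by simp
 show "A \<otimes>\<^bsub>?U\<^esub> B =
   B \<otimes>\<^bsub>?U\<^esub> A"
  using xy Q_mult by (simp add: m_comm add.commute)
 fix C assume "C \<in> carrier ?U"
 then obtain z K where z: "z \<in> carrier R" "C = Q z K" by (auto simp: CH_def)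
 show "A \<otimes>\<^bsub>?U\<^esub> B
   \<otimes>\<^bsub>?U\<^esub> C =
   A \<otimes>\<^bsub>?U\<^esub>
   (B \<otimes>\<^bsub>?U\<^esub> C)"
  using xy z Q_mult by (simp add: m_assoc add.assoc)
next
 fix A assume "A \<in> carrier ?U"
 then obtain x N where x: "x \<in> carrier R" "A = Q x N" "A ~= Q \<zero> 0" by (auto simp: CH_def)
 then have nz: "x ~= \<zero>" using Q_zero_iff by auto
 show "\<one>\<^bsub>?U\<^esub>
   \<otimes>\<^bsub>?U\<^esub> A = A"
  using x Q_mult by simp
 obtain d where d: "d \<in> Units R" "x = \<pi>0 [^] v x \<otimes> d" using factor_v x nz by metis
 have dc: "d \<in> carrier R" "inv d \<in> carrier R" using d by auto
 define B where "B = Q (\<pi>0 [^] N \<otimes> inv d) (v x)"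
 have nz': "\<pi>0 [^] N \<otimes> inv d ~= \<zero>"
 proof -
  have "\<zero> \<notin> Units R" using Units_iff_notin_F1[of \<zero>] by simp
  then have "inv d ~= \<zero>" using Units_inv_Units[OF d(1)] by metis
  then show ?thesis using pi0_pow_nonzero[of N] dc pi0(1) by (simp add: integral_iff)
 qed
 have "B \<otimes>\<^bsub>Hn\<^esub> A = Q (\<pi>0 [^] N \<otimes> inv d \<otimes> x) (v x + N)" using x dc pi0(1) Q_mult by (simp add: B_def)
 also have "\<pi>0 [^] N \<otimes> inv d \<otimes> x = \<pi>0 [^] N \<otimes> (inv d \<otimes> d) \<otimes> \<pi>0 [^] v x"
 proof -
  have "\<pi>0 [^] N \<otimes> inv d \<otimes> (\<pi>0 [^] v x \<otimes> d) = \<pi>0 [^] N \<otimes> (inv d \<otimes> d) \<otimes> \<pi>0 [^] v x"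
   using dc pi0(1) by (simp add: m_ac del: Units_l_inv Units_r_inv)
  then show ?thesis using d(2) by metis
 qed
 also have "\<dots> = \<pi>0 [^] (v x + N) \<otimes> \<one>" using d pi0(1) by (simp add: nat_pow_mult add.commute)
 also have "Q \<dots> (v x + N) = Q \<one> 0" using Q_scale[of \<one> "v x + N" 0] by simp
 finally have "B \<otimes>\<^bsub>Hn\<^esub> A = Q \<one> 0" .
 moreover have "B ~= Q \<zero> 0" using nz' Q_zero_iff[of "\<pi>0 [^] N \<otimes> inv d" "v x" 0] dc pi0(1) by (simp add: B_def)
 moreover have "B \<in> CH" using dc pi0(1) by (auto simp: B_def)
 ultimately show "\<exists>B\<in>carrier ?U.
   B \<otimes>\<^bsub>?U\<^esub> A =
   \<one>\<^bsub>?U\<^esub>"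
  by auto
qed

lemma Hn_hyperfield: "hyperfield Hn"
proof (rule hyperfield.intro)
 show "hzero Hn \<in> carrier Hn" by simp
 show "comm_group \<lparr>carrier = carrier Hn - {hzero Hn}, monoid.mult = mult Hn, one = one Hn\<rparr>" by (rule Hn_units)
next
 fix A assume "A \<in> carrier Hn"
 then obtain x N where x: "x \<in> carrier R" "A = Q x N" by (auto simp: CH_def)
 show "hzero Hn \<otimes>\<^bsub>Hn\<^esub> A = hzero Hn" "A \<otimes>\<^bsub>Hn\<^esub> hzero Hn = hzero Hn"
  using x Q_mult Q_zero_iff[of \<zero> N 0] by simp_all
 show "hadd Hn A (hzero Hn) = {A}"
 proof (intro equalityI subsetI)
  fix D assume "D \<in> hadd Hn A (hzero Hn)"
  then have "D \<in> hadd Hn (Q x N) (Q \<zero> N)" using x Q_zero_iff[of \<zero> 0 N] by simp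
  then obtain c d where cd: "c \<in> V" "d \<in> V" "D = Q (x \<otimes> c \<oplus> \<zero> \<otimes> d) N" using hadd_Q x by blast
  then have "D = Q (x \<otimes> c) N" using x V_carrier by simp
  moreover have "Q x N = Q (x \<otimes> c) N" using Q_eq_same[of x "x \<otimes> c" N] x cd V_carrier by auto
  ultimately show "D \<in> {A}" using x by simp
 next
  fix D assume "D \<in> {A}"
  then have "D = Q (x \<otimes> \<one> \<oplus> \<zero> \<otimes> \<one>) N" using x by simp
  then have "D \<in> hadd Hn (Q x N) (Q \<zero> N)" using hadd_Q x(1) zero_closed V_one by blast
  then show "D \<in> hadd Hn A (hzero Hn)" using x Q_zero_iff[of \<zero> 0 N] by simp
 qed
 show "\<exists>!B. B \<in> carrier Hn & hzero Hn \<in> hadd Hn A B"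
 proof (rule ex1I)
  show "Q (\<ominus> x) N \<in> carrier Hn & hzero Hn \<in> hadd Hn A (Q (\<ominus> x) N)" using neg_Q[of x "\<ominus> x" N] x by simp
  fix B assume B: "B \<in> carrier Hn & hzero Hn \<in> hadd Hn A B"
  then obtain x' y M where xy: "x' \<in> carrier R" "y \<in> carrier R" "A = Q x' M" "B = Q y M"
   using common2[of A B] x by (metis Hn_simps(1) Q_in_CH)
  then have "B = Q (\<ominus> x') M" using neg_Q[OF xy(1,2), of M] B by simp
  also have "\<dots> = Q (\<ominus> x) N" using hneg_Q[OF xy(1), of M] hneg_Q[OF x(1), of N] x xy by simp
  finally show "B = Q (\<ominus> x) N" .
 qed
next
 fix A B assume "A \<in> carrier Hn" "B \<in> carrier Hn"
 then show "hadd Hn A B \<subseteq> carrier Hn" using hadd_Q_carrier[of A B] by auto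
 show "hadd Hn A B = hadd Hn B A" by (rule hadd_comm_Q)
next
 fix A B C assume "A \<in> carrier Hn" "B \<in> carrier Hn" "C \<in> carrier Hn"
 then have ABC: "A \<in> CH" "B \<in> CH" "C \<in> CH" by simp_all
 obtain x y z N where xyz: "x \<in> carrier R" "y \<in> carrier R" "z \<in> carrier R" "A = Q x N" "B = Q y N" "C = Q z N"
  by (rule common3[OF ABC])
 show "hset_add Hn {A} (hadd Hn B C) = hset_add Hn (hadd Hn A B) {C}"
 proof -
  have "hset_add Hn {A} (hadd Hn B C) = hset_add Hn (hadd Hn B C) {A}"
   by (simp add: hset_add_def hadd_comm_Q[of A])
  moreover have "D \<in> hset_add Hn (hadd Hn B C) {A} \<longleftrightarrow> D \<in> hset_add Hn (hadd Hn A B) {C}" for D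
  proof -
   have e: "y \<otimes> c \<oplus> z \<otimes> d \<oplus> x \<otimes> f = x \<otimes> f \<oplus> y \<otimes> c \<oplus> z \<otimes> d" if "c \<in> V" "d \<in> V" "f \<in> V" for c d f
    using that V_carrier xyz by (simp add: a_ac)
   show ?thesis unfolding xyz(4-6) hadd3[OF xyz(2,3,1)] hadd3[OF xyz(1-3)]
   proof (intro iffI; elim bexE)
    fix c d f assume "c \<in> V" "d \<in> V" "f \<in> V" "D = Q (y \<otimes> c \<oplus> z \<otimes> d \<oplus> x \<otimes> f) N"
    then show "\<exists>c\<in>V. \<exists>d\<in>V. \<exists>f\<in>V. D = Q (x \<otimes> c \<oplus> y \<otimes> d \<oplus> z \<otimes> f) N" using e[of c d f] by - (rule bexI[of _ f], rule bexI[of _ c], rule bexI[of _ d], simp_all)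
   next
    fix c d f assume "c \<in> V" "d \<in> V" "f \<in> V" "D = Q (x \<otimes> c \<oplus> y \<otimes> d \<oplus> z \<otimes> f) N"
    then show "\<exists>c\<in>V. \<exists>d\<in>V. \<exists>f\<in>V. D = Q (y \<otimes> c \<oplus> z \<otimes> d \<oplus> x \<otimes> f) N" using e[of d f c] by - (rule bexI[of _ d], rule bexI[of _ f], rule bexI[of _ c], simp_all)
   qed
  qed
  ultimately show ?thesis by blast
 qed
 show "(%D. D \<otimes>\<^bsub>Hn\<^esub> C) ` hadd Hn A B \<subseteq> hadd Hn (A \<otimes>\<^bsub>Hn\<^esub> C) (B \<otimes>\<^bsub>Hn\<^esub> C)"
 proof (intro subsetI, elim imageE)
  fix T D assume T: "T = D \<otimes>\<^bsub>Hn\<^esub> C" and "D \<in> hadd Hn A B"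
  then obtain c d where cd: "c \<in> V" "d \<in> V" "D = Q (x \<otimes> c \<oplus> y \<otimes> d) N" using hadd_Q xyz by blast
  have cc: "c \<in> carrier R" "d \<in> carrier R" using cd V_carrier by auto
  have e: "(x \<otimes> c \<oplus> y \<otimes> d) \<otimes> z = (x \<otimes> z) \<otimes> c \<oplus> (y \<otimes> z) \<otimes> d"
   by (use xyz cc in algebra)
  have "T = Q ((x \<otimes> z) \<otimes> c \<oplus> (y \<otimes> z) \<otimes> d) (N + N)"
   unfolding T cd(3) xyz(6) e[symmetric] using xyz cc by (simp add: Q_mult)
  then show "T \<in> hadd Hn (A \<otimes>\<^bsub>Hn\<^esub> C) (B \<otimes>\<^bsub>Hn\<^esub> C)"
   using xyz Q_mult hadd_Q[of "x \<otimes> z" "y \<otimes> z" T "N + N"] cd by auto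
 qed
 show "A \<in> hsub Hn B C \<longleftrightarrow> B \<in> hadd Hn A C"
 proof
  assume "A \<in> hsub Hn B C"
  then obtain c d where cd: "c \<in> V" "d \<in> V" "Q x N = Q (y \<otimes> c \<oplus> (\<ominus> z) \<otimes> d) N"
   using hsub_Q[of y z N] hadd_Q[of y "\<ominus> z" A N] xyz by auto
  have cc: "c \<in> carrier R" "d \<in> carrier R" using cd V_carrier by auto
  obtain f where f: "f \<in> V" "x \<otimes> f = y \<otimes> c \<oplus> (\<ominus> z) \<otimes> d" using Q_eq_same[of x "y \<otimes> c \<oplus> (\<ominus> z) \<otimes> d" N] cd xyz cc by auto
  have fc: "f \<in> carrier R" using f V_carrier by auto
  have "y \<otimes> c = x \<otimes> f \<oplus> z \<otimes> d" unfolding f(2) using xyz cc by (simp add: l_minus a_assoc l_neg)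
  then have "Q y N = Q (x \<otimes> f \<oplus> z \<otimes> d) N" using Q_eq_same[of y "x \<otimes> f \<oplus> z \<otimes> d" N] xyz cc fc cd by auto
  then show "B \<in> hadd Hn A C" unfolding xyz(4-6) using hadd_Q[OF xyz(1,3)] f(1) cd(2) by blast
 next
  assume "B \<in> hadd Hn A C"
  then obtain c d where cd: "c \<in> V" "d \<in> V" "Q y N = Q (x \<otimes> c \<oplus> z \<otimes> d) N" using hadd_Q[of x z B N] xyz by auto
  have cc: "c \<in> carrier R" "d \<in> carrier R" using cd V_carrier by auto
  obtain f where f: "f \<in> V" "y \<otimes> f = x \<otimes> c \<oplus> z \<otimes> d" using Q_eq_same[of y "x \<otimes> c \<oplus> z \<otimes> d" N] cd xyz cc by auto
  have fc: "f \<in> carrier R" using f V_carrier by auto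
  have "x \<otimes> c = y \<otimes> f \<oplus> (\<ominus> z) \<otimes> d" unfolding f(2) using xyz cc by (simp add: l_minus a_assoc r_neg)
  then have "Q x N = Q (y \<otimes> f \<oplus> (\<ominus> z) \<otimes> d) N" using Q_eq_same[of x "y \<otimes> f \<oplus> (\<ominus> z) \<otimes> d" N] xyz cc fc cd by auto
  then show "A \<in> hsub Hn B C" unfolding xyz(4-6) hsub_Q[OF xyz(2,3)] using hadd_Q[OF xyz(2) a_inv_closed[OF xyz(3)]] f(1) cd(2) by blast
 qed
qed

end

text \<open>The relation between a ring and its hyperfield, stated without reference to the construction of the latter. So
a given hyperfield can be recognized as the one of a ring.\<close>

locale truncation = R: cdvr_object R p e + H: normalized_hyperfield H e n
 for R :: "'u ring" (structure) and p e and H :: "'u pointed_hyperfield" and n +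
 fixes sp :: "'u => 'u"
 assumes n_gt: "n > e"
  and sp_Oh: "x \<in> carrier R ==> sp x \<in> H.Oh"
  and sp_surj: "a \<in> H.Oh ==> \<exists>x \<in> carrier R. sp x = a"
  and sp_one: "sp \<one> = \<one>\<^bsub>H\<^esub>"
  and sp_mult: "[|x \<in> carrier R; y \<in> carrier R|] ==> sp (x \<otimes> y) = sp x \<otimes>\<^bsub>H\<^esub> sp y"
  and sp_val: "x \<in> carrier R ==> H.E k \<le> val H (sp x) \<longleftrightarrow> x \<in> R.F k"
  and sp_add: "[|x \<in> carrier R; y \<in> carrier R|] ==> sp (x \<oplus> y) \<in> hadd H (sp x) (sp y)"
  and sp_p: "sp (nat_elem R p) = pelt H"
begin

lemma sp_pow: "x \<in> carrier R ==> sp (x [^] (k::nat)) = sp x [^]\<^bsub>H\<^esub> k"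
 by (induction k) (simp_all add: sp_one sp_mult)

lemma sp_carrier: "x \<in> carrier R ==> sp x \<in> carrier H" using sp_Oh H.Oh_carrier by blast

lemma sp_zero: "sp \<zero> = hzero H"
proof (rule ccontr)
 assume "sp \<zero> ~= hzero H"
 then obtain k where k: "val H (sp \<zero>) = H.E k" using H.val_Oh sp_Oh by blast
 have "H.E (Suc k) \<le> val H (sp \<zero>)" using sp_val[of \<zero> "Suc k"] by simp
 then show False unfolding k H.E_le by simp
qed

lemma sp_hom:
 assumes "0 < \<eta>" "\<eta> \<le> rho H" shows "(%x. hclass H \<eta> (sp x)) \<in> ring_hom R (hquot H \<eta>)"
proof (rule ring_hom_memI)
 fix x y assume x: "x \<in> carrier R" and y: "y \<in> carrier R"
 show "hclass H \<eta> (sp x) \<in> carrier (hquot H \<eta>)" using sp_Oh x by (simp add: H.Q_carrier[OF assms])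
 show "hclass H \<eta> (sp (x \<otimes> y)) = hclass H \<eta> (sp x) \<otimes>\<^bsub>hquot H \<eta>\<^esub> hclass H \<eta> (sp y)"
  using sp_Oh x y by (simp add: H.Q_mult[OF assms] sp_mult)
 show "hclass H \<eta> (sp (x \<oplus> y)) = hclass H \<eta> (sp x) \<oplus>\<^bsub>hquot H \<eta>\<^esub> hclass H \<eta> (sp y)"
  using H.Q_add[OF assms sp_Oh[OF x] sp_Oh[OF y] sp_add[OF x y]] by simp
qed (simp add: H.Q_one[OF assms] sp_one)

lemma sp_hom_res: "(%x. hclass H (theta H) (sp x)) \<in> ring_hom R (res_field H)"
 and sp_hom_trunc: "(%x. H.cr (sp x)) \<in> ring_hom R (trunc_ring H)"
 using sp_hom[OF H.theta_least(2) H.theta_le_rho] sp_hom[OF H.rho_pos order_refl]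
 by (simp_all add: res_field_def trunc_ring_def)

lemma res_cring: "cring (res_field H)"
 using H.Q_cring[OF H.theta_least(2) H.theta_le_rho] by (simp add: res_field_def)

lemma res_zero_iff: "x \<in> carrier R ==> hclass H (theta H) (sp x) = \<zero>\<^bsub>res_field H\<^esub> \<longleftrightarrow> x \<in> R.F 1"
 using H.cl_zero_iff[OF H.theta_least(2) H.theta_le_rho, of "sp x"] sp_Oh sp_val[of x 1] H.theta_E by (simp add: res_field_def)

lemma res_char: "ring_char (res_field H) = p"
proof -
 have e: "nat_elem (res_field H) k = \<zero>\<^bsub>res_field H\<^esub> \<longleftrightarrow> nat_elem (R Quot R.F 1) k = \<zero>\<^bsub>R Quot R.F 1\<^esub>" for k
  using R.hom_nat_elem[OF sp_hom_res res_cring, of k] res_zero_iff[of "nat_elem R k"] R.Quot_nat_elem_zero[of k] by simp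
 have "ring_char (res_field H) = ring_char (R Quot R.F 1)" by (simp only: ring_char_def e)
 then show ?thesis using R.R_facts(2) R.F_1 by simp
qed

lemma res_surj: "Y \<in> carrier (res_field H) ==> \<exists>x \<in> carrier R. Y = hclass H (theta H) (sp x)"
 using H.Q_carrier[OF H.theta_least(2) H.theta_le_rho] sp_surj by (auto simp: res_field_def) (metis imageE)

lemma res_eq_iff: "[|x \<in> carrier R; y \<in> carrier R|] ==>
 hclass H (theta H) (sp x) = hclass H (theta H) (sp y) \<longleftrightarrow> x \<ominus> y \<in> R.F 1"
proof -
 assume xy: "x \<in> carrier R" "y \<in> carrier R"
 interpret h: ring_hom_cring R "res_field H" "%x. hclass H (theta H) (sp x)"
  using sp_hom_res R.is_cring res_cring by (simp add: ring_hom_cring_def ring_hom_cring_axioms_def)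
 have "hclass H (theta H) (sp (x \<ominus> y)) = hclass H (theta H) (sp x) \<ominus>\<^bsub>res_field H\<^esub> hclass H (theta H) (sp y)"
  using xy by (simp add: a_minus_def)
 then show ?thesis using res_zero_iff[of "x \<ominus> y"] xy h.S.r_right_minus_eq h.hom_closed by simp
qed

lemma res_perfect: "perfect_field (res_field H)"
proof -
 interpret K: cring "res_field H" by (rule res_cring)
 interpret h: ring_hom_cring R "res_field H" "%x. hclass H (theta H) (sp x)"
  using sp_hom_res R.is_cring res_cring by (simp add: ring_hom_cring_def ring_hom_cring_axioms_def)
 have "field (res_field H)"
 proof (rule K.cring_fieldI, intro equalityI subsetI)
  fix Y assume Y: "Y \<in> Units (res_field H)"
  have "Y ~= \<zero>\<^bsub>res_field H\<^esub>"
  proof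
   assume "Y = \<zero>\<^bsub>res_field H\<^esub>"
   then have "Y \<otimes>\<^bsub>res_field H\<^esub> inv\<^bsub>res_field H\<^esub> Y = \<zero>\<^bsub>res_field H\<^esub>"
    using K.l_null[OF K.Units_inv_closed[OF Y]] by metis
   then have "\<one>\<^bsub>res_field H\<^esub> = \<zero>\<^bsub>res_field H\<^esub>" using K.Units_r_inv[OF Y] by simp
   then have "hclass H (theta H) (sp \<one>) = \<zero>\<^bsub>res_field H\<^esub>" using h.hom_one by simp
   then show False using res_zero_iff[of \<one>] R.one_notin_F1 by simp
  qed
  then show "Y \<in> carrier (res_field H) - {\<zero>\<^bsub>res_field H\<^esub>}" using Y by auto
 next
  fix Y assume "Y \<in> carrier (res_field H) - {\<zero>\<^bsub>res_field H\<^esub>}"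
  then obtain x where x: "x \<in> carrier R" "Y = hclass H (theta H) (sp x)" "x \<notin> R.F 1" using res_surj res_zero_iff by blast
  then have u: "x \<in> Units R" using R.Units_if_notin_F1 by blast
  have "hclass H (theta H) (sp (inv x)) \<otimes>\<^bsub>res_field H\<^esub> Y = \<one>\<^bsub>res_field H\<^esub>"
   "Y \<otimes>\<^bsub>res_field H\<^esub> hclass H (theta H) (sp (inv x)) = \<one>\<^bsub>res_field H\<^esub>"
   using u x h.hom_mult[of "inv x" x] h.hom_mult[of x "inv x"] h.hom_one by simp_all
  moreover have "hclass H (theta H) (sp (inv x)) \<in> carrier (res_field H)" using u h.hom_closed by simp
  moreover have "Y \<in> carrier (res_field H)" using x h.hom_closed by simp
  ultimately show "Y \<in> Units (res_field H)" unfolding Units_def by blast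
 qed
 moreover have "\<exists>y \<in> carrier (res_field H). y [^]\<^bsub>res_field H\<^esub> p = Y" if Y: "Y \<in> carrier (res_field H)" for Y
 proof -
  obtain x where x: "x \<in> carrier R" "Y = hclass H (theta H) (sp x)" using res_surj[OF Y] by blast
  obtain y where y: "y \<in> carrier R" "x \<ominus> y [^] p \<in> R.F 1" using R.perfect x by blast
  have "hclass H (theta H) (sp y) [^]\<^bsub>res_field H\<^esub> p = hclass H (theta H) (sp (y [^] p))"
   using ring_hom_ring.hom_nat_pow[OF ring_hom_ringI2[OF R.ring_axioms K.ring_axioms sp_hom_res] y(1)] by simp
  also have "\<dots> = Y" using res_eq_iff[of x "y [^] p"] x y by simp
  finally show ?thesis using h.hom_closed[OF y(1)] by blast
 qed
 ultimately show ?thesis unfolding perfect_field_def res_char by blast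
qed

lemma sp_pi_val: assumes "R.unif x" shows "val H (sp x) = H.E 1"
proof -
 have xc: "x \<in> carrier R" using assms by (simp add: R.unif_def)
 have "x \<notin> R.F (Suc 1)"
 proof
  assume "x \<in> R.F (Suc 1)"
  then have "x [^] (1::nat) \<otimes> \<one> \<in> R.F (1 + 1)" using xc by simp
  then show False using R.unif_div[OF assms R.one_closed] R.one_notin_F1 by blast
 qed
 then have a: "H.E 1 \<le> val H (sp x)" "\<not> H.E (Suc 1) \<le> val H (sp x)" using sp_val xc R.unif_F1[OF assms] by auto
 then have "sp x ~= hzero H" by auto
 then obtain k where "val H (sp x) = H.E k" using H.val_Oh sp_Oh xc by blast
 then show ?thesis using a by (simp add: H.E_le) (metis le_antisym not_less_eq_eq One_nat_def)
qed

lemma sp_unit_val: assumes "u \<in> Units R" shows "val H (sp u) = 0"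
 using H.not_E1[OF sp_Oh] sp_val[of u 1] R.Units_iff_notin_F1[of u] assms R.Units_closed by blast

lemma HF_object: "H \<in> HF_objects p e n"
proof (rule HF_objectI)
 show "discrete_valued_hyperfield H" by (rule H.discrete_valued_hyperfield_axioms)
 show "pelt_over H p e" unfolding pelt_over_def
 proof (intro conjI)
  obtain u where u: "u \<in> carrier R" "nat_elem R p = R.\<pi>0 [^] e \<otimes> u" using R.p_in_Fe R.mem_F by blast
  have "u \<notin> R.F 1"
  proof
   assume "u \<in> R.F 1"
   then have "nat_elem R p \<in> R.F (e + 1)" unfolding u(2)
    by (intro R.F_mult) (use R.mem_F R.pi0(1) in \<open>auto intro!: bexI[of _ \<one>]\<close>)
   then show False using R.p_notin by simp
  qed
  then have uu: "u \<in> Units R" using R.Units_if_notin_F1 u by blast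
  have "pelt H = sp u \<otimes>\<^bsub>H\<^esub> sp R.\<pi>0 [^]\<^bsub>H\<^esub> e"
   unfolding sp_p[symmetric] u(2) using u R.pi0(1) by (simp add: sp_mult sp_pow H.m_comm sp_carrier)
  then show "\<exists>a\<in>carrier H. \<exists>\<pi>\<in>carrier H. val H \<pi> = ereal (theta H) & val H a = 0 & pelt H = a \<otimes>\<^bsub>H\<^esub> \<pi> [^]\<^bsub>H\<^esub> e"
   using sp_pi_val[OF R.unif_pi0] sp_unit_val[OF uu] H.theta_E sp_carrier u(1) R.pi0(1) by auto
  show "H.cr (pelt H) = nat_elem (trunc_ring H) p"
   using R.hom_nat_elem[OF sp_hom_trunc H.Rh_cring, of p] by (simp add: sp_p)
 qed
qed (use res_char res_perfect n_gt H.e_pos H.normalized H.len in auto)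

end

context truncated_field begin

sublocale HH: hyperfield Hn by (rule Hn_hyperfield)

lemma n_pos: "n > 0" using n_gt by simp

lemma hadd_Q_mem:
 assumes x: "x \<in> carrier R" "x ~= \<zero>" and y: "y \<in> F (v x)" and s: "s \<in> carrier R"
 shows "Q s N \<in> hadd Hn (Q x N) (Q y N) \<longleftrightarrow> s \<ominus> (x \<oplus> y) \<in> F (v x + n)"
proof
 have yc: "y \<in> carrier R" using y F_carrier by blast
 have xF: "x \<in> F (v x)" using v_iff x by simp
 {
  assume "Q s N \<in> hadd Hn (Q x N) (Q y N)"
  then obtain c d where cd: "c \<in> V" "d \<in> V" "Q s N = Q (x \<otimes> c \<oplus> y \<otimes> d) N" using hadd_Q x yc by blast
  have cc: "c \<in> carrier R" "d \<in> carrier R" using cd V_carrier by auto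
  obtain f where f: "f \<in> V" "(x \<otimes> c \<oplus> y \<otimes> d) \<otimes> f = s"
   using Q_eq_same[of "x \<otimes> c \<oplus> y \<otimes> d" s N] cd s x yc cc by auto
  have fc: "f \<in> carrier R" using f V_carrier by auto
  have "x \<otimes> (c \<otimes> f \<ominus> \<one>) \<oplus> y \<otimes> (d \<otimes> f \<ominus> \<one>) \<in> F (v x + n)"
   using V_mult[OF cd(1) f(1)] V_mult[OF cd(2) f(1)] F_mult[OF xF] F_mult[OF y] F_add by (simp add: V_def)
  moreover have "x \<otimes> (c \<otimes> f \<ominus> \<one>) \<oplus> y \<otimes> (d \<otimes> f \<ominus> \<one>) = (x \<otimes> c \<oplus> y \<otimes> d) \<otimes> f \<ominus> (x \<oplus> y)"
   by (use x yc cc fc in algebra)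
  ultimately show "s \<ominus> (x \<oplus> y) \<in> F (v x + n)" using f by simp }
 assume "s \<ominus> (x \<oplus> y) \<in> F (v x + n)"
 then obtain t where t: "t \<in> F n" "s \<ominus> (x \<oplus> y) = x \<otimes> t" using divide_F[OF x, of _ n] by (metis add.commute)
 have tc: "t \<in> carrier R" using t F_carrier by blast
 have "(\<one> \<oplus> t) \<ominus> \<one> = t" by (use tc in algebra)
 then have V: "\<one> \<oplus> t \<in> V" using t tc by (simp add: V_def)
 have "s = (x \<oplus> y) \<oplus> (s \<ominus> (x \<oplus> y))" using plus_minus_cancel[of "x \<oplus> y" s] x yc s by simp
 also have "\<dots> = x \<otimes> (\<one> \<oplus> t) \<oplus> y \<otimes> \<one>"
  unfolding t(2) using x yc tc by (simp add: r_distr a_ac)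
 finally show "Q s N \<in> hadd Hn (Q x N) (Q y N)" using hadd_Q[of x y] x yc V V_one by blast
qed

lemma v_add_small:
 assumes a: "a \<in> carrier R" "a ~= \<zero>" and z: "z \<in> F (Suc (v a))" shows "a \<oplus> z ~= \<zero> & v (a \<oplus> z) = v a"
proof -
 have zc: "z \<in> carrier R" using z F_carrier by blast
 have "a \<oplus> z \<notin> F (Suc (v a))"
 proof
  assume "a \<oplus> z \<in> F (Suc (v a))"
  then have "(a \<oplus> z) \<ominus> z \<in> F (Suc (v a))" using z F_diff by blast
  moreover have "(a \<oplus> z) \<ominus> z = a" by (use a zc in algebra)
  ultimately show False using v_iff[OF a, of "Suc (v a)"] by simp
 qed
 moreover have "a \<in> F (v a)" using v_iff[OF a, of "v a"] by simp
 then have "a \<oplus> z \<in> F (v a)" using F_add F_monoD[OF z, of "v a"] by simp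
 ultimately show ?thesis using v_eqI by auto
qed

lemma hadd_cases:
 assumes "A \<in> CH" "B \<in> CH"
 shows "(A = Q \<zero> 0 & B = Q \<zero> 0) \<or> (\<exists>x y N. x \<in> carrier R & x ~= \<zero> & y \<in> F (v x) &
  hadd Hn A B = hadd Hn (Q x N) (Q y N) & min (val Hn A) (val Hn B) = val Hn (Q x N))"
proof -
 obtain x y N where xy: "x \<in> carrier R" "y \<in> carrier R" "A = Q x N" "B = Q y N" using common2 assms by metis
 have val_le: "val Hn (Q a N) \<le> val Hn (Q b N)" if "a \<in> carrier R" "b \<in> carrier R" "a ~= \<zero>" "b \<in> F (v a)" for a b
  using that v_iff[of b "v a"] e_pos by (auto simp: Q_val divide_right_mono)
 show ?thesis
 proof (cases "x = \<zero> & y = \<zero>")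
  case True
  then show ?thesis using xy Q_zero_iff[of \<zero> N 0] by simp
 next
  case False
  have "(x ~= \<zero> & y \<in> F (v x)) \<or> (y ~= \<zero> & x \<in> F (v y))"
   using False v_iff[OF xy(1)] v_iff[OF xy(2)] by (cases "x = \<zero>"; cases "y = \<zero>") (auto simp: linear)
  then show ?thesis
  proof
   assume a: "x ~= \<zero> & y \<in> F (v x)"
   then have "min (val Hn A) (val Hn B) = val Hn (Q x N)" using val_le[OF xy(1,2)] xy by (simp add: min_def)
   then show ?thesis using a xy by blast
  next
   assume a: "y ~= \<zero> & x \<in> F (v y)"
   then have "min (val Hn A) (val Hn B) = val Hn (Q y N)" using val_le[OF xy(2,1)] xy by (simp add: min_absorb2)
   moreover have "hadd Hn A B = hadd Hn (Q y N) (Q x N)" unfolding xy by (rule hadd_comm_Q)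
   ultimately show ?thesis using a xy by blast
  qed
 qed
qed

lemma hadd_elem: assumes x: "x \<in> carrier R" "y \<in> carrier R" and D: "D \<in> hadd Hn (Q x N) (Q y N)"
 obtains s where "s \<in> carrier R" "D = Q s N"
proof -
 obtain c d where cd: "c \<in> V" "d \<in> V" "D = Q (x \<otimes> c \<oplus> y \<otimes> d) N" using hadd_Q[OF x] D by blast
 have "x \<otimes> c \<oplus> y \<otimes> d \<in> carrier R" using x cd V_carrier by auto
 then show thesis using that cd by blast
qed

lemma hadd_val_const:
 assumes x: "x \<in> carrier R" "x ~= \<zero>" and y: "y \<in> F (v x)" and z: "Q \<zero> 0 \<notin> hadd Hn (Q x N) (Q y N)"
  and D: "D \<in> hadd Hn (Q x N) (Q y N)"
 shows "val Hn D = val Hn (Q (x \<oplus> y) N)"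
proof -
 have yc: "y \<in> carrier R" using y F_carrier by blast
 obtain s where s: "s \<in> carrier R" "D = Q s N" using hadd_elem x yc D by metis
 have sF: "s \<ominus> (x \<oplus> y) \<in> F (v x + n)" using hadd_Q_mem[OF x y s(1)] D s by simp
 have "Q \<zero> N \<notin> hadd Hn (Q x N) (Q y N)" using z Q_zero_iff[of \<zero> N 0] by simp
 then have "\<zero> \<ominus> (x \<oplus> y) \<notin> F (v x + n)" using hadd_Q_mem[OF x y, of \<zero>] by simp
 then have nF: "x \<oplus> y \<notin> F (v x + n)" using F_diff[OF F_zero] by blast
 have xy: "x \<oplus> y \<in> carrier R" "x \<oplus> y ~= \<zero>" using nF x yc by auto
 have "v (x \<oplus> y) < v x + n" using v_iff[OF xy, of "v x + n"] nF by simp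
 then have "s \<ominus> (x \<oplus> y) \<in> F (Suc (v (x \<oplus> y)))" using F_monoD[OF sF] by simp
 then have "s ~= \<zero> & v s = v (x \<oplus> y)"
  using v_add_small[OF xy] plus_minus_cancel[OF xy(1) s(1)] by metis
 then show ?thesis using s xy by (simp add: Q_val)
qed

lemma val_diff_Q:
 assumes s: "s \<in> carrier R" and t: "t \<in> carrier R" and ne: "Q s N ~= Q t N"
 shows "val_diff Hn (Q s N) (Q t N) = val Hn (Q (s \<ominus> t) N)"
proof -
 have z: "Q \<zero> 0 \<notin> hadd Hn (Q s N) (Q (\<ominus> t) N)"
  using HH.zero_in_hsub_iff[of "Q s N" "Q t N"] ne s t hsub_Q[OF s t] by simp
 have const: "val Hn D = val Hn (Q (s \<ominus> t) N)" if D: "D \<in> hadd Hn (Q s N) (Q (\<ominus> t) N)" for D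
 proof (cases "s ~= \<zero> & \<ominus> t \<in> F (v s)")
  case True then show ?thesis using hadd_val_const[OF s _ _ z D] by (simp add: minus_eq)
 next
  case False
  have "\<ominus> t ~= \<zero> & s \<in> F (v (\<ominus> t))"
  proof -
   have "\<ominus> t ~= \<zero>"
   proof
    assume "\<ominus> t = \<zero>"
    then show False using False s ne t F_zero by (metis minus_minus minus_zero)
   qed
   then show ?thesis using False v_iff[of s] v_iff[of "\<ominus> t"] s t by (cases "s = \<zero>") auto
  qed
  then have "val Hn D = val Hn (Q (\<ominus> t \<oplus> s) N)"
   using hadd_val_const[of "\<ominus> t" s N D] z D t by (simp add: hadd_comm_Q[of "Q s N"])
  then show ?thesis using s t by (simp add: minus_eq a_comm)
 qed
 have "Q (s \<ominus> t) N \<in> hadd Hn (Q s N) (Q (\<ominus> t) N)"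
  using hadd_Q[OF s, of "\<ominus> t" "Q (s \<ominus> t) N" N] s t V_one by (auto simp: minus_eq intro!: bexI[of _ \<one>])
 note mem = this
 show ?thesis unfolding val_diff_def hsub_Q[OF s t]
 proof (rule the_equality)
  show "\<forall>\<gamma>\<in>hadd Hn (Q s N) (Q (\<ominus> t) N). val Hn \<gamma> = val Hn (Q (s \<ominus> t) N)" using const by blast
 qed (use mem in auto)
qed

lemma hadd_ball_Q:
 assumes x: "x \<in> carrier R" "x ~= \<zero>" and y: "y \<in> F (v x)" and D: "D \<in> CH"
 shows "D \<in> hadd Hn (Q x N) (Q y N) \<longleftrightarrow>
  D = Q (x \<oplus> y) N \<or> val_diff Hn D (Q (x \<oplus> y) N) \<ge> ereal (real n / real e) + val Hn (Q x N)"
proof -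
 have same: "Q s N \<in> hadd Hn (Q x N) (Q y N) \<longleftrightarrow>
   Q s N = Q (x \<oplus> y) N \<or> val_diff Hn (Q s N) (Q (x \<oplus> y) N) \<ge> ereal (real n / real e) + val Hn (Q x N)"
  if x: "x \<in> carrier R" "x ~= \<zero>" and y: "y \<in> F (v x)" and s: "s \<in> carrier R" for x y s N
 proof (cases "Q s N = Q (x \<oplus> y) N")
  case True
  have yc: "y \<in> carrier R" using y F_carrier by blast
  have "Q (x \<oplus> y) N \<in> hadd Hn (Q x N) (Q y N)"
   using hadd_Q_mem[OF x y, of "x \<oplus> y"] x yc by simp
  then show ?thesis using True by simp
 next
  case False
  have yc: "y \<in> carrier R" using y F_carrier by blast
  have d: "s \<ominus> (x \<oplus> y) \<in> carrier R" "s \<ominus> (x \<oplus> y) ~= \<zero>" using False s x yc by auto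
  have "val_diff Hn (Q s N) (Q (x \<oplus> y) N) = ereal ((real (v (s \<ominus> (x \<oplus> y))) - real N) / real e)"
   using val_diff_Q[OF s _ False] x yc d Q_val[OF d(1)] by simp
  moreover have "ereal (real n / real e) + val Hn (Q x N) = ereal ((real (v x + n) - real N) / real e)"
   using x by (simp add: Q_val add_divide_distrib diff_divide_distrib)
  ultimately have "val_diff Hn (Q s N) (Q (x \<oplus> y) N) \<ge> ereal (real n / real e) + val Hn (Q x N) \<longleftrightarrow> v x + n \<le> v (s \<ominus> (x \<oplus> y))"
   using e_pos by (simp add: divide_le_cancel) linarith
  also have "\<dots> \<longleftrightarrow> s \<ominus> (x \<oplus> y) \<in> F (v x + n)" using v_iff[OF d] by simp
  finally show ?thesis using hadd_Q_mem[OF x y s] False by simp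
 qed
 have yc: "y \<in> carrier R" using y F_carrier by blast
 obtain d M where d: "d \<in> carrier R" "D = Q d M" using D common1 by metis
 define x' y' s where "x' = \<pi>0 [^] M \<otimes> x" "y' = \<pi>0 [^] M \<otimes> y" "s = \<pi>0 [^] N \<otimes> d"
 have c: "x' \<in> carrier R" "s \<in> carrier R" "x' ~= \<zero>" using d x yc pi0(1) pi0_pow_nonzero[of M] by (auto simp: x'_y'_s_def integral_iff)
 have "v x' = M + v x" using v_mult[of "\<pi>0 [^] M" x] x pi0(1) pi0_pow_nonzero[of M] v_pi by (simp add: x'_y'_s_def)
 then have y': "y' \<in> F (v x')" using F_mult[OF pi0_pow_in_F y] by (simp add: x'_y'_s_def)
 have e: "Q x N = Q x' (N + M)" "Q y N = Q y' (N + M)" "D = Q s (N + M)" "Q (x \<oplus> y) N = Q (x' \<oplus> y') (N + M)"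
  using Q_scale[of x M N] Q_scale[of y M N] Q_scale[of d N M] Q_scale[of "x \<oplus> y" M N] x yc d pi0(1)
  by (simp_all add: x'_y'_s_def r_distr add.commute)
 show ?thesis unfolding e by (rule same[OF c(1,3) y' c(2)])
qed

lemma Hn_value_group: "value_group Hn = range (%k::int. of_int k / real e)"
proof (intro equalityI subsetI)
 fix r assume "r \<in> value_group Hn"
 then obtain x N where "x \<in> carrier R" "val Hn (Q x N) = ereal r" by (auto simp: value_group_def CH_def)
 then have "r = (real (v x) - real N) / real e" using Q_val[of x N] by (auto split: if_splits)
 then have "r = of_int (int (v x) - int N) / real e" by simp
 then show "r \<in> range (%k::int. of_int k / real e)" by blast
next
 fix r assume "r \<in> range (%k::int. of_int k / real e)"
 then obtain k :: int where k: "r = of_int k / real e" by blast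
 have "Q (\<pi>0 [^] nat k) (nat (- k)) \<in> CH" "val Hn (Q (\<pi>0 [^] nat k) (nat (- k))) = ereal r"
  using pi0(1) pi0_pow_nonzero[of "nat k"] v_pi[of "nat k"] k by (auto simp: Q_val)
 moreover have "Q (\<pi>0 [^] nat k) (nat (- k)) ~= Q \<zero> 0" using Q_zero_iff[of "\<pi>0 [^] nat k" "nat (- k)" 0] pi0(1) pi0_pow_nonzero[of "nat k"] by simp
 ultimately show "r \<in> value_group Hn" unfolding value_group_def by auto
qed

lemma Hn_radius: "is_radius Hn (real n / real e)"
 unfolding is_radius_def
proof (intro conjI ballI)
 have "real n / real e = of_int (int n) / real e" by simp
 then show "real n / real e \<in> value_group Hn" unfolding Hn_value_group by blast
 fix A B assume "A \<in> carrier Hn" "B \<in> carrier Hn"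
 then have AB: "A \<in> CH" "B \<in> CH" by simp_all
 show "is_closed_ball Hn (ereal (real n / real e) + min (val Hn A) (val Hn B)) (hadd Hn A B)"
  using hadd_cases[OF AB]
 proof (elim disjE exE conjE)
  assume z: "A = Q \<zero> 0" "B = Q \<zero> 0"
  have "val_diff Hn D (Q \<zero> 0) ~= \<infinity>" if D: "D \<in> CH" "D ~= Q \<zero> 0" for D
  proof -
   obtain d M where d: "d \<in> carrier R" "D = Q d M" using D common1 by metis
   have "Q d M ~= Q \<zero> M" "d ~= \<zero>" using d D Q_zero_iff[of \<zero> M 0] Q_zero_iff[of d M 0] by auto
   then have "val_diff Hn D (Q \<zero> M) ~= \<infinity>" using val_diff_Q[of d \<zero> M] d by (simp add: minus_eq Q_val)
   then show ?thesis using Q_zero_iff[of \<zero> M 0] by simp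
  qed
  then have "closed_ball Hn (Q \<zero> 0) \<infinity> = {Q \<zero> 0}" by (auto simp: closed_ball_def)
  moreover have "hadd Hn A B = {Q \<zero> 0}" using HH.hadd_zero[of "Q \<zero> 0"] z by simp
  ultimately show ?thesis unfolding is_closed_ball_def using z by (intro bexI[of _ "Q \<zero> 0"]) (auto simp: Q_val)
 next
  fix x y N assume x: "x \<in> carrier R" "x ~= \<zero>" "y \<in> F (v x)" and h: "hadd Hn A B = hadd Hn (Q x N) (Q y N)"
   and m: "min (val Hn A) (val Hn B) = val Hn (Q x N)"
  have yc: "y \<in> carrier R" using x F_carrier by blast
  have "hadd Hn (Q x N) (Q y N) \<subseteq> CH" using hadd_Q_carrier[of "Q x N" "Q y N"] x yc by auto
  then have "hadd Hn A B = closed_ball Hn (Q (x \<oplus> y) N) (ereal (real n / real e) + val Hn (Q x N))"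
   unfolding h closed_ball_def using hadd_ball_Q[OF x] by auto
  then show ?thesis unfolding is_closed_ball_def m using x yc by (intro bexI[of _ "Q (x \<oplus> y) N"]) auto
 qed
qed

lemma Hn_dvh: "discrete_valued_hyperfield Hn"
proof (intro discrete_valued_hyperfield.intro Hn_hyperfield discrete_valued_hyperfield_axioms.intro)
 fix A assume "A \<in> carrier Hn"
 then obtain x N where x: "x \<in> carrier R" "A = Q x N" by (auto simp: CH_def)
 show "val Hn A ~= - \<infinity>" "val Hn A = \<infinity> \<longleftrightarrow> A = hzero Hn" using x Q_zero_iff[of x N 0] by (auto simp: Q_val)
next
 fix A B assume "A \<in> carrier Hn" "B \<in> carrier Hn"
 then obtain x N y M where xy: "x \<in> carrier R" "A = Q x N" "y \<in> carrier R" "B = Q y M" by (auto simp: CH_def)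
 show "val Hn (A \<otimes>\<^bsub>Hn\<^esub> B) = val Hn A + val Hn B"
  using xy v_mult[of x y] by (auto simp: Q_mult Q_val integral_iff diff_divide_distrib add_divide_distrib)
next
 show "discrete (value_group Hn)"
 proof (rule discreteI)
  fix r assume r: "r \<in> value_group Hn"
  then obtain k :: int where k: "r = of_int k / real e" by (auto simp: Hn_value_group)
  have "\<exists>d>0. \<forall>y\<in>value_group Hn. dist r y < d --> y = r"
  proof (intro exI[of _ "1 / real e"] conjI ballI impI)
   fix y assume "y \<in> value_group Hn" and d: "dist r y < 1 / real e"
   then obtain j :: int where j: "y = of_int j / real e" by (auto simp: Hn_value_group)
   have "\<bar>of_int k - of_int j\<bar> / real e < 1 / real e" using d e_pos by (simp add: dist_real_def k j abs_divide flip: diff_divide_distrib)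
   then have "\<bar>real_of_int k - of_int j\<bar> < 1" using e_pos by (simp add: divide_less_cancel)
   then have "k = j" by linarith
   then show "y = r" using k j by simp
  qed (use e_pos in simp)
  then show "r isolated_in value_group Hn" unfolding isolated_in_dist_Ex_iff using r by blast
 qed
 have "1 / real e \<in> value_group Hn" unfolding Hn_value_group by (intro range_eqI[of _ _ 1]) simp
 moreover have "1 / real e ~= 0" using e_pos by simp
 ultimately show "value_group Hn ~= {0}" by blast
 show "\<exists>\<rho>. is_radius Hn \<rho>" using Hn_radius by blast
next
 fix A B D assume "A \<in> carrier Hn" "B \<in> carrier Hn" and D: "D \<in> hadd Hn A B"
 then have AB: "A \<in> CH" "B \<in> CH" by simp_all
 show "min (val Hn A) (val Hn B) \<le> val Hn D" using hadd_cases[OF AB]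
 proof (elim disjE exE conjE)
  assume "A = Q \<zero> 0" "B = Q \<zero> 0"
  then show ?thesis using D HH.hadd_zero[of "Q \<zero> 0"] by simp
 next
  fix x y N assume x: "x \<in> carrier R" "x ~= \<zero>" "y \<in> F (v x)" and h: "hadd Hn A B = hadd Hn (Q x N) (Q y N)"
   and m: "min (val Hn A) (val Hn B) = val Hn (Q x N)"
  have yc: "y \<in> carrier R" using x F_carrier by blast
  obtain s where s: "s \<in> carrier R" "D = Q s N" using hadd_elem x(1) yc D h by metis
  have "s \<ominus> (x \<oplus> y) \<in> F (v x + n)" using hadd_Q_mem[OF x s(1)] D s h by simp
  then have "s \<ominus> (x \<oplus> y) \<in> F (v x)" using F_monoD by auto
  moreover have "x \<oplus> y \<in> F (v x)" using F_add v_iff[OF x(1,2)] x by auto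
  ultimately have "s \<in> F (v x)" using F_diff_mem s by blast
  then show ?thesis unfolding m using s x v_iff[of s "v x"] e_pos by (auto simp: Q_val divide_right_mono)
 qed
 fix D' assume z: "hzero Hn \<notin> hadd Hn A B" and D': "D' \<in> hadd Hn A B"
 show "val Hn D = val Hn D'" using hadd_cases[OF AB]
 proof (elim disjE exE conjE)
  assume "A = Q \<zero> 0" "B = Q \<zero> 0"
  then show ?thesis using z HH.hadd_zero[of "Q \<zero> 0"] by simp
 next
  fix x y N assume x: "x \<in> carrier R" "x ~= \<zero>" "y \<in> F (v x)" and h: "hadd Hn A B = hadd Hn (Q x N) (Q y N)"
  show ?thesis using hadd_val_const[OF x, of N D] hadd_val_const[OF x, of N D'] z D D' h by simp
 qed
qed

lemma Hn_normalized: "normalized_hyperfield Hn e n"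
proof -
 interpret D: discrete_valued_hyperfield Hn by (rule Hn_dvh)
 have one: "1 / real e \<in> value_group Hn" unfolding Hn_value_group by (intro range_eqI[of _ _ 1]) simp
 obtain k :: int where k: "theta Hn = of_int k / real e" using D.theta_least(1) by (auto simp: Hn_value_group)
 have "k > 0" using D.theta_least(2) e_pos unfolding k by (simp add: zero_less_divide_iff)
 then have "1 / real e \<le> theta Hn" unfolding k using e_pos by (simp add: divide_right_mono)
 moreover have "theta Hn \<le> 1 / real e" using D.theta_least(3)[OF one] e_pos by simp
 ultimately have t: "theta Hn = 1 / real e" by simp
 have "rho Hn = real n / real e" using D.is_radius_unique[OF Hn_radius] by simp
 then show ?thesis using t e_pos n_pos
  by (intro normalized_hyperfield.intro Hn_dvh normalized_hyperfield_axioms.intro) (auto simp: normalized_def has_length_def)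
qed

lemma Hn_truncation: "truncation R p e Hn n (%x. Q x 0)"
proof -
 interpret D: normalized_hyperfield Hn e n by (rule Hn_normalized)
 show ?thesis
 proof (intro truncation.intro truncation_axioms.intro cdvr_object_axioms Hn_normalized n_gt)
  fix x k assume x: "x \<in> carrier R"
  show "Q x 0 \<in> D.Oh" using x e_pos by (auto simp: D.Oh_iff Q_val zero_ereal_def)
  show "D.E k \<le> val Hn (Q x 0) \<longleftrightarrow> x \<in> F k"
   using x v_iff[of x k] e_pos by (auto simp: Q_val D.E_def divide_le_cancel)
  fix y assume y: "y \<in> carrier R"
  show "Q (x \<otimes> y) 0 = Q x 0 \<otimes>\<^bsub>Hn\<^esub> Q y 0" using x y by (simp add: Q_mult)
  have "Q (x \<oplus> y) 0 = Q (x \<otimes> \<one> \<oplus> y \<otimes> \<one>) 0" using x y by simp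
  then show "Q (x \<oplus> y) 0 \<in> hadd Hn (Q x 0) (Q y 0)" using hadd_Q[OF x y] V_one by blast
 next
  fix A assume A: "A \<in> D.Oh"
  then obtain x N where x: "x \<in> carrier R" "A = Q x N" by (auto simp: D.Oh_iff CH_def)
  show "\<exists>x\<in>carrier R. Q x 0 = A"
  proof (cases "x = \<zero>")
   case True then show ?thesis using x Q_zero_iff[of \<zero> N 0] by auto
  next
   case False
   then have "0 \<le> (real (v x) - real N) / real e" using A x by (simp add: D.Oh_iff Q_val zero_ereal_def)
   then have "N \<le> v x" using e_pos by (simp add: zero_le_divide_iff)
   then have "x \<in> F N" using v_iff[OF x(1) False] by simp
   then obtain r where r: "r \<in> carrier R" "x = \<pi>0 [^] N \<otimes> r" using mem_F by blast
   then have "A = Q r 0" using Q_scale[OF r(1), of N 0] x by simp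
   then show ?thesis using r by blast
  qed
 qed simp_all
qed

end

lemma seq_universe_enc:
 assumes "seq_closed_universe TYPE('u)" and ab: "(a::'u) ~= b"
 shows "\<exists>enc :: 'u \<times> nat => 'u. inj enc"
proof -
 obtain c :: "(nat => 'u) => 'u" where c: "inj c" using assms unfolding seq_closed_universe_def by blast
 define g where "g z = (%i. if i = 0 then fst z else if i \<le> snd z then a else b)" for z :: "'u \<times> nat"
 have "inj g"
 proof (rule injI)
  fix z w assume eq: "g z = g w"
  have "fst z = fst w" using fun_cong[OF eq, of 0] by (simp add: g_def)
  moreover have "(i \<le> snd z) = (i \<le> snd w)" if "i > 0" for i
   using fun_cong[OF eq, of i] ab that by (auto simp: g_def split: if_splits)
  then have "snd z = snd w" by (metis le_antisym order_refl not_gr_zero le_zero_eq)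
  ultimately show "z = w" by (simp add: prod_eq_iff)
 qed
 then have "inj (c \<circ> g)" using c by (rule inj_compose[rotated])
 then show ?thesis by blast
qed

section \<open>Homomorphisms of truncations\<close>

lemma (in perfect_residue_ring) teich_ring_hom:
 assumes "perfect_residue_ring S F' p" "h \<in> ring_hom R S" "t \<in> teich"
 shows "h t \<in> perfect_residue_ring.teich S p"
proof -
 interpret S: perfect_residue_ring S F' p by fact
 show ?thesis unfolding S.teich_def
 proof (intro CollectI conjI allI)
  show "h t \<in> carrier S" by (rule ring_hom_closed[OF assms(2) teich_carrier[OF assms(3)]])
  fix j :: nat
  obtain y where y: "y \<in> carrier R" "y [^] (p ^ j) = t" using assms(3) unfolding teich_def by blast
  have "h y [^]\<^bsub>S\<^esub> (p ^ j) = h t"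
   using ring_hom_ring.hom_nat_pow[OF ring_hom_ringI2[OF ring_axioms S.ring_axioms assms(2)] y(1), of "p ^ j"] y(2) by simp
  then show "\<exists>y \<in> carrier S. y [^]\<^bsub>S\<^esub> (p ^ j) = h t" using ring_hom_closed[OF assms(2) y(1)] by blast
 qed
qed

lemma ring_hom_diff:
 assumes "cring R" "cring S" "h \<in> ring_hom R S" "x \<in> carrier R" "y \<in> carrier R"
 shows "h (x \<ominus>\<^bsub>R\<^esub> y) = h x \<ominus>\<^bsub>S\<^esub> h y"
proof -
 interpret h: ring_hom_cring R S h using assms by (simp add: ring_hom_cring_def ring_hom_cring_axioms_def)
 show ?thesis using assms by (simp add: a_minus_def)
qed

text \<open>Comparing \<open>a = t + x b\<close> under both homomorphisms improves the agreement by one step of the filtration.\<close>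

lemma (in cdvr_object) hom_determined:
 assumes S: "filtered_ring S F'" and h: "h1 \<in> ring_hom R S" "h2 \<in> ring_hom R S"
  and x: "unif x" "h1 x = h2 x" "h1 x \<in> F' 1" and t: "!!t. t \<in> teich ==> h1 t = h2 t" and a: "a \<in> carrier R"
 shows "h1 a = h2 a"
proof -
 interpret S: filtered_ring S F' by fact
 have xc: "x \<in> carrier R" using x by (simp add: unif_def)
 have "h1 a \<ominus>\<^bsub>S\<^esub> h2 a \<in> F' m" for m using a
 proof (induction m arbitrary: a)
  case 0
  then show ?case using ring_hom_closed[OF h(1)] ring_hom_closed[OF h(2)] by (simp add: S.F_0)
 next
  case (Suc m)
  obtain t0 where t0: "t0 \<in> teich" "a \<ominus> t0 \<in> F 1" using teich_exists Suc.prems by blast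
  have tc: "t0 \<in> carrier R" using t0 teich_carrier by blast
  obtain b where b: "b \<in> carrier R" "a \<ominus> t0 = x \<otimes> b" using unif_mem[OF x(1), of "a \<ominus> t0" 1] t0 xc by auto
  have ab: "a = t0 \<oplus> x \<otimes> b" using plus_minus_cancel[OF tc Suc.prems] b by simp
  define A B X T where "A = h1 b" "B = h2 b" "X = h1 x" "T = h1 t0"
  have c: "A \<in> carrier S" "B \<in> carrier S" "X \<in> carrier S" "T \<in> carrier S"
   using h b xc tc ring_hom_closed unfolding A_B_X_T_def by metis+
  have "h1 a = T \<oplus>\<^bsub>S\<^esub> X \<otimes>\<^bsub>S\<^esub> A" "h2 a = T \<oplus>\<^bsub>S\<^esub> X \<otimes>\<^bsub>S\<^esub> B"
   unfolding ab A_B_X_T_def using xc tc b t[OF t0(1)] x(2) h by (simp_all add: ring_hom_add ring_hom_mult)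
  then have "h1 a \<ominus>\<^bsub>S\<^esub> h2 a = (T \<oplus>\<^bsub>S\<^esub> X \<otimes>\<^bsub>S\<^esub> A) \<ominus>\<^bsub>S\<^esub> (T \<oplus>\<^bsub>S\<^esub> X \<otimes>\<^bsub>S\<^esub> B)" by simp
  also have "\<dots> = X \<otimes>\<^bsub>S\<^esub> (A \<ominus>\<^bsub>S\<^esub> B)" by (use c in algebra)
  also have "\<dots> \<in> F' (1 + m)" using x(3) Suc.IH[OF b(1)] by (intro S.F_mult) (auto simp: A_B_X_T_def)
  finally show ?case by simp
 qed
 then show ?thesis by (rule S.F_eqI[OF ring_hom_closed[OF h(1) a] ring_hom_closed[OF h(2) a]])
qed

lemma (in cdvr_object) unifI:
 assumes "x \<in> F 1" "x \<notin> F (Suc 1)" shows "unif x"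
proof -
 obtain r where r: "r \<in> carrier R" "x = \<pi>0 \<otimes> r" using mem_F[of x 1] assms pi0(1) by auto
 have "r \<notin> F 1"
 proof
  assume "r \<in> F 1"
  then have "\<pi>0 \<otimes> r \<in> F (1 + 1)" using unif_F1[OF unif_pi0] by (intro F_mult)
  then show False using assms r by simp
 qed
 then have "r \<in> Units R" using r Units_if_notin_F1 by blast
 then show ?thesis using unif_mult_unit[OF unif_pi0, of r] r pi0(1) by (simp add: m_comm)
qed

lemma (in discrete_valued_hyperfield) hom_into_quotient:
 assumes "0 < \<eta>" "\<eta> \<le> rho H" and s: "!!x. x \<in> carrier R ==> s x \<in> Oh" "s \<one>\<^bsub>R\<^esub> = \<one>"
  "!!x y. [|x \<in> carrier R; y \<in> carrier R|] ==> s (x \<otimes>\<^bsub>R\<^esub> y) = s x \<otimes> s y"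
  "!!x y. [|x \<in> carrier R; y \<in> carrier R|] ==> s (x \<oplus>\<^bsub>R\<^esub> y) \<in> hadd H (s x) (s y)"
 shows "(%x. hclass H \<eta> (s x)) \<in> ring_hom R (hquot H \<eta>)"
proof (rule ring_hom_memI)
 fix x y assume x: "x \<in> carrier R" and y: "y \<in> carrier R"
 show "hclass H \<eta> (s x) \<in> carrier (hquot H \<eta>)" using s(1)[OF x] by (simp add: Q_carrier[OF assms(1,2)])
 show "hclass H \<eta> (s (x \<otimes>\<^bsub>R\<^esub> y)) = hclass H \<eta> (s x) \<otimes>\<^bsub>hquot H \<eta>\<^esub> hclass H \<eta> (s y)"
  using s(3)[OF x y] s(1)[OF x] s(1)[OF y] by (simp add: Q_mult[OF assms(1,2)])
 show "hclass H \<eta> (s (x \<oplus>\<^bsub>R\<^esub> y)) = hclass H \<eta> (s x) \<oplus>\<^bsub>hquot H \<eta>\<^esub> hclass H \<eta> (s y)"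
  using Q_add[OF assms(1,2) s(1)[OF x] s(1)[OF y] s(4)[OF x y]] by simp
qed (simp add: Q_one[OF assms(1,2)] s(2))

context truncation begin

lemma sp_neg: "x \<in> carrier R ==> sp (\<ominus> x) = hneg H (sp x)"
 using H.hneg_unique[of "sp x" "sp (\<ominus> x)"] sp_add[of x "\<ominus> x"] sp_carrier sp_zero by (simp add: R.r_neg)

lemma sp_diff: "[|x \<in> carrier R; y \<in> carrier R|] ==> sp (x \<ominus> y) \<in> hsub H (sp x) (sp y)"
 using sp_add[of x "\<ominus> y"] by (simp add: R.minus_eq hsub_def sp_neg)

lemma near_sp: assumes s: "s \<in> carrier R" and t: "t \<in> R.F i"
 shows "H.near (H.E (n + i)) (sp s) (sp t) \<longleftrightarrow> s \<ominus> t \<in> R.F (n + i)"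
proof -
 have tc: "t \<in> carrier R" using t R.F_carrier by blast
 note d = sp_diff[OF s tc]
 have st: "s \<ominus> t \<in> carrier R" using s tc by simp
 show ?thesis
 proof (cases "sp s = sp t")
  case True
  have "val H (sp (s \<ominus> t)) \<ge> ereal (rho H) + val H (sp t)"
   using d H.hsub_self_iff[OF sp_carrier[OF tc] sp_carrier[OF st]] True by simp
  moreover have "val H (sp t) \<ge> H.E i" using sp_val tc t by simp
  then have "ereal (rho H) + val H (sp t) \<ge> H.E (n + i)" unfolding H.rho_E H.E_add[symmetric] by (rule add_left_mono)
  ultimately have "val H (sp (s \<ominus> t)) \<ge> H.E (n + i)" by (rule order_trans[rotated])
  then show ?thesis using True sp_val[OF st] sp_carrier[OF tc] by simp
 next
  case False
  have "H.near (H.E (n + i)) (sp s) (sp t) \<longleftrightarrow> H.E (n + i) \<le> val H (sp (s \<ominus> t))"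
   using H.near_iff_val_diff[OF sp_carrier[OF s] sp_carrier[OF tc]] H.val_diff_eq[OF sp_carrier[OF s] sp_carrier[OF tc] False d] False by simp
  then show ?thesis using sp_val[OF st] by simp
 qed
qed

lemma val_sp: assumes "x \<in> R.F i" "x \<notin> R.F (Suc i)" shows "val H (sp x) = H.E i"
proof -
 have xc: "x \<in> carrier R" using assms R.F_carrier by blast
 have a: "H.E i \<le> val H (sp x)" "\<not> H.E (Suc i) \<le> val H (sp x)" using sp_val[OF xc] assms by auto
 then have "sp x ~= hzero H" by auto
 then obtain k where "val H (sp x) = H.E k" using H.val_Oh sp_Oh xc by blast
 then show ?thesis using a by (simp add: H.E_le) (metis le_antisym not_less_eq_eq)
qed

lemma sp_eq_iff: assumes "s \<in> carrier R" "t \<in> R.F i" "t \<notin> R.F (Suc i)"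
 shows "sp s = sp t \<longleftrightarrow> s \<ominus> t \<in> R.F (n + i)"
proof -
 have tc: "t \<in> carrier R" using assms R.F_carrier by blast
 have "H.near (H.E (n + i)) (sp s) (sp t) \<longleftrightarrow> sp s = sp t"
 proof
  assume "H.near (H.E (n + i)) (sp s) (sp t)"
  then have "H.near (ereal (rho H) + val H (sp t)) (sp t) (sp s)"
   using H.near_sym[of "H.E (n + i)" "sp s" "sp t"] sp_carrier[OF tc] sp_carrier[OF assms(1)] val_sp[OF assms(2,3)] by (simp add: H.rho_E H.E_add)
  then show "sp s = sp t" using H.near_imp_eq[of "sp t" "sp s"] H.rho_pos sp_carrier[OF tc] sp_carrier[OF assms(1)] by simp
 qed (use sp_carrier[OF assms(1)] in simp)
 then show ?thesis using near_sp[OF assms(1,2)] by simp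
qed

lemma sp_zero_iff: assumes x: "x \<in> carrier R" shows "sp x = hzero H \<longleftrightarrow> x = \<zero>"
proof
 assume z: "sp x = hzero H"
 have "x \<in> R.F k" for k using sp_val[OF x, of k] unfolding z by simp
 then show "x = \<zero>" by (rule R.F_separated[OF x])
qed (simp add: sp_zero)

text \<open>Hence the hyperaddition is determined by the ring and its valuation alone.\<close>

lemma hadd_sp_iff:
 assumes s: "s \<in> carrier R" and x: "x \<in> R.F i" and y: "y \<in> R.F i" and o: "x \<notin> R.F (Suc i) \<or> y \<notin> R.F (Suc i)"
 shows "sp s \<in> hadd H (sp x) (sp y) \<longleftrightarrow> s \<ominus> (x \<oplus> y) \<in> R.F (n + i)"
proof -
 have c: "x \<in> carrier R" "y \<in> carrier R" using R.F_carrier[OF x] R.F_carrier[OF y] .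
 have "min (val H (sp x)) (val H (sp y)) = H.E i"
  using o val_sp[OF x] val_sp[OF y] sp_val[OF c(1), of i] sp_val[OF c(2), of i] x y by (auto simp: min_def)
 then have "sp s \<in> hadd H (sp x) (sp y) \<longleftrightarrow> H.near (H.E (n + i)) (sp s) (sp (x \<oplus> y))"
  using H.hadd_ball[OF sp_carrier[OF c(1)] sp_carrier[OF c(2)] sp_add[OF c], of "sp s"] sp_carrier[OF s] by (simp add: H.rho_E H.E_add)
 then show ?thesis using near_sp[OF s R.F_add[OF x y]] by simp
qed

lemma exact_level: assumes "x \<in> carrier R" "x ~= \<zero>" obtains i where "x \<in> R.F i" "x \<notin> R.F (Suc i)"
proof -
 have "x \<in> R.F (R.v x)" "x \<notin> R.F (Suc (R.v x))" using R.v_iff[OF assms] by auto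
 then show thesis by (rule that)
qed

lemma sp_pi0_nonzero: "sp R.\<pi>0 ~= hzero H"
 using sp_zero_iff R.pi0(1) R.pi0_nonzero by simp

lemma represent: assumes a: "a \<in> carrier H"
 shows "\<exists>N::nat. \<exists>x \<in> carrier R. a \<otimes>\<^bsub>H\<^esub> sp R.\<pi>0 [^]\<^bsub>H\<^esub> N = sp x"
proof -
 have pc: "sp R.\<pi>0 \<in> carrier H" using sp_carrier R.pi0(1) by blast
 have "\<exists>N. a \<otimes>\<^bsub>H\<^esub> sp R.\<pi>0 [^]\<^bsub>H\<^esub> (N::nat) \<in> H.Oh"
 proof (cases "a = hzero H")
  case True
  then have "a \<otimes>\<^bsub>H\<^esub> sp R.\<pi>0 [^]\<^bsub>H\<^esub> (0::nat) \<in> H.Oh" using a by simp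
  then show ?thesis by blast
 next
  case False
  then obtain k :: int where k: "val H a = ereal (of_int k / real e)" using H.val_int a by blast
  have "val H (sp R.\<pi>0 [^]\<^bsub>H\<^esub> nat (- k)) = H.E (nat (- k))"
   using H.val_pow[OF pc, of "1 / real e" "nat (- k)"] sp_pi_val[OF R.unif_pi0] by (simp add: H.E_def)
  then have "val H (a \<otimes>\<^bsub>H\<^esub> sp R.\<pi>0 [^]\<^bsub>H\<^esub> nat (- k)) = ereal ((of_int k + real (nat (- k))) / real e)"
   using H.val_mult[OF a, of "sp R.\<pi>0 [^]\<^bsub>H\<^esub> nat (- k)"] pc k by (simp add: H.E_def add_divide_distrib)
  then have "a \<otimes>\<^bsub>H\<^esub> sp R.\<pi>0 [^]\<^bsub>H\<^esub> nat (- k) \<in> H.Oh" using a pc by (simp add: H.Oh_iff zero_ereal_def)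
  then show ?thesis by blast
 qed
 then obtain N :: nat where N: "a \<otimes>\<^bsub>H\<^esub> sp R.\<pi>0 [^]\<^bsub>H\<^esub> N \<in> H.Oh" by blast
 obtain x where "x \<in> carrier R" "sp x = a \<otimes>\<^bsub>H\<^esub> sp R.\<pi>0 [^]\<^bsub>H\<^esub> N" using sp_surj[OF N] by blast
 then show ?thesis by (intro exI[of _ N] bexI[of _ x]) simp_all
qed

end

locale truncation_pair = T1: truncation R p e H1 n sp1 + T2: truncation S p e H2 n sp2
 for R :: "'u ring" (structure) and p e and H1 :: "'u pointed_hyperfield" and n and sp1
  and S :: "'u ring" and H2 :: "'u pointed_hyperfield" and sp2
begin

context
 fixes f assumes f: "f \<in> CDVR_hom R S"
begin

lemma f_hom: "f \<in> ring_hom R S" using f by (simp add: CDVR_hom_def)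
lemma f_closed: "x \<in> carrier R ==> f x \<in> carrier S" by (rule ring_hom_closed[OF f_hom])
lemma f_F: "x \<in> carrier R ==> f x \<in> T2.R.F k \<longleftrightarrow> x \<in> T1.R.F k"
 using f by (simp add: CDVR_hom_def T1.R.F_def T2.R.F_def)
lemma f_diff: "[|x \<in> carrier R; y \<in> carrier R|] ==> f (x \<ominus> y) = f x \<ominus>\<^bsub>S\<^esub> f y"
 by (rule ring_hom_diff[OF T1.R.is_cring T2.R.is_cring f_hom])
lemma f_zero: "f \<zero> = \<zero>\<^bsub>S\<^esub>"
 using ring_hom_zero[OF f_hom T1.R.ring_axioms T2.R.ring_axioms] .
lemma f_pow: "x \<in> carrier R ==> f (x [^] (k::nat)) = f x [^]\<^bsub>S\<^esub> k"
 using ring_hom_ring.hom_nat_pow[OF ring_hom_ringI2[OF T1.R.ring_axioms T2.R.ring_axioms f_hom]] .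

lemma f_val: assumes x: "x \<in> carrier R" shows "val H2 (sp2 (f x)) = val H1 (sp1 x)"
proof (cases "x = \<zero>")
 case True then show ?thesis by (simp add: f_zero T1.sp_zero T2.sp_zero)
next
 case False
 then obtain i where i: "x \<in> T1.R.F i" "x \<notin> T1.R.F (Suc i)" using T1.exact_level x by blast
 then show ?thesis using T1.val_sp[OF i] T2.val_sp[of "f x" i] f_F[OF x] by (simp add: T1.H.E_def T2.H.E_def)
qed

lemma sp_eq_transfer: assumes x: "x \<in> carrier R" and y: "y \<in> carrier R"
 shows "sp1 x = sp1 y \<longleftrightarrow> sp2 (f x) = sp2 (f y)"
proof (cases "y = \<zero>")
 case True
 have "sp1 x = hzero H1 \<longleftrightarrow> sp2 (f x) = hzero H2"
  using f_val[OF x] T1.H.val_eq_PInf[of "sp1 x"] T2.H.val_eq_PInf[of "sp2 (f x)"] T1.sp_carrier[OF x] T2.sp_carrier[OF f_closed[OF x]] by simp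
 then show ?thesis using True by (simp add: f_zero T1.sp_zero T2.sp_zero)
next
 case False
 then obtain i where i: "y \<in> T1.R.F i" "y \<notin> T1.R.F (Suc i)" using T1.exact_level y by blast
 then show ?thesis using T1.sp_eq_iff[OF x i] T2.sp_eq_iff[OF f_closed[OF x], of "f y" i] f_F[OF y] f_F[of "x \<ominus> y" "n + i"] f_diff[OF x y] x y by simp
qed

lemma hadd_transfer: assumes x: "x \<in> carrier R" and y: "y \<in> carrier R" and z: "z \<in> carrier R"
 shows "sp1 z \<in> hadd H1 (sp1 x) (sp1 y) \<longleftrightarrow> sp2 (f z) \<in> hadd H2 (sp2 (f x)) (sp2 (f y))"
proof (cases "x = \<zero> & y = \<zero>")
 case True
 then show ?thesis using sp_eq_transfer[OF z, of \<zero>] T1.H.hadd_zero[of "hzero H1"] T2.H.hadd_zero[of "hzero H2"]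
  by (simp add: f_zero T1.sp_zero T2.sp_zero)
next
 case False
 have "\<exists>i. x \<in> T1.R.F i & y \<in> T1.R.F i & (x \<notin> T1.R.F (Suc i) \<or> y \<notin> T1.R.F (Suc i))"
 proof (cases "x = \<zero> \<or> y = \<zero>")
  case True
  then show ?thesis using False T1.exact_level[OF x] T1.exact_level[OF y] T1.R.F_zero by metis
 next
  case False
  obtain i where i: "x \<in> T1.R.F i" "x \<notin> T1.R.F (Suc i)" using T1.exact_level x False by blast
  obtain j where j: "y \<in> T1.R.F j" "y \<notin> T1.R.F (Suc j)" using T1.exact_level y False by blast
  show ?thesis
  proof (cases "i \<le> j")
   case True then show ?thesis using i T1.R.F_monoD[OF j(1)] by blast
  next
   case False then show ?thesis using j T1.R.F_monoD[OF i(1), of j] by auto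
  qed
 qed
 then obtain i where i: "x \<in> T1.R.F i" "y \<in> T1.R.F i" "x \<notin> T1.R.F (Suc i) \<or> y \<notin> T1.R.F (Suc i)" by blast
 have "f z \<ominus>\<^bsub>S\<^esub> (f x \<oplus>\<^bsub>S\<^esub> f y) = f (z \<ominus> (x \<oplus> y))" using f_diff[OF z, of "x \<oplus> y"] x y ring_hom_add[OF f_hom] by simp
 then show ?thesis
  using T1.hadd_sp_iff[OF z i] T2.hadd_sp_iff[OF f_closed[OF z], of "f x" i "f y"] f_F[OF x] f_F[OF y] f_F[of "z \<ominus> (x \<oplus> y)" "n + i"] i x y z by simp
qed

abbreviation P1 where "P1 \<equiv> sp1 T1.R.\<pi>0"
abbreviation P2 where "P2 \<equiv> sp2 (f T1.R.\<pi>0)"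

lemma P: "P1 \<in> carrier H1" "P2 \<in> carrier H2" "P2 ~= hzero H2"
 using T1.sp_carrier T2.sp_carrier f_closed T1.R.pi0(1) sp_eq_transfer[OF T1.R.pi0(1), of \<zero>] T1.sp_pi0_nonzero
 by (auto simp: f_zero T1.sp_zero T2.sp_zero)

lemma P2_pow: "P2 [^]\<^bsub>H2\<^esub> (N::nat) \<in> carrier H2" "P2 [^]\<^bsub>H2\<^esub> N ~= hzero H2"
 using P T2.H.pow_nonzero by auto

text \<open>The graph of the induced map: \<open>a\<close> is the class of \<open>x / \<pi>0^N\<close> and \<open>b\<close> that of its image under \<open>f\<close>.\<close>

definition Gr :: "nat => 'u => 'u => 'u => bool" where
 "Gr N x a b \<longleftrightarrow> x \<in> carrier R & a \<in> carrier H1 & b \<in> carrier H2 &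
   a \<otimes>\<^bsub>H1\<^esub> P1 [^]\<^bsub>H1\<^esub> N = sp1 x & b \<otimes>\<^bsub>H2\<^esub> P2 [^]\<^bsub>H2\<^esub> N = sp2 (f x)"

lemma Gr_exists: assumes a: "a \<in> carrier H1" shows "\<exists>N x b. Gr N x a b"
proof -
 obtain N x where x: "x \<in> carrier R" "a \<otimes>\<^bsub>H1\<^esub> P1 [^]\<^bsub>H1\<^esub> (N::nat) = sp1 x" using T1.represent[OF a] by blast
 obtain i where i: "i \<in> carrier H2" "i \<otimes>\<^bsub>H2\<^esub> P2 [^]\<^bsub>H2\<^esub> N = \<one>\<^bsub>H2\<^esub>" using T2.H.nonzero_inverse[OF P2_pow] by blast
 have "sp2 (f x) \<otimes>\<^bsub>H2\<^esub> i \<otimes>\<^bsub>H2\<^esub> P2 [^]\<^bsub>H2\<^esub> N = sp2 (f x)"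
  using i P2_pow T2.sp_carrier[OF f_closed[OF x(1)]] by (simp add: T2.H.m_assoc)
 then have "Gr N x a (sp2 (f x) \<otimes>\<^bsub>H2\<^esub> i)" using x a i T2.sp_carrier[OF f_closed[OF x(1)]] by (simp add: Gr_def)
 then show ?thesis by blast
qed

lemma Gr_raise: assumes "Gr N x a b" shows "Gr (N + M) (x \<otimes> T1.R.\<pi>0 [^] M) a b"
 using assms P P2_pow T1.sp_carrier[OF T1.R.pi0(1)] T1.R.pi0(1) f_closed T1.sp_mult T2.sp_mult T1.sp_pow T2.sp_pow
 unfolding Gr_def
 by (simp add: ring_hom_mult[OF f_hom] f_pow T1.H.nat_pow_mult[symmetric] T2.H.nat_pow_mult[symmetric]
   T1.H.m_assoc[symmetric] T2.H.m_assoc[symmetric])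

lemma Gr_common: assumes "Gr N x a b" "Gr M y c d" obtains K x' y' where "Gr K x' a b" "Gr K y' c d"
 using Gr_raise[OF assms(1), of M] Gr_raise[OF assms(2), of N] by (auto simp: add.commute)

lemma Gr_common3: assumes "Gr N x a b" "Gr M y c d" "Gr L z g h"
 obtains K x' y' z' where "Gr K x' a b" "Gr K y' c d" "Gr K z' g h"
proof -
 obtain K x' y' where 1: "Gr K x' a b" "Gr K y' c d" using Gr_common assms by blast
 show thesis using that[of "K + L" "x' \<otimes> T1.R.\<pi>0 [^] L" "y' \<otimes> T1.R.\<pi>0 [^] L" "z \<otimes> T1.R.\<pi>0 [^] K"]
   Gr_raise[OF 1(1), of L] Gr_raise[OF 1(2), of L] Gr_raise[OF assms(3), of K] by (simp add: add.commute)
qed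

lemma P1_pow: "P1 [^]\<^bsub>H1\<^esub> (N::nat) \<in> carrier H1" "P1 [^]\<^bsub>H1\<^esub> N ~= hzero H1"
 using P T1.H.pow_nonzero T1.sp_pi0_nonzero by auto

lemma Gr_eq: assumes "Gr N x a b" "Gr M y c d" shows "a = c \<longleftrightarrow> b = d"
proof -
 obtain K x' y' where g: "Gr K x' a b" "Gr K y' c d" using Gr_common assms by blast
 have "a = c \<longleftrightarrow> sp1 x' = sp1 y'"
  using g T1.H.hyper_cancel[of a c "P1 [^]\<^bsub>H1\<^esub> K"] P1_pow by (auto simp: Gr_def)
 also have "\<dots> \<longleftrightarrow> sp2 (f x') = sp2 (f y')" using g sp_eq_transfer by (simp add: Gr_def)
 also have "\<dots> \<longleftrightarrow> b = d"
  using g T2.H.hyper_cancel[of b d "P2 [^]\<^bsub>H2\<^esub> K"] P2_pow by (auto simp: Gr_def)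
 finally show ?thesis .
qed

lemma P_val: "val H1 (P1 [^]\<^bsub>H1\<^esub> (N::nat)) = T1.H.E N" "val H2 (P2 [^]\<^bsub>H2\<^esub> (N::nat)) = T1.H.E N"
proof -
 have "val H1 P1 = ereal (1 / real e)" using T1.sp_pi_val[OF T1.R.unif_pi0] by (simp add: T1.H.E_def)
 moreover then have "val H2 P2 = ereal (1 / real e)" using f_val[OF T1.R.pi0(1)] by simp
 ultimately show "val H1 (P1 [^]\<^bsub>H1\<^esub> N) = T1.H.E N" "val H2 (P2 [^]\<^bsub>H2\<^esub> N) = T1.H.E N"
  using T1.H.val_pow[OF P(1)] T2.H.val_pow[OF P(2)] by (auto simp: T1.H.E_def)
qed

lemma value_groups_eq: "value_group H1 = value_group H2"
 using T1.H.value_group_eq T2.H.value_group_eq T1.H.normalized T2.H.normalized by (simp add: normalized_def)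

lemma induced_hom: "\<exists>!g. g \<in> HF_hom H1 H2 & (\<forall>x \<in> carrier R. g (sp1 x) = sp2 (f x))"
proof (rule ex1I)
 define g where "g = restrict (%a. SOME b. \<exists>N x. Gr N x a b) (carrier H1)"
 have g: "\<exists>N x. Gr N x a (g a)" if "a \<in> carrier H1" for a
  using someI_ex[of "%b. \<exists>N x. Gr N x a b"] Gr_exists[OF that] that unfolding g_def by auto
 have guniq: "g a = b" if "Gr N x a b" for N x a b
 proof -
  have a: "a \<in> carrier H1" using that by (simp add: Gr_def)
  show ?thesis using g[OF a] Gr_eq[OF _ that, of _ _ a "g a"] by blast
 qed
 have gsp: "g (sp1 x) = sp2 (f x)" if "x \<in> carrier R" for x
  by (rule guniq[of 0 x]) (use that T1.sp_carrier T2.sp_carrier f_closed in \<open>auto simp: Gr_def\<close>)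
 have "is_isometric_hom H1 H2 g"
 proof (rule is_isometric_homI[OF T1.H.discrete_valued_hyperfield_axioms value_groups_eq])
  fix a b assume a: "a \<in> carrier H1" and b: "b \<in> carrier H1"
  obtain N x where x: "Gr N x a (g a)" using g a by blast
  obtain M y where y: "Gr M y b (g b)" using g b by blast
  show "g a \<in> carrier H2" using x by (simp add: Gr_def)
  have "Gr (N + M) (x \<otimes> y) (a \<otimes>\<^bsub>H1\<^esub> b) (g a \<otimes>\<^bsub>H2\<^esub> g b)"
  proof -
   have 1: "a \<otimes>\<^bsub>H1\<^esub> b \<otimes>\<^bsub>H1\<^esub> P1 [^]\<^bsub>H1\<^esub> (N + M) = (a \<otimes>\<^bsub>H1\<^esub> P1 [^]\<^bsub>H1\<^esub> N) \<otimes>\<^bsub>H1\<^esub> (b \<otimes>\<^bsub>H1\<^esub> P1 [^]\<^bsub>H1\<^esub> M)"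
    using a b P P1_pow by (simp add: T1.H.nat_pow_mult[symmetric] T1.H.m_ac)
   have 2: "g a \<otimes>\<^bsub>H2\<^esub> g b \<otimes>\<^bsub>H2\<^esub> P2 [^]\<^bsub>H2\<^esub> (N + M) = (g a \<otimes>\<^bsub>H2\<^esub> P2 [^]\<^bsub>H2\<^esub> N) \<otimes>\<^bsub>H2\<^esub> (g b \<otimes>\<^bsub>H2\<^esub> P2 [^]\<^bsub>H2\<^esub> M)"
   proof -
    have gc: "g a \<in> carrier H2" "g b \<in> carrier H2" using x y by (simp_all add: Gr_def)
    show ?thesis using gc P(2) by (simp add: T2.H.nat_pow_mult[symmetric] T2.H.m_ac)
   qed
   show ?thesis unfolding Gr_def 1 2 using x y T1.sp_mult T2.sp_mult ring_hom_mult[OF f_hom] f_closed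
    by (auto simp: Gr_def)
  qed
  then show "g (a \<otimes>\<^bsub>H1\<^esub> b) = g a \<otimes>\<^bsub>H2\<^esub> g b" by (rule guniq)
  show "val H2 (g a) = val H1 a"
  proof -
   have "val H2 (g a) + T1.H.E N = val H2 (sp2 (f x))"
    using x T2.H.val_mult[of "g a" "P2 [^]\<^bsub>H2\<^esub> N"] P2_pow P_val by (simp add: Gr_def)
   also have "\<dots> = val H1 (sp1 x)" using f_val x by (simp add: Gr_def)
   also have "\<dots> = val H1 a + T1.H.E N"
    using x T1.H.val_mult[of a "P1 [^]\<^bsub>H1\<^esub> N"] P1_pow P_val by (simp add: Gr_def)
   finally show ?thesis by (cases "val H2 (g a)"; cases "val H1 a") (auto simp: T1.H.E_def)
  qed
  fix c assume c: "c \<in> carrier H1"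
  obtain L z where z: "Gr L z c (g c)" using g c by blast
  obtain K x' y' z' where k: "Gr K x' a (g a)" "Gr K y' b (g b)" "Gr K z' c (g c)" using Gr_common3[OF x y z] by blast
  have "g c \<in> hadd H2 (g a) (g b) \<longleftrightarrow> sp2 (f z') \<in> hadd H2 (sp2 (f x')) (sp2 (f y'))"
   using T2.H.hadd_mult_iff[of "g a" "g b" "P2 [^]\<^bsub>H2\<^esub> K" "g c"] k P2_pow by (simp add: Gr_def)
  also have "\<dots> \<longleftrightarrow> sp1 z' \<in> hadd H1 (sp1 x') (sp1 y')" using hadd_transfer k by (simp add: Gr_def)
  also have "\<dots> \<longleftrightarrow> c \<in> hadd H1 a b"
   using T1.H.hadd_mult_iff[of a b "P1 [^]\<^bsub>H1\<^esub> K" c] k P1_pow by (simp add: Gr_def)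
  finally show "g c \<in> hadd H2 (g a) (g b) \<longleftrightarrow> c \<in> hadd H1 a b" .
 next
  show "g (hzero H1) = hzero H2" using gsp[of \<zero>] by (simp add: T1.sp_zero T2.sp_zero f_zero)
  show "g \<one>\<^bsub>H1\<^esub> = \<one>\<^bsub>H2\<^esub>" using gsp[of \<one>] ring_hom_one[OF f_hom] by (simp add: T1.sp_one T2.sp_one)
  show "inj_on g (carrier H1)" using g Gr_eq by (intro inj_onI) metis
 qed
 moreover have "g (pelt H1) = pelt H2"
  using gsp[of "nat_elem R p"] T1.R.hom_nat_elem[OF f_hom T2.R.is_cring, of p] by (simp add: T1.sp_p T2.sp_p)
 ultimately show "g \<in> HF_hom H1 H2 & (\<forall>x\<in>carrier R. g (sp1 x) = sp2 (f x))"
  using gsp by (simp add: HF_hom_def g_def)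
 fix g' assume g': "g' \<in> HF_hom H1 H2 & (\<forall>x\<in>carrier R. g' (sp1 x) = sp2 (f x))"
 interpret g': isometric_hom H1 H2 e n g'
  using g' T1.H.normalized_hyperfield_axioms T2.H.normalized_hyperfield_axioms
  by (simp add: isometric_hom_def isometric_hom_axioms_def HF_hom_def)
 show "g' = g"
 proof (rule extensionalityI[of _ "carrier H1"])
  show "g' \<in> extensional (carrier H1)" "g \<in> extensional (carrier H1)" using g' by (auto simp: HF_hom_def g_def)
  fix a assume a: "a \<in> carrier H1"
  obtain N x where x: "Gr N x a (g a)" using g a by blast
  have pw: "g' (P1 [^]\<^bsub>H1\<^esub> (k::nat)) = P2 [^]\<^bsub>H2\<^esub> k" for k
   by (induction k) (use P P1_pow g' T1.R.pi0(1) in \<open>auto simp: g'.f_one g'.f_mult\<close>)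
  have "g' a \<otimes>\<^bsub>H2\<^esub> P2 [^]\<^bsub>H2\<^esub> N = g' (sp1 x)"
   using g'.f_mult[OF a P1_pow(1)[of N]] pw x by (simp add: Gr_def)
  then have "Gr N x a (g' a)" using x g' g'.f_closed[OF a] by (simp add: Gr_def)
  then show "g' a = g a" using guniq by simp
 qed
qed

end

end

lemma (in discrete_valued_hyperfield) cl_diff_val:
 assumes "0 < \<eta>" "\<eta> \<le> rho H" "a \<in> Oh" "b \<in> Oh" "near r a b" "r \<ge> 0"
 shows "\<exists>d \<in> Oh. hclass H \<eta> a \<ominus>\<^bsub>hquot H \<eta>\<^esub> hclass H \<eta> b = hclass H \<eta> d & val H d \<ge> r"
proof -
 obtain d where d: "d \<in> hsub H a b" "val H d \<ge> r" using assms(5) unfolding near_def by blast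
 have "d \<in> Oh" using hsub_closed[OF Oh_carrier[OF assms(3)] Oh_carrier[OF assms(4)] d(1)] order_trans[OF assms(6) d(2)]
  by (simp add: Oh_iff)
 then show ?thesis using Q_minus[OF assms(1-4) d(1)] d(2) by blast
qed

lemma (in normalized_hyperfield) Fh_1_of_res_eq:
 assumes a: "a \<in> Oh" and b: "b \<in> Oh" and eq: "hclass H (theta H) a = hclass H (theta H) b"
 shows "cr a \<ominus>\<^bsub>Rh\<^esub> cr b \<in> Fh 1"
proof -
 have "near (E 1) a b" using cl_eq_iff[OF theta_least(2) theta_le_rho a b] eq by (simp add: theta_E)
 then obtain d where "d \<in> Oh" "cr a \<ominus>\<^bsub>hquot H (rho H)\<^esub> cr b = cr d" "val H d \<ge> E 1"
  using cl_diff_val[OF rho_pos order_refl a b, of "E 1"] by auto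
 then show ?thesis unfolding Fh_def by (auto simp: trunc_ring_def)
qed

lemma (in truncation) H_perfect_residue: "perfect_residue_ring (trunc_ring H) H.Fh p"
 by (rule H.Rh_perfect_residue[OF R.prime_p res_char res_perfect])

context truncation_pair begin

text \<open>Teichmueller elements are determined by their residues, on which \<open>f1\<close> and \<open>f2\<close> agree. For \<open>x\<close> with
\<open>p = w x^e\<close> the images \<open>f1 x\<close> and \<open>f2 x\<close> therefore have the same \<open>e\<close>-th power, and their quotient is a
one-unit, so it is one.\<close>

lemma faithful:
 assumes e: "\<not> p dvd e" and f1: "f1 \<in> CDVR_hom R S" and f2: "f2 \<in> CDVR_hom R S"
  and eq: "!!x. x \<in> carrier R ==> sp2 (f1 x) = sp2 (f2 x)"
 shows "f1 = f2"
proof (rule extensionalityI[of _ "carrier R"])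
 show "f1 \<in> extensional (carrier R)" "f2 \<in> extensional (carrier R)" using f1 f2 by (auto simp: CDVR_hom_def)
 fix a assume a: "a \<in> carrier R"
 note h1 = f_hom[OF f1] and h2 = f_hom[OF f2]
 have t: "f1 t = f2 t" if t: "t \<in> T1.R.teich" for t
 proof (rule T2.R.teich_unique)
  have tc: "t \<in> carrier R" using t T1.R.teich_carrier by blast
  show "f1 t \<in> T2.R.teich" "f2 t \<in> T2.R.teich"
   using T1.R.teich_ring_hom[OF T2.R.perfect_residue h1 t] T1.R.teich_ring_hom[OF T2.R.perfect_residue h2 t] .
  have "f1 t \<ominus>\<^bsub>S\<^esub> f2 t \<in> T2.R.F (n + 0)"
   using T2.near_sp[of "f1 t" "f2 t" 0] eq[OF tc] T2.sp_carrier ring_hom_closed[OF h1 tc] ring_hom_closed[OF h2 tc] by (simp add: T2.R.F_0)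
  then show "f1 t \<ominus>\<^bsub>S\<^esub> f2 t \<in> T2.R.F 1" by (rule T2.R.F_monoD) (use T1.n_gt in simp)
 qed
 obtain x w where x: "T1.R.unif x" "w \<in> T1.R.teich" "w ~= \<zero>" "nat_elem R p = w \<otimes> x [^] e"
  using T1.R.tame_uniformizer[OF e] by blast
 have xc: "x \<in> carrier R" "w \<in> carrier R" using x(1) T1.R.teich_carrier[OF x(2)] by (auto simp: T1.R.unif_def)
 have xF: "x \<in> T1.R.F 1" "x \<notin> T1.R.F (Suc 1)"
 proof -
  show "x \<in> T1.R.F 1" by (rule T1.R.unif_F1[OF x(1)])
  show "x \<notin> T1.R.F (Suc 1)"
   using T1.sp_pi_val[OF x(1)] T1.sp_val[OF xc(1), of "Suc 1"] by (simp add: T1.H.E_le)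
 qed
 define y where "y = f1 x"
 have y: "y \<in> T2.R.F 1" "y \<notin> T2.R.F (Suc 1)" "f2 x \<in> T2.R.F 1" "f2 x \<in> carrier S"
  using f_F[OF f1 xc(1)] f_F[OF f2 xc(1)] xF ring_hom_closed[OF h2 xc(1)] by (auto simp: y_def)
 have uy: "T2.R.unif y" by (rule T2.R.unifI[OF y(1,2)])
 have yc: "y \<in> carrier S" using uy by (simp add: T2.R.unif_def)
 have xx: "f1 x = f2 x"
 proof -
  obtain r where r: "r \<in> carrier S" "f2 x = y \<otimes>\<^bsub>S\<^esub> r" using T2.R.unif_mem[OF uy, of "f2 x" 1] y yc by auto
  have wu: "f1 w \<in> Units S"
   using T1.R.teich_unit[OF x(2,3)] T1.R.Units_iff_notin_F1[OF xc(2)] T2.R.Units_iff_notin_F1 f_F[OF f1 xc(2)] f_closed[OF f1 xc(2)] by blast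
  have pe: "nat_elem S p = f w \<otimes>\<^bsub>S\<^esub> f x [^]\<^bsub>S\<^esub> e" if f: "f \<in> CDVR_hom R S" for f
  proof -
   have "nat_elem S p = f (nat_elem R p)" using T1.R.hom_nat_elem[OF f_hom[OF f] T2.R.is_cring] by simp
   then show ?thesis using ring_hom_mult[OF f_hom[OF f] xc(2), of "x [^] e"] xc(1) f_pow[OF f xc(1)] x(4) by simp
  qed
  have "f1 w \<otimes>\<^bsub>S\<^esub> y [^]\<^bsub>S\<^esub> e = f1 w \<otimes>\<^bsub>S\<^esub> (y \<otimes>\<^bsub>S\<^esub> r) [^]\<^bsub>S\<^esub> e"
   using pe[OF f1] pe[OF f2] t[OF x(2)] r(2) by (simp add: y_def)
  then have "y [^]\<^bsub>S\<^esub> e = (y \<otimes>\<^bsub>S\<^esub> r) [^]\<^bsub>S\<^esub> e" using wu yc r(1) by (simp add: T2.R.Units_l_cancel)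
  then have "y [^]\<^bsub>S\<^esub> e \<otimes>\<^bsub>S\<^esub> \<one>\<^bsub>S\<^esub> = y [^]\<^bsub>S\<^esub> e \<otimes>\<^bsub>S\<^esub> r [^]\<^bsub>S\<^esub> e" using yc r(1) by (simp add: T2.R.nat_pow_distrib)
  then have re: "r [^]\<^bsub>S\<^esub> e = \<one>\<^bsub>S\<^esub>"
   using T2.R.m_lcancel[OF T2.R.unif_pow_nonzero[OF uy], of e "\<one>\<^bsub>S\<^esub>" "r [^]\<^bsub>S\<^esub> e"] yc r(1) by simp
  have "f2 x \<ominus>\<^bsub>S\<^esub> y \<in> T2.R.F (n + 1)" using T2.sp_eq_iff[OF y(4,1,2)] eq[OF xc(1)] by (simp add: y_def)
  then have "y [^]\<^bsub>S\<^esub> (1::nat) \<otimes>\<^bsub>S\<^esub> (r \<ominus>\<^bsub>S\<^esub> \<one>\<^bsub>S\<^esub>) \<in> T2.R.F (1 + n)"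
   using r yc by (simp add: T2.R.minus_eq T2.R.r_distr T2.R.r_minus)
  then have "r \<ominus>\<^bsub>S\<^esub> \<one>\<^bsub>S\<^esub> \<in> T2.R.F n" using T2.R.unif_div[OF uy, of "r \<ominus>\<^bsub>S\<^esub> \<one>\<^bsub>S\<^esub>" 1 n] r by simp
  then have "r \<ominus>\<^bsub>S\<^esub> \<one>\<^bsub>S\<^esub> \<in> T2.R.F 1" by (rule T2.R.F_monoD) (use T1.n_gt in simp)
  then have "r = \<one>\<^bsub>S\<^esub>" using T2.R.one_unit_root_unique[OF e r(1) _ re] by blast
  then show ?thesis using r yc by (simp add: y_def)
 qed
 show "f1 a = f2 a"
  by (rule T1.R.hom_determined[OF T2.R.filtered h1 h2 x(1) xx _ t a]) (use y(1) y_def in auto)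
qed

text \<open>Let \<open>p = w x^e\<close> in \<open>R\<close> with \<open>w\<close> a Teichmueller element. A lift \<open>y\<close> of \<open>g (sp1 x)\<close> satisfies \<open>p = w' c y^e\<close>
with \<open>c\<close> in \<open>1 + m^n\<close>, because \<open>g\<close> is over \<open>p\<close>. The \<open>e\<close>-th root \<open>d\<close> of \<open>c\<close> in \<open>1 + m^n\<close> changes \<open>y\<close> to
\<open>y' = d y\<close> with the same class and \<open>p = w' y'^e\<close>, so there is a homomorphism with \<open>x \<mapsto> y'\<close>. It induces \<open>g\<close>,
since both agree on \<open>x\<close> and on Teichmueller elements modulo \<open>m^n\<close>.\<close>

lemma full:
 assumes e: "\<not> p dvd e" and g: "g \<in> HF_hom H1 H2"
 shows "\<exists>f \<in> CDVR_hom R S. \<forall>a \<in> carrier R. g (sp1 a) = sp2 (f a)"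
proof -
 interpret g: isometric_hom H1 H2 e n g
  using g T1.H.normalized_hyperfield_axioms T2.H.normalized_hyperfield_axioms
  by (simp add: isometric_hom_def isometric_hom_axioms_def HF_hom_def)
 interpret Q: perfect_residue_ring "trunc_ring H2" T2.H.Fh p by (rule T2.H_perfect_residue)
 have gO: "g (sp1 a) \<in> T2.H.Oh" if "a \<in> carrier R" for a
  using T1.sp_Oh[OF that] g.f_closed[OF T1.sp_carrier[OF that]] g.f_val[OF T1.sp_carrier[OF that]]
  by (simp add: T1.H.Oh_iff T2.H.Oh_iff)
 have gm: "g (sp1 (a \<otimes> b)) = g (sp1 a) \<otimes>\<^bsub>H2\<^esub> g (sp1 b)" if "a \<in> carrier R" "b \<in> carrier R" for a b
  using that T1.sp_mult g.f_mult T1.sp_carrier by simp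
 have ga: "g (sp1 (a \<oplus> b)) \<in> hadd H2 (g (sp1 a)) (g (sp1 b))" if "a \<in> carrier R" "b \<in> carrier R" for a b
  using g.f_hadd[OF T1.sp_carrier[OF that(1)] T1.sp_carrier[OF that(2)] T1.sp_add[OF that]] .
 have g1: "g (sp1 \<one>) = \<one>\<^bsub>H2\<^esub>" by (simp add: T1.sp_one g.f_one)
 have gp: "g (sp1 (a [^] (k::nat))) = g (sp1 a) [^]\<^bsub>H2\<^esub> k" if "a \<in> carrier R" for a k
  by (induction k) (use that g1 gm in auto)
 have hr: "(%a. hclass H2 (theta H2) (g (sp1 a))) \<in> ring_hom R (res_field H2)"
  unfolding res_field_def
  by (rule T2.H.hom_into_quotient[OF T2.H.theta_least(2) T2.H.theta_le_rho]) (use gO g1 gm ga in blast)+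
 have h1: "(%a. T2.H.cr (g (sp1 a))) \<in> ring_hom R (trunc_ring H2)"
  unfolding trunc_ring_def
  by (rule T2.H.hom_into_quotient[OF T2.H.rho_pos order_refl]) (use gO g1 gm ga in blast)+
 have gE: "T2.H.E k \<le> val H2 (g (sp1 a)) \<longleftrightarrow> a \<in> T1.R.F k" if "a \<in> carrier R" for a k
  using T1.sp_val[OF that, of k] g.f_val[OF T1.sp_carrier[OF that]] by (simp add: T1.H.E_def T2.H.E_def)
 obtain x w where x: "T1.R.unif x" "w \<in> T1.R.teich" "w ~= \<zero>" "nat_elem R p = w \<otimes> x [^] e"
  using T1.R.tame_uniformizer[OF e] by blast
 have xc: "x \<in> carrier R" "w \<in> carrier R" using x(1) T1.R.teich_carrier[OF x(2)] by (auto simp: T1.R.unif_def)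
 have wu: "w \<in> Units R" by (rule T1.R.teich_unit[OF x(2,3)])
 obtain y where y: "y \<in> carrier S" "sp2 y = g (sp1 x)" using T2.sp_surj[OF gO[OF xc(1)]] by blast
 have yF: "y \<in> T2.R.F 1" "y \<notin> T2.R.F (Suc 1)"
 proof -
  have v: "val H2 (sp2 y) = T1.H.E 1" using y g.f_val[OF T1.sp_carrier[OF xc(1)]] T1.sp_pi_val[OF x(1)] by simp
  show "y \<in> T2.R.F 1" "y \<notin> T2.R.F (Suc 1)"
   using T2.sp_val[OF y(1), of 1] T2.sp_val[OF y(1), of "Suc 1"] v T2.H.E_le[of "Suc 1" 1] by (auto simp: T1.H.E_def T2.H.E_def)
 qed
 have uy: "T2.R.unif y" by (rule T2.R.unifI[OF yF])
 obtain y0 where y0: "y0 \<in> carrier S" "sp2 y0 = g (sp1 w)" using T2.sp_surj[OF gO[OF xc(2)]] by blast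
 obtain w' where w': "w' \<in> T2.R.teich" "y0 \<ominus>\<^bsub>S\<^esub> w' \<in> T2.R.F 1" using T2.R.teich_exists[OF y0(1)] by blast
 have w'c: "w' \<in> carrier S" by (rule T2.R.teich_carrier[OF w'(1)])
 \<comment> \<open>Both elements are Teichmueller elements of the residue ring with the same residue.\<close>
 have res_w: "hclass H2 (theta H2) (g (sp1 w)) = hclass H2 (theta H2) (sp2 w')"
  using T2.res_eq_iff[OF y0(1) w'c] w'(2) y0(2) by simp
 have "T2.H.cr (g (sp1 w)) = T2.H.cr (sp2 w')"
 proof (rule Q.teich_unique)
  show "T2.H.cr (g (sp1 w)) \<in> Q.teich" by (rule T1.R.teich_ring_hom[OF T2.H_perfect_residue h1 x(2)])
  show "T2.H.cr (sp2 w') \<in> Q.teich" by (rule T2.R.teich_ring_hom[OF T2.H_perfect_residue T2.sp_hom_trunc w'(1)])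
  show "T2.H.cr (g (sp1 w)) \<ominus>\<^bsub>trunc_ring H2\<^esub> T2.H.cr (sp2 w') \<in> T2.H.Fh 1"
   by (rule T2.H.Fh_1_of_res_eq[OF gO[OF xc(2)] T2.sp_Oh[OF w'c] res_w])
 qed
 then have "T2.H.near (T2.H.E n) (g (sp1 w)) (sp2 w')"
  using T2.H.cr_eq_iff[OF gO[OF xc(2)] T2.sp_Oh[OF w'c]] by simp
 moreover have vw: "val H2 (g (sp1 w)) = 0" using g.f_val[OF T1.sp_carrier[OF xc(2)]] T1.sp_unit_val[OF wu] by simp
 ultimately have spw: "g (sp1 w) = sp2 w'"
  using T2.H.near_rho_eq[OF g.f_closed[OF T1.sp_carrier[OF xc(2)]] _ T2.sp_carrier[OF w'c]] by simp
 have w'F: "w' \<notin> T2.R.F 1" using T2.sp_val[OF w'c, of 1] spw vw T2.H.E_le[of 1 0] by auto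
 have w'u: "w' \<in> Units S" by (rule T2.R.Units_if_notin_F1[OF w'c w'F])
 have "pelt H2 = g (pelt H1)" using g by (simp add: HF_hom_def)
 also have "\<dots> = g (sp1 w) \<otimes>\<^bsub>H2\<^esub> g (sp1 x) [^]\<^bsub>H2\<^esub> e"
  unfolding T1.sp_p[symmetric] x(4) using gm[OF xc(2), of "x [^] e"] gp[OF xc(1)] xc(1) by simp
 also have "\<dots> = sp2 (w' \<otimes>\<^bsub>S\<^esub> y [^]\<^bsub>S\<^esub> e)" using spw y w'c by (simp add: T2.sp_mult T2.sp_pow)
 finally have spp: "sp2 (nat_elem S p) = sp2 (w' \<otimes>\<^bsub>S\<^esub> y [^]\<^bsub>S\<^esub> e)" by (simp add: T2.sp_p)
 define z where "z = w' \<otimes>\<^bsub>S\<^esub> y [^]\<^bsub>S\<^esub> e"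
 have zc: "z \<in> carrier S" using w'c y by (simp add: z_def)
 have zF: "z \<in> T2.R.F e" "z \<notin> T2.R.F (Suc e)"
 proof -
  have ye: "y [^]\<^bsub>S\<^esub> e \<in> T2.R.F e" using T2.R.unif_mem[OF uy, of "y [^]\<^bsub>S\<^esub> e" e] y(1) by (auto intro!: bexI[of _ "\<one>\<^bsub>S\<^esub>"])
  show "z \<in> T2.R.F e" unfolding z_def by (rule T2.R.F_mult_l[OF ye w'c])
  show "z \<notin> T2.R.F (Suc e)"
  proof
   assume "z \<in> T2.R.F (Suc e)"
   then have "y [^]\<^bsub>S\<^esub> e \<otimes>\<^bsub>S\<^esub> w' \<in> T2.R.F (e + 1)" using w'c y(1) by (simp add: z_def T2.R.m_comm)
   then show False using T2.R.unif_div[OF uy w'c] w'F by blast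
  qed
 qed
 have pz: "nat_elem S p \<ominus>\<^bsub>S\<^esub> z \<in> T2.R.F (n + e)"
  using T2.sp_eq_iff[OF T2.R.nat_elem_closed zF, of p] spp by (simp add: z_def)
 obtain s where s: "s \<in> carrier S" "nat_elem S p = y [^]\<^bsub>S\<^esub> e \<otimes>\<^bsub>S\<^esub> s" using T2.R.unif_mem[OF uy] T2.R.p_in_Fe by blast
 define c where "c = inv\<^bsub>S\<^esub> w' \<otimes>\<^bsub>S\<^esub> s"
 have cc: "c \<in> carrier S" using w'u s by (simp add: c_def)
 have wc: "w' \<otimes>\<^bsub>S\<^esub> c = s" using w'u s w'c by (simp add: c_def T2.R.m_assoc[symmetric])
 have pwc: "nat_elem S p = w' \<otimes>\<^bsub>S\<^esub> c \<otimes>\<^bsub>S\<^esub> y [^]\<^bsub>S\<^esub> e" unfolding wc s(2) using s y by (simp add: T2.R.m_comm)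
 have c1: "c \<ominus>\<^bsub>S\<^esub> \<one>\<^bsub>S\<^esub> \<in> T2.R.F n"
 proof -
  have "nat_elem S p \<ominus>\<^bsub>S\<^esub> z = y [^]\<^bsub>S\<^esub> e \<otimes>\<^bsub>S\<^esub> (w' \<otimes>\<^bsub>S\<^esub> (c \<ominus>\<^bsub>S\<^esub> \<one>\<^bsub>S\<^esub>))"
  proof -
   define Y where "Y = y [^]\<^bsub>S\<^esub> e"
   have Yc: "Y \<in> carrier S" using y by (simp add: Y_def)
   show ?thesis unfolding pwc z_def Y_def[symmetric] by (use Yc w'c cc in algebra)
  qed
  then have "w' \<otimes>\<^bsub>S\<^esub> (c \<ominus>\<^bsub>S\<^esub> \<one>\<^bsub>S\<^esub>) \<in> T2.R.F n"
   using T2.R.unif_div[OF uy, of "w' \<otimes>\<^bsub>S\<^esub> (c \<ominus>\<^bsub>S\<^esub> \<one>\<^bsub>S\<^esub>)" e n] pz w'c cc by (simp add: add.commute)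
  then have "inv\<^bsub>S\<^esub> w' \<otimes>\<^bsub>S\<^esub> (w' \<otimes>\<^bsub>S\<^esub> (c \<ominus>\<^bsub>S\<^esub> \<one>\<^bsub>S\<^esub>)) \<in> T2.R.F n"
   by (rule T2.R.F_mult_l) (use w'u in simp)
  then show ?thesis using w'u w'c cc by (simp add: T2.R.m_assoc[symmetric])
 qed
 obtain m where m: "n = Suc m" using T1.n_gt by (cases n) auto
 obtain d where d: "d \<in> carrier S" "d \<ominus>\<^bsub>S\<^esub> \<one>\<^bsub>S\<^esub> \<in> T2.R.F n" "T2.R.unif (d \<otimes>\<^bsub>S\<^esub> y)" "nat_elem S p = w' \<otimes>\<^bsub>S\<^esub> (d \<otimes>\<^bsub>S\<^esub> y) [^]\<^bsub>S\<^esub> e"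
  using T2.R.tame_root[OF e uy w'u c1[unfolded m] cc pwc] unfolding m by blast
 define y' where "y' = d \<otimes>\<^bsub>S\<^esub> y"
 have y'c: "y' \<in> carrier S" using d y by (simp add: y'_def)
 have spy': "sp2 y' = sp2 y"
 proof -
  have "y' \<ominus>\<^bsub>S\<^esub> y = (d \<ominus>\<^bsub>S\<^esub> \<one>\<^bsub>S\<^esub>) \<otimes>\<^bsub>S\<^esub> y" unfolding y'_def by (use d(1) y(1) in algebra)
  then have "y' \<ominus>\<^bsub>S\<^esub> y \<in> T2.R.F (n + 1)" using T2.R.F_mult[OF d(2) yF(1)] by simp
  then show ?thesis using T2.sp_eq_iff[OF y'c yF] by simp
 qed
 obtain j where j: "e = Suc j" using T1.R.e_pos by (cases e) auto
 have pair: "residue_pair R T1.R.F p S T2.R.F (res_field H2) (%a. hclass H2 (theta H2) (g (sp1 a)))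
   (%a. hclass H2 (theta H2) (sp2 a)) x w y' w' j (%_. True)"
 proof (intro residue_pair.intro T1.R.perfect_residue T2.R.perfect_residue residue_pair_axioms.intro
   T2.res_cring hr T2.sp_hom_res x(2) w'(1) res_w)
  fix a assume a: "a \<in> carrier R"
  show "hclass H2 (theta H2) (g (sp1 a)) = \<zero>\<^bsub>res_field H2\<^esub> \<longleftrightarrow> a \<in> T1.R.F 1"
   using T2.H.cl_zero_iff[OF T2.H.theta_least(2) T2.H.theta_le_rho gO[OF a]] gE[OF a, of 1] T2.H.theta_E by (simp add: res_field_def)
  show "\<exists>b\<in>carrier S. hclass H2 (theta H2) (sp2 b) = hclass H2 (theta H2) (g (sp1 a))"
  proof -
   obtain b where b: "b \<in> carrier S" "sp2 b = g (sp1 a)" using T2.sp_surj[OF gO[OF a]] by blast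
   show ?thesis by (rule bexI[OF _ b(1)]) (simp add: b(2))
  qed
  fix k assume "x \<otimes> a \<in> T1.R.F (Suc k)"
  then show "a \<in> T1.R.F k" using T1.R.unif_div[OF x(1) a, of 1 k] xc by simp
 next
  fix b assume "b \<in> carrier S"
  then show "hclass H2 (theta H2) (sp2 b) = \<zero>\<^bsub>res_field H2\<^esub> \<longleftrightarrow> b \<in> T2.R.F 1" by (rule T2.res_zero_iff)
 next
  fix k b assume "b \<in> carrier S" "y' \<otimes>\<^bsub>S\<^esub> b \<in> T2.R.F (Suc k)"
  then show "b \<in> T2.R.F k" using T2.R.unif_div[OF d(3), of b 1 k] y'c by (simp add: y'_def)
 next
  show "x \<in> T1.R.F 1" by (rule T1.R.unif_F1[OF x(1)])
  show "y' \<in> T2.R.F 1" unfolding y'_def by (rule T2.R.unif_F1[OF d(3)])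
  fix a assume "a \<in> T1.R.F 1"
  then show "\<exists>b\<in>carrier R. a = x \<otimes> b" using T1.R.unif_mem[OF x(1), of a 1] xc by simp
 next
  show "nat_elem R p = w \<otimes> x [^] Suc j" using x(4) j by simp
  show "nat_elem S p = w' \<otimes>\<^bsub>S\<^esub> y' [^]\<^bsub>S\<^esub> Suc j" using d(4) j by (simp add: y'_def)
 qed simp_all
 obtain h where h0: "h \<in> ring_hom R S" "h x = y'" "\<forall>k. \<forall>a \<in> T1.R.F k. h a \<in> T2.R.F k"
  "\<forall>k. True --> (\<forall>a \<in> carrier R. h a \<in> T2.R.F k --> a \<in> T1.R.F k)"
  "\<forall>a \<in> carrier R. hclass H2 (theta H2) (sp2 (h a)) = hclass H2 (theta H2) (g (sp1 a))"
  using residue_pair.graph_hom[OF pair] by (elim bexE conjE) (rule that)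
 have h: "h \<in> ring_hom R S" "h x = y'" "!!k a. a \<in> T1.R.F k ==> h a \<in> T2.R.F k"
  "!!k a. a \<in> carrier R ==> h a \<in> T2.R.F k ==> a \<in> T1.R.F k"
  "!!a. a \<in> carrier R ==> hclass H2 (theta H2) (sp2 (h a)) = hclass H2 (theta H2) (g (sp1 a))"
  using h0 by simp_all
 note hcl = ring_hom_closed[OF h(1)]
 have h2: "(%a. T2.H.cr (sp2 (h a))) \<in> ring_hom R (trunc_ring H2)"
  using ring_hom_trans[OF h(1) T2.sp_hom_trunc] by (simp add: comp_def)
 have same: "T2.H.cr (g (sp1 a)) = T2.H.cr (sp2 (h a))" if a: "a \<in> carrier R" for a
 proof (rule T1.R.hom_determined[OF T2.H.Rh_filtered h1 h2 x(1) _ _ _ a])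
  show "T2.H.cr (g (sp1 x)) = T2.H.cr (sp2 (h x))" using h(2) spy' y by simp
  show "T2.H.cr (g (sp1 x)) \<in> T2.H.Fh 1"
   unfolding T2.H.Fh_def using gO[OF xc(1)] gE[OF xc(1), of 1] T1.R.unif_F1[OF x(1)] by simp
  fix t assume t: "t \<in> T1.R.teich"
  have tc: "t \<in> carrier R" by (rule T1.R.teich_carrier[OF t])
  show "T2.H.cr (g (sp1 t)) = T2.H.cr (sp2 (h t))"
  proof (rule Q.teich_unique)
   show "T2.H.cr (g (sp1 t)) \<in> Q.teich" by (rule T1.R.teich_ring_hom[OF T2.H_perfect_residue h1 t])
   show "T2.H.cr (sp2 (h t)) \<in> Q.teich" by (rule T1.R.teich_ring_hom[OF T2.H_perfect_residue h2 t])
   show "T2.H.cr (g (sp1 t)) \<ominus>\<^bsub>trunc_ring H2\<^esub> T2.H.cr (sp2 (h t)) \<in> T2.H.Fh 1"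
    by (rule T2.H.Fh_1_of_res_eq[OF gO[OF tc] T2.sp_Oh[OF hcl[OF tc]]]) (simp add: h(5)[OF tc])
  qed
 qed
 have unit: "g (sp1 a) = sp2 (h a)" if a: "a \<in> Units R" for a
 proof -
  have ac: "a \<in> carrier R" using a by blast
  have "T2.H.near (T2.H.E n) (g (sp1 a)) (sp2 (h a))"
   using T2.H.cr_eq_iff[OF gO[OF ac] T2.sp_Oh[OF hcl[OF ac]]] same[OF ac] by simp
  moreover have "val H2 (g (sp1 a)) = 0" using g.f_val[OF T1.sp_carrier[OF ac]] T1.sp_unit_val[OF a] by simp
  ultimately show ?thesis
   using T2.H.near_rho_eq[OF g.f_closed[OF T1.sp_carrier[OF ac]] _ T2.sp_carrier[OF hcl[OF ac]]] by simp
 qed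
 have hpow: "h (x [^] (k::nat)) = y' [^]\<^bsub>S\<^esub> k" for k
  using ring_hom_ring.hom_nat_pow[OF ring_hom_ringI2[OF T1.R.ring_axioms T2.R.ring_axioms h(1)] xc(1)] h(2) by simp
 have all: "g (sp1 a) = sp2 (h a)" if a: "a \<in> carrier R" for a
 proof (cases "a = \<zero>")
  case True
  have "h \<zero> = \<zero>\<^bsub>S\<^esub>" by (rule ring_hom_zero[OF h(1) T1.R.ring_axioms T2.R.ring_axioms])
  then show ?thesis using True by (simp add: T1.sp_zero T2.sp_zero g.f_zero)
 next
  case False
  obtain k :: nat and u where u: "u \<in> Units R" "a = x [^] k \<otimes> u" using T1.R.factorization[OF x(1) a False] by blast
  have uc: "u \<in> carrier R" using u by blast
  have "g (sp1 a) = g (sp1 x) [^]\<^bsub>H2\<^esub> k \<otimes>\<^bsub>H2\<^esub> g (sp1 u)" unfolding u(2) using gm gp xc uc by simp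
  also have "\<dots> = sp2 (y' [^]\<^bsub>S\<^esub> k \<otimes>\<^bsub>S\<^esub> h u)"
   using unit[OF u(1)] y spy' y'c hcl[OF uc] by (simp add: T2.sp_mult T2.sp_pow)
  also have "y' [^]\<^bsub>S\<^esub> k \<otimes>\<^bsub>S\<^esub> h u = h a"
   unfolding u(2) using ring_hom_mult[OF h(1) _ uc, of "x [^] k"] xc hpow by simp
  finally show ?thesis .
 qed
 define f where "f = restrict h (carrier R)"
 have "f \<in> CDVR_hom R S"
 proof -
  have "inj_on h (carrier R)"
  proof (rule inj_onI)
   fix a b assume ab: "a \<in> carrier R" "b \<in> carrier R" "h a = h b"
   have d0: "h (a \<ominus> b) = \<zero>\<^bsub>S\<^esub>"
    using ring_hom_diff[OF T1.R.is_cring T2.R.is_cring h(1) ab(1,2)] ab(3) hcl[OF ab(2)] by (simp add: T2.R.minus_eq T2.R.r_neg)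
   show "a = b"
   proof (rule T1.R.F_eqI[OF ab(1,2)])
    fix k show "a \<ominus> b \<in> T1.R.F k" by (rule h(4)) (use ab d0 in auto)
   qed
  qed
  then have "inj_on f (carrier R)" unfolding f_def by (simp add: inj_on_def)
  moreover have "f \<in> ring_hom R S"
   by (rule ring_hom_memI) (simp_all add: f_def hcl ring_hom_mult[OF h(1)] ring_hom_add[OF h(1)] ring_hom_one[OF h(1)])
  moreover have "f a \<in> T2.R.F k \<longleftrightarrow> a \<in> T1.R.F k" if a: "a \<in> carrier R" for a k
   using h(3)[of a k] h(4)[OF a, of k] a by (auto simp: f_def)
  ultimately show ?thesis by (simp add: CDVR_hom_def f_def T1.R.F_def T2.R.F_def)
 qed
 moreover have "\<forall>a \<in> carrier R. g (sp1 a) = sp2 (f a)" using all by (simp add: f_def)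
 ultimately show ?thesis by blast
qed

end

section \<open>The monoid ring of a perfect field\<close>

lemma prime_power_add_comm_ring:
 fixes a b :: "'a :: comm_ring_1"
 assumes p: "Factorial_Ring.prime (p::nat)"
 shows "\<exists>c. (a + b) ^ p = a ^ p + b ^ p + of_nat p * (a * c)"
proof -
 have "\<exists>q. p choose k = p * q" if "0 < k" "k < p" for k
  using dvd_choose_prime[of k p] p that by (auto elim: dvdE)
 then obtain q where q: "!!k. 0 < k ==> k < p ==> p choose k = p * q k" by metis
 have p0: "0 < p" using p prime_gt_0_nat by blast
 have "(a + b) ^ p = (\<Sum>k\<le>p. of_nat (p choose k) * a ^ k * b ^ (p - k))" by (rule binomial_ring)
 also have "{..p} = insert 0 (insert p {0<..<p})" using p0 by auto
 also have "(\<Sum>k\<in>insert 0 (insert p {0<..<p}). of_nat (p choose k) * a ^ k * b ^ (p - k)) =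
   b ^ p + (a ^ p + (\<Sum>k\<in>{0<..<p}. of_nat (p choose k) * a ^ k * b ^ (p - k)))" using p0 by simp
 also have "(\<Sum>k\<in>{0<..<p}. of_nat (p choose k) * a ^ k * b ^ (p - k)) =
   (\<Sum>k\<in>{0<..<p}. of_nat p * (a * (of_nat (q k) * a ^ (k - 1) * b ^ (p - k))))"
 proof (rule sum.cong[OF refl])
  fix k assume k: "k \<in> {0<..<p}"
  then have "a ^ k = a * a ^ (k - 1)" by (cases k) auto
  with q[of k] k show "of_nat (p choose k) * a ^ k * b ^ (p - k) = of_nat p * (a * (of_nat (q k) * a ^ (k - 1) * b ^ (p - k)))"
   by (simp add: mult_ac)
 qed
 also have "\<dots> = of_nat p * (a * (\<Sum>k\<in>{0<..<p}. of_nat (q k) * a ^ (k - 1) * b ^ (p - k)))"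
  by (simp add: sum_distrib_left)
 finally show ?thesis by (intro exI[of _ "\<Sum>k\<in>{0<..<p}. of_nat (q k) * a ^ (k - 1) * b ^ (p - k)"]) (simp add: ac_simps)
qed

lemma prime_power_diff_comm_ring:
 fixes a b :: "'a :: comm_ring_1"
 assumes p: "Factorial_Ring.prime (p::nat)"
 shows "\<exists>c. (a - b) ^ p = a ^ p - b ^ p + of_nat p * ((a - b) * c)"
proof -
 obtain c where "((a - b) + b) ^ p = (a - b) ^ p + b ^ p + of_nat p * ((a - b) * c)"
  using prime_power_add_comm_ring[OF p] by blast
 then show ?thesis by (intro exI[of _ "- c"]) (simp add: algebra_simps)
qed

lemma frag_of_mult: "frag_of m * frag_of n = frag_of (m + n)" for m n :: "'m :: comm_monoid_add"
 by (simp add: mult_single)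

lemma frag_of_0: "frag_of 0 = (1 :: 'm :: comm_monoid_add \<Rightarrow>\<^sub>0 int)"
 by simp

lemma frag_induct [case_names zero one diff]:
 assumes "Q 0" "!!m. Q (frag_of m)" "!!a b. [|Q a; Q b|] ==> Q (a - b)"
 shows "Q c"
 using subset_UNIV by (induction c rule: frag_induction) (use assms in auto)

lemma frag_extend_of_nat_mult:
 fixes y :: "'m :: comm_monoid_add \<Rightarrow>\<^sub>0 int"
 shows "frag_extend f (of_nat k * y) = frag_cmul (int k) (frag_extend f y)"
 by (induction k) (simp_all add: distrib_right frag_extend_add frag_cmul_distrib)

locale perfect_residue_field = field K for K (structure) +
 fixes p :: nat
 assumes prime_p: "Factorial_Ring.prime p" and p_zero: "nat_elem K p = \<zero>"
  and roots: "!!x. x \<in> carrier K ==> \<exists>y \<in> carrier K. y [^] p = x"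
begin

lemma p_pos: "0 < p" using prime_p prime_gt_0_nat by blast

lemma Frobenius_inj: "[|a \<in> carrier K; b \<in> carrier K; a [^] p = b [^] p|] ==> a = b"
proof -
 assume ab: "a \<in> carrier K" "b \<in> carrier K" "a [^] p = b [^] p"
 define h where "h = a \<ominus> b"
 have h: "h \<in> carrier K" using ab by (simp add: h_def)
 have "\<exists>Q\<in>carrier K. (h \<oplus> b) [^] p = h [^] p \<oplus> b [^] p \<oplus> nat_elem K p \<otimes> (h \<otimes> b \<otimes> Q)"
  by (rule power_prime_add[OF prime_p subset_refl]) (use ab h in auto)
 moreover have "h \<oplus> b = a" unfolding h_def by (use ab in algebra)
 ultimately have "b [^] p = h [^] p \<oplus> b [^] p" using ab h by (auto simp: p_zero)
 then have "h [^] p = \<zero>" using ab h add.r_cancel_one'[of "b [^] p" "h [^] p"] by simp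
 moreover have "h [^] k = \<zero> ==> h = \<zero>" for k :: nat using h by (induction k) (auto simp: integral_iff)
 ultimately have "h = \<zero>" by blast
 then show ?thesis using ab by (simp add: h_def)
qed

text \<open>Elements outside the carrier are ignored, so that the steps commute on the whole type.\<close>

definition ev_step :: "'a => 'a => 'a" where
 "ev_step a z = (if a \<in> carrier K & z \<in> carrier K then a \<otimes> z else z)"

definition ev :: "'a multiset => 'a" where "ev m = fold_mset ev_step \<one> m"

lemma ev_comm: "comp_fun_commute ev_step"
 by unfold_locales (auto simp: ev_step_def m_lcomm fun_eq_iff)

lemma ev_empty [simp]: "ev {#} = \<one>" by (simp add: ev_def)

lemma ev_add_mset: "ev (add_mset a m) = ev_step a (ev m)"
 using comp_fun_commute.fold_mset_add_mset[OF ev_comm] by (simp add: ev_def)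

lemma ev_closed [simp]: "ev m \<in> carrier K"
 by (induction m) (auto simp: ev_add_mset ev_step_def)

lemma ev_single [simp]: "a \<in> carrier K ==> ev {#a#} = a"
 by (simp add: ev_add_mset ev_step_def)

lemma ev_add: "ev (m + n) = ev m \<otimes> ev n"
 by (induction m) (auto simp: ev_add_mset ev_step_def m_assoc)

text \<open>The monoid ring of multisets over \<open>K\<close> is a ring by its type. It maps onto the ring \<open>Z[K]\<close>, in which a multiset
becomes the generator of its product. Here \<open>lin y\<close> is the image of \<open>y\<close> in the free abelian group on
\<open>K\<close>; thus \<open>lin y = 0\<close> says that \<open>y\<close> vanishes in \<open>Z[K]\<close>.\<close>

definition lin :: "('a multiset \<Rightarrow>\<^sub>0 int) => ('a \<Rightarrow>\<^sub>0 int)" where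
 "lin y = frag_extend (%m. frag_of (ev m)) y"

lemma lin_of [simp]: "lin (frag_of m) = frag_of (ev m)" by (simp add: lin_def)
lemma lin_diff: "lin (y - z) = lin y - lin z" by (simp add: lin_def frag_extend_diff)
lemma lin_add: "lin (y + z) = lin y + lin z" by (simp add: lin_def frag_extend_add)
lemma lin_zero [simp]: "lin 0 = 0" by (simp add: lin_def)

lemma lin_mult_zero: assumes "lin y = 0" shows "lin (c * y) = 0"
proof (induction c rule: frag_induct)
 case (one m)
 have "lin (frag_of m * z) = frag_extend (%a. frag_of (ev m \<otimes> a)) (lin z)" for z
  by (induction z rule: frag_induct) (simp_all add: right_diff_distrib lin_diff frag_extend_diff frag_of_mult ev_add)
 then show ?case using assms by simp
qed (simp_all add: left_diff_distrib lin_diff)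

lemma lin_torsion_free: "lin (of_nat p * y) = 0 ==> lin y = 0"
 unfolding lin_def frag_extend_of_nat_mult using p_pos by simp

definition mult_bij :: "('a => 'a) => bool" where
 "mult_bij g \<longleftrightarrow> g \<one> = \<one> & g \<zero> = \<zero> & (\<forall>a. g a \<in> carrier K \<longleftrightarrow> a \<in> carrier K) &
   (\<forall>a\<in>carrier K. \<forall>b\<in>carrier K. g (a \<otimes> b) = g a \<otimes> g b)"

definition transport :: "('a => 'a) => ('a multiset \<Rightarrow>\<^sub>0 int) => ('a multiset \<Rightarrow>\<^sub>0 int)" where
 "transport g y = frag_extend (%m. frag_of (image_mset g m)) y"

lemma transport_of [simp]: "transport g (frag_of m) = frag_of (image_mset g m)" by (simp add: transport_def)
lemma transport_diff: "transport g (y - z) = transport g y - transport g z" by (simp add: transport_def frag_extend_diff)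
lemma transport_zero [simp]: "transport g 0 = 0" by (simp add: transport_def)

lemma transport_mult: "transport g (y * z) = transport g y * transport g z"
proof (induction y rule: frag_induct)
 case (one m)
 show ?case by (induction z rule: frag_induct) (simp_all add: right_diff_distrib transport_diff frag_of_mult)
qed (simp_all add: left_diff_distrib transport_diff)

lemma transport_of_nat: "transport g (of_nat k * y) = of_nat k * transport g y"
proof (induction k)
 case (Suc k)
 have "of_nat (Suc k) * y = of_nat k * y - (0 - y)" by (simp add: algebra_simps)
 then have "transport g (of_nat (Suc k) * y) = transport g (of_nat k * y) - (0 - transport g y)"
  by (simp only: transport_diff transport_zero)
 then show ?case using Suc by (simp add: algebra_simps)
qed simp

lemma ev_image: "mult_bij g ==> ev (image_mset g m) = g (ev m)"
proof (induction m)
 case (add a m)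
 then show ?case using ev_closed[of m] by (auto simp: ev_add_mset ev_step_def mult_bij_def)
qed (simp add: mult_bij_def)

lemma lin_transport: "mult_bij g ==> lin (transport g y) = frag_extend (%a. frag_of (g a)) (lin y)"
 by (induction y rule: frag_induct) (simp_all add: transport_diff lin_diff frag_extend_diff ev_image)

lemma transport_inverse: "(!!a. g (h a) = a) ==> transport g (transport h y) = y"
 by (induction y rule: frag_induct) (simp_all add: transport_diff image_mset.compositionality comp_def)

definition frob :: "'a => 'a" where "frob a = (if a \<in> carrier K then a [^] p else a)"
definition unfrob :: "'a => 'a" where
 "unfrob a = (if a \<in> carrier K then SOME b. b \<in> carrier K & b [^] p = a else a)"

lemma unfrob: "a \<in> carrier K ==> unfrob a \<in> carrier K & unfrob a [^] p = a"
 unfolding unfrob_def using roots[of a] someI_ex[of "%b. b \<in> carrier K & b [^] p = a"] by auto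

lemma frob_unfrob: "frob (unfrob a) = a"
 using unfrob[of a] by (cases "a \<in> carrier K") (auto simp: frob_def unfrob_def)

lemma unfrob_frob: "unfrob (frob a) = a"
proof (cases "a \<in> carrier K")
 case True
 then show ?thesis using unfrob[of "a [^] p"] Frobenius_inj[of "unfrob (a [^] p)" a] by (simp add: frob_def)
qed (simp add: frob_def unfrob_def)

lemma frob_mult_bij: "mult_bij frob"
 using p_pos by (auto simp: mult_bij_def frob_def nat_pow_distrib nat_pow_zero)

lemma unfrob_mult_bij: "mult_bij unfrob"
proof -
 have c: "unfrob a \<in> carrier K \<longleftrightarrow> a \<in> carrier K" for a using unfrob[of a] by (auto simp: unfrob_def)
 have i: "unfrob b = a" if "frob a = b" for a b using that unfrob_frob by blast
 have "unfrob (a \<otimes> b) = unfrob a \<otimes> unfrob b" if "a \<in> carrier K" "b \<in> carrier K" for a b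
  by (rule i) (use unfrob[OF that(1)] unfrob[OF that(2)] in \<open>simp add: frob_def nat_pow_distrib\<close>)
 then show ?thesis using c i[of \<one> \<one>] i[of \<zero> \<zero>] p_pos by (auto simp: mult_bij_def frob_def nat_pow_zero)
qed

definition \<phi> where "\<phi> = transport frob"

text \<open>Both sides are additive modulo \<open>p\<close>, and they agree on generators.\<close>

lemma Frobenius_lift: "\<exists>d j. \<phi> y = y ^ p + of_nat p * d + j & lin j = 0"
proof (induction y rule: frag_induct)
 case zero
 show ?case by (intro exI[of _ 0]) (use p_pos in \<open>simp add: \<phi>_def zero_power\<close>)
next
 case (one m)
 have "frag_of m ^ k = frag_of (repeat_mset k m)" for k by (induction k) (simp_all add: frag_of_mult)
 moreover have "ev (repeat_mset k m) = ev m [^] k" for k by (induction k) (simp_all add: ev_add m_comm)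
 ultimately have "lin (\<phi> (frag_of m) - frag_of m ^ p) = 0"
  by (simp add: \<phi>_def lin_diff ev_image[OF frob_mult_bij] frob_def)
 then show ?case by (intro exI[of _ 0] exI[of _ "\<phi> (frag_of m) - frag_of m ^ p"]) simp
next
 case (diff a b)
 then obtain d j d' j' where a: "\<phi> a = a ^ p + of_nat p * d + j" "lin j = 0"
  and b: "\<phi> b = b ^ p + of_nat p * d' + j'" "lin j' = 0" by blast
 obtain c where c: "(a - b) ^ p = a ^ p - b ^ p + of_nat p * ((a - b) * c)"
  using prime_power_diff_comm_ring[OF prime_p] by blast
 have "\<phi> (a - b) = \<phi> a - \<phi> b" by (simp add: \<phi>_def transport_diff)
 then have "\<phi> (a - b) = (a - b) ^ p + of_nat p * (d - d' - (a - b) * c) + (j - j')"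
  unfolding c a(1) b(1) by (simp add: algebra_simps)
 then show ?case using a(2) b(2) by (metis lin_diff diff_zero)
qed

definition aug :: "('a \<Rightarrow>\<^sub>0 int) => 'a" where
 "aug = (SOME h. h \<in> hom (free_Abelian_group UNIV) (add_monoid K) &
   (\<forall>a. h (frag_of a) = (if a \<in> carrier K then a else \<zero>)))"

lemma aug: "aug \<in> hom (free_Abelian_group UNIV) (add_monoid K)" "aug (frag_of a) = (if a \<in> carrier K then a else \<zero>)"
proof -
 have "(%a. if a \<in> carrier K then a else \<zero>) ` UNIV \<subseteq> carrier (add_monoid K)" by auto
 then obtain h where "h \<in> hom (free_Abelian_group UNIV) (add_monoid K)"
   "!!a. a \<in> UNIV ==> h (frag_of a) = (if a \<in> carrier K then a else \<zero>)"
  using comm_group.free_Abelian_group_universal[OF a_comm_group] by blast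
 then have "\<exists>h. h \<in> hom (free_Abelian_group UNIV) (add_monoid K) & (\<forall>a. h (frag_of a) = (if a \<in> carrier K then a else \<zero>))"
  by blast
 from someI_ex[OF this] show "aug \<in> hom (free_Abelian_group UNIV) (add_monoid K)"
  "aug (frag_of a) = (if a \<in> carrier K then a else \<zero>)" by (auto simp: aug_def)
qed

lemma aug_closed [simp]: "aug x \<in> carrier K" using aug(1) by (auto simp: hom_def Pi_iff)

lemma aug_add: "aug (x + y) = aug x \<oplus> aug y" using aug(1) by (auto simp: hom_def)

lemma aug_zero [simp]: "aug 0 = \<zero>" using aug_add[of 0 0] add.r_cancel_one'[of "aug 0" "aug 0"] by simp

lemma aug_diff: "aug (x - y) = aug x \<ominus> aug y"
proof -
 have "aug x = aug (x - y) \<oplus> aug y" using aug_add[of "x - y" y] by simp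
 then show ?thesis by (simp add: minus_eq a_assoc r_neg)
qed

definition res :: "('a multiset \<Rightarrow>\<^sub>0 int) => 'a" where "res y = aug (lin y)"

lemma res_closed [simp]: "res y \<in> carrier K" by (simp add: res_def)
lemma res_of [simp]: "res (frag_of m) = ev m" by (simp add: res_def aug)
lemma res_add: "res (y + z) = res y \<oplus> res z" by (simp add: res_def lin_add aug_add)
lemma res_diff: "res (y - z) = res y \<ominus> res z" by (simp add: res_def lin_diff aug_diff)
lemma res_lin_zero: "lin y = 0 ==> res y = \<zero>" by (simp add: res_def)
lemma res_zero [simp]: "res 0 = \<zero>" by (simp add: res_def)

lemma res_mult: "res (y * z) = res y \<otimes> res z"
proof (induction y rule: frag_induct)
 case (one m)
 show ?case
  by (induction z rule: frag_induct)
   (simp_all add: right_diff_distrib res_diff frag_of_mult ev_add minus_eq r_distr r_minus)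
qed (simp_all add: left_diff_distrib res_diff minus_eq l_distr l_minus)

lemma res_one [simp]: "res 1 = \<one>" using res_of[of 0] frag_of_0[where 'm = "'a multiset"] by simp

lemma res_power: "res (y ^ k) = res y [^] k"
 by (induction k) (simp_all add: res_mult m_comm)

lemma res_of_nat: "res (of_nat k) = nat_elem K k"
 by (induction k) (simp_all add: nat_elem_0 nat_elem_Suc res_add a_comm nat_elem_closed)

lemma res_p [simp]: "res (of_nat p) = \<zero>" by (simp add: res_of_nat p_zero)

lemma res_\<phi>: "res (\<phi> y) = res y [^] p"
proof -
 obtain d j where "\<phi> y = y ^ p + of_nat p * d + j" "lin j = 0" using Frobenius_lift by blast
 then show ?thesis by (simp add: res_add res_mult res_power res_lin_zero)
qed

text \<open>The preimage of the \<open>n\<close>-th power of the kernel \<open>I\<close> of \<open>Z[K] \<rightarrow> K\<close>. The quotients of \<open>Z[K]\<close> by these powers are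
the truncated rings of Witt vectors of the perfect field \<open>K\<close> (Cuntz and Deninger).\<close>

inductive adic :: "nat => ('a multiset \<Rightarrow>\<^sub>0 int) => bool" where
 base: "adic 0 y"
| null: "lin y = 0 ==> adic n y"
| mult: "res x = \<zero> ==> adic n y ==> adic (Suc n) (x * y)"
| diff: "adic n x ==> adic n y ==> adic n (x - y)"

lemma adic_zero [simp]: "adic n 0" by (simp add: null)

lemma adic_add: "adic n x ==> adic n y ==> adic n (x + y)"
 using diff[OF _ diff[OF adic_zero], of n x y] by simp

lemma adic_ideal: "adic n y ==> adic n (c * y)"
proof (induction rule: adic.induct)
 case (null y n)
 then show ?case by (intro adic.null lin_mult_zero)
next
 case (mult x n y)
 have "c * (x * y) = x * (c * y)" by (simp add: mult_ac)
 then show ?case using adic.mult[OF mult(1) mult(3)] by (simp only:)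
qed (simp_all add: adic.base adic.diff right_diff_distrib)

lemma adic_decr: "adic (Suc n) y ==> adic n y"
proof (induction "Suc n" y arbitrary: n rule: adic.induct)
 case (mult x n y)
 then show ?case by (intro adic_ideal)
qed (auto intro: adic.null adic.diff)

lemma adic_res: "adic (Suc n) y ==> res y = \<zero>"
 by (induction "Suc n" y rule: adic.induct) (simp_all add: res_lin_zero res_mult res_diff)

lemma adic_1_iff: "adic 1 y \<longleftrightarrow> res y = \<zero>"
 using adic_res[of 0 y] mult[of y 0 1] base by auto

lemma adic_p: "adic n y ==> adic (Suc n) (of_nat p * y)" by (rule mult) simp_all

lemma adic_mult: "adic m x ==> adic n y ==> adic (m + n) (x * y)"
proof (induction rule: adic.induct)
 case (null x m)
 then have "lin (y * x) = 0" by (intro lin_mult_zero)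
 then show ?case by (intro adic.null) (simp add: mult.commute)
next
 case (mult x m z)
 then show ?case using adic.mult[of x "m + n" "z * y"] by (simp add: mult.assoc)
qed (simp_all add: adic_ideal adic.diff left_diff_distrib)

lemma adic_unfrob: "adic n y ==> adic n (transport unfrob y)"
proof (induction rule: adic.induct)
 case (null y n)
 then show ?case by (intro adic.null) (simp add: lin_transport[OF unfrob_mult_bij])
next
 case (mult x n y)
 have "res (transport unfrob x) [^] p = res x"
  using res_\<phi>[of "transport unfrob x"] transport_inverse[of frob unfrob, OF frob_unfrob] by (simp add: \<phi>_def)
 then have "res (transport unfrob x) = \<zero>"
  using Frobenius_inj[of "res (transport unfrob x)" \<zero>] mult(1) p_pos by (simp add: nat_pow_zero)
 then show ?case unfolding transport_mult by (rule adic.mult) (rule mult)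
qed (simp_all add: adic.base adic.diff transport_diff)

text \<open>The map \<open>(\<phi> y - y^p) / p\<close> lowers the order by at most one, as one sees on products and differences.\<close>

lemma Frobenius_lift_adic: "adic (Suc n) y ==> \<exists>d j. \<phi> y = y ^ p + of_nat p * d + j & adic n d & lin j = 0"
proof (induction "Suc n" y arbitrary: n rule: adic.induct)
 case (null y n)
 have "lin (\<phi> y - y ^ p) = 0"
  using null p_pos lin_mult_zero[OF null, of "y ^ (p - 1)"]
  by (simp add: lin_diff \<phi>_def lin_transport[OF frob_mult_bij] power_eq_if mult.commute)
 then show ?case by (intro exI[of _ 0] exI[of _ "\<phi> y - y ^ p"]) simp
next
 case (mult x n y)
 obtain d j where x: "\<phi> x = x ^ p + of_nat p * d + j" "lin j = 0" using Frobenius_lift by blast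
 obtain d' j' where y: "\<phi> y = y ^ p + of_nat p * d' + j'" "lin j' = 0" "n = 0 \<or> adic (n - 1) d'"
 proof (cases n)
  case 0
  then show ?thesis using Frobenius_lift[of y] that by blast
 next
  case (Suc m)
  then show ?thesis using mult(3)[of m] that by auto
 qed
 define D where "D = x ^ p * d' + d * y ^ p + of_nat p * (d * d')"
 have D: "adic n D"
 proof (cases n)
  case (Suc m)
  have "adic n (x * (x ^ (p - 1) * d'))" unfolding Suc by (rule adic.mult[OF mult(1)], rule adic_ideal) (use y Suc in simp)
  moreover have "x * (x ^ (p - 1) * d') = x ^ p * d'" using p_pos by (simp add: power_eq_if mult.assoc)
  moreover have "adic n (d * y ^ (p - 1) * y)" by (rule adic_ideal[OF mult(2)])
  moreover have "d * y ^ (p - 1) * y = d * y ^ p" using p_pos by (simp add: power_eq_if mult_ac)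
  moreover have "adic n (of_nat p * (d * d'))" unfolding Suc by (rule adic_p, rule adic_ideal) (use y Suc in simp)
  ultimately show ?thesis unfolding D_def by (auto intro!: adic_add)
 qed (simp add: adic.base)
 define j'' where "j'' = j * \<phi> y + (x ^ p + of_nat p * d) * j'"
 have "lin j'' = 0"
  using lin_mult_zero[OF x(2), of "\<phi> y"] lin_mult_zero[OF y(2), of "x ^ p + of_nat p * d"]
  by (simp add: j''_def lin_add mult.commute)
 moreover have "\<phi> (x * y) = (x * y) ^ p + of_nat p * D + j''"
 proof -
  have "\<phi> (x * y) = \<phi> x * \<phi> y" by (simp add: \<phi>_def transport_mult)
  also have "\<dots> = (x ^ p + of_nat p * d) * (y ^ p + of_nat p * d') + j''"
   unfolding j''_def by (subst x(1), subst y(1)) (simp add: y(1) algebra_simps)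
  finally show ?thesis unfolding D_def power_mult_distrib by (simp add: algebra_simps)
 qed
 ultimately show ?case using D by blast
next
 case (diff a b)
 obtain d j where a: "\<phi> a = a ^ p + of_nat p * d + j" "lin j = 0" "adic n d" using diff(2) by blast
 obtain d' j' where b: "\<phi> b = b ^ p + of_nat p * d' + j'" "lin j' = 0" "adic n d'" using diff(4) by blast
 obtain c where c: "(a - b) ^ p = a ^ p - b ^ p + of_nat p * ((a - b) * c)"
  using prime_power_diff_comm_ring[OF prime_p] by blast
 have "adic n (c * (a - b))" by (rule adic_ideal, rule adic_decr, rule adic.diff) (rule diff)+
 then have "adic n (d - d' - (a - b) * c)" using a b by (intro adic.diff) (simp_all add: mult.commute)
 moreover have "\<phi> (a - b) = \<phi> a - \<phi> b" by (simp add: \<phi>_def transport_diff)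
 then have "\<phi> (a - b) = (a - b) ^ p + of_nat p * (d - d' - (a - b) * c) + (j - j')"
  unfolding c a(1) b(1) by (simp add: algebra_simps)
 moreover have "lin (j - j') = 0" using a b by (simp add: lin_diff)
 ultimately show ?case by blast
qed

text \<open>For \<open>y = p a\<close> the preceding lemma reads \<open>p \<phi> a = p^p a^p + p d\<close>. Cancelling \<open>p\<close> in the torsion-free
group \<open>Z[K]\<close> gives \<open>\<phi> a\<close> in \<open>I^n\<close>, and \<open>\<phi>\<close> is bijective and preserves \<open>I^n\<close>.\<close>

lemma adic_p_cancel: "adic (Suc n) (of_nat p * a) ==> adic n a"
proof (induction n)
 case (Suc n)
 have an: "adic n a" by (rule Suc.IH, rule adic_decr) (rule Suc.prems)
 obtain d j where d: "\<phi> (of_nat p * a) = (of_nat p * a) ^ p + of_nat p * d + j" "adic (Suc n) d" "lin j = 0"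
  using Frobenius_lift_adic[OF Suc.prems] by blast
 obtain q where q: "p = Suc (Suc q)" using prime_ge_2_nat[OF prime_p] by (metis le_Suc_ex numeral_2_eq_2 plus_nat.simps(2) add_0)
 define z where "z = \<phi> a - of_nat p * (of_nat p ^ q * a ^ p) - d"
 have "of_nat p * z = j"
 proof -
  have "of_nat p * z = of_nat p * \<phi> a - of_nat p ^ p * a ^ p - of_nat p * d"
   unfolding z_def by (subst (2) q) (simp add: algebra_simps)
  also have "\<dots> = j" using d(1) by (simp add: \<phi>_def transport_of_nat power_mult_distrib)
  finally show ?thesis .
 qed
 then have "lin z = 0" using d(3) lin_torsion_free by simp
 then have "adic (Suc n) z" by (rule adic.null)
 moreover have "adic (Suc n) (of_nat p * (of_nat p ^ q * a ^ p))"
 proof (rule adic_p)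
  have "of_nat p ^ q * a ^ p = (of_nat p ^ q * a ^ (p - 1)) * a" using p_pos by (simp add: power_eq_if mult_ac)
  then show "adic n (of_nat p ^ q * a ^ p)" using adic_ideal[OF an] by (simp only:)
 qed
 ultimately have "adic (Suc n) (z + of_nat p * (of_nat p ^ q * a ^ p) + d)" using d(2) by (intro adic_add)
 then have "adic (Suc n) (\<phi> a)" by (simp add: z_def)
 from adic_unfrob[OF this] show ?case using transport_inverse[of unfrob frob, OF unfrob_frob] by (simp add: \<phi>_def)
qed (simp add: adic.base)

text \<open>\<open>\<phi>\<close> is bijective and congruent to the \<open>p\<close>-th power modulo \<open>p\<close>, so \<open>I\<close> is contained in \<open>I^p + p Z[K]\<close>; this is iterated.\<close>

lemma adic_1_decompose: "res y = \<zero> ==> \<exists>d. adic n (y - of_nat p * d)"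
proof (induction n)
 case 0
 then show ?case using base by blast
next
 case (Suc n)
 have two: "\<exists>d. adic 2 (x - of_nat p * d)" if x: "res x = \<zero>" for x
 proof -
  define z where "z = transport unfrob x"
  have xz: "x = \<phi> z" using transport_inverse[of frob unfrob, OF frob_unfrob] by (simp add: z_def \<phi>_def)
  have "adic 1 z" unfolding z_def by (rule adic_unfrob) (use x in \<open>simp add: adic_1_iff[unfolded One_nat_def]\<close>)
  then have zr: "res z = \<zero>" by (simp only: adic_1_iff)
  obtain d j where d: "x = z ^ p + of_nat p * d + j" "lin j = 0" using Frobenius_lift[of z] xz by blast
  obtain q where q: "p = Suc (Suc q)" using prime_ge_2_nat[OF prime_p] by (metis le_Suc_ex numeral_2_eq_2 plus_nat.simps(2) add_0)
  have "adic (Suc (Suc 0)) (z * (z * z ^ q))" by (intro adic.mult zr adic.base)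
  then have "adic 2 (z ^ p)" by (simp add: q numeral_2_eq_2)
  then have "adic 2 (z ^ p + j)" by (rule adic_add) (rule adic.null[OF d(2)])
  then show ?thesis by (intro exI[of _ d]) (simp add: d(1))
 qed
 have step: "adic (Suc n) y ==> \<exists>d. adic (Suc (Suc n)) (y - of_nat p * d)" for y n
 proof (induction "Suc n" y rule: adic.induct)
  case (null y)
  then show ?case by (intro exI[of _ 0]) (simp add: adic.null)
 next
  case (mult x y)
  obtain d where "adic 2 (x - of_nat p * d)" using two[OF mult(1)] by blast
  from adic_mult[OF this mult(2)] have "adic (Suc (Suc n)) (x * y - of_nat p * (d * y))"
   by (simp add: algebra_simps)
  then show ?case by blast
 next
  case (diff a b)
  then obtain d d' where "adic (Suc (Suc n)) (a - of_nat p * d)" "adic (Suc (Suc n)) (b - of_nat p * d')" by blast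
  from adic.diff[OF this] have "adic (Suc (Suc n)) (a - b - of_nat p * (d - d'))" by (simp add: algebra_simps)
  then show ?case by blast
 qed
 show ?case
 proof (cases n)
  case 0
  then show ?thesis using Suc.prems by (intro exI[of _ 0]) (simp add: adic_1_iff[unfolded One_nat_def])
 next
  case (Suc m)
  obtain d where d: "adic n (y - of_nat p * d)" using Suc.IH Suc.prems by blast
  obtain d' where "adic (Suc n) ((y - of_nat p * d) - of_nat p * d')" using step[of m "y - of_nat p * d"] d Suc by blast
  then show ?thesis by (intro exI[of _ "d + d'"]) (simp add: algebra_simps)
 qed
qed

lemma adic_monomial: "ev m = ev m' ==> adic n (frag_of m - frag_of m')"
 by (rule adic.null) (simp add: lin_diff)

end

text \<open>Polynomials over \<open>Z[K]\<close> modulo \<open>x^e - c\<close> with \<open>c = p / [t]\<close>, that is, with the relation \<open>p = [t] x^e\<close>. The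
reduced \<open>i\<close>-th coefficient of \<open>b\<close> is \<open>co i b\<close>. Since \<open>p\<close> has order \<open>e\<close>, order \<open>m\<close> of \<open>b\<close> requires this
coefficient to lie in \<open>I^k\<close> for the least \<open>k\<close> with \<open>e k + i \<ge> m\<close> (\<open>Fil\<close>).\<close>

locale eisenstein = perfect_residue_field K p for K (structure) and p +
 fixes e :: nat and t :: 'a
 assumes e_pos: "1 \<le> e" and t: "t \<in> carrier K" "t ~= \<zero>"
begin

abbreviation T where "T \<equiv> frag_of {#t#}"
definition c where "c = of_nat p * frag_of {#inv t#}"

lemma T_inv: "adic n (T * (frag_of {#inv t#} * y) - y)"
proof -
 have i: "inv t \<in> carrier K" "t \<otimes> inv t = \<one>" using t field_Units by auto
 have "ev {#t, inv t#} = ev {#}" using t i by (simp add: ev_add_mset ev_step_def)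
 then have "adic n (y * (frag_of {#t, inv t#} - frag_of {#}))" by (intro adic_ideal adic_monomial)
 moreover have "T * (frag_of {#inv t#} * y) = y * frag_of {#t, inv t#}"
  by (simp add: mult.assoc[symmetric] frag_of_mult) (simp add: mult.commute add_mset_commute)
 ultimately show ?thesis using frag_of_0[where 'm = "'a multiset"] by (simp add: right_diff_distrib)
qed

lemma adic_c: "adic (Suc n) (c * y) \<longleftrightarrow> adic n y"
proof
 assume "adic (Suc n) (c * y)"
 then have "adic n (frag_of {#inv t#} * y)" using adic_p_cancel by (simp add: c_def mult.assoc)
 then have "adic n (T * (frag_of {#inv t#} * y) - (T * (frag_of {#inv t#} * y) - y))"
  by (intro adic.diff[OF adic_ideal T_inv])
 then show "adic n y" by simp
next
 assume "adic n y"
 then show "adic (Suc n) (c * y)" unfolding c_def mult.assoc by (intro adic_p adic_ideal)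
qed

lemma adic_mono: "[|adic n y; m \<le> n|] ==> adic m y"
 by (induction n) (auto simp: le_Suc_eq dest: adic_decr)

definition co :: "nat => ('a multiset \<Rightarrow>\<^sub>0 int) poly => ('a multiset \<Rightarrow>\<^sub>0 int)" where
 "co i b = (\<Sum>j\<le>degree b. coeff b (i + e * j) * c ^ j)"

lemma co_alt: "degree b \<le> D ==> co i b = (\<Sum>j\<le>D. coeff b (i + e * j) * c ^ j)"
proof -
 assume D: "degree b \<le> D"
 have "coeff b (i + e * j) = 0" if "degree b < j" for j
 proof (rule coeff_eq_0)
  have "j \<le> e * j" using e_pos by simp
  then show "degree b < i + e * j" using that by linarith
 qed
 then show ?thesis unfolding co_def by (intro sum.mono_neutral_left) (use D in auto)
qed

lemma co_diff: "co i (a - b) = co i a - co i b"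
proof -
 define D where "D = max (degree a) (degree b)"
 have "degree (a - b) \<le> D" "degree a \<le> D" "degree b \<le> D" by (auto simp: D_def degree_diff_le_max)
 then show ?thesis by (simp add: co_alt[of _ D] sum_subtractf left_diff_distrib)
qed

lemma co_const: "co i [:a:] = (if i = 0 then a else 0)"
 by (cases i) (simp_all add: co_def)

lemma co_smult: "co i (smult a b) = a * co i b"
 using co_alt[OF degree_smult_le, of i a b] by (simp add: co_def sum_distrib_left mult.assoc)

lemma co_pCons_Suc: "co (Suc i) (pCons 0 b) = co i b"
 using co_alt[of "pCons 0 b" "Suc (degree b)" "Suc i"] co_alt[of b "Suc (degree b)" i] degree_pCons_le[of 0 b] by simp

lemma co_pCons_0: "co 0 (pCons 0 b) = c * co (e - 1) b"
proof -
 have s: "e * Suc j = Suc (e - 1 + e * j)" for j using e_pos by simp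
 have "co 0 (pCons 0 b) = (\<Sum>j\<le>Suc (degree b). coeff (pCons 0 b) (e * j) * c ^ j)"
  using co_alt[of "pCons 0 b" "Suc (degree b)" 0] degree_pCons_le[of 0 b] by simp
 also have "\<dots> = (\<Sum>j\<le>degree b. coeff (pCons 0 b) (e * Suc j) * c ^ Suc j)"
  by (subst sum.atMost_Suc_shift) simp
 also have "\<dots> = (\<Sum>j\<le>degree b. c * (coeff b (e - 1 + e * j) * c ^ j))"
  unfolding s by (simp add: mult_ac)
 finally show ?thesis by (simp add: co_def sum_distrib_left)
qed

lemma co_pCons: "co 0 (pCons a b) = a + c * co (e - 1) b"
 using co_diff[of 0 "pCons a b" "[:a:]"] co_pCons_0[of b] co_const[of 0 a] by (simp add: diff_eq_eq)

definition Fil :: "nat => ('a multiset \<Rightarrow>\<^sub>0 int) poly => bool" where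
 "Fil m b \<longleftrightarrow> (\<forall>i<e. adic ((m - i + e - 1) div e) (co i b))"

lemma Fil_0: "Fil 0 b" using e_pos by (simp add: Fil_def adic.base)
lemma Fil_diff: "[|Fil m a; Fil m b|] ==> Fil m (a - b)" by (simp add: Fil_def co_diff adic.diff)
lemma Fil_add: "[|Fil m a; Fil m b|] ==> Fil m (a + b)"
 using Fil_diff[of m a "[:0:] - b"] Fil_diff[of m "[:0:]" b] by (simp add: Fil_def co_const[where a = 0, simplified])

lemma Fil_mono: "[|Fil n b; m \<le> n|] ==> Fil m b"
 unfolding Fil_def by (blast intro: adic_mono div_le_mono diff_le_mono add_le_mono1)

lemma Fil_pCons: "Fil (Suc m) (pCons 0 b) \<longleftrightarrow> Fil m b"
proof -
 have "{..<e} = insert (e - 1) {..<e - 1}" using e_pos by auto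
 then have all1: "(\<forall>i<e. Q i) \<longleftrightarrow> Q (e - 1) & (\<forall>i<e - 1. Q i)" for Q by (metis insert_iff lessThan_iff)
 have all0: "(\<forall>i<e. Q i) \<longleftrightarrow> Q 0 & (\<forall>i<e - 1. Q (Suc i))" for Q
  using e_pos by (cases e) (auto simp: less_Suc_eq_0_disj)
 have "(m - (e - 1) + e - 1) div e = m div e"
  using e_pos by (cases "e - 1 \<le> m") auto
 moreover have "(Suc m - 0 + e - 1) div e = Suc (m div e)" using e_pos by simp
 ultimately show ?thesis unfolding Fil_def all0[of "%i. adic ((Suc m - i + e - 1) div e) (co i (pCons 0 b))"]
   all1[of "%i. adic ((m - i + e - 1) div e) (co i b)"]
  by (simp add: co_pCons_0 co_pCons_Suc adic_c del: One_nat_def)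
qed

lemma Fil_ideal: "Fil m b ==> Fil m (a * b)"
proof (induction a)
 case 0
 then show ?case using Fil_diff[of m b b] by simp
next
 case (pCons a0 a)
 have "Fil m (smult a0 b)" using pCons.prems by (simp add: Fil_def co_smult adic_ideal)
 moreover have "Fil m (pCons 0 (a * b))" by (rule Fil_mono[of "Suc m"]) (use pCons Fil_pCons in auto)
 ultimately show ?case by (simp add: Fil_add)
qed

lemma Fil_1: "Fil 1 b \<longleftrightarrow> res (coeff b 0) = \<zero>"
proof -
 have "(1 - i + e - 1) div e = (if i = 0 then 1 else 0)" for i using e_pos by (cases i) auto
 then have "Fil 1 b \<longleftrightarrow> adic 1 (co 0 b)" using e_pos by (auto simp: Fil_def adic.base)
 also have "\<dots> \<longleftrightarrow> res (co 0 b) = \<zero>" by (rule adic_1_iff)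
 also have "res (co 0 b) = res (coeff b 0)"
  by (cases b) (simp add: co_pCons res_add res_mult c_def)
 finally show ?thesis .
qed

lemma Fil_const: "adic n a ==> Fil n [:a:]"
proof -
 assume a: "adic n a"
 have "(n + e - 1) div e \<le> n"
 proof (cases n)
  case (Suc m)
  have "m div e \<le> m" by simp
  then show ?thesis using Suc e_pos by simp
 qed (use e_pos in simp)
 then show ?thesis using adic_mono[OF a] by (auto simp: Fil_def co_const)
qed

lemma Fil_p: "Fil n (of_nat p - [:T:] * [:0, 1:] ^ e)"
proof -
 have m: "[:T:] * [:0, 1:] ^ e = monom T e" by (simp add: monom_altdef)
 have dm: "degree (monom T e) \<le> e" by (rule degree_monom_le)
 have ei: "e = i + e * j \<longleftrightarrow> i = 0 & j = 1" if "i < e" for i j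
  using that e_pos by (cases j) auto
 have "co i (monom T e) = (if i = 0 then T * c else 0)" if i: "i < e" for i
 proof -
  have "co i (monom T e) = (\<Sum>j\<le>e. if j = 1 then (if i = 0 then T * c else 0) else 0)"
   unfolding co_alt[OF dm] by (rule sum.cong) (auto simp: coeff_monom ei[OF i])
  then show ?thesis using e_pos by simp
 qed
 moreover have "of_nat p = [:of_nat p :: 'a multiset \<Rightarrow>\<^sub>0 int:]" by (simp add: of_nat_poly)
 moreover have "adic k (of_nat p - T * c)" for k
  using adic.diff[OF adic_zero T_inv[of k "of_nat p"]] by (simp add: c_def mult_ac)
 ultimately show ?thesis unfolding m by (simp add: Fil_def co_diff co_const)
qed

lemma Fil_approx: assumes "Fil 1 b" shows "\<exists>d. Fil n (b - [:0, 1:] * d)"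
proof (cases b)
 case (pCons a b')
 then have "res a = \<zero>" using assms Fil_1 by simp
 then obtain d where "adic n (a - of_nat p * d)" using adic_1_decompose by blast
 then have f: "Fil n ([:a - of_nat p * d:] + [:d:] * (of_nat p - [:T:] * [:0, 1:] ^ e))"
  by (intro Fil_add Fil_const Fil_ideal Fil_p)
 have e1: "[:a - of_nat p * d:] = [:a:] - of_nat p * [:d:]" by (simp add: of_nat_poly)
 have e2: "b = [:a:] + [:0, 1:] * b'" by (simp add: pCons)
 have e3: "[:0, 1:] ^ e = [:0, 1:] * ([:0, 1:] :: ('a multiset \<Rightarrow>\<^sub>0 int) poly) ^ (e - 1)" using e_pos by (simp add: power_eq_if)
 have e4: "A + Y * B - Y * (B + D * (U * Z)) = A - P * D + D * (P - U * (Y * Z))"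
  for A B D P U Y Z :: "('a multiset \<Rightarrow>\<^sub>0 int) poly" by (simp add: algebra_simps)
 have "Fil n (b - [:0, 1:] * (b' + [:d:] * ([:T:] * [:0, 1:] ^ (e - 1))))"
  using f unfolding e1 e3 unfolding e2 unfolding e4[where P = "of_nat p"] .
 then show ?thesis by blast
qed

end

section \<open>Completion\<close>

text \<open>A ring whose completion is a discrete valuation ring with uniformizer \<open>x\<close>: multiplication by \<open>x\<close> raises the order
by exactly one, and an element of positive order is a multiple of \<open>x\<close> up to any order.\<close>

locale graded_approximation = K: field K for K :: "('a, 'z) ring_scheme" (structure) +
 fixes F :: "nat => 'b :: comm_ring_1 => bool" and x T :: 'b and r0 :: "'b => 'a"
  and p e :: nat and enc :: "(nat => 'a) => 'u"
 assumes F_0: "F 0 b" and F_diff: "[|F m b; F m b'|] ==> F m (b - b')"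
  and F_ideal: "F m b ==> F m (b' * b)" and F_mono: "[|F n b; m \<le> n|] ==> F m b"
  and F_x: "F (Suc m) (x * b) \<longleftrightarrow> F m b" and F_approx: "F 1 b ==> \<exists>d. F n (b - x * d)"
  and F_p: "F n (of_nat p - T * x ^ e)"
  and r0_closed: "r0 b \<in> carrier K" and r0_surj: "a \<in> carrier K ==> \<exists>b. r0 b = a"
  and r0_add: "r0 (b + b') = r0 b \<oplus> r0 b'" and r0_mult: "r0 (b * b') = r0 b \<otimes> r0 b'"
  and r0_one: "r0 1 = \<one>" and r0_zero: "r0 b = \<zero> \<longleftrightarrow> F 1 b"
  and enc: "inj_on enc (UNIV \<rightarrow> carrier K)"
begin

lemma F_zero: "F m 0" using F_diff[OF F_p F_p, of m] by simp
lemma F_neg: "F m b ==> F m (- b)" using F_diff[OF F_zero, of m b] by simp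
lemma F_add: "[|F m b; F m b'|] ==> F m (b + b')" using F_diff[OF _ F_neg, of m b b'] by simp
lemma F_trans: "[|F m (a - b); F m (b - d)|] ==> F m (a - d)" using F_add[of m "a - b" "b - d"] by simp
lemma F_sym: "F m (a - b) ==> F m (b - a)" using F_neg[of m "a - b"] by simp
lemma F_xpow: "F (k + m) (x ^ k * b) \<longleftrightarrow> F m b"
 by (induction k) (simp_all add: F_x mult.assoc)

lemma F_approx_pow: "F k b ==> \<exists>d. F n (b - x ^ k * d)"
proof (induction k arbitrary: b n)
 case 0
 show ?case by (rule exI[of _ b]) (simp add: F_zero)
next
 case (Suc k)
 have b: "F 1 b" using F_mono[OF Suc.prems, of 1] by simp
 obtain d where d: "F (Suc (n + k)) (b - x * d)" using F_approx[OF b] by blast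
 have "F (Suc k) (b - (b - x * d))" by (rule F_diff[OF Suc.prems F_mono[OF d]]) simp
 then have "F k d" by (simp add: F_x)
 then obtain d' where "F n (d - x ^ k * d')" using Suc.IH by blast
 then have "F (Suc n) (x * (d - x ^ k * d'))" by (simp add: F_x)
 then have "F n (x * d - x ^ Suc k * d')" using F_mono[of "Suc n" _ n] by (simp add: right_diff_distrib mult.assoc)
 then have "F n (b - x ^ Suc k * d')" using F_trans[OF F_mono[OF d, of n]] by simp
 then show ?case by blast
qed

lemma F_1_mult: assumes y: "F 1 y" and z: "F j z" shows "F (Suc j) (y * z)"
proof -
 obtain d where d: "F (Suc j) (y - x * d)" using F_approx[OF y] by blast
 have "F (Suc j) (z * (y - x * d) + x * (d * z))" by (rule F_add[OF F_ideal[OF d]]) (simp add: F_x F_ideal[OF z])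
 then show ?thesis by (simp add: algebra_simps)
qed

lemma r0_diff: "r0 (a - b) = r0 a \<ominus> r0 b"
proof -
 have "r0 a = r0 (a - b) \<oplus> r0 b" using r0_add[of "a - b" b] by simp
 then show ?thesis using r0_closed by (simp add: K.minus_eq K.a_assoc K.r_neg)
qed

lemma r0_eq_iff: "r0 a = r0 b \<longleftrightarrow> F 1 (a - b)"
 using r0_zero[of "a - b"] r0_diff[of a b] r0_closed by simp

lemma not_F_1_one: "\<not> F 1 1" using r0_zero[of 1] r0_one K.one_not_zero by simp

lemma F_pow_one: "\<not> F (Suc k) (x ^ k)" using F_xpow[of k 1 1] not_F_1_one by simp

lemma F_unit: assumes b: "\<not> F 1 b" shows "\<exists>d. F n (b * d - 1)"
proof -
 have "r0 b \<in> Units K" using b r0_zero r0_closed K.field_Units by auto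
 then obtain a where a: "r0 a = inv r0 b" "r0 b \<otimes> r0 a = \<one>" using r0_surj by (metis K.Units_inv_closed K.Units_r_inv)
 define y where "y = 1 - b * a"
 have y: "F 1 y" unfolding y_def r0_eq_iff[symmetric] by (simp add: r0_mult a(2) r0_one)
 have "F n (y ^ n)" for n by (induction n) (simp_all add: F_0 F_1_mult[OF y])
 moreover have "b * (a * (\<Sum>i<n. y ^ i)) - 1 = - (y ^ n)"
  using one_diff_power_eq[of y n] by (simp add: y_def mult.assoc algebra_simps)
 ultimately show ?thesis using F_neg by metis
qed

definition coherent :: "(nat => 'b) => bool" where "coherent s \<longleftrightarrow> (\<forall>m. F m (s (Suc m) - s m))"

lemma coherent_le: "[|coherent s; k \<le> m|] ==> F k (s m - s k)"
proof (induction m)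
 case (Suc m)
 show ?case
 proof (cases "k = Suc m")
  case False
  then have "F k (s (Suc m) - s m)" using Suc.prems F_mono[of m _ k] by (auto simp: coherent_def)
  then show ?thesis using Suc False by (auto intro: F_trans)
 qed (simp add: F_zero)
qed (simp add: F_zero)

lemma coherent_mult: assumes "coherent s" "coherent s'" shows "coherent (%m. s m * s' m)"
 unfolding coherent_def
proof
 fix m
 have "F m (s' (Suc m) * (s (Suc m) - s m) + s m * (s' (Suc m) - s' m))"
  using assms by (intro F_add F_ideal) (auto simp: coherent_def)
 then show "F m (s (Suc m) * s' (Suc m) - s m * s' m)" by (simp add: algebra_simps)
qed

lemma coherent_const: "coherent (%_. a)" by (simp add: coherent_def F_zero)

lemma coherent_add: assumes "coherent s" "coherent s'" shows "coherent (%m. s m + s' m)"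
 unfolding coherent_def
proof
 fix m
 have "F m ((s (Suc m) - s m) + (s' (Suc m) - s' m))" using assms by (intro F_add) (auto simp: coherent_def)
 then show "F m (s (Suc m) + s' (Suc m) - (s m + s' m))" by (simp add: algebra_simps)
qed

lemma coherent_minus: assumes "coherent s" shows "coherent (%m. - s m)"
 using coherent_mult[OF coherent_const[of "- 1"] assms] by simp

lemma coherent_diff: assumes "coherent s" "coherent s'" shows "coherent (%m. s m - s' m)"
 using coherent_add[OF assms(1) coherent_minus[OF assms(2)]] by simp

definition CR :: "(nat => 'b) ring" where
 "CR = \<lparr>carrier = Collect coherent, monoid.mult = (%s s' m. s m * s' m), monoid.one = (%_. 1),
   ring.zero = (%_. 0), ring.add = (%s s' m. s m + s' m)\<rparr>"

lemma CR_simps: "carrier CR = Collect coherent" "s \<otimes>\<^bsub>CR\<^esub> s' = (%m. s m * s' m)" "\<one>\<^bsub>CR\<^esub> = (%_. 1)"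
  "\<zero>\<^bsub>CR\<^esub> = (%_. 0)" "s \<oplus>\<^bsub>CR\<^esub> s' = (%m. s m + s' m)"
 by (simp_all add: CR_def)

lemma CR_cring: "cring CR"
proof (intro cringI abelian_groupI comm_monoidI)
 fix s assume s: "s \<in> carrier CR"
 show "\<exists>s'\<in>carrier CR. s' \<oplus>\<^bsub>CR\<^esub> s = \<zero>\<^bsub>CR\<^esub>"
  by (rule bexI[of _ "%m. - s m"]) (use s coherent_minus in \<open>auto simp: CR_simps\<close>)
qed (auto simp: CR_simps coherent_mult coherent_add coherent_const algebra_simps)

interpretation CR: cring CR by (rule CR_cring)

lemma CR_minus: assumes "coherent s" "coherent s'" shows "s \<ominus>\<^bsub>CR\<^esub> s' = (%m. s m - s' m)"
proof -
 have "\<ominus>\<^bsub>CR\<^esub> s' = (%m. - s' m)"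
  by (rule CR.minus_equality) (use assms coherent_minus in \<open>auto simp: CR_simps\<close>)
 then show ?thesis by (simp add: CR.minus_eq CR_simps)
qed

definition Null :: "(nat => 'b) set" where "Null = {s. coherent s & (\<forall>m. F m (s m))}"

lemma Null_ideal: "ideal Null CR"
proof (rule CR.idealI')
 show "Null \<subseteq> carrier CR" by (auto simp: Null_def CR_simps)
 show "\<zero>\<^bsub>CR\<^esub> \<in> Null" by (simp add: Null_def CR_simps coherent_const F_zero)
qed (use CR_cring in \<open>auto simp: Null_def CR_simps coherent_mult coherent_add F_add F_ideal\<close>)

definition \<tau> :: "'a => 'b" where "\<tau> a = (SOME b. r0 b = a)"

lemma r0_\<tau>: "a \<in> carrier K ==> r0 (\<tau> a) = a" unfolding \<tau>_def using r0_surj[of a] by (auto intro: someI)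

definition psum :: "(nat => 'a) => nat => 'b" where "psum a m = (\<Sum>i<m. x ^ i * \<tau> (a i))"

lemma digits_exist: assumes s: "coherent s"
 shows "\<exists>a. a \<in> UNIV \<rightarrow> carrier K & (\<forall>m. F m (s m - psum a m))"
proof -
 have step: "\<exists>c. c \<in> carrier K & (F m (s m - v) --> F (Suc m) (s (Suc m) - (v + x ^ m * \<tau> c)))" for m v
 proof (cases "F m (s m - v)")
  case True
  then have "F m (s (Suc m) - v)" using s by (auto simp: coherent_def intro: F_trans)
  then obtain d where d: "F (Suc m) (s (Suc m) - v - x ^ m * d)" using F_approx_pow by blast
  have "F 1 (d - \<tau> (r0 d))" unfolding r0_eq_iff[symmetric] by (simp add: r0_\<tau> r0_closed)
  then have "F (Suc m) (x ^ m * (d - \<tau> (r0 d)))" using F_xpow[of m 1] by simp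
  from F_add[OF d this] have "F (Suc m) (s (Suc m) - (v + x ^ m * \<tau> (r0 d)))" by (simp add: algebra_simps)
  then show ?thesis using r0_closed by blast
 qed (use K.zero_closed in blast)
 define dg where "dg m v = (SOME c. c \<in> carrier K & (F m (s m - v) --> F (Suc m) (s (Suc m) - (v + x ^ m * \<tau> c))))" for m v
 have dg: "dg m v \<in> carrier K" "F m (s m - v) ==> F (Suc m) (s (Suc m) - (v + x ^ m * \<tau> (dg m v)))" for m v
  using someI_ex[OF step[of m v]] by (auto simp: dg_def)
 define V where "V = rec_nat 0 (%m v. v + x ^ m * \<tau> (dg m v))"
 have V: "V 0 = 0" "V (Suc m) = V m + x ^ m * \<tau> (dg m (V m))" for m by (simp_all add: V_def)
 define a where "a m = dg m (V m)" for m
 have "F m (s m - V m)" for m by (induction m) (simp_all add: F_0 V dg)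
 moreover have "V m = psum a m" for m by (induction m) (simp_all add: V psum_def a_def)
 ultimately have "F m (s m - psum a m)" for m by simp
 moreover have "a \<in> UNIV \<rightarrow> carrier K" using dg(1) by (simp add: a_def)
 ultimately show ?thesis by blast
qed

lemma digits_unique:
 assumes a: "a \<in> UNIV \<rightarrow> carrier K" "a' \<in> UNIV \<rightarrow> carrier K" and d: "!!m. F m (psum a m - psum a' m)"
 shows "a = a'"
proof
 fix i show "a i = a' i"
 proof (induction i rule: less_induct)
  case (less i)
  have "psum a i = psum a' i" unfolding psum_def by (rule sum.cong) (auto simp: less)
  then have "psum a (Suc i) - psum a' (Suc i) = x ^ i * (\<tau> (a i) - \<tau> (a' i))"
   by (simp add: psum_def right_diff_distrib)
  then have "F 1 (\<tau> (a i) - \<tau> (a' i))" using d[of "Suc i"] F_xpow[of i 1] by simp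
  then show ?case using a r0_\<tau> unfolding r0_eq_iff[symmetric] by (auto simp: Pi_iff)
 qed
qed

definition digits :: "(nat => 'b) => nat => 'a" where
 "digits s = (SOME a. a \<in> UNIV \<rightarrow> carrier K & (\<forall>m. F m (s m - psum a m)))"

lemma digits: "coherent s ==> digits s \<in> UNIV \<rightarrow> carrier K & (\<forall>m. F m (s m - psum (digits s) m))"
 unfolding digits_def by (rule someI_ex[OF digits_exist])

text \<open>A limit of a coherent sequence is encoded by the residues of its digits. This embeds the completion into
the universe, which need only contain the sequences in \<open>K\<close>.\<close>

definition q :: "(nat => 'b) => 'u" where "q s = enc (digits s)"

lemma q_eq_iff: assumes s: "coherent s" "coherent s'" shows "q s = q s' \<longleftrightarrow> (\<forall>m. F m (s m - s' m))"
proof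
 assume "q s = q s'"
 then have "digits s = digits s'" using inj_onD[OF enc] digits[OF s(1)] digits[OF s(2)] by (simp add: q_def)
 then have "F m (psum (digits s) m - s' m)" for m using digits[OF s(2)] F_sym[of m "s' m" "psum (digits s) m"] by simp
 then show "\<forall>m. F m (s m - s' m)" using digits[OF s(1)] by (blast intro: F_trans)
next
 assume d: "\<forall>m. F m (s m - s' m)"
 have "F m (psum (digits s) m - s m)" for m using digits[OF s(1)] F_sym[of m "s m" "psum (digits s) m"] by simp
 then have "F m (psum (digits s) m - psum (digits s') m)" for m
  using F_trans[OF F_trans, of m _ "s m" "s' m"] d digits[OF s(2)] by blast
 then have "digits s = digits s'" by (intro digits_unique) (use digits[OF s(1)] digits[OF s(2)] in simp_all)
 then show "q s = q s'" by (simp add: q_def)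
qed

lemma q_weak: "weak_ring_morphism q Null CR"
 by (rule weak_ring_morphismI[OF Null_ideal]) (simp add: CR_simps CR_minus q_eq_iff Null_def coherent_diff)

definition R :: "'u ring" where "R = image_ring q CR"

lemma R_carrier: "carrier R = q ` Collect coherent" by (simp add: R_def image_ring_carrier CR_simps)

lemma q_hom: "q \<in> ring_hom CR R" unfolding R_def by (rule CR.weak_ring_morphism_is_hom[OF q_weak])

lemma q_mult: "[|coherent s; coherent s'|] ==> q s \<otimes>\<^bsub>R\<^esub> q s' = q (%m. s m * s' m)"
 using ring_hom_mult[OF q_hom, of s s'] by (simp add: CR_simps)

lemma R_cring: "cring R"
proof -
 interpret ring R unfolding R_def by (rule CR.image_ring_is_ring[OF q_weak])
 have "comm_monoid R"
  by unfold_locales (auto simp: R_carrier q_mult mult.commute)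
 then show ?thesis by (simp add: cring_def ring_axioms)
qed

interpretation R: cring R by (rule R_cring)

lemma q_closed: "coherent s ==> q s \<in> carrier R" by (simp add: R_carrier)
lemma q_add: "[|coherent s; coherent s'|] ==> q s \<oplus>\<^bsub>R\<^esub> q s' = q (%m. s m + s' m)"
 using ring_hom_add[OF q_hom, of s s'] by (simp add: CR_simps)
lemma q_one: "\<one>\<^bsub>R\<^esub> = q (%_. 1)" using ring_hom_one[OF q_hom] by (simp add: CR_simps)
lemma q_zero: "\<zero>\<^bsub>R\<^esub> = q (%_. 0)" using ring_hom_zero[OF q_hom CR.ring_axioms R.ring_axioms] by (simp add: CR_simps)
lemma q_minus: assumes "coherent s" "coherent s'" shows "q s \<ominus>\<^bsub>R\<^esub> q s' = q (%m. s m - s' m)"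
 using ring_hom_diff[OF CR_cring R_cring q_hom, of s s'] assms by (simp add: CR_simps CR_minus)
lemma q_nat: "nat_elem R k = q (%_. of_nat k)"
 by (induction k) (simp_all add: nat_elem_0 nat_elem_Suc q_zero q_one q_add coherent_const add.commute)
lemma q_pow: "q (%_. b) [^]\<^bsub>R\<^esub> (k :: nat) = q (%_. b ^ k)"
 by (induction k) (simp_all add: q_one q_mult coherent_const mult.commute)

definition \<pi> where "\<pi> = q (%_. x)"

lemma \<pi>_pow: "\<pi> [^]\<^bsub>R\<^esub> (k :: nat) = q (%_. x ^ k)" unfolding \<pi>_def by (rule q_pow)
lemma \<pi>_closed [simp]: "\<pi> \<in> carrier R" by (simp add: \<pi>_def q_closed coherent_const)

lemma divide_q: assumes s: "coherent s" and k: "F k (s k)"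
 shows "\<exists>s'. coherent s' & q s = \<pi> [^]\<^bsub>R\<^esub> k \<otimes>\<^bsub>R\<^esub> q s' & (\<forall>m. F (k + m) (s (k + m) - x ^ k * s' m))"
proof -
 have "F k (s (k + m))" for m using F_add[OF coherent_le[OF s, of k "k + m"] k] by simp
 then have "\<forall>m. \<exists>d. F (k + m) (s (k + m) - x ^ k * d)" using F_approx_pow by blast
 then obtain s' where s': "!!m. F (k + m) (s (k + m) - x ^ k * s' m)" by metis
 have coh: "coherent s'" unfolding coherent_def
 proof
  fix m
  have "F (k + m) (x ^ k * s' (Suc m) - s (k + Suc m))"
   by (rule F_sym, rule F_mono[OF s'[of "Suc m"]]) simp
  moreover have "F (k + m) (s (k + Suc m) - s (k + m))" using s by (simp add: coherent_def)
  ultimately have "F (k + m) (x ^ k * s' (Suc m) - x ^ k * s' m)" using s'[of m] by (meson F_trans)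
  then show "F m (s' (Suc m) - s' m)" by (simp add: right_diff_distrib[symmetric] F_xpow)
 qed
 have "F m (s m - x ^ k * s' m)" for m
 proof (rule F_trans)
  show "F m (s m - s (k + m))" by (rule F_sym, rule coherent_le[OF s]) simp
  show "F m (s (k + m) - x ^ k * s' m)" by (rule F_mono[OF s']) simp
 qed
 then have "q s = \<pi> [^]\<^bsub>R\<^esub> k \<otimes>\<^bsub>R\<^esub> q s'"
  unfolding \<pi>_pow q_mult[OF coherent_const coh] by (subst q_eq_iff) (auto simp: s coh coherent_mult coherent_const)
 then show ?thesis using coh s' by blast
qed

lemma unit_q: assumes s: "coherent s" and n1: "\<not> F 1 (s 1)" shows "q s \<in> Units R"
proof -
 have "\<exists>d. F m (s m * d - 1)" for m
 proof (cases m)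
  case (Suc n)
  have "\<not> F 1 (s m)" using F_diff[OF _ coherent_le[OF s, of 1 m], of "s m"] n1 Suc by auto
  then show ?thesis by (rule F_unit)
 qed (simp add: F_0)
 then obtain s' where s': "!!m. F m (s m * s' m - 1)" by metis
 have coh: "coherent s'" unfolding coherent_def
 proof
  fix m
  define A B where "A = s (Suc m) * s' (Suc m) - 1" "B = s m * s' m - 1"
  have A: "F m A" unfolding A_B_def by (rule F_mono[OF s'[of "Suc m"]]) simp
  have B: "F m B" unfolding A_B_def by (rule s')
  have D: "F m (s (Suc m) - s m)" using s by (simp add: coherent_def)
  have "F m (s' (Suc m) * (A - B - s' m * (s (Suc m) - s m)) - (s' (Suc m) - s' m) * A)"
   by (intro F_diff F_ideal A B D)
  moreover have "s' (Suc m) * (A - B - s' m * (s (Suc m) - s m)) - (s' (Suc m) - s' m) * A = s' (Suc m) - s' m"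
   unfolding A_B_def by (simp add: algebra_simps)
  ultimately show "F m (s' (Suc m) - s' m)" by simp
 qed
 have "q s \<otimes>\<^bsub>R\<^esub> q s' = \<one>\<^bsub>R\<^esub>"
  unfolding q_mult[OF s coh] q_one by (subst q_eq_iff) (auto simp: s s' coh coherent_mult coherent_const)
 then show ?thesis using R.m_comm[OF q_closed[OF s] q_closed[OF coh]] q_closed[OF s] q_closed[OF coh] by (auto simp: Units_def)
qed

lemma in_PIdl_iff: assumes s: "coherent s" shows "q s \<in> PIdl\<^bsub>R\<^esub> (\<pi> [^]\<^bsub>R\<^esub> k) \<longleftrightarrow> F k (s k)"
proof
 assume "q s \<in> PIdl\<^bsub>R\<^esub> (\<pi> [^]\<^bsub>R\<^esub> k)"
 then obtain s' where s': "coherent s'" "q s = q s' \<otimes>\<^bsub>R\<^esub> \<pi> [^]\<^bsub>R\<^esub> k" by (auto simp: cgenideal_def R_carrier)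
 then have "q s = q (%m. s' m * x ^ k)" by (simp add: \<pi>_pow q_mult coherent_const)
 then have "F k (s k - s' k * x ^ k)" using q_eq_iff[OF s coherent_mult[OF s'(1) coherent_const]] by simp
 moreover have "F k (s' k * x ^ k)" using F_ideal[of k "x ^ k"] F_xpow[of k 0 1] F_0 by simp
 ultimately show "F k (s k)" using F_add by fastforce
next
 assume "F k (s k)"
 then obtain s' where s': "coherent s'" "q s = \<pi> [^]\<^bsub>R\<^esub> k \<otimes>\<^bsub>R\<^esub> q s'" using divide_q[OF s] by blast
 then show "q s \<in> PIdl\<^bsub>R\<^esub> (\<pi> [^]\<^bsub>R\<^esub> k)" using q_closed[OF s'(1)] by (auto simp: cgenideal_def R.m_comm)
qed

lemma \<pi>_pow_nonzero: "\<pi> [^]\<^bsub>R\<^esub> (k :: nat) ~= \<zero>\<^bsub>R\<^esub>"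
 unfolding \<pi>_pow q_zero using q_eq_iff[OF coherent_const coherent_const, of "x ^ k" 0] F_pow_one[of k] by auto

lemma factor_q: assumes a: "a \<in> carrier R" "a ~= \<zero>\<^bsub>R\<^esub>"
 shows "\<exists>k::nat. \<exists>u\<in>Units R. a = \<pi> [^]\<^bsub>R\<^esub> k \<otimes>\<^bsub>R\<^esub> u"
proof -
 obtain s where s: "coherent s" "a = q s" using a by (auto simp: R_carrier)
 obtain m where m: "\<not> F m (s m)" using a(2) s q_eq_iff[OF s(1) coherent_const[of 0]] by (auto simp: q_zero)
 define l where "l = (LEAST m. \<not> F m (s m))"
 have l: "\<not> F l (s l)" unfolding l_def by (rule LeastI[of "%m. \<not> F m (s m)", OF m])
 have lk: "F k (s k)" if "k < l" for k using not_less_Least[of k "%m. \<not> F m (s m)"] that by (auto simp only: l_def)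
 obtain k where k: "l = Suc k" using l F_0 by (cases l) auto
 obtain s' where s': "coherent s'" "q s = \<pi> [^]\<^bsub>R\<^esub> k \<otimes>\<^bsub>R\<^esub> q s'" "\<forall>m. F (k + m) (s (k + m) - x ^ k * s' m)"
  using divide_q[OF s(1) lk[of k]] k by blast
 have "\<not> F 1 (s' 1)"
 proof
  assume "F 1 (s' 1)"
  then have "F (k + 1) (x ^ k * s' 1)" by (simp only: F_xpow)
  then have "F (k + 1) (s (k + 1))" using s'(3)[rule_format, of 1] F_add by fastforce
  then show False using l k by simp
 qed
 then show ?thesis using unit_q[OF s'(1)] s'(2) s(2) by blast
qed

end

lemma (in cring) discrete_valuation_ring_if_uniformizer:
 assumes x: "x \<in> carrier R" "x \<notin> Units R" and pow: "!!k::nat. x [^] k ~= \<zero>"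
  and fac: "!!a. [|a \<in> carrier R; a ~= \<zero>|] ==> \<exists>k::nat. \<exists>u\<in>Units R. a = x [^] k \<otimes> u"
 shows "discrete_valuation_ring R" "max_ideal R = PIdl x"
proof -
 have one: "\<one> ~= \<zero>" using pow[of 0] by simp
 have M: "ideal (PIdl x) R" by (rule cgenideal_ideal) (rule x)
 have one_M: "\<one> \<notin> PIdl x"
 proof
  assume "\<one> \<in> PIdl x"
  then obtain b where "b \<in> carrier R" "\<one> = b \<otimes> x" by (auto simp: cgenideal_def)
  then show False using x m_comm[of b x] by (auto simp: Units_def)
 qed
 have zM: "\<zero> \<in> PIdl (x [^] k)" for k :: nat
  using additive_subgroup.zero_closed[OF ideal.axioms(1)[OF cgenideal_ideal[of "x [^] k"]]] x by simp
 have unit: "a \<in> Units R" if a: "a \<in> carrier R" "a \<notin> PIdl x" for a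
 proof -
  have "a ~= \<zero>" using a(2) zM[of 1] x by auto
  then obtain k :: nat and u where u: "u \<in> Units R" "a = x [^] k \<otimes> u" using fac[OF a(1)] by blast
  have "k = 0"
  proof (rule ccontr)
   assume "k ~= 0"
   then obtain j where "k = Suc j" by (cases k) auto
   then have "a = (x [^] j \<otimes> u) \<otimes> x" using u x by (simp add: m_ac Units_closed)
   then show False using a(2) u x by (auto simp: cgenideal_def Units_closed)
  qed
  then show ?thesis using u by simp
 qed
 note loc = local_ringI[OF M one_M unit]
 show "max_ideal R = PIdl x" by (rule loc(3))
 have dom: "domain R"
 proof (unfold_locales)
  show "\<one> ~= \<zero>" by (rule one)
  fix a b assume ab: "a \<otimes> b = \<zero>" "a \<in> carrier R" "b \<in> carrier R"
  show "a = \<zero> \<or> b = \<zero>"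
  proof (rule ccontr)
   assume "\<not> ?thesis"
   then obtain j k :: nat and u v where u: "u \<in> Units R" "a = x [^] j \<otimes> u" and v: "v \<in> Units R" "b = x [^] k \<otimes> v"
    using fac[OF ab(2)] fac[OF ab(3)] by blast
   have uv: "u \<otimes> v \<in> Units R" using u v by simp
   have "x [^] (j + k) \<otimes> (u \<otimes> v) = \<zero>"
    using ab(1) u v x by (simp add: nat_pow_mult[symmetric] m_ac Units_closed)
   then have "x [^] (j + k) \<otimes> (u \<otimes> v) \<otimes> inv (u \<otimes> v) = \<zero>" using uv by simp
   then have "x [^] (j + k) = \<zero>" using uv x Units_closed[OF uv] by (simp add: m_assoc)
   then show False using pow by blast
  qed
 qed
 have pid: "principal_domain R"
 proof (intro principal_domain.intro principal_domain_axioms.intro dom)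
  fix J assume J: "ideal J R"
  interpret J: ideal J R by (rule J)
  show "\<exists>a\<in>carrier R. J = PIdl a"
  proof (cases "J = {\<zero>}")
   case True
   then show ?thesis by (intro bexI[of _ \<zero>]) (simp_all add: PIdl_zero)
  next
   case False
   then obtain a where a: "a \<in> J" "a ~= \<zero>" using J.zero_closed by blast
   have mem: "x [^] k \<in> J" if "x [^] k \<otimes> u \<in> J" "u \<in> Units R" for k :: nat and u
   proof -
    have "x [^] k \<otimes> u \<otimes> inv u \<in> J" using J.I_r_closed that by blast
    then show ?thesis using that x by (simp add: m_assoc Units_closed)
   qed
   define k where "k = (LEAST k :: nat. x [^] k \<in> J)"
   have ex: "\<exists>k::nat. x [^] k \<in> J" using fac[OF J.Icarr[OF a(1)] a(2)] a(1) mem by blast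
   then have k: "x [^] k \<in> J" unfolding k_def by (rule LeastI_ex)
   have "J = PIdl (x [^] k)"
   proof
    show "PIdl (x [^] k) \<subseteq> J" by (rule cgenideal_minimal[OF J k])
    show "J \<subseteq> PIdl (x [^] k)"
    proof
     fix b assume b: "b \<in> J"
     show "b \<in> PIdl (x [^] k)"
     proof (cases "b = \<zero>")
      case False
      obtain l :: nat and u where u: "u \<in> Units R" "b = x [^] l \<otimes> u" using fac[OF J.Icarr[OF b] False] by blast
      have "k \<le> l" unfolding k_def by (rule Least_le) (use mem[of l u] u b in simp)
      then have "b = (x [^] (l - k) \<otimes> u) \<otimes> x [^] k"
       using u x nat_pow_mult[of x "l - k" k] by (simp add: m_ac Units_closed)
      then show ?thesis using u x by (auto simp: cgenideal_def Units_closed)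
     qed (use zM in simp)
    qed
   qed
   then show ?thesis using x by blast
  qed
 qed
 show "discrete_valuation_ring R"
 proof (intro discrete_valuation_ring.intro discrete_valuation_ring_axioms.intro pid)
  show "\<exists>!I. maximalideal I R" using loc(1,2) by blast
  show "\<not> field R" using x pow[of 1] field.field_Units by fastforce
 qed
qed

lemma perfect_field_ring_iso:
 assumes f: "f \<in> ring_iso A B" and A: "field A" and B: "perfect_field B"
 shows "perfect_field A" "ring_char A = ring_char B"
proof -
 have fB: "field B" using B by (simp add: perfect_field_def)
 interpret A: field A by fact
 interpret B: field B by fact
 have h: "f \<in> ring_hom A B" and bij: "bij_betw f (carrier A) (carrier B)" using f by (auto simp: ring_iso_def)
 interpret h: ring_hom_ring A B f by (rule ring_hom_ringI2[OF A.ring_axioms B.ring_axioms h])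
 have inj: "[|f a = f b; a \<in> carrier A; b \<in> carrier A|] ==> a = b" for a b using bij by (auto simp: bij_betw_def dest: inj_onD)
 have z: "nat_elem A k = \<zero>\<^bsub>A\<^esub> \<longleftrightarrow> nat_elem B k = \<zero>\<^bsub>B\<^esub>" for k
  using inj[of "nat_elem A k" "\<zero>\<^bsub>A\<^esub>"] A.hom_nat_elem[OF h B.is_cring, of k] h.hom_zero
  by (auto simp: nat_elem_def)
 show c: "ring_char A = ring_char B" by (simp only: ring_char_def z)
 have "\<exists>y\<in>carrier A. y [^]\<^bsub>A\<^esub> ring_char A = a" if a: "a \<in> carrier A" and c0: "ring_char A ~= 0" for a
 proof -
  have "f a \<in> carrier B" using a by simp
  then obtain z where z: "z \<in> carrier B" "z [^]\<^bsub>B\<^esub> ring_char B = f a" using B c c0 by (auto simp: perfect_field_def)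
  then obtain y where y: "y \<in> carrier A" "z = f y" using bij by (auto simp: bij_betw_def)
  have "f (y [^]\<^bsub>A\<^esub> ring_char A) = f a" using y z c by (simp add: h.hom_nat_pow)
  then show ?thesis using inj y a by blast
 qed
 then show "perfect_field A" using A by (auto simp: perfect_field_def)
qed

lemma (in cring) nat_elem_zero_iff_char_dvd:
 assumes "ring_char R = p" "p ~= 0" shows "nat_elem R k = \<zero> \<longleftrightarrow> p dvd k"
proof -
 have ex: "\<exists>k>0. nat_elem R k = \<zero>" using assms by (auto simp: ring_char_def split: if_splits)
 then have p: "p = (LEAST k. k > 0 & nat_elem R k = \<zero>)" using assms by (simp add: ring_char_def)
 have p0: "nat_elem R p = \<zero>" unfolding p using LeastI_ex[OF ex] by blast
 have "nat_elem R k = nat_elem R (k div p * p + k mod p)" by simp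
 also have "\<dots> = nat_elem R (k mod p)" unfolding nat_elem_add nat_elem_mult p0 by simp
 finally have "nat_elem R k = nat_elem R (k mod p)" .
 moreover have "nat_elem R (k mod p) = \<zero> ==> k mod p = 0"
  using not_less_Least[of "k mod p" "%k. k > 0 & nat_elem R k = \<zero>", folded p] assms(2) by auto
 ultimately show ?thesis using nat_elem_0[of R] by (metis dvd_eq_mod_eq_0)
qed

locale lifting_data = graded_approximation K F x T r0 p e enc
 for K :: "('a, 'z) ring_scheme" (structure) and F :: "nat => 'b :: comm_ring_1 => bool" and x T r0 p e
  and enc :: "(nat => 'a) => 'u" +
 assumes r0_T: "r0 T ~= \<zero>" and prime_p: "Factorial_Ring.prime p" and K_char: "ring_char K = p"
  and K_perfect: "perfect_field K" and e_pos: "1 \<le> e"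
begin

interpretation R: cring R by (rule R_cring)

definition resid :: "'u => 'a" where "resid a = r0 ((SOME s. coherent s & q s = a) 1)"

lemma resid_q: assumes s: "coherent s" shows "resid (q s) = r0 (s 1)"
proof -
 define s' where "s' = (SOME s'. coherent s' & q s' = q s)"
 have s': "coherent s' & q s' = q s" unfolding s'_def by (rule someI[of _ s]) (simp add: s)
 then have "F 1 (s' 1 - s 1)" using q_eq_iff[of s' s] s by blast
 then show ?thesis by (simp only: resid_def s'_def[symmetric] r0_eq_iff)
qed

lemma resid_hom: "resid \<in> ring_hom R K"
 by (rule ring_hom_memI)
  (auto simp: R_carrier q_mult q_add q_one resid_q coherent_mult coherent_add coherent_const r0_closed r0_mult r0_add r0_one)

lemma resid_surj: "resid ` carrier R = carrier K"
proof
 show "resid ` carrier R \<subseteq> carrier K" using ring_hom_closed[OF resid_hom] by blast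
 show "carrier K \<subseteq> resid ` carrier R"
 proof
  fix a assume "a \<in> carrier K"
  then obtain b where "r0 b = a" using r0_surj by blast
  then have "resid (q (%_. b)) = a" by (simp add: resid_q coherent_const)
  then show "a \<in> resid ` carrier R" using q_closed[OF coherent_const, of b] by blast
 qed
qed

lemma resid_zero: assumes "a \<in> carrier R" shows "resid a = \<zero> \<longleftrightarrow> a \<in> PIdl\<^bsub>R\<^esub> \<pi>"
proof -
 obtain s where s: "coherent s" "a = q s" using assms by (auto simp: R_carrier)
 have "\<pi> [^]\<^bsub>R\<^esub> (1::nat) = \<pi>" by (rule R.nat_pow_eone) simp
 then show ?thesis using in_PIdl_iff[OF s(1), of 1] r0_zero[of "s 1"] resid_q[OF s(1)] s(2) by (simp only:)
qed

lemma not_unit_\<pi>: "\<pi> \<notin> Units R"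
proof
 assume "\<pi> \<in> Units R"
 then have "\<one>\<^bsub>R\<^esub> \<in> PIdl\<^bsub>R\<^esub> \<pi>" by (auto simp: cgenideal_def intro!: exI[of _ "inv\<^bsub>R\<^esub> \<pi>"])
 then show False using resid_zero[of "\<one>\<^bsub>R\<^esub>"] ring_hom_one[OF resid_hom] K.one_not_zero by simp
qed

lemma dvr: "discrete_valuation_ring R" "max_ideal R = PIdl\<^bsub>R\<^esub> \<pi>"
 by (rule R.discrete_valuation_ring_if_uniformizer[OF \<pi>_closed not_unit_\<pi> \<pi>_pow_nonzero], rule factor_q, assumption+)+

interpretation D: discrete_valuation_ring R by (rule dvr(1))

lemma ideal_pow_iff: "coherent s ==> q s \<in> ideal_pow R (max_ideal R) k \<longleftrightarrow> F k (s k)"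
 using in_PIdl_iff by (simp add: dvr(2) R.ideal_pow_PIdl)

lemma p_factor: "nat_elem R p = q (%_. T) \<otimes>\<^bsub>R\<^esub> \<pi> [^]\<^bsub>R\<^esub> e" "q (%_. T) \<in> Units R" "resid (q (%_. T)) = r0 T"
proof -
 show "nat_elem R p = q (%_. T) \<otimes>\<^bsub>R\<^esub> \<pi> [^]\<^bsub>R\<^esub> e"
  by (simp add: q_nat \<pi>_pow q_mult coherent_const q_eq_iff F_p)
 show "q (%_. T) \<in> Units R" using r0_T r0_zero by (intro unit_q coherent_const) simp
 show "resid (q (%_. T)) = r0 T" by (simp add: resid_q coherent_const)
qed

lemma char_zero: "ring_char R = 0"
proof -
 have "k = 0" if "nat_elem R k = \<zero>\<^bsub>R\<^esub>" for k using that
 proof (induction k rule: less_induct)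
  case (less k)
  have p0: "p ~= 0" "1 < p" using prime_p prime_gt_1_nat[of p] by auto
  have "nat_elem K k = \<zero>"
   using R.hom_nat_elem[OF resid_hom K.is_cring, of k] less.prems
    ring_hom_zero[OF resid_hom R.ring_axioms K.ring_axioms] by simp
  then have "p dvd k" using K.nat_elem_zero_iff_char_dvd[OF K_char p0(1)] by simp
  then obtain l where l: "k = p * l" by (rule dvdE)
  have "nat_elem R p ~= \<zero>\<^bsub>R\<^esub>"
   using p_factor(1) D.integral[of "q (%_. T)" "\<pi> [^]\<^bsub>R\<^esub> e"] \<pi>_pow_nonzero[of e] p_factor(2) R.Units_closed
    ring_hom_zero[OF resid_hom R.ring_axioms K.ring_axioms] p_factor(3) r0_T by force
  moreover have "nat_elem R p \<otimes>\<^bsub>R\<^esub> nat_elem R l = \<zero>\<^bsub>R\<^esub>" using less.prems by (simp add: l R.nat_elem_mult)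
  ultimately have "nat_elem R l = \<zero>\<^bsub>R\<^esub>" using D.integral by blast
  then show ?case using less.IH[of l] l p0 by (cases "l = 0") auto
 qed
 then show ?thesis by (auto simp: ring_char_def)
qed

lemma quotient: "perfect_field (R Quot max_ideal R)" "ring_char (R Quot max_ideal R) = p"
proof -
 interpret h: ring_hom_ring R K resid by (rule ring_hom_ringI2[OF R.ring_axioms K.ring_axioms resid_hom])
 have "PIdl\<^bsub>R\<^esub> \<pi> \<subseteq> carrier R" by (auto simp: cgenideal_def)
 then have "{a \<in> carrier R. resid a = \<zero>} = PIdl\<^bsub>R\<^esub> \<pi>" using resid_zero by blast
 then have k: "a_kernel R K resid = max_ideal R" by (simp only: a_kernel_def' dvr(2))
 have iso: "(%X. the_elem (resid ` X)) \<in> ring_iso (R Quot max_ideal R) K"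
  using h.FactRing_iso_set[OF resid_surj] unfolding k .
 have "maximalideal (max_ideal R) R" unfolding max_ideal_def using theI'[OF D.ex1_maximal] .
 then have f: "field (R Quot max_ideal R)" by (rule maximalideal.quotient_is_field[OF _ R_cring])
 show "perfect_field (R Quot max_ideal R)" "ring_char (R Quot max_ideal R) = p"
  using perfect_field_ring_iso[OF iso f K_perfect] K_char by simp_all
qed

lemma complete:
 assumes a: "!!i. a i \<in> carrier R"
  and C: "\<forall>k. \<exists>N. \<forall>i\<ge>N. \<forall>j\<ge>N. a i \<ominus>\<^bsub>R\<^esub> a j \<in> ideal_pow R (max_ideal R) k"
 shows "\<exists>L \<in> carrier R. \<forall>k. \<exists>N. \<forall>i\<ge>N. a (i::nat) \<ominus>\<^bsub>R\<^esub> L \<in> ideal_pow R (max_ideal R) k"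
proof -
 have "\<forall>i. \<exists>s. coherent s & a i = q s" using a by (auto simp: R_carrier)
 then obtain s where s: "!!i. coherent (s i)" "!!i. a i = q (s i)" by metis
 have d: "a i \<ominus>\<^bsub>R\<^esub> q t \<in> ideal_pow R (max_ideal R) k \<longleftrightarrow> F k (s i k - t k)" if "coherent t" for i t k
  using s that by (simp add: q_minus ideal_pow_iff coherent_diff)
 have "\<forall>k. \<exists>N. \<forall>i\<ge>N. \<forall>j\<ge>N. F k (s i k - s j k)" using C unfolding s(2) using d[OF s(1)] unfolding s(2) by simp
 then obtain N where N: "!!k i j. N k \<le> i ==> N k \<le> j ==> F k (s i k - s j k)" by metis
 define t where "t k = s (N k) k" for k
 have lim: "F k (s i k - t k)" if "N k \<le> i" for i k unfolding t_def using N that by simp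
 have coh: "coherent t" unfolding coherent_def
 proof
  fix m
  define i where "i = max (N m) (N (Suc m))"
  have "F m (t (Suc m) - s i (Suc m))" by (rule F_sym, rule F_mono[OF lim]) (simp_all add: i_def)
  moreover have "F m (s i (Suc m) - s i m)" using s(1) by (simp add: coherent_def)
  moreover have "F m (s i m - t m)" by (rule lim) (simp add: i_def)
  ultimately show "F m (t (Suc m) - t m)" by (meson F_trans)
 qed
 show ?thesis by (rule bexI[of _ "q t"]) (use lim d[OF coh] q_closed[OF coh] in blast)+
qed

theorem R_object: "R \<in> CDVR_objects p e"
proof -
 have "complete_discrete_valuation_ring R"
  by (intro complete_discrete_valuation_ring.intro complete_discrete_valuation_ring_axioms.intro dvr(1) complete) auto
 moreover have "PIdl\<^bsub>R\<^esub> nat_elem R p = PIdl\<^bsub>R\<^esub> (\<pi> [^]\<^bsub>R\<^esub> e)"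
 proof -
  have c: "q (%_. T) \<in> carrier R" using p_factor(2) by blast
  have pe: "\<pi> [^]\<^bsub>R\<^esub> e \<in> carrier R" by simp
  have "inv\<^bsub>R\<^esub> q (%_. T) \<otimes>\<^bsub>R\<^esub> nat_elem R p = \<pi> [^]\<^bsub>R\<^esub> e"
   unfolding p_factor(1) using p_factor(2) c pe by (simp add: R.m_assoc[symmetric])
  then have "\<pi> [^]\<^bsub>R\<^esub> e \<in> PIdl\<^bsub>R\<^esub> nat_elem R p"
   using R.Units_inv_closed[OF p_factor(2)] unfolding cgenideal_def by (intro CollectI exI[of _ "inv\<^bsub>R\<^esub> q (%_. T)"]) simp
  moreover have "nat_elem R p \<in> PIdl\<^bsub>R\<^esub> (\<pi> [^]\<^bsub>R\<^esub> e)"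
   unfolding p_factor(1) cgenideal_def using c by blast
  ultimately show ?thesis
   by (intro equalityI R.cgenideal_minimal[OF R.cgenideal_ideal]) simp_all
 qed
 ultimately show ?thesis
  using char_zero quotient dvr(2) by (simp add: CDVR_objects_def R.ideal_pow_PIdl)
qed

lemma residue_data: "\<exists>r. r \<in> ring_hom R K & r ` carrier R = carrier K &
  (\<forall>a\<in>carrier R. r a = \<zero> \<longleftrightarrow> a \<in> max_ideal R) &
  (\<exists>\<pi> t. \<pi> \<in> carrier R & max_ideal R = PIdl\<^bsub>R\<^esub> \<pi> & t \<in> carrier R & r t = r0 T & nat_elem R p = t \<otimes>\<^bsub>R\<^esub> \<pi> [^]\<^bsub>R\<^esub> e)"
proof -
 have "\<pi> \<in> carrier R & max_ideal R = PIdl\<^bsub>R\<^esub> \<pi> & q (%_. T) \<in> carrier R & resid (q (%_. T)) = r0 T &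
   nat_elem R p = q (%_. T) \<otimes>\<^bsub>R\<^esub> \<pi> [^]\<^bsub>R\<^esub> e"
  using dvr(2) \<pi>_closed q_closed[OF coherent_const] p_factor(1,3) by blast
 moreover have "\<forall>a\<in>carrier R. resid a = \<zero> \<longleftrightarrow> a \<in> max_ideal R" using resid_zero dvr(2) by simp
 ultimately show ?thesis using resid_hom resid_surj by blast
qed

end

text \<open>The ring \<open>W(K)[x] / (x^e - p / [t])\<close>.\<close>

theorem CDVR_with_residue_field:
 fixes K :: "('k, 'z) ring_scheme" and enc :: "(nat => 'k) => 'u"
 assumes K: "perfect_field K" "ring_char K = p" and p: "Factorial_Ring.prime p" and e: "1 \<le> e"
  and enc: "inj_on enc (UNIV \<rightarrow> carrier K)" and t: "t \<in> carrier K" "t ~= \<zero>\<^bsub>K\<^esub>"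
 shows "\<exists>(R :: 'u ring) \<in> CDVR_objects p e. \<exists>r. r \<in> ring_hom R K & r ` carrier R = carrier K &
  (\<forall>a\<in>carrier R. r a = \<zero>\<^bsub>K\<^esub> \<longleftrightarrow> a \<in> max_ideal R) &
  (\<exists>\<pi> t'. \<pi> \<in> carrier R & max_ideal R = PIdl\<^bsub>R\<^esub> \<pi> & t' \<in> carrier R & r t' = t & nat_elem R p = t' \<otimes>\<^bsub>R\<^esub> \<pi> [^]\<^bsub>R\<^esub> e)"
proof -
 interpret K: field K using K by (simp add: perfect_field_def)
 have p0: "p ~= 0" using p prime_gt_0_nat[of p] by simp
 interpret E: eisenstein K p e t
 proof (unfold_locales)
  show "nat_elem K p = \<zero>\<^bsub>K\<^esub>" using K.nat_elem_zero_iff_char_dvd[OF K(2) p0] by simp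
  show "\<exists>y\<in>carrier K. y [^]\<^bsub>K\<^esub> p = x" if "x \<in> carrier K" for x using that K p0 by (auto simp: perfect_field_def)
 qed (use p e t in auto)
 interpret L: lifting_data K E.Fil "[:0, 1:]" "[:E.T:]" "%b. E.res (coeff b 0)" p e enc
 proof (unfold_locales)
  fix m n b b' a
  show "E.Fil 0 b" by (rule E.Fil_0)
  show "E.Fil m b ==> E.Fil m b' ==> E.Fil m (b - b')" by (rule E.Fil_diff)
  show "E.Fil m b ==> E.Fil m (b' * b)" by (rule E.Fil_ideal)
  show "E.Fil n b ==> m \<le> n ==> E.Fil m b" by (rule E.Fil_mono)
  show "E.Fil (Suc m) ([:0, 1:] * b) = E.Fil m b" by (simp add: E.Fil_pCons)
  show "E.Fil 1 b ==> \<exists>d. E.Fil n (b - [:0, 1:] * d)" by (rule E.Fil_approx)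
  show "E.Fil n (of_nat p - [:E.T:] * [:0, 1:] ^ e)" by (rule E.Fil_p)
  show "(E.res (coeff b 0) = \<zero>\<^bsub>K\<^esub>) = E.Fil 1 b" by (rule E.Fil_1[symmetric])
  assume "a \<in> carrier K"
  then show "\<exists>b. E.res (coeff b 0) = a" by (intro exI[of _ "[:frag_of {#a#}:]"]) simp
 qed (use K p e t enc in \<open>auto simp: E.res_add E.res_mult coeff_mult_0\<close>)
 have "E.res (coeff [:E.T:] 0) = t" using t by simp
 then show ?thesis using L.R_object L.residue_data by (intro bexI[of _ L.R]) simp_all
qed

section \<open>Essential surjectivity\<close>

context normalized_hyperfield begin

definition tres :: "'a set => 'a set" where "tres Y = hclass H (theta H) (SOME a. a \<in> Oh & cr a = Y)"

lemma tres_cr: assumes a: "a \<in> Oh" shows "tres (cr a) = hclass H (theta H) a"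
proof -
 define b where "b = (SOME b. b \<in> Oh & cr b = cr a)"
 have b: "b \<in> Oh & cr b = cr a" unfolding b_def by (rule someI[of _ a]) (simp add: a)
 then have "near (E n) b a" using cr_eq_iff a by blast
 then have "near (E 1) b a" using near_mono E_le n_pos by blast
 then show ?thesis using cl_eq_iff[OF theta_least(2) theta_le_rho, of b a] a b
  by (simp add: tres_def b_def[symmetric] theta_E)
qed

lemma tres_hom: "tres \<in> ring_hom Rh (res_field H)"
proof (rule ring_hom_memI)
 note th = theta_least(2) theta_le_rho
 fix A B assume "A \<in> carrier Rh" "B \<in> carrier Rh"
 then obtain a b where ab: "a \<in> Oh" "A = cr a" "b \<in> Oh" "B = cr b" by (auto simp: Rh_carrier)
 show "tres (A \<otimes>\<^bsub>Rh\<^esub> B) = tres A \<otimes>\<^bsub>res_field H\<^esub> tres B"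
  using ab by (simp add: tres_cr Rh_mult Oh_mult res_field_def Q_mult[OF th])
 obtain c where c: "c \<in> hadd H a b" using hadd_nonempty[of a b] ab Oh_carrier by blast
 then have "c \<in> Oh" using Oh_hadd ab by blast
 then show "tres (A \<oplus>\<^bsub>Rh\<^esub> B) = tres A \<oplus>\<^bsub>res_field H\<^esub> tres B"
  using ab c by (simp add: tres_cr Rh_add[OF ab(1,3) c] Q_add[OF th ab(1,3) c] res_field_def)
next
 note th = theta_least(2) theta_le_rho
 show "tres \<one>\<^bsub>Rh\<^esub> = \<one>\<^bsub>res_field H\<^esub>" by (simp add: Rh_one tres_cr res_field_def Q_one[OF th])
 fix A assume "A \<in> carrier Rh"
 then show "tres A \<in> carrier (res_field H)" by (auto simp: Rh_carrier tres_cr res_field_def Q_carrier[OF th])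
qed

lemma tres_zero: assumes "A \<in> carrier Rh" shows "tres A = \<zero>\<^bsub>res_field H\<^esub> \<longleftrightarrow> A \<in> Fh 1"
proof -
 obtain a where a: "a \<in> Oh" "A = cr a" using assms by (auto simp: Rh_carrier)
 show ?thesis
  using cl_zero_iff[OF theta_least(2) theta_le_rho a(1)] cr_in_Fh_iff[OF a(1) n_pos] a
  by (simp add: tres_cr res_field_def theta_E)
qed

lemma Rh_unit_lift: assumes "Y \<in> carrier Rh" "Y \<notin> Fh 1" shows "\<exists>a \<in> carrier H. val H a = 0 & cr a = Y"
proof -
 obtain a where a: "a \<in> Oh" "Y = cr a" using assms(1) by (auto simp: Rh_carrier)
 then have "val H a = 0" using assms(2) cr_in_Fh_iff[OF a(1) n_pos] not_E1 by blast
 then show ?thesis using a Oh_carrier by blast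
qed

text \<open>Balls around units have radius \<open>rho\<close>, the radius of congruence in the truncated ring.\<close>

lemma unit_cr_inj: "[|a \<in> carrier H; val H a = 0; b \<in> carrier H; val H b = 0; cr a = cr b|] ==> a = b"
 using cr_eq_iff[of a b] near_rho_eq[of a b] by (simp add: Oh_iff)

end

text \<open>A homomorphism \<open>h\<close> onto the truncated ring lifts to \<open>sp\<close>: the unit \<open>h u\<close> has exactly one lift to a
unit of \<open>H\<close>, and \<open>x\<close> goes to \<open>\<pi>\<close>, so \<open>sp (x^k u)\<close> has to be \<open>\<pi>^k\<close> times the lift of \<open>h u\<close>.\<close>

locale truncation_lift = R: cdvr_object R p e + H: normalized_hyperfield H e n
 for R :: "'u ring" (structure) and p e and H :: "'u pointed_hyperfield" and n +
 fixes h :: "'u => 'u set" and x w \<pi> \<omega> :: 'u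
 assumes n_gt: "n > e" and x: "R.unif x" and h: "h \<in> ring_hom R (trunc_ring H)"
  and hx: "h x = H.cr \<pi>" and pi: "\<pi> \<in> carrier H" "val H \<pi> = H.E 1"
  and om: "\<omega> \<in> carrier H" "val H \<omega> = 0" and P: "pelt H = \<omega> \<otimes>\<^bsub>H\<^esub> \<pi> [^]\<^bsub>H\<^esub> e"
  and w: "w \<in> Units R" "nat_elem R p = w \<otimes> x [^] e" "h w = H.cr \<omega>"
  and surj: "Y \<in> carrier (trunc_ring H) ==> \<exists>a \<in> carrier R. h a = Y"
  and hF: "[|a \<in> carrier R; k \<le> n|] ==> h a \<in> H.Fh k \<longleftrightarrow> a \<in> R.F k"
begin

interpretation Q: cring "trunc_ring H" by (rule H.Rh_cring)

lemma xc [simp]: "x \<in> carrier R" using x by (simp add: R.unif_def)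
lemma piO: "\<pi> \<in> H.Oh" using pi by (simp add: H.Oh_iff)
lemma pi_pow: "\<pi> [^]\<^bsub>H\<^esub> (k::nat) \<in> H.Oh" "val H (\<pi> [^]\<^bsub>H\<^esub> (k::nat)) = H.E k"
 using H.Oh_pow[OF piO] H.val_pow[OF pi(1), of "1 / real e" k] pi(2) by (simp_all add: H.E_def)

lemma hpow: "h (x [^] (k::nat)) = H.cr (\<pi> [^]\<^bsub>H\<^esub> k)"
 using ring_hom_ring.hom_nat_pow[OF ring_hom_ringI2[OF R.ring_axioms Q.ring_axioms h] xc] hx H.Rh_pow[OF piO] by simp

definition lift :: "'u => 'u" where "lift u = (SOME b. b \<in> carrier H & val H b = 0 & H.cr b = h u)"

lemma lift: assumes u: "u \<in> Units R" shows "lift u \<in> carrier H" "val H (lift u) = 0" "H.cr (lift u) = h u"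
proof -
 have uc: "u \<in> carrier R" using u by blast
 have "h u \<notin> H.Fh 1" using hF[OF uc H.n_pos] R.Units_iff_notin_F1[OF uc] u by blast
 then have "\<exists>b. b \<in> carrier H & val H b = 0 & H.cr b = h u"
  using H.Rh_unit_lift[OF ring_hom_closed[OF h uc]] by blast
 from someI_ex[OF this] show "lift u \<in> carrier H" "val H (lift u) = 0" "H.cr (lift u) = h u"
  by (simp_all add: lift_def)
qed

lemma lift_Oh: "u \<in> Units R ==> lift u \<in> H.Oh" using lift by (simp add: H.Oh_iff)

lemma lift_eq: "[|u \<in> Units R; b \<in> carrier H; val H b = 0; H.cr b = h u|] ==> lift u = b"
 using H.unit_cr_inj[of "lift u" b] lift[of u] by simp

definition sp :: "'u => 'u" where
 "sp a = (if a = \<zero> then hzero H else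
   SOME b. \<exists>k::nat. \<exists>u \<in> Units R. a = x [^] k \<otimes> u & b = \<pi> [^]\<^bsub>H\<^esub> k \<otimes>\<^bsub>H\<^esub> lift u)"

lemma decomposition_F: assumes u: "u \<in> Units R" shows "x [^] k \<otimes> u \<in> R.F l \<longleftrightarrow> l \<le> (k::nat)"
proof
 have uc: "u \<in> carrier R" using u by blast
 show "l \<le> k" if A: "x [^] k \<otimes> u \<in> R.F l"
 proof (rule ccontr)
  assume "\<not> l \<le> k"
  then have "x [^] k \<otimes> u \<in> R.F (k + 1)" using R.F_monoD[OF A] by simp
  then show False using R.unif_div[OF x uc] R.Units_iff_notin_F1[OF uc] u by blast
 qed
 assume "l \<le> k"
 then have "x [^] k \<otimes> u = x [^] l \<otimes> (x [^] (k - l) \<otimes> u)" using uc by (simp add: R.nat_pow_mult R.m_assoc[symmetric])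
 then show "x [^] k \<otimes> u \<in> R.F l" unfolding R.unif_mem[OF x] by (rule bexI) (use uc in simp)
qed

lemma sp_decomp: assumes u: "u \<in> Units R" shows "sp (x [^] (k::nat) \<otimes> u) = \<pi> [^]\<^bsub>H\<^esub> k \<otimes>\<^bsub>H\<^esub> lift u"
proof -
 have uc: "u \<in> carrier R" using u by blast
 define a where "a = x [^] k \<otimes> u"
 have nz: "a ~= \<zero>" using decomposition_F[OF u, of k "Suc k"] R.F_zero[of "Suc k"] by (auto simp: a_def)
 have uniq: "l = k & v = u" if v: "v \<in> Units R" and eq: "a = x [^] l \<otimes> v" for l :: nat and v
 proof -
  have "i \<le> k \<longleftrightarrow> i \<le> l" for i using decomposition_F[OF u, of k i] decomposition_F[OF v, of l i] eq by (simp add: a_def)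
  from this[of k] this[of l] have "l = k" by simp
  then show ?thesis using eq R.m_lcancel[OF R.unif_pow_nonzero[OF x, of k], of u v] uc v by (auto simp: a_def)
 qed
 have "(SOME b. \<exists>k::nat. \<exists>u \<in> Units R. a = x [^] k \<otimes> u & b = \<pi> [^]\<^bsub>H\<^esub> k \<otimes>\<^bsub>H\<^esub> lift u) = \<pi> [^]\<^bsub>H\<^esub> k \<otimes>\<^bsub>H\<^esub> lift u"
 proof (rule some_equality)
  show "\<exists>k'::nat. \<exists>u' \<in> Units R. a = x [^] k' \<otimes> u' & \<pi> [^]\<^bsub>H\<^esub> k \<otimes>\<^bsub>H\<^esub> lift u = \<pi> [^]\<^bsub>H\<^esub> k' \<otimes>\<^bsub>H\<^esub> lift u'"
   using u a_def by blast
  fix b assume "\<exists>l::nat. \<exists>v \<in> Units R. a = x [^] l \<otimes> v & b = \<pi> [^]\<^bsub>H\<^esub> l \<otimes>\<^bsub>H\<^esub> lift v"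
  then show "b = \<pi> [^]\<^bsub>H\<^esub> k \<otimes>\<^bsub>H\<^esub> lift u" using uniq by blast
 qed
 then show ?thesis using nz by (simp add: sp_def a_def)
qed

lemma sp_zero: "sp \<zero> = hzero H" by (simp add: sp_def)

lemma decomp: assumes "a \<in> carrier R" "a ~= \<zero>" obtains k :: nat and u where "u \<in> Units R" "u \<in> carrier R" "a = x [^] k \<otimes> u"
proof -
 obtain k :: nat and u where "u \<in> Units R" "a = x [^] k \<otimes> u" using R.factorization[OF x assms] by blast
 then show ?thesis using that[of u k] R.Units_closed[of u] by blast
qed

lemma sp_Oh: assumes a: "a \<in> carrier R" shows "sp a \<in> H.Oh"
proof (cases "a = \<zero>")
 case False
 then obtain k :: nat and u where u: "u \<in> Units R" "u \<in> carrier R" "a = x [^] k \<otimes> u" using decomp a by blast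
 then show ?thesis using sp_decomp[OF u(1), of k] H.Oh_mult[OF pi_pow(1)[of k] lift_Oh[OF u(1)]] by simp
qed (simp add: sp_zero)

lemma cr_sp: assumes a: "a \<in> carrier R" shows "H.cr (sp a) = h a"
proof (cases "a = \<zero>")
 case True
 then show ?thesis using ring_hom_zero[OF h R.ring_axioms Q.ring_axioms] by (simp add: sp_zero H.Rh_zero)
next
 case False
 then obtain k :: nat and u where u: "u \<in> Units R" "u \<in> carrier R" "a = x [^] k \<otimes> u" using decomp a by blast
 have "H.cr (\<pi> [^]\<^bsub>H\<^esub> k \<otimes>\<^bsub>H\<^esub> lift u) = h (x [^] k) \<otimes>\<^bsub>trunc_ring H\<^esub> h u"
  using H.Rh_mult[OF pi_pow(1)[of k] lift_Oh[OF u(1)]] lift[OF u(1)] by (simp add: hpow)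
 then show ?thesis using sp_decomp[OF u(1), of k] ring_hom_mult[OF h _ u(2), of "x [^] k"] u(3) by simp
qed

lemma lift_mult: assumes u: "u \<in> Units R" and v: "v \<in> Units R" shows "lift (u \<otimes> v) = lift u \<otimes>\<^bsub>H\<^esub> lift v"
proof (rule lift_eq)
 note l = lift[OF u] lift[OF v]
 show "H.cr (lift u \<otimes>\<^bsub>H\<^esub> lift v) = h (u \<otimes> v)"
  using H.Rh_mult[of "lift u" "lift v"] l ring_hom_mult[OF h R.Units_closed[OF u] R.Units_closed[OF v]] by (simp add: H.Oh_iff)
qed (use u v lift[OF u] lift[OF v] in \<open>simp_all add: H.val_mult\<close>)

lemma sp_mult: assumes a: "a \<in> carrier R" and b: "b \<in> carrier R" shows "sp (a \<otimes> b) = sp a \<otimes>\<^bsub>H\<^esub> sp b"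
proof (cases "a = \<zero> \<or> b = \<zero>")
 case True
 then show ?thesis using a b H.Oh_carrier[OF sp_Oh[OF a]] H.Oh_carrier[OF sp_Oh[OF b]]
  by (auto simp: sp_zero H.zero_mult H.mult_zero)
next
 case False
 then have nz: "a ~= \<zero>" "b ~= \<zero>" by auto
 obtain j :: nat and u where u: "u \<in> Units R" "u \<in> carrier R" "a = x [^] j \<otimes> u" using decomp[OF a nz(1)] by blast
 obtain k :: nat and v where v: "v \<in> Units R" "v \<in> carrier R" "b = x [^] k \<otimes> v" using decomp[OF b nz(2)] by blast
 have "a \<otimes> b = x [^] (j + k) \<otimes> (u \<otimes> v)" using u v by (simp add: R.nat_pow_mult[symmetric] R.m_ac)
 then have "sp (a \<otimes> b) = \<pi> [^]\<^bsub>H\<^esub> (j + k) \<otimes>\<^bsub>H\<^esub> (lift u \<otimes>\<^bsub>H\<^esub> lift v)"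
  using sp_decomp[of "u \<otimes> v" "j + k"] u(1) v(1) by (simp add: lift_mult)
 also have "\<dots> = sp a \<otimes>\<^bsub>H\<^esub> sp b"
  using sp_decomp[OF u(1), of j] sp_decomp[OF v(1), of k] lift[OF u(1)] lift[OF v(1)] pi u(3) v(3)
  by (simp add: H.nat_pow_mult[symmetric] H.m_ac)
 finally show ?thesis .
qed

lemma sp_val: assumes a: "a \<in> carrier R" shows "H.E k \<le> val H (sp a) \<longleftrightarrow> a \<in> R.F k"
proof (cases "a = \<zero>")
 case True
 then show ?thesis using H.val_eq_PInf[of "hzero H"] H.zero_closed by (simp add: sp_zero)
next
 case False
 then obtain j :: nat and u where u: "u \<in> Units R" "u \<in> carrier R" "a = x [^] j \<otimes> u" using decomp a by blast
 have "val H (sp a) = H.E j"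
  using sp_decomp[OF u(1), of j] lift[OF u(1)] pi_pow[of j] H.Oh_carrier u(3) by (simp add: H.val_mult)
 then show ?thesis using decomposition_F[OF u(1)] u(3) by (simp add: H.E_le)
qed

lemma lift_one: "lift \<one> = \<one>\<^bsub>H\<^esub>"
 by (rule lift_eq) (simp_all add: ring_hom_one[OF h] H.Rh_one)

lemma sp_pow_x: "sp (x [^] (k::nat)) = \<pi> [^]\<^bsub>H\<^esub> k"
 using sp_decomp[of \<one> k] pi by (simp add: lift_one)

lemma sp_unit: "u \<in> Units R ==> sp u = lift u"
 using sp_decomp[of u 0] lift(1)[of u] R.Units_closed[of u] by simp

lemma sp_surj: assumes b: "b \<in> H.Oh" shows "\<exists>a \<in> carrier R. sp a = b"
proof (cases "b = hzero H")
 case True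
 then show ?thesis using sp_zero by blast
next
 case False
 obtain k where k: "val H b = H.E k" using H.val_Oh[OF b False] by blast
 obtain d where d: "d \<in> carrier H" "b = \<pi> [^]\<^bsub>H\<^esub> k \<otimes>\<^bsub>H\<^esub> d"
  using H.divide_exists[of b "\<pi> [^]\<^bsub>H\<^esub> k" k 0] H.Oh_carrier[OF b] H.Oh_carrier[OF pi_pow(1)[of k]] pi_pow(2)[of k] k by auto
 have "H.E k + val H d = H.E k" using k d H.val_mult[OF H.Oh_carrier[OF pi_pow(1)[of k]] d(1)] pi_pow(2)[of k] by simp
 then have vd: "val H d = 0" by (cases "val H d") (auto simp: H.E_def)
 have dO: "d \<in> H.Oh" using d vd by (simp add: H.Oh_iff)
 obtain u where u: "u \<in> carrier R" "h u = H.cr d" using surj[of "H.cr d"] dO by (auto simp: H.Rh_carrier)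
 have "H.cr d \<notin> H.Fh 1" using H.cr_in_Fh_iff[OF dO H.n_pos] vd H.E_le[of 1 0] by simp
 then have uU: "u \<in> Units R" using u hF[OF u(1) H.n_pos] R.Units_if_notin_F1 by simp
 then have "sp (x [^] k \<otimes> u) = b" using sp_decomp[of u k] lift_eq[of u d] u d vd by simp
 then show ?thesis using u by (intro bexI[of _ "x [^] k \<otimes> u"]) auto
qed

text \<open>A sum with a unit is a ball of radius \<open>rho\<close>, that is, a class of the truncated ring, where \<open>h\<close> is additive.\<close>

lemma sp_add_unit: assumes u: "u \<in> Units R" and b: "b \<in> carrier R" shows "sp (u \<oplus> b) \<in> hadd H (sp u) (sp b)"
proof -
 have uc: "u \<in> carrier R" using u by blast
 note O = sp_Oh[OF uc] sp_Oh[OF b] sp_Oh[OF R.a_closed[OF uc b]]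
 note C = O[THEN H.Oh_carrier]
 obtain g where g: "g \<in> hadd H (sp u) (sp b)" using H.hadd_nonempty[OF C(1,2)] by blast
 have gO: "g \<in> H.Oh" using H.Oh_hadd[OF g O(1,2)] .
 have "H.cr g = H.cr (sp (u \<oplus> b))"
  using H.Rh_add[OF O(1,2) g] ring_hom_add[OF h uc b] cr_sp uc b by simp
 then have "H.near (H.E n) (sp (u \<oplus> b)) g" using H.cr_eq_iff[OF O(3) gO] by simp
 moreover have "min (val H (sp u)) (val H (sp b)) = 0"
  using lift(2)[OF u] sp_unit[OF u] O(2) by (simp add: H.Oh_iff min_def)
 ultimately show ?thesis using H.hadd_ball[OF C(1,2) g, of "sp (u \<oplus> b)"] C(3) by (simp add: H.rho_E)
qed

lemma sp_add_le:
 assumes a: "a \<in> carrier R" "a ~= \<zero>" and b: "b \<in> carrier R" and le: "!!k. a \<in> R.F k ==> b \<in> R.F k"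
 shows "sp (a \<oplus> b) \<in> hadd H (sp a) (sp b)"
proof -
 obtain k :: nat and u where u: "u \<in> Units R" "u \<in> carrier R" "a = x [^] k \<otimes> u" using decomp a by blast
 have "b \<in> R.F k" using le decomposition_F[OF u(1), of k k] u(3) by simp
 then obtain d where d: "d \<in> carrier R" "b = x [^] k \<otimes> d" using R.unif_mem[OF x] by blast
 have c: "x [^] k \<in> carrier R" by simp
 have "sp (u \<oplus> d) \<otimes>\<^bsub>H\<^esub> sp (x [^] k) \<in> hadd H (sp u \<otimes>\<^bsub>H\<^esub> sp (x [^] k)) (sp d \<otimes>\<^bsub>H\<^esub> sp (x [^] k))"
  by (rule H.hadd_mult[OF _ _ _ sp_add_unit[OF u(1) d(1)]]) (use sp_Oh u(2) d(1) c H.Oh_carrier in auto)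
 moreover have "sp (u \<oplus> d) \<otimes>\<^bsub>H\<^esub> sp (x [^] k) = sp (a \<oplus> b)"
 proof -
  have "(u \<oplus> d) \<otimes> x [^] k = a \<oplus> b" using u(2,3) d by (simp add: R.l_distr R.m_comm[of "x [^] k"])
  then show ?thesis using sp_mult[of "u \<oplus> d" "x [^] k"] u(2) d(1) by simp
 qed
 moreover have "sp u \<otimes>\<^bsub>H\<^esub> sp (x [^] k) = sp a" using sp_mult[of u "x [^] k"] u by (simp add: R.m_comm)
 moreover have "sp d \<otimes>\<^bsub>H\<^esub> sp (x [^] k) = sp b" using sp_mult[of d "x [^] k"] d by (simp add: R.m_comm)
 ultimately show ?thesis by simp
qed

lemma sp_add: assumes a: "a \<in> carrier R" and b: "b \<in> carrier R" shows "sp (a \<oplus> b) \<in> hadd H (sp a) (sp b)"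
proof -
 note C = H.Oh_carrier[OF sp_Oh[OF a]] H.Oh_carrier[OF sp_Oh[OF b]]
 consider "b = \<zero>" | "a = \<zero>" | "a ~= \<zero>" "b ~= \<zero>" by blast
 then show ?thesis
 proof cases
  case 1
  then show ?thesis using a C H.hadd_zero by (simp add: sp_zero)
 next
  case 2
  then show ?thesis using b C H.hadd_zero H.hadd_comm[of "hzero H" "sp b"] H.zero_closed by (simp add: sp_zero)
 next
  case 3
  obtain j :: nat and u where u: "u \<in> Units R" "a = x [^] j \<otimes> u" using decomp[OF a 3(1)] by blast
  obtain k :: nat and v where v: "v \<in> Units R" "b = x [^] k \<otimes> v" using decomp[OF b 3(2)] by blast
  show ?thesis
  proof (cases "j \<le> k")
   case True
   then show ?thesis by (intro sp_add_le a b 3) (simp add: u v decomposition_F)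
  next
   case False
   then have "sp (b \<oplus> a) \<in> hadd H (sp b) (sp a)" by (intro sp_add_le a b 3) (simp add: u v decomposition_F)
   then show ?thesis using H.hadd_comm[OF C] R.a_comm[OF a b] by simp
  qed
 qed
qed

theorem truncation: "truncation R p e H n sp"
proof (intro truncation.intro truncation_axioms.intro R.cdvr_object_axioms H.normalized_hyperfield_axioms n_gt
  sp_Oh sp_surj sp_mult sp_val sp_add)
 show "sp \<one> = \<one>\<^bsub>H\<^esub>" using sp_unit[of \<one>] lift_one by simp
 have wc: "w \<in> carrier R" using w by blast
 have "sp (nat_elem R p) = lift w \<otimes>\<^bsub>H\<^esub> \<pi> [^]\<^bsub>H\<^esub> e"
  unfolding w(2) using sp_mult[OF wc, of "x [^] e"] sp_unit[OF w(1)] sp_pow_x[of e] by simp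
 then show "sp (nat_elem R p) = pelt H" using lift_eq[OF w(1) om(1,2)] w(3) P by simp
qed

end

text \<open>Write the chosen element of \<open>H\<close> over \<open>p\<close> as \<open>a \<pi>0^e\<close>. In the truncated ring \<open>a = t d^e\<close> with a Teichmueller
element \<open>t\<close>, and this lifts to an equation of units of \<open>H\<close>. So that element is \<open>\<omega> \<pi>^e\<close> with \<open>\<omega>\<close> of class \<open>t\<close>.
A valuation ring with the same residue field in which \<open>p = w x^e\<close> for a Teichmueller element \<open>w\<close> of the same
residue as \<open>t\<close> then maps onto the truncated ring.\<close>

theorem truncation_exists:
 fixes H :: "'u pointed_hyperfield" and cc :: "(nat => 'u) => 'u"
 assumes p: "Factorial_Ring.prime p" and e: "e \<ge> 1" "\<not> p dvd e" and n: "n > e"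
  and H: "H \<in> HF_objects p e n" and cc: "inj cc"
 shows "\<exists>R sp. truncation R p e H n sp"
proof -
 let ?A = "trunc_ring H" and ?k = "res_field H"
 interpret H: normalized_hyperfield H e n by (rule HF_objectD[OF H e(1)])
 note th = H.theta_least(2) H.theta_le_rho
 have char: "ring_char ?k = p" and perf: "perfect_field ?k"
  using H by (auto simp: HF_objects_def mixed_char_def)
 interpret Q: perfect_residue_ring "?A" H.Fh p by (rule H.Rh_perfect_residue[OF p char perf])
 interpret K: field "?k" using perf by (simp add: perfect_field_def)
 obtain a \<pi>0 where a: "a \<in> carrier H" "val H a = 0" and pi0: "\<pi>0 \<in> carrier H" "val H \<pi>0 = H.E 1"
  and Pa: "pelt H = a \<otimes>\<^bsub>H\<^esub> \<pi>0 [^]\<^bsub>H\<^esub> e" and Pp: "H.cr (pelt H) = nat_elem ?A p"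
  using H by (auto simp: HF_objects_def pelt_over_def H.theta_E)
 have aO: "a \<in> H.Oh" using a by (simp add: H.Oh_iff)
 have Ac: "H.cr a \<in> carrier ?A" using aO by (simp add: H.Rh_carrier)
 have AU: "H.cr a \<in> Units ?A" by (rule H.Rh_unit[OF a])
 obtain t d where t: "t \<in> Q.teich" and dU: "d \<in> Units ?A" and tU: "t \<in> Units ?A"
  and ad: "H.cr a = t \<otimes>\<^bsub>?A\<^esub> d [^]\<^bsub>?A\<^esub> e" using Q.unit_eq_teich_power[OF e(2) AU] by blast
 have tc: "t \<in> carrier ?A" and dc: "d \<in> carrier ?A" using tU dU by auto
 have tF: "t \<notin> H.Fh 1" and "d \<notin> H.Fh 1" using Q.Units_iff_notin_F1 tc tU dc dU by blast+
 then obtain \<delta> where \<delta>: "\<delta> \<in> carrier H" "val H \<delta> = 0" "H.cr \<delta> = d" using H.Rh_unit_lift[OF dc] by blast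
 obtain \<omega> where \<omega>: "\<omega> \<in> carrier H" "val H \<omega> = 0" "H.cr \<omega> = t" using H.Rh_unit_lift[OF tc tF] by blast
 have O: "\<delta> \<in> H.Oh" "\<omega> \<in> H.Oh" using \<delta> \<omega> by (simp_all add: H.Oh_iff)
 have a_eq: "\<omega> \<otimes>\<^bsub>H\<^esub> \<delta> [^]\<^bsub>H\<^esub> e = a"
 proof (rule H.unit_cr_inj)
  have "val H (\<delta> [^]\<^bsub>H\<^esub> e) = 0" using H.val_pow[OF \<delta>(1), of 0 e] \<delta>(2) by (simp add: zero_ereal_def)
  then show "val H (\<omega> \<otimes>\<^bsub>H\<^esub> \<delta> [^]\<^bsub>H\<^esub> e) = 0" using \<omega> \<delta> by (simp add: H.val_mult)
  show "H.cr (\<omega> \<otimes>\<^bsub>H\<^esub> \<delta> [^]\<^bsub>H\<^esub> e) = H.cr a"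
   using H.Rh_mult[OF O(2) H.Oh_pow[OF O(1)], of e] H.Rh_pow[OF O(1), of e] \<omega>(3) \<delta>(3) ad by simp
 qed (use a \<omega> \<delta> in auto)
 define \<pi> where "\<pi> = \<delta> \<otimes>\<^bsub>H\<^esub> \<pi>0"
 have pi: "\<pi> \<in> carrier H" "val H \<pi> = H.E 1" using \<delta> pi0 by (simp_all add: \<pi>_def H.val_mult)
 have piO: "\<pi> \<in> H.Oh" using pi by (simp add: H.Oh_iff)
 have P: "pelt H = \<omega> \<otimes>\<^bsub>H\<^esub> \<pi> [^]\<^bsub>H\<^esub> e"
  unfolding Pa a_eq[symmetric] \<pi>_def using \<delta> \<omega> pi0 by (simp add: H.nat_pow_distrib H.m_assoc)
 define \<tau> where "\<tau> = H.tres t"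
 have \<tau>: "\<tau> \<in> carrier ?k" "\<tau> ~= \<zero>\<^bsub>?k\<^esub>"
  using ring_hom_closed[OF H.tres_hom tc] H.tres_zero[OF tc] tF by (simp_all add: \<tau>_def)
 have kc: "carrier ?k = hclass H (theta H) ` H.Oh" using H.Q_carrier[OF th] by (simp add: res_field_def)
 define enc where "enc s = cc (%i. SOME b. b \<in> s i)" for s :: "nat => 'u set"
 have enc: "inj_on enc (UNIV \<rightarrow> carrier ?k)"
 proof (rule inj_onI, rule ext)
  fix s s' i assume s: "s \<in> UNIV \<rightarrow> carrier ?k" "s' \<in> UNIV \<rightarrow> carrier ?k" and eq: "enc s = enc s'"
  have pick: "(SOME b. b \<in> Y) \<in> H.Oh & hclass H (theta H) (SOME b. b \<in> Y) = Y" if Y: "Y \<in> carrier ?k" for Y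
  proof -
   obtain b where b: "b \<in> H.Oh" "Y = hclass H (theta H) b" using Y unfolding kc by blast
   have "b \<in> Y" using b H.Oh_carrier by (simp add: H.in_cl[OF th])
   define z where "z = (SOME b. b \<in> Y)"
   have "z \<in> Y" unfolding z_def by (rule someI) (rule \<open>b \<in> Y\<close>)
   then have z: "z \<in> H.Oh" "H.near (ereal (theta H)) b z" using b(2) H.in_cl[OF th, of z b] by simp_all
   then have "hclass H (theta H) z = Y" using H.cl_eq_iff[OF th b(1) z(1)] b(2) by simp
   then show ?thesis using z(1) by (simp add: z_def[symmetric])
  qed
  have "(SOME b. b \<in> s i) = (SOME b. b \<in> s' i)" using injD[OF cc] eq unfolding enc_def by metis
  then show "s i = s' i" using pick[of "s i"] pick[of "s' i"] s by (metis PiE UNIV_I)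
 qed
 obtain R :: "'u ring" and r \<pi>' t' where R: "R \<in> CDVR_objects p e" and r: "r \<in> ring_hom R ?k"
   "r ` carrier R = carrier ?k" "\<forall>a\<in>carrier R. r a = \<zero>\<^bsub>?k\<^esub> \<longleftrightarrow> a \<in> max_ideal R"
  and pi': "\<pi>' \<in> carrier R" "max_ideal R = PIdl\<^bsub>R\<^esub> \<pi>'" and t': "t' \<in> carrier R" "r t' = \<tau>" "nat_elem R p = t' \<otimes>\<^bsub>R\<^esub> \<pi>' [^]\<^bsub>R\<^esub> e"
  using CDVR_with_residue_field[OF perf char p e(1) enc \<tau>] by blast
 interpret R: cdvr_object R p e by (intro cdvr_object.intro R p e)
 have rz: "r a = \<zero>\<^bsub>?k\<^esub> \<longleftrightarrow> a \<in> R.F 1" if "a \<in> carrier R" for a using r(3) that R.F_1 by simp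
 have ux: "R.unif \<pi>'" using pi' R.ideal_pow_PIdl by (simp add: R.unif_def R.F_def)
 have "t' \<in> Units R" using rz[OF t'(1)] t'(2) \<tau>(2) R.Units_if_notin_F1[OF t'(1)] by simp
 from R.unit_eq_teich_power[OF e(2) this] obtain w d' where w: "w \<in> R.teich" "t' \<ominus>\<^bsub>R\<^esub> w \<in> R.F 1"
  and d'U: "d' \<in> Units R" and wU: "w \<in> Units R" and t'w: "t' = w \<otimes>\<^bsub>R\<^esub> d' [^]\<^bsub>R\<^esub> e" by blast
 have wc: "w \<in> carrier R" by (rule R.teich_carrier[OF w(1)])
 have rw: "r w = \<tau>"
 proof -
  have "r t' \<ominus>\<^bsub>?k\<^esub> r w = \<zero>\<^bsub>?k\<^esub>"
   using ring_hom_diff[OF R.is_cring K.is_cring r(1) t'(1) wc] rz[of "t' \<ominus>\<^bsub>R\<^esub> w"] w(2) t'(1) wc by simp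
  then show ?thesis using t'(2) K.r_right_minus_eq[of "r t'" "r w"] ring_hom_closed[OF r(1)] t'(1) wc \<tau>(1) by simp
 qed
 define x where "x = d' \<otimes>\<^bsub>R\<^esub> \<pi>'"
 have x: "R.unif x" "nat_elem R p = w \<otimes>\<^bsub>R\<^esub> x [^]\<^bsub>R\<^esub> e"
  unfolding x_def t'(3) t'w using R.unif_mult_unit[OF ux d'U] pi'(1) d'U wc
  by (simp_all add: R.nat_pow_distrib R.m_assoc R.Units_closed)
 have xc: "x \<in> carrier R" using x by (simp add: R.unif_def)
 obtain j where j: "e = Suc j" using e(1) by (cases e) auto
 have pair: "residue_pair R R.F p ?A H.Fh ?k r H.tres x w (H.cr \<pi>) t j (%k. k \<le> n)"
 proof (intro residue_pair.intro R.perfect_residue Q.perfect_residue_ring_axioms residue_pair_axioms.intro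
   K.is_cring r(1) H.tres_hom rz H.tres_zero w(1) t)
  fix a assume a: "a \<in> carrier R"
  show "\<exists>y\<in>carrier ?A. H.tres y = r a"
  proof -
   obtain b where b: "b \<in> H.Oh" "r a = hclass H (theta H) b"
    using ring_hom_closed[OF r(1) a] unfolding kc by blast
   then show ?thesis using H.tres_cr[OF b(1)] by (intro bexI[of _ "H.cr b"]) (simp_all add: H.Rh_carrier)
  qed
  fix k assume "x \<otimes>\<^bsub>R\<^esub> a \<in> R.F (Suc k)"
  then show "a \<in> R.F k" using R.unif_div[OF x(1) a, of 1 k] xc by simp
 next
  fix k y assume "Suc k \<le> n" "y \<in> carrier ?A" "H.cr \<pi> \<otimes>\<^bsub>?A\<^esub> y \<in> H.Fh (Suc k)"
  then show "y \<in> H.Fh k" by (rule H.Rh_div[OF pi])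
 next
  show "x \<in> R.F 1" by (rule R.unif_F1[OF x(1)])
  show "H.cr \<pi> \<in> H.Fh 1" using piO pi by (auto simp: H.Fh_def)
  fix a assume "a \<in> R.F 1"
  then show "\<exists>b\<in>carrier R. a = x \<otimes>\<^bsub>R\<^esub> b" using R.unif_mem[OF x(1), of a 1] xc by simp
 next
  show "nat_elem R p = w \<otimes>\<^bsub>R\<^esub> x [^]\<^bsub>R\<^esub> Suc j" using x(2) j by simp
  have "nat_elem ?A p = t \<otimes>\<^bsub>?A\<^esub> H.cr \<pi> [^]\<^bsub>?A\<^esub> e"
   using H.Rh_mult[OF O(2) H.Oh_pow[OF piO], of e] H.Rh_pow[OF piO, of e] \<omega>(3) P Pp by simp
  then show "nat_elem ?A p = t \<otimes>\<^bsub>?A\<^esub> H.cr \<pi> [^]\<^bsub>?A\<^esub> Suc j" using j by simp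
  show "r w = H.tres t" using rw by (simp add: \<tau>_def)
 qed auto
 obtain h where h: "h \<in> ring_hom R ?A" "h x = H.cr \<pi>"
   "\<forall>t\<in>R.teich. \<forall>t'\<in>Q.teich. r t = H.tres t' --> h t = t'"
   "\<forall>k. \<forall>a\<in>R.F k. h a \<in> H.Fh k" "\<forall>k. k \<le> n --> (\<forall>a\<in>carrier R. h a \<in> H.Fh k --> a \<in> R.F k)"
   "(\<forall>y\<in>carrier ?A. \<exists>a\<in>carrier R. r a = H.tres y) -->
    (\<forall>y\<in>H.Fh 1. \<exists>z\<in>carrier ?A. y = H.cr \<pi> \<otimes>\<^bsub>?A\<^esub> z) -->
    (\<forall>k. \<forall>y\<in>carrier ?A. \<exists>a\<in>carrier R. y \<ominus>\<^bsub>?A\<^esub> h a \<in> H.Fh k)"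
  using residue_pair.graph_hom[OF pair] by (elim bexE conjE) (rule that)
 have surj: "\<exists>a\<in>carrier R. h a = Y" if Y: "Y \<in> carrier ?A" for Y
 proof -
  have "\<forall>y\<in>carrier ?A. \<exists>a\<in>carrier R. r a = H.tres y"
  proof
   fix y assume "y \<in> carrier ?A"
   then have "H.tres y \<in> r ` carrier R" using ring_hom_closed[OF H.tres_hom] r(2) by simp
   then show "\<exists>a\<in>carrier R. r a = H.tres y" by (metis imageE)
  qed
  moreover have "\<forall>y\<in>H.Fh 1. \<exists>z\<in>carrier ?A. y = H.cr \<pi> \<otimes>\<^bsub>?A\<^esub> z"
  proof
   fix y assume "y \<in> H.Fh 1"
   moreover have "H.cr \<pi> \<in> carrier ?A" using piO by (simp add: H.Rh_carrier)
   ultimately show "\<exists>z\<in>carrier ?A. y = H.cr \<pi> \<otimes>\<^bsub>?A\<^esub> z"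
    unfolding H.Fh_PIdl[OF pi] cgenideal_def using Q.m_comm by auto
  qed
  ultimately obtain a where a: "a \<in> carrier R" "Y \<ominus>\<^bsub>?A\<^esub> h a \<in> H.Fh n" using h(6) Y by blast
  then have "Y \<ominus>\<^bsub>?A\<^esub> h a = \<zero>\<^bsub>?A\<^esub>" using H.Fh_large[of n] by simp
  then have "Y = h a" using Q.r_right_minus_eq[OF Y ring_hom_closed[OF h(1) a(1)]] by simp
  then show ?thesis using a(1) by blast
 qed
 have "truncation_lift R p e H n h x w \<pi> \<omega>"
 proof (intro truncation_lift.intro truncation_lift_axioms.intro R.cdvr_object_axioms H.normalized_hyperfield_axioms
   n x h(1,2) pi \<omega>(1,2) P wU surj)
  show "h w = H.cr \<omega>" using h(3) w(1) t rw \<omega>(3) by (simp add: \<tau>_def)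
  fix a k assume "a \<in> carrier R" "k \<le> n"
  then show "h a \<in> H.Fh k \<longleftrightarrow> a \<in> R.F k" using h(4,5) by blast
 qed
 from truncation_lift.truncation[OF this] show ?thesis by blast
qed

section \<open>The equivalence\<close>

definition truncate :: "nat => nat => nat => 'u ring => 'u pointed_hyperfield \<times> ('u => 'u)" where
 "truncate p e n R = (SOME z. truncation R p e (fst z) n (snd z))"

definition truncation_functor :: "nat => nat => nat =>
  ('u ring, 'u => 'u, 'u pointed_hyperfield, 'u => 'u) cat_functor" where
 "truncation_functor p e n = \<lparr>on_obj = (%R. fst (truncate p e n R)),
   on_arr = (%R S f. THE g. g \<in> HF_hom (fst (truncate p e n R)) (fst (truncate p e n S)) &
    (\<forall>x\<in>carrier R. g (snd (truncate p e n R) x) = snd (truncate p e n S) (f x)))\<rparr>"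

lemma truncate:
 fixes R :: "'u ring"
 assumes p: "Factorial_Ring.prime p" and e: "e \<ge> 1" and n: "n > e" and U: "seq_closed_universe TYPE('u)"
  and R: "R \<in> CDVR_objects p e"
 shows "truncation R p e (fst (truncate p e n R)) n (snd (truncate p e n R))"
proof -
 interpret R: cdvr_object R p e by (intro cdvr_object.intro R p e)
 obtain enc :: "'u \<times> nat => 'u" where "inj enc" using seq_universe_enc[OF U R.one_not_zero] by blast
 then interpret truncated_field R p e n enc by (intro truncated_field.intro truncated_field_axioms.intro R.cdvr_object_axioms n)
 show ?thesis unfolding truncate_def
  by (rule someI[of _ "(Hn, %x. Q x 0)"]) (simp add: Hn_truncation)
qed

theorem theorem4p11:
  fixes p e n :: nat
  assumes "Factorial_Ring.prime p" and "e \<ge> 1" and "\<not> p dvd e" and "n > e"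
    and "seq_closed_universe TYPE('u)"
  shows "equivalent_categories
           (HF_cat p e n :: ('u pointed_hyperfield, 'u \<Rightarrow> 'u) category)
           (CDVR_cat p e :: ('u ring, 'u \<Rightarrow> 'u) category)"
proof -
 define \<Phi> :: "'u ring => 'u pointed_hyperfield" where "\<Phi> R = fst (truncate p e n R)" for R
 define \<sigma> :: "'u ring => 'u => 'u" where "\<sigma> R = snd (truncate p e n R)" for R
 define \<Psi> where "\<Psi> R S f = (THE g. g \<in> HF_hom (\<Phi> R) (\<Phi> S) & (\<forall>x\<in>carrier R. g (\<sigma> R x) = \<sigma> S (f x)))" for R S f
 have F: "on_obj (truncation_functor p e n) = \<Phi>" "on_arr (truncation_functor p e n) = \<Psi>"
  by (simp_all add: truncation_functor_def \<Phi>_def \<sigma>_def \<Psi>_def fun_eq_iff)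
 have cats: "Obj (HF_cat p e n) = HF_objects p e n" "Hom (HF_cat p e n) = HF_hom"
   "!!H. Ident (HF_cat p e n) H = restrict id (carrier H)"
   "!!H1 H2 H3 g f. Comp (HF_cat p e n) H1 H2 H3 g f = compose (carrier H1) g f"
   "Obj (CDVR_cat p e) = CDVR_objects p e" "Hom (CDVR_cat p e) = CDVR_hom"
   "!!R. Ident (CDVR_cat p e) R = restrict id (carrier R)"
   "!!R S T g f. Comp (CDVR_cat p e) R S T g f = compose (carrier R) g f"
  by (simp_all add: HF_cat_def CDVR_cat_def)
 have tr: "truncation R p e (\<Phi> R) n (\<sigma> R)" if "R \<in> CDVR_objects p e" for R
  unfolding \<Phi>_def \<sigma>_def by (rule truncate[OF assms(1,2,4,5) that])
 have arr: "g \<in> HF_hom (\<Phi> R) (\<Phi> S) ==> (!!x. x \<in> carrier R ==> g (\<sigma> R x) = \<sigma> S (f x)) ==> \<Psi> R S f = g"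
   "\<Psi> R S f \<in> HF_hom (\<Phi> R) (\<Phi> S)" "!!x. x \<in> carrier R ==> \<Psi> R S f (\<sigma> R x) = \<sigma> S (f x)"
  if RS: "R \<in> CDVR_objects p e" "S \<in> CDVR_objects p e" and f: "f \<in> CDVR_hom R S" for R S f g
 proof -
  note ind = truncation_pair.induced_hom[OF truncation_pair.intro[OF tr[OF RS(1)] tr[OF RS(2)]] f]
  from theI'[OF ind] show "\<Psi> R S f \<in> HF_hom (\<Phi> R) (\<Phi> S)" "!!x. x \<in> carrier R ==> \<Psi> R S f (\<sigma> R x) = \<sigma> S (f x)"
   by (simp_all add: \<Psi>_def)
  assume "g \<in> HF_hom (\<Phi> R) (\<Phi> S)" "!!x. x \<in> carrier R ==> g (\<sigma> R x) = \<sigma> S (f x)"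
  then show "\<Psi> R S f = g" unfolding \<Psi>_def by (intro the1_equality[OF ind]) simp
 qed
 interpret D: category "CDVR_cat p e :: ('u ring, 'u => 'u) category" by (rule CDVR_category)
 have HF: "\<Phi> R \<in> HF_objects p e n" if "R \<in> CDVR_objects p e" for R by (rule truncation.HF_object[OF tr[OF that]])
 have idR: "restrict id (carrier R) \<in> CDVR_hom R R" if "R \<in> CDVR_objects p e" for R :: "'u ring"
  using D.Ident_in_Hom[of R] that by (simp add: cats)
 have compR: "compose (carrier R) g f \<in> CDVR_hom R T" if "R \<in> CDVR_objects p e" "S \<in> CDVR_objects p e" "T \<in> CDVR_objects p e"
   "f \<in> CDVR_hom R S" "g \<in> CDVR_hom S T" for R S T :: "'u ring" and f g
  using D.Comp_in_Hom[of R S T f g] that by (simp add: cats)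
 have sc: "\<sigma> R x \<in> carrier (\<Phi> R)" if "R \<in> CDVR_objects p e" "x \<in> carrier R" for R x
  by (rule truncation.sp_carrier[OF tr[OF that(1)] that(2)])
 have func: "cat_functor (CDVR_cat p e) (HF_cat p e n) (truncation_functor p e n :: ('u ring, 'u => 'u, 'u pointed_hyperfield, 'u => 'u) cat_functor)"
 proof (intro cat_functor.intro cat_functor_axioms.intro CDVR_category HF_category[OF assms(2)]; unfold F cats)
  fix R S T :: "'u ring" and f g
  show "R \<in> CDVR_objects p e ==> \<Phi> R \<in> HF_objects p e n" by (rule HF)
  show "[|R \<in> CDVR_objects p e; S \<in> CDVR_objects p e; f \<in> CDVR_hom R S|] ==> \<Psi> R S f \<in> HF_hom (\<Phi> R) (\<Phi> S)"
   by (rule arr(2))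
  show "\<Psi> R R (restrict id (carrier R)) = restrict id (carrier (\<Phi> R))" if R: "R \<in> CDVR_objects p e"
   by (rule arr(1)[OF R R idR[OF R] HF_hom_id[OF HF[OF R] assms(2)]]) (simp add: sc[OF R])
  show "\<Psi> R T (compose (carrier R) g f) = compose (carrier (\<Phi> R)) (\<Psi> S T g) (\<Psi> R S f)"
   if R: "R \<in> CDVR_objects p e" and S: "S \<in> CDVR_objects p e" and T: "T \<in> CDVR_objects p e"
    and f: "f \<in> CDVR_hom R S" and g: "g \<in> CDVR_hom S T"
  proof (rule arr(1)[OF R T compR[OF R S T f g]])
   show "compose (carrier (\<Phi> R)) (\<Psi> S T g) (\<Psi> R S f) \<in> HF_hom (\<Phi> R) (\<Phi> T)"
    by (rule HF_hom_compose[OF HF[OF R] HF[OF S] HF[OF T] assms(2) arr(2)[OF R S f] arr(2)[OF S T g]])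
   fix x assume x: "x \<in> carrier R"
   have "f x \<in> carrier S" using CDVR_hom_range[OF f] x by blast
   then show "compose (carrier (\<Phi> R)) (\<Psi> S T g) (\<Psi> R S f) (\<sigma> R x) = \<sigma> T (compose (carrier R) g f x)"
    using x sc[OF R x] arr(3)[OF R S f x] arr(3)[OF S T g] by (simp add: compose_def)
  qed
 qed
 show ?thesis
 proof (rule equivalent_categories_if_fully_faithful_ess_surj[OF func]; unfold F cats)
  fix R S :: "'u ring" and g
  assume R: "R \<in> CDVR_objects p e" and S: "S \<in> CDVR_objects p e" and g: "g \<in> HF_hom (\<Phi> R) (\<Phi> S)"
  note pair = truncation_pair.intro[OF tr[OF R] tr[OF S]]
  obtain f where f: "f \<in> CDVR_hom R S" "!!a. a \<in> carrier R ==> g (\<sigma> R a) = \<sigma> S (f a)"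
   using truncation_pair.full[OF pair assms(3) g] by blast
  show "\<exists>!f. f \<in> CDVR_hom R S & \<Psi> R S f = g"
  proof (rule ex1I[of _ f])
   show "f \<in> CDVR_hom R S & \<Psi> R S f = g" using arr(1)[OF R S f(1) g f(2)] f(1) by blast
   fix f' assume f': "f' \<in> CDVR_hom R S & \<Psi> R S f' = g"
   then have "\<sigma> S (f' x) = \<sigma> S (f x)" if "x \<in> carrier R" for x
    using arr(3)[OF R S, of f' x] f(2)[OF that] that by simp
   then show "f' = f" using truncation_pair.faithful[OF pair assms(3), of f' f] f' f(1) by blast
  qed
 next
  fix H :: "'u pointed_hyperfield" assume H: "H \<in> HF_objects p e n"
  obtain cc :: "(nat => 'u) => 'u" where "inj cc" using assms(5) by (auto simp: seq_closed_universe_def)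
  then obtain R sp where t: "truncation R p e H n sp" using truncation_exists[OF assms(1,2,3,4) H] by blast
  then interpret t: truncation R p e H n sp .
  have R: "R \<in> CDVR_objects p e" by (rule t.R.R_obj)
  have idsp: "restrict id (carrier R) x = x" if "x \<in> carrier R" for x using that by simp
  note u = tr[OF R]
  obtain f where f: "f \<in> HF_hom H (\<Phi> R)" "!!x. x \<in> carrier R ==> f (sp x) = \<sigma> R x"
   using truncation_pair.induced_hom[OF truncation_pair.intro[OF t u] idR[OF R]] by auto
  obtain g where g: "g \<in> HF_hom (\<Phi> R) H" "!!x. x \<in> carrier R ==> g (\<sigma> R x) = sp x"
   using truncation_pair.induced_hom[OF truncation_pair.intro[OF u t] idR[OF R]] by auto
  have gf: "compose (carrier H) g f = restrict id (carrier H)"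
   using truncation_pair.induced_hom[OF truncation_pair.intro[OF t t] idR[OF R]]
    HF_hom_compose[OF H HF[OF R] H assms(2) f(1) g(1)] HF_hom_id[OF H assms(2)] f(2) g(2) t.sp_carrier
   by (auto simp: compose_def)
  have fg: "compose (carrier (\<Phi> R)) f g = restrict id (carrier (\<Phi> R))"
   using truncation_pair.induced_hom[OF truncation_pair.intro[OF u u] idR[OF R]]
    HF_hom_compose[OF HF[OF R] H HF[OF R] assms(2) g(1) f(1)] HF_hom_id[OF HF[OF R] assms(2)] f(2) g(2) sc[OF R]
   by (auto simp: compose_def)
  have "iso_arrow (HF_cat p e n) H (\<Phi> R) f"
   unfolding iso_arrow_def cats using f(1) g(1) gf fg by blast
  then show "\<exists>R\<in>CDVR_objects p e. \<exists>f. iso_arrow (HF_cat p e n) H (\<Phi> R) f" using R by blast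
 qed
qed

end
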